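(* Let $k\in\mathbb N$ and let $\pi:\mathcal X\to\mathbb C$ be an analytic family of surfaces (with parameter $t$) associated to a real wall structure on a two-dimensional asymptotically cylindrical integral affine manifold $B$, with functions $w$, $f_{\rm out}$, integers $\kappa$, $e$, relative holomorphic $2$-forms $\Omega_t$ and positive real cylinders $\Gamma_t(s_0,s_1)$ as described in the context. Then for $s_1>s_0>0$ and $t>0$ sufficiently small, $$\int_{\Gamma_t(s_0,s_1)}\Omega_t=-\int_{s_0}^{s_1}\Big(\log t^{\kappa}-\log s^{e}+\log f_{\rm out}(s,t)\Big)\,d\log s+O(t^{k+1}).$$
   Context: **Affine geometry.** $B$ is an integral affine surface (with singularities) with integral polyhedral decomposition $\mathscr P$ that is asymptotically cylindrical: all unbounded edges of $\mathscr P$ are parallel. Outside a compact set $K$, $B\setminus K\simeq(\mathbb R_{>0}\times[0,\ell])/\!\sim$, where $\sim$ identifies $\mathbb R_{>0}\times\{0\}$ with $\mathbb R_{>0}\times\{\ell\}$, $\mathbb R_{>0}\times(0,\ell)$ is embedded affinely, and the integer $e$ is given by the linear part $\begin{pmatrix}1&e\\0&1\end{pmatrix}$ of the affine monodromy. The outward direction of the unbounded edges is $(1,0)$, and $w$ denotes the monomial of degree $0$ with exponent $(1,0)$. **Wall structure.** $B$ carries a consistent wall structure with real coefficients in the sense of Gross--Hacking--Siebert over $\mathbb C[[t]]$. All monomials in the functions of unbounded walls and slabs are outgoing, i.e. the functions are polynomials in $w^{-1}$. Working modulo $t^{k+1}$, only finitely many unbounded walls and slabs matter. The unbounded slabs (walls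 contained in unbounded edges) are labelled cyclically $\mathfrak b_0,\dots,\mathfrak b_m$, with functions $f_{\mathfrak b_i}$ and kinks $\kappa_i\in\mathbb N$ of the multivalued piecewise linear function of the construction. $\mathfrak P_i$ denotes the set of unbounded walls $\mathfrak p$ between $\mathfrak b_i$ and $\mathfrak b_{i+1}$ (indices cyclic, $\mathfrak b_{m+1}=\mathfrak b_0$), with functions $f_{\mathfrak p}$. Put $$\kappa=\sum_i\kappa_i,\qquad f_{\rm out}=\prod_{\mathfrak p}f_{\mathfrak p}\cdot\prod_{i}f_{\mathfrak b_i}\in\mathbb R[t,w^{-1}]$$ (product over all unbounded walls and slabs, $t$-exponents at most $k$), and $f_{\rm out}\equiv1$ modulo $t$. We write $f_{\rm out}(s,t)$ for its value at $w=s$. **Analytic family.** $\mathcal X\to\mathbb C$ is an analytic family with real structure agreeing modulo $t^{k+1}$ with the scheme constructed from the wall structure. Denote by $X_b\subset\mathcal X_0$ the union of the irreducible components corresponding to bounded cells. $w$ is a real holomorphic function on an open neighbourhood of $\mathcal X_0\setminus X_b$ in $\mathcal X$, extending the monomial $w$. $\mathcal X_0\setminus X_b$ is covered by open sets $U_i\subset\mathcal X$, $i=0,\dots,m$, carrying holomorphic functions $u_i,v_i$ compatible with the real structure with $$u_iv_i=f_{\mathfrak b_i}(w,t)\,t^{\kappa_i},\qquad\Omega_t=d\log w\wedge d\log u_i,$$ and on overlaps $U_i\cap U_{i+1}$, $0\le i<m$, $u_iv_{i+1}=f_i(w,t)^{-1}$ with $f_i\equiv\prod_{\mathfrak p\in\mathfrak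 P_i}f_{\mathfrak p}$ modulo $t^{k+1}$, while on $U_m\cap U_0$, because of the affine monodromy, $u_mv_0=f_m(w,t)^{-1}$ with $f_m\equiv w^{-e}\prod_{\mathfrak p\in\mathfrak P_m}f_{\mathfrak p}$ modulo $t^{k+1}$. Here $\Omega_t$ is the distinguished relative holomorphic $2$-form of the construction, $d\log z_1\wedge d\log z_2$ in toric charts. **Positive real cylinder.** $\mathcal X_0^>$ is the positive real locus of $\mathcal X_0$ (on each irreducible toric component, the closure of $\mathbb R_{>0}^2\subset(\mathbb C^* )^2$), and $\mathcal X_t^>$ is the intersection with $\mathcal X_t$ of the connected component of the real locus of $\mathcal X$ containing $\mathcal X_0^>$. For $s_1>s_0>0$ and small $t>0$, $$\Gamma_t(s_0,s_1)=\mathcal X_t^>\cap w^{-1}([s_0,s_1]),$$ a cylinder, oriented so that $(w,u_i)$ are oriented coordinates.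
   Formalization: The cylinder is cut from the real locus over [0,t] and w in [s_0,s_1] with the double locus of X_0 removed (the literal component also contains the sheet u,v<0), and the unbounded slab functions are assumed positive at t=0, without which no positive cylinder exists. *)

theory Defs
  imports
    "HOL-Analysis.Analysis"
    "HOL-Library.Poly_Mapping"
    "HOL-Library.Landau_Symbols"
    "HOL-Computational_Algebra.Formal_Power_Series"
    "HOL-Computational_Algebra.Polynomial"
begin

unbundle no fps_syntax

section \<open>Lattice vectors and Laurent polynomials\<close>

type_synonym zvec = "int \<times> int"

definition rvec :: "zvec \<Rightarrow> real \<times> real" where
  "rvec m = (real_of_int (fst m), real_of_int (snd m))"

definition pairing :: "zvec \<Rightarrow> zvec \<Rightarrow> int" where
  "pairing n m = fst n * fst m + snd n * snd m"

definition zscale :: "int \<Rightarrow> zvec \<Rightarrow> zvec" where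
  "zscale j m = (j * fst m, j * snd m)"

definition zdet :: "zvec \<Rightarrow> zvec \<Rightarrow> int" where
  "zdet a b = fst a * snd b - snd a * fst b"

definition primitive_vec :: "zvec \<Rightarrow> bool" where
  "primitive_vec m \<longleftrightarrow> coprime (fst m) (snd m)"

text \<open>The coordinate of \<open>m\<close> with respect to a generator \<open>d\<close> of a rank one sublattice containing it.\<close>

definition zcoord :: "zvec \<Rightarrow> zvec \<Rightarrow> int" where
  "zcoord d m = (THE j. m = zscale j d)"

definition SL2Z :: "(zvec \<Rightarrow> zvec) \<Rightarrow> bool" where
  "SL2Z A \<longleftrightarrow> (\<forall>a b. A (a + b) = A a + A b) \<and> zdet (A (1, 0)) (A (0, 1)) = 1"

definition rlin :: "(zvec \<Rightarrow> zvec) \<Rightarrow> real \<times> real \<Rightarrow> real \<times> real" where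
  "rlin A x = fst x *\<^sub>R rvec (A (1, 0)) + snd x *\<^sub>R rvec (A (0, 1))"

text \<open>Elements of \<open>\<real>[\<int>\<^sup>2][t]/(t\<^sup>k\<^sup>+\<^sup>1)\<close> are represented by power series in \<open>t\<close> over the group
  ring \<open>\<real>[\<int>\<^sup>2]\<close>, considered up to \<open>ser_eq k\<close>.\<close>

type_synonym laurent = "zvec \<Rightarrow>\<^sub>0 real"
type_synonym ser = "laurent fps"

definition ser_eq :: "nat \<Rightarrow> ser \<Rightarrow> ser \<Rightarrow> bool" where
  "ser_eq k F G \<longleftrightarrow> fps_cutoff (Suc k) F = fps_cutoff (Suc k) G"

definition zmon :: "zvec \<Rightarrow> ser" where
  "zmon m = fps_const (Poly_Mapping.single m 1)"

text \<open>Integral powers modulo \<open>t\<^sup>k\<^sup>+\<^sup>1\<close>. Negative exponents are used only for \<open>F\<close> congruent to \<open>1\<close>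
  modulo \<open>t\<close>, where \<open>F\<^sup>-\<^sup>1\<close> is the truncated geometric series in \<open>1 - F\<close>.\<close>

definition ser_pow :: "nat \<Rightarrow> ser \<Rightarrow> int \<Rightarrow> ser" where
  "ser_pow k F n = (if 0 \<le> n then F ^ nat n else (\<Sum>j\<le>k. (1 - F) ^ j) ^ nat (- n))"

definition ser_map :: "(zvec \<Rightarrow> zvec) \<Rightarrow> ser \<Rightarrow> ser" where
  "ser_map A F = Abs_fps (\<lambda>h. \<Sum>m\<in>Poly_Mapping.keys (fps_nth F h).
     Poly_Mapping.single (A m) (Poly_Mapping.lookup (fps_nth F h) m))"

text \<open>The \<open>t\<close>-linear automorphism \<open>z\<^sup>m \<mapsto> f\<^bsup>\<langle>n,m\<rangle>\<^esup> z\<^sup>m\<close> modulo \<open>t\<^sup>k\<^sup>+\<^sup>1\<close>.\<close>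

definition wall_auto :: "nat \<Rightarrow> ser \<Rightarrow> zvec \<Rightarrow> ser \<Rightarrow> ser" where
  "wall_auto k f n F = (\<Sum>h\<le>k. fps_X ^ h * (\<Sum>m\<in>Poly_Mapping.keys (fps_nth F h).
     fps_const (Poly_Mapping.single m (Poly_Mapping.lookup (fps_nth F h) m)) * ser_pow k f (pairing n m)))"

text \<open>Evaluation with the monomials \<open>z\<^sup>m\<close> replaced by \<open>c m\<close>.\<close>

definition ser_eval :: "nat \<Rightarrow> (zvec \<Rightarrow> complex) \<Rightarrow> complex \<Rightarrow> ser \<Rightarrow> complex" where
  "ser_eval k c t F = (\<Sum>h\<le>k. \<Sum>m\<in>Poly_Mapping.keys (fps_nth F h).
     of_real (Poly_Mapping.lookup (fps_nth F h) m) * c m * t ^ h)"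

text \<open>Evaluation of an element of \<open>\<real>[w\<^sup>-\<^sup>1][[t]]\<close>, truncated modulo \<open>t\<^sup>k\<^sup>+\<^sup>1\<close>, at \<open>w = s\<close>;
  the polynomial variable is \<open>w\<^sup>-\<^sup>1\<close>.\<close>

definition out_eval :: "nat \<Rightarrow> real poly fps \<Rightarrow> 'a::real_field \<Rightarrow> 'a \<Rightarrow> 'a" where
  "out_eval k F s t = (\<Sum>h\<le>k. poly (map_poly of_real (fps_nth F h)) (inverse s) * t ^ h)"


section \<open>Asymptotically cylindrical integral affine surfaces\<close>

text \<open>
  The surface is glued from its maximal cells as in the work of Gross, Hacking and Siebert: each
  maximal cell \<open>\<sigma>\<close> has a chart onto an integral polygon, and for each edge \<open>\<rho>\<close> in two maximal
  cells \<open>\<sigma>\<close>, \<open>\<sigma>'\<close> the map \<open>glin \<sigma> \<rho> \<sigma>'\<close> is the linear part of the integral affine change of charts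
  that extends the affine structure over the interior of \<open>\<rho>\<close>. The affine structure may be singular
  at the vertices. Charts are oriented, as the existence of a global holomorphic 2-form requires.

  The remaining components describe the cylindrical end. For \<open>i \<le> emax\<close> (\<open>m\<close> in the usual notation),
  \<open>ucell i\<close> is the unbounded maximal cell between the unbounded edges \<open>uedge i\<close> and \<open>uedge (i+1)\<close>
  (cyclically). \<open>cyl\<close> is the affine parametrization of the complement of \<open>Kset\<close> by
  \<open>\<real>\<^sub>>\<^sub>0 \<times> [0, ell]\<close>; \<open>height i\<close> is the second coordinate of \<open>uedge i\<close>; \<open>udir i\<close> and \<open>uxi i\<close> are the
  images of \<open>(1,0)\<close> and \<open>(0,1)\<close> under the linear part of \<open>cyl\<close> in the chart of \<open>ucell i\<close>.
\<close>

record 'b cyl_surface =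
  spc :: "'b topology"
  Pmax :: "'b set set"
  chart :: "'b set \<Rightarrow> 'b \<Rightarrow> real \<times> real"
  glin :: "'b set \<Rightarrow> 'b set \<Rightarrow> 'b set \<Rightarrow> zvec \<Rightarrow> zvec"
  Kset :: "'b set"
  ell :: real
  cyl :: "real \<times> real \<Rightarrow> 'b"
  emax :: nat
  ucell :: "nat \<Rightarrow> 'b set"
  uedge :: "nat \<Rightarrow> 'b set"
  height :: "nat \<Rightarrow> real"
  udir :: "nat \<Rightarrow> zvec"
  uxi :: "nat \<Rightarrow> zvec"
  shear :: int

definition integral_polygon :: "(real \<times> real) set \<Rightarrow> bool" where
  "integral_polygon P \<longleftrightarrow>
     (\<exists>V D. finite V \<and> V \<noteq> {} \<and> finite D \<and>
        P = {x + y | x y. x \<in> convex hull (rvec ` V) \<and> y \<in> convex_cone hull (rvec ` D)}) \<and>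
     (\<exists>x. x extreme_point_of P) \<and> interior P \<noteq> {}"

definition is_face :: "'b cyl_surface \<Rightarrow> 'b set \<Rightarrow> 'b set \<Rightarrow> bool" where
  "is_face S \<sigma> \<tau> \<longleftrightarrow> \<tau> \<noteq> {} \<and> \<tau> \<subseteq> \<sigma> \<and> chart S \<sigma> ` \<tau> face_of chart S \<sigma> ` \<sigma>"

definition cells :: "'b cyl_surface \<Rightarrow> 'b set set" where
  "cells S = {\<tau>. \<exists>\<sigma>\<in>Pmax S. is_face S \<sigma> \<tau>}"

definition edges :: "'b cyl_surface \<Rightarrow> 'b set set" where
  "edges S = {\<rho>. \<exists>\<sigma>\<in>Pmax S. is_face S \<sigma> \<rho> \<and> aff_dim (chart S \<sigma> ` \<rho>) = 1}"

definition vertices :: "'b cyl_surface \<Rightarrow> 'b set" where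
  "vertices S = {v. {v} \<in> cells S}"

text \<open>The maximal cell containing a two-dimensional subset.\<close>

definition cell_of :: "'b cyl_surface \<Rightarrow> 'b set \<Rightarrow> 'b set" where
  "cell_of S \<uu> = (THE \<sigma>. \<sigma> \<in> Pmax S \<and> \<uu> \<subseteq> \<sigma>)"

text \<open>The primitive covector, in the chart of \<open>\<sigma>\<close>, that is constant on the one-dimensional set \<open>Y\<close> and
  nonnegative on the two-dimensional set \<open>\<uu>\<close> having \<open>Y\<close> in its boundary.\<close>

definition conormal :: "'b cyl_surface \<Rightarrow> 'b set \<Rightarrow> 'b set \<Rightarrow> 'b set \<Rightarrow> zvec" where
  "conormal S \<sigma> Y \<uu> = (THE n. primitive_vec n \<and>
     (\<forall>y\<in>Y. \<forall>x\<in>Y. rvec n \<bullet> (chart S \<sigma> x - chart S \<sigma> y) = 0) \<and>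
     (\<forall>y\<in>Y. \<forall>x\<in>\<uu>. rvec n \<bullet> (chart S \<sigma> x - chart S \<sigma> y) \<ge> 0))"

definition integral_affine_surface :: "'b cyl_surface \<Rightarrow> bool" where
  "integral_affine_surface S \<longleftrightarrow>
     Hausdorff_space (spc S) \<and> connected_space (spc S) \<and>
     (\<forall>x\<in>topspace (spc S). \<exists>U. openin (spc S) U \<and> x \<in> U \<and>
        subtopology (spc S) U homeomorphic_space (euclidean :: (real \<times> real) topology)) \<and>
     finite (Pmax S) \<and> topspace (spc S) = \<Union>(Pmax S) \<and>
     (\<forall>\<sigma>\<in>Pmax S. closedin (spc S) \<sigma> \<and> integral_polygon (chart S \<sigma> ` \<sigma>) \<and>
        homeomorphic_map (subtopology (spc S) \<sigma>) (top_of_set (chart S \<sigma> ` \<sigma>)) (chart S \<sigma>)) \<and>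
     (\<forall>\<sigma>\<in>Pmax S. \<forall>\<sigma>'\<in>Pmax S. \<sigma> \<noteq> \<sigma>' \<longrightarrow>
        \<sigma> \<inter> \<sigma>' = \<Union>{\<tau>. is_face S \<sigma> \<tau> \<and> is_face S \<sigma>' \<tau> \<and> \<tau> \<noteq> \<sigma> \<and> \<tau> \<noteq> \<sigma>'}) \<and>
     (\<forall>\<rho>\<in>edges S. card {\<sigma>\<in>Pmax S. \<rho> \<subseteq> \<sigma>} = 2) \<and>
     (\<forall>\<rho>\<in>edges S. \<forall>\<sigma>\<in>Pmax S. \<forall>\<sigma>'\<in>Pmax S. \<rho> \<subseteq> \<sigma> \<and> \<rho> \<subseteq> \<sigma>' \<and> \<sigma> \<noteq> \<sigma>' \<longrightarrow>
        is_face S \<sigma> \<rho> \<and> is_face S \<sigma>' \<rho> \<and>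
        SL2Z (glin S \<sigma> \<rho> \<sigma>') \<and>
        (\<forall>m. glin S \<sigma>' \<rho> \<sigma> (glin S \<sigma> \<rho> \<sigma>' m) = m) \<and>
        (\<forall>p\<in>\<rho>. \<forall>q\<in>\<rho>. chart S \<sigma>' p - chart S \<sigma>' q =
             rlin (glin S \<sigma> \<rho> \<sigma>') (chart S \<sigma> p - chart S \<sigma> q)) \<and>
        \<comment> \<open>the two cells lie on opposite sides of \<open>\<rho>\<close>\<close>
        (\<forall>m. pairing (conormal S \<sigma>' \<rho> \<sigma>') (glin S \<sigma> \<rho> \<sigma>' m) = - pairing (conormal S \<sigma> \<rho> \<sigma>) m))"

definition nxt :: "'b cyl_surface \<Rightarrow> nat \<Rightarrow> nat" where
  "nxt S i = Suc i mod Suc (emax S)"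

text \<open>
  The strip is closed up by the integral affine map with linear part \<open>(1 e; 0 1)\<close>, \<open>e = shear S\<close>,
  which is the transition function from the affine coordinates near \<open>y = ell\<close> to those near \<open>y = 0\<close>.
  Thus parallel transport across \<open>uedge 0\<close> maps the tangent vector \<open>(0,1)\<close> in the coordinates of
  \<open>ucell emax\<close> to \<open>(e,1)\<close> in those of \<open>ucell 0\<close>.
\<close>

definition asymptotically_cylindrical :: "'b cyl_surface \<Rightarrow> bool" where
  "asymptotically_cylindrical S \<longleftrightarrow> integral_affine_surface S \<and>
     (let m = emax S; \<sigma> = ucell S; b = uedge S; d = udir S; \<xi> = uxi S; y = height S in
     1 \<le> m \<and>
     bij_betw \<sigma> {..m} {\<tau> \<in> Pmax S. \<not> compactin (spc S) \<tau>} \<and>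
     bij_betw b {..m} {\<rho> \<in> edges S. \<not> compactin (spc S) \<rho>} \<and>
     (\<forall>i\<le>m. is_face S (\<sigma> i) (b i) \<and> is_face S (\<sigma> i) (b (nxt S i))) \<and>
     \<comment> \<open>all unbounded edges are parallel, with outward direction \<open>(1,0)\<close>\<close>
     (\<forall>i\<le>m. \<forall>\<rho>\<in>{b i, b (nxt S i)}. \<forall>p\<in>\<rho>. \<forall>s\<ge>0.
        chart S (\<sigma> i) p + s *\<^sub>R rvec (d i) \<in> chart S (\<sigma> i) ` \<rho>) \<and>
     (\<forall>i\<le>m. zdet (d i) (\<xi> i) = 1) \<and>
     (\<forall>i<m. glin S (\<sigma> i) (b (Suc i)) (\<sigma> (Suc i)) (d i) = d (Suc i) \<and>
             glin S (\<sigma> i) (b (Suc i)) (\<sigma> (Suc i)) (\<xi> i) = \<xi> (Suc i)) \<and>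
     glin S (\<sigma> m) (b 0) (\<sigma> 0) (d m) = d 0 \<and>
     glin S (\<sigma> m) (b 0) (\<sigma> 0) (\<xi> m) = \<xi> 0 + zscale (shear S) (d 0) \<and>
     compactin (spc S) (Kset S) \<and> 0 < ell S \<and>
     quotient_map (top_of_set ({0<..} \<times> {0..ell S}))
        (subtopology (spc S) (topspace (spc S) - Kset S)) (cyl S) \<and>
     (\<forall>p\<in>{0<..} \<times> {0..ell S}. \<forall>q\<in>{0<..} \<times> {0..ell S}. cyl S p = cyl S q \<longleftrightarrow>
        p = q \<or> (fst p = fst q \<and> {snd p, snd q} = {0, ell S})) \<and>
     0 \<le> y 0 \<and> (\<forall>i<m. y i < y (Suc i)) \<and> y m < ell S \<and>
     (\<forall>i\<le>m. \<forall>x>0. cyl S (x, y i) \<in> b i) \<and>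
     (\<forall>i\<le>m. \<exists>c. \<forall>x>0. \<forall>\<eta>\<in>{y i..(if i < m then y (Suc i) else ell S)}.
        cyl S (x, \<eta>) \<in> \<sigma> i \<and>
        chart S (\<sigma> i) (cyl S (x, \<eta>)) = c + x *\<^sub>R rvec (d i) + \<eta> *\<^sub>R rvec (\<xi> i)) \<and>
     (\<exists>c. \<forall>x>0. \<forall>\<eta>\<in>{0..y 0}. cyl S (x, \<eta>) \<in> \<sigma> m \<and>
        chart S (\<sigma> m) (cyl S (x, \<eta>)) =
          c + x *\<^sub>R rvec (d m) + \<eta> *\<^sub>R rvec (\<xi> m - zscale (shear S) (d m))))"


section \<open>Wall structures\<close>

text \<open>The function of a wall is written in the chart of the maximal cell \<open>home\<close> containing the wall.\<close>

record 'b wall =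
  seg :: "'b set"
  home :: "'b set"
  wfun :: ser

record 'b wall_str =
  walls :: "'b wall set"
  chambers :: "'b set set"
  kink :: "'b set \<Rightarrow> nat"

definition rational_segment :: "(real \<times> real) set \<Rightarrow> zvec \<Rightarrow> bool" where
  "rational_segment Y d \<longleftrightarrow> primitive_vec d \<and>
     (\<exists>a\<in>\<rat> \<times> \<rat>. Y = {a + s *\<^sub>R rvec d | s. 0 \<le> s} \<or>
       (\<exists>L>0. L \<in> \<rat> \<and> Y = {a + s *\<^sub>R rvec d | s. 0 \<le> s \<and> s \<le> L}))"

definition slab :: "'b cyl_surface \<Rightarrow> 'b wall \<Rightarrow> bool" where
  "slab S p \<longleftrightarrow> (\<exists>\<rho>\<in>edges S. seg p \<subseteq> \<rho>)"

definition slab_edge :: "'b cyl_surface \<Rightarrow> 'b wall \<Rightarrow> 'b set" where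
  "slab_edge S p = (THE \<rho>. \<rho> \<in> edges S \<and> seg p \<subseteq> \<rho>)"

definition wfun_in :: "'b cyl_surface \<Rightarrow> 'b wall \<Rightarrow> 'b set \<Rightarrow> ser" where
  "wfun_in S p \<sigma> = (if home p = \<sigma> then wfun p
     else ser_map (glin S (home p) (slab_edge S p) \<sigma>) (wfun p))"

definition chamber_face :: "'b cyl_surface \<Rightarrow> 'b set \<Rightarrow> 'b set \<Rightarrow> bool" where
  "chamber_face S \<uu> \<tau> \<longleftrightarrow> \<tau> \<noteq> {} \<and> \<tau> \<subseteq> \<uu> \<and>
     chart S (cell_of S \<uu>) ` \<tau> face_of chart S (cell_of S \<uu>) ` \<uu>"

definition wall_structure :: "nat \<Rightarrow> 'b cyl_surface \<Rightarrow> 'b wall_str \<Rightarrow> bool" where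
  "wall_structure k S W \<longleftrightarrow>
     \<comment> \<open>kinks of a multivalued piecewise linear function with central fibre the union of the toric
        surfaces of the maximal cells\<close>
     (\<forall>\<rho>\<in>edges S. 1 \<le> kink W \<rho>) \<and>
     finite (walls W) \<and> inj_on seg (walls W) \<and>
     (\<forall>p\<in>walls W. home p \<in> Pmax S \<and> seg p \<subseteq> home p \<and>
        fps_cutoff (Suc k) (wfun p) = wfun p \<and>
        (\<exists>d. rational_segment (chart S (home p) ` seg p) d \<and>
           (\<forall>h. \<forall>m\<in>Poly_Mapping.keys (fps_nth (wfun p) h). \<exists>j. m = zscale j d)) \<and>
        (\<not> slab S p \<longrightarrow> fps_nth (wfun p) 0 = 1) \<and>
        \<comment> \<open>the exponents lie in the monoid \<open>P\<^sub>y\<close> for the points \<open>y\<close> of \<open>p\<close> on edges of the home cell\<close>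
        (\<forall>\<rho>\<in>edges S. \<forall>y\<in>seg p \<inter> \<rho> - vertices S. \<rho> \<subseteq> home p \<longrightarrow>
           (\<forall>h. \<forall>m\<in>Poly_Mapping.keys (fps_nth (wfun p) h).
              int h \<ge> - int (kink W \<rho>) * pairing (conormal S (home p) \<rho> (home p)) m))) \<and>
     \<comment> \<open>the walls are the one-dimensional cells of a polyhedral decomposition refining that of \<open>S\<close>\<close>
     finite (chambers W) \<and> \<Union>(chambers W) = topspace (spc S) \<and>
     (\<forall>\<uu>\<in>chambers W. \<exists>\<sigma>\<in>Pmax S. \<uu> \<subseteq> \<sigma> \<and> polyhedron (chart S \<sigma> ` \<uu>) \<and>
        interior (chart S \<sigma> ` \<uu>) \<noteq> {}) \<and>
     (\<forall>\<uu>\<in>chambers W. \<forall>\<uu>'\<in>chambers W. \<uu> \<noteq> \<uu>' \<longrightarrow>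
        \<uu> \<inter> \<uu>' = \<Union>{\<tau>. chamber_face S \<uu> \<tau> \<and> chamber_face S \<uu>' \<tau> \<and> \<tau> \<noteq> \<uu> \<and> \<tau> \<noteq> \<uu>'}) \<and>
     seg ` walls W = {\<tau>. \<exists>\<uu>\<in>chambers W. chamber_face S \<uu> \<tau> \<and>
        aff_dim (chart S (cell_of S \<uu>) ` \<tau>) = 1}"

definition adjacent :: "'b wall_str \<Rightarrow> 'b set \<Rightarrow> 'b wall \<Rightarrow> 'b set \<Rightarrow> bool" where
  "adjacent W \<uu> p \<uu>' \<longleftrightarrow> \<uu> \<in> chambers W \<and> \<uu>' \<in> chambers W \<and> \<uu> \<noteq> \<uu>' \<and>
     p \<in> walls W \<and> seg p \<subseteq> \<uu> \<inter> \<uu>'"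


subsection \<open>Consistency in codimensions zero, one and two\<close>

text \<open>The automorphism for crossing a wall that is not a slab, starting in the chamber \<open>\<uu>\<close>.\<close>

definition crossing :: "nat \<Rightarrow> 'b cyl_surface \<Rightarrow> 'b wall \<Rightarrow> 'b set \<Rightarrow> ser \<Rightarrow> ser" where
  "crossing k S p \<uu> = wall_auto k (wfun_in S p (cell_of S \<uu>)) (conormal S (cell_of S \<uu>) (seg p) \<uu>)"

inductive_set gen_subring :: "nat \<Rightarrow> (ser \<times> ser) set \<Rightarrow> (ser \<times> ser) set" for k G where
  gen: "g \<in> G \<Longrightarrow> g \<in> gen_subring k G"
| add: "(a, b) \<in> gen_subring k G \<Longrightarrow> (a', b') \<in> gen_subring k G \<Longrightarrow> (a + a', b + b') \<in> gen_subring k G"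
| mult: "(a, b) \<in> gen_subring k G \<Longrightarrow> (a', b') \<in> gen_subring k G \<Longrightarrow> (a * a', b * b') \<in> gen_subring k G"
| cong: "(a, b) \<in> gen_subring k G \<Longrightarrow> ser_eq k a a' \<Longrightarrow> ser_eq k b b' \<Longrightarrow> (a', b') \<in> gen_subring k G"

text \<open>The image of the slab ring
  \<open>\<real>[t]/(t\<^sup>k\<^sup>+\<^sup>1)[\<Lambda>\<^sub>\<rho>][Z\<^sub>+, Z\<^sub>-]/(Z\<^sub>+ Z\<^sub>- - f t\<^sup>\<kappa>)\<close> in the product of the rings of the two chambers
  \<open>\<uu>\<close>, \<open>\<uu>'\<close> adjacent to the slab: \<open>Z\<^sub>+ = z\<^bsup>\<xi>\<^esup>\<close> on \<open>\<uu>\<close> and \<open>Z\<^sub>- = z\<^bsup>-\<xi>\<^esup>\<close> on \<open>\<uu>'\<close>.\<close>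

definition slab_ring :: "nat \<Rightarrow> 'b cyl_surface \<Rightarrow> 'b wall_str \<Rightarrow> 'b wall \<Rightarrow> 'b set \<Rightarrow> 'b set \<Rightarrow> (ser \<times> ser) set" where
  "slab_ring k S W p \<uu> \<uu>' =
     (let \<sigma> = cell_of S \<uu>; \<sigma>' = cell_of S \<uu>'; \<rho> = slab_edge S p; A = glin S \<sigma> \<rho> \<sigma>';
          n = conormal S \<sigma> \<rho> \<sigma>; \<kappa> = kink W \<rho>; f = wfun_in S p \<sigma>; f' = wfun_in S p \<sigma>'
      in gen_subring k (
        {(fps_const (Poly_Mapping.single 0 c), fps_const (Poly_Mapping.single 0 c)) | c. True} \<union>
        {(fps_X, fps_X)} \<union>
        {(zmon m, zmon (A m)) | m. pairing n m = 0} \<union>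
        {(zmon \<xi>, f' * fps_X ^ \<kappa> * zmon (A \<xi>)) | \<xi>. pairing n \<xi> = 1} \<union>
        {(f * fps_X ^ \<kappa> * zmon (- \<xi>), zmon (- A \<xi>)) | \<xi>. pairing n \<xi> = 1}))"

definition joints :: "'b cyl_surface \<Rightarrow> 'b wall_str \<Rightarrow> 'b set" where
  "joints S W = {j. \<exists>\<uu>\<in>chambers W. chamber_face S \<uu> {j}}"

text \<open>The chambers \<open>c 0, ..., c (r-1)\<close> and walls \<open>p 0, ..., p (r-1)\<close> at \<open>j\<close> in cyclic order, with \<open>p i\<close>
  between \<open>c i\<close> and \<open>c (i+1)\<close>.\<close>

definition cyclic_at :: "'b wall_str \<Rightarrow> 'b \<Rightarrow> nat \<Rightarrow> (nat \<Rightarrow> 'b set) \<Rightarrow> (nat \<Rightarrow> 'b wall) \<Rightarrow> bool" where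
  "cyclic_at W j r c p \<longleftrightarrow>
     bij_betw c {..<r} {\<uu> \<in> chambers W. j \<in> \<uu>} \<and>
     bij_betw p {..<r} {q \<in> walls W. j \<in> seg q} \<and>
     (\<forall>i<r. seg (p i) \<subseteq> c i \<inter> c (Suc i mod r))"

definition consistent0 :: "nat \<Rightarrow> 'b cyl_surface \<Rightarrow> 'b wall_str \<Rightarrow> bool" where
  "consistent0 k S W \<longleftrightarrow> (\<forall>j\<in>joints S W - \<Union>(edges S). \<forall>r c p. cyclic_at W j r c p \<longrightarrow>
     (\<forall>m. ser_eq k (fold (\<lambda>i. crossing k S (p i) (c i)) [0..<r] (zmon m)) (zmon m)))"

definition consistent1 :: "nat \<Rightarrow> 'b cyl_surface \<Rightarrow> 'b wall_str \<Rightarrow> bool" where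
  "consistent1 k S W \<longleftrightarrow> (\<forall>j\<in>joints S W \<inter> \<Union>(edges S) - vertices S. \<forall>r c p a.
     cyclic_at W j r c p \<and> Suc a < r \<and> slab S (p a) \<and> slab S (p (r - 1)) \<longrightarrow>
       (let \<theta> = fold (\<lambda>i. crossing k S (p i) (c i)) [0..<a];
            \<theta>' = fold (\<lambda>i. crossing k S (p i) (c (Suc i))) (rev [Suc a..<r - 1])
        in {(x, x'). \<exists>(y, y') \<in> slab_ring k S W (p (r - 1)) (c 0) (c (r - 1)).
              ser_eq k (\<theta> y) x \<and> ser_eq k (\<theta>' y') x'}
           = slab_ring k S W (p a) (c a) (c (Suc a))))"

text \<open>
  Broken lines at a vertex \<open>v\<close> live on the cone complex of tangent wedges at \<open>v\<close>. A segment of a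
  broken line is given by its chamber \<open>\<uu>\<close> and its monomial \<open>a t\<^sup>h z\<^sup>m\<close>, with \<open>m\<close> in the chart of the
  maximal cell containing \<open>\<uu>\<close>; the line moves in direction \<open>-m\<close>.
\<close>

type_synonym 'b segment = "'b set \<times> real \<times> nat \<times> zvec"

definition tcone :: "'b cyl_surface \<Rightarrow> 'b \<Rightarrow> 'b set \<Rightarrow> 'b set \<Rightarrow> (real \<times> real) set" where
  "tcone S v \<sigma> Y = {s *\<^sub>R (chart S \<sigma> x - chart S \<sigma> v) | s x. 0 \<le> s \<and> x \<in> Y}"

definition wall_trans :: "'b cyl_surface \<Rightarrow> 'b wall \<Rightarrow> 'b set \<Rightarrow> 'b set \<Rightarrow> zvec \<Rightarrow> zvec" where
  "wall_trans S p \<uu> \<uu>' = (if slab S p then glin S (cell_of S \<uu>) (slab_edge S p) (cell_of S \<uu>') else id)"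

text \<open>The monomial \<open>a t\<^sup>h z\<^sup>m\<close> on \<open>\<uu>\<close> is a term in the expansion obtained by transporting
  \<open>a' t\<^bsup>h'\<^esup> z\<^bsup>m'\<^esup>\<close> from \<open>\<uu>'\<close> across \<open>p\<close>.\<close>

definition transport_term :: "nat \<Rightarrow> 'b cyl_surface \<Rightarrow> 'b wall_str \<Rightarrow> 'b wall \<Rightarrow> 'b segment \<Rightarrow> 'b segment \<Rightarrow> bool" where
  "transport_term k S W p = (\<lambda>(\<uu>', a', h', m') (\<uu>, a, h, m).
     let n = conormal S (cell_of S \<uu>') (seg p) \<uu>'; N = pairing n m';
         \<kappa> = (if slab S p then kink W (slab_edge S p) else 0);
         f = wfun_in S p (cell_of S \<uu>')
     in adjacent W \<uu>' p \<uu> \<and> 0 < N \<and>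
        (\<exists>\<mu> g. let c = Poly_Mapping.lookup (fps_nth (f ^ nat N) g) \<mu> in
           c \<noteq> 0 \<and> a = a' * c \<and> h = h' + \<kappa> * nat N + g \<and> h \<le> k \<and>
           m = wall_trans S p \<uu>' \<uu> (m' + \<mu>)))"

text \<open>The list of segments is in reverse order, beginning with the segment that ends at \<open>x\<close>. In the
  second equation \<open>y\<close> is the point at which the last wall is crossed.\<close>

fun broken_line :: "nat \<Rightarrow> 'b cyl_surface \<Rightarrow> 'b wall_str \<Rightarrow> 'b \<Rightarrow> real \<times> real \<Rightarrow> 'b segment list \<Rightarrow> bool" where
  "broken_line k S W v x [] \<longleftrightarrow> False"
| "broken_line k S W v x [(\<uu>, a, h, m)] \<longleftrightarrow>
     \<uu> \<in> chambers W \<and> v \<in> \<uu> \<and> x \<in> tcone S v (cell_of S \<uu>) \<uu> \<and>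
     rvec m \<in> tcone S v (cell_of S \<uu>) \<uu> \<and> a = 1 \<and> h = 0"
| "broken_line k S W v x (s # s' # L) \<longleftrightarrow>
     (case s of (\<uu>, a, h, m) \<Rightarrow> \<exists>p y l. v \<in> seg p \<and> transport_term k S W p s' s \<and>
        x \<in> tcone S v (cell_of S \<uu>) \<uu> \<and>
        y \<in> tcone S v (cell_of S \<uu>) (seg p) \<and> y \<noteq> 0 \<and> 0 < l \<and> x = y - l *\<^sub>R rvec m \<and>
        broken_line k S W v (rlin (wall_trans S p \<uu> (fst s')) y) (s' # L))"

text \<open>An asymptotic monomial on the ray between two chambers has a representative in each of them.\<close>

definition same_asymptotic :: "'b cyl_surface \<Rightarrow> 'b wall_str \<Rightarrow> 'b \<Rightarrow> 'b set \<times> zvec \<Rightarrow> 'b set \<times> zvec \<Rightarrow> bool" where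
  "same_asymptotic S W v = (\<lambda>(\<uu>, m) (\<uu>', m'). (\<uu>, m) = (\<uu>', m') \<or>
     (\<exists>p. v \<in> seg p \<and> adjacent W \<uu> p \<uu>' \<and> rvec m \<in> tcone S v (cell_of S \<uu>) (seg p) \<and>
        m' = wall_trans S p \<uu> \<uu>' m))"

text \<open>The local theta function of the asymptotic monomial \<open>m\<^sub>0\<close> on \<open>\<uu>\<^sub>0\<close>, evaluated with end point \<open>x\<close>
  in \<open>\<uu>\<close>.\<close>

definition local_theta :: "nat \<Rightarrow> 'b cyl_surface \<Rightarrow> 'b wall_str \<Rightarrow> 'b \<Rightarrow> 'b set \<Rightarrow> zvec \<Rightarrow> 'b set \<Rightarrow> real \<times> real \<Rightarrow> ser" where
  "local_theta k S W v \<uu>\<^sub>0 m\<^sub>0 \<uu> x =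
     (\<Sum>L | broken_line k S W v x L \<and> fst (hd L) = \<uu> \<and>
            same_asymptotic S W v (\<uu>\<^sub>0, m\<^sub>0) (fst (last L), snd (snd (snd (last L)))).
        case hd L of (_, a, h, m) \<Rightarrow> fps_const (Poly_Mapping.single m a) * fps_X ^ h)"

text \<open>Broken lines through \<open>v\<close> end on rays of rational slope, so points of irrational slope are general.\<close>

definition general_point :: "'b cyl_surface \<Rightarrow> 'b \<Rightarrow> 'b set \<Rightarrow> real \<times> real \<Rightarrow> bool" where
  "general_point S v \<uu> x \<longleftrightarrow> x \<in> interior (tcone S v (cell_of S \<uu>) \<uu>) \<and>
     (\<forall>m. m \<noteq> 0 \<longrightarrow> fst x * snd (rvec m) - snd x * fst (rvec m) \<noteq> 0)"

definition consistent2 :: "nat \<Rightarrow> 'b cyl_surface \<Rightarrow> 'b wall_str \<Rightarrow> bool" where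
  "consistent2 k S W \<longleftrightarrow> (\<forall>v\<in>vertices S. \<forall>\<uu>\<^sub>0\<in>chambers W. \<forall>m\<^sub>0.
     v \<in> \<uu>\<^sub>0 \<and> m\<^sub>0 \<noteq> 0 \<and> rvec m\<^sub>0 \<in> tcone S v (cell_of S \<uu>\<^sub>0) \<uu>\<^sub>0 \<longrightarrow>
       (let th = local_theta k S W v \<uu>\<^sub>0 m\<^sub>0 in
        (\<forall>\<uu>\<in>chambers W. \<forall>x x'. v \<in> \<uu> \<and> general_point S v \<uu> x \<and> general_point S v \<uu> x' \<longrightarrow>
           ser_eq k (th \<uu> x) (th \<uu> x')) \<and>
        (\<forall>\<uu> p \<uu>' x x'. adjacent W \<uu> p \<uu>' \<and> v \<in> seg p \<and>
             general_point S v \<uu> x \<and> general_point S v \<uu>' x' \<longrightarrow>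
           (if slab S p then (th \<uu> x, th \<uu>' x') \<in> slab_ring k S W p \<uu> \<uu>'
            else ser_eq k (crossing k S p \<uu> (th \<uu> x)) (th \<uu>' x')))))"

definition consistent_wall_structure :: "nat \<Rightarrow> 'b cyl_surface \<Rightarrow> 'b wall_str \<Rightarrow> bool" where
  "consistent_wall_structure k S W \<longleftrightarrow>
     wall_structure k S W \<and> consistent0 k S W \<and> consistent1 k S W \<and> consistent2 k S W"


subsection \<open>Unbounded walls\<close>

definition unbounded_walls :: "'b cyl_surface \<Rightarrow> 'b wall_str \<Rightarrow> 'b wall set" where
  "unbounded_walls S W = {p \<in> walls W. \<not> compactin (spc S) (seg p)}"

text \<open>The exponent of \<open>w\<close> in the chart of an unbounded maximal cell.\<close>

definition wdir :: "'b cyl_surface \<Rightarrow> 'b set \<Rightarrow> zvec" where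
  "wdir S \<sigma> = udir S (THE i. i \<le> emax S \<and> ucell S i = \<sigma>)"

definition outgoing :: "'b cyl_surface \<Rightarrow> 'b wall_str \<Rightarrow> bool" where
  "outgoing S W \<longleftrightarrow> (\<forall>p\<in>unbounded_walls S W. \<forall>h. \<forall>m\<in>Poly_Mapping.keys (fps_nth (wfun p) h).
     \<exists>j::nat. m = zscale (- int j) (wdir S (home p)))"

text \<open>The function of an unbounded wall as an element of \<open>\<real>[w\<^sup>-\<^sup>1][[t]]\<close>.\<close>

definition out_fun :: "'b cyl_surface \<Rightarrow> 'b wall \<Rightarrow> real poly fps" where
  "out_fun S p = Abs_fps (\<lambda>h. \<Sum>m\<in>Poly_Mapping.keys (fps_nth (wfun p) h).
     monom (Poly_Mapping.lookup (fps_nth (wfun p) h) m) (nat (- zcoord (wdir S (home p)) m)))"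

definition unbounded_slab :: "'b cyl_surface \<Rightarrow> 'b wall_str \<Rightarrow> nat \<Rightarrow> 'b wall" where
  "unbounded_slab S W i = (THE p. p \<in> unbounded_walls S W \<and> seg p \<subseteq> uedge S i)"

definition walls_between :: "'b cyl_surface \<Rightarrow> 'b wall_str \<Rightarrow> nat \<Rightarrow> 'b wall set" where
  "walls_between S W i = {p \<in> unbounded_walls S W. \<not> slab S p \<and> home p = ucell S i}"

definition f_out :: "nat \<Rightarrow> 'b cyl_surface \<Rightarrow> 'b wall_str \<Rightarrow> real poly fps" where
  "f_out k S W = fps_cutoff (Suc k) (\<Prod>p\<in>unbounded_walls S W. out_fun S p)"

text \<open>Modulo \<open>t\<close> the functions of the unbounded slabs are constants with product \<open>1\<close> if \<open>f_out\<close> is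
  congruent to \<open>1\<close>. They have to be positive for \<open>u\<^sub>i v\<^sub>i = f\<^sub>\<bb>\<^sub>i t\<^sup>\<kappa>\<^sub>i\<close> to have points with \<open>u\<^sub>i, v\<^sub>i > 0\<close>
  on the fibres over small \<open>t > 0\<close>, that is, for the positive real locus to extend as a cylinder.\<close>

definition positive_slabs :: "nat \<Rightarrow> 'b cyl_surface \<Rightarrow> 'b wall_str \<Rightarrow> bool" where
  "positive_slabs k S W \<longleftrightarrow>
     (\<forall>i\<le>emax S. \<forall>s>0. out_eval k (out_fun S (unbounded_slab S W i)) s (0::real) > 0)"

definition total_kink :: "'b cyl_surface \<Rightarrow> 'b wall_str \<Rightarrow> nat" where
  "total_kink S W = (\<Sum>i\<le>emax S. kink W (uedge S i))"


section \<open>Reduced complex spaces and holomorphic relative 2-forms\<close>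

text \<open>
  A reduced complex space is a topological space with a sheaf of complex-valued functions that is
  locally isomorphic to an analytic subset of an open set in \<open>\<complex>\<^sup>n\<close>; the functions in \<open>hol V\<close> matter only on \<open>V\<close>.

  Further components: \<open>tpar\<close> is the parameter \<open>t\<close>; \<open>rconj\<close> is the antiholomorphic involution of the
  real structure; \<open>orbit \<tau>\<close> is the toric stratum of the central fibre for the cell \<open>\<tau>\<close>; \<open>zmono \<uu> m\<close> is
  the monomial \<open>z\<^sup>m\<close> of the chamber \<open>\<uu>\<close>, a function on \<open>cham \<uu>\<close>; \<open>wdom\<close> is the domain of \<open>wfct\<close>;
  \<open>Uset i\<close>, \<open>ufct i\<close>, \<open>vfct i\<close>, \<open>glue i\<close> are \<open>U\<^sub>i\<close>, \<open>u\<^sub>i\<close>, \<open>v\<^sub>i\<close>, \<open>f\<^sub>i\<close> (the latter a function of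
  \<open>(w,t)\<close>); \<open>overlap i\<close> is the overlap of \<open>U\<^sub>i\<close> and \<open>U\<^sub>i\<^sub>+\<^sub>1\<close> along the component of \<open>ucell i\<close>.

  \<open>form2 x a b\<close> is the coefficient at \<open>x\<close> of the relative 2-form with respect to \<open>da \<and> db\<close>, for functions
  \<open>a\<close>, \<open>b\<close> that are holomorphic coordinates near \<open>x\<close> on the fibres of \<open>tpar\<close>.
\<close>

record ('b, 'x) family =
  xtop :: "'x topology"
  hol :: "'x set \<Rightarrow> ('x \<Rightarrow> complex) set"
  tpar :: "'x \<Rightarrow> complex"
  rconj :: "'x \<Rightarrow> 'x"
  orbit :: "'b set \<Rightarrow> 'x set"
  cham :: "'b set \<Rightarrow> 'x set"
  zmono :: "'b set \<Rightarrow> zvec \<Rightarrow> 'x \<Rightarrow> complex"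
  wdom :: "'x set"
  wfct :: "'x \<Rightarrow> complex"
  Uset :: "nat \<Rightarrow> 'x set"
  ufct :: "nat \<Rightarrow> 'x \<Rightarrow> complex"
  vfct :: "nat \<Rightarrow> 'x \<Rightarrow> complex"
  overlap :: "nat \<Rightarrow> 'x set"
  glue :: "nat \<Rightarrow> complex ^ 2 \<Rightarrow> complex"
  form2 :: "'x \<Rightarrow> ('x \<Rightarrow> complex) \<Rightarrow> ('x \<Rightarrow> complex) \<Rightarrow> complex"

definition holomorphic_several :: "(complex ^ 'n::finite \<Rightarrow> complex) \<Rightarrow> (complex ^ 'n) set \<Rightarrow> bool" where
  "holomorphic_several F D \<longleftrightarrow> open D \<and>
     (\<forall>z\<in>D. \<exists>F'. (F has_derivative F') (at z) \<and> (\<forall>c v. F' (c *s v) = c * F' v))"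

text \<open>\<open>\<phi>\<close> is an isomorphism from \<open>V\<close> onto the (locally closed) analytic set \<open>A\<close>.\<close>

definition model_chart :: "('b, 'x) family \<Rightarrow> 'x set \<Rightarrow> ('x \<Rightarrow> complex ^ 'n::finite) \<Rightarrow> (complex ^ 'n) set \<Rightarrow> bool" where
  "model_chart X V \<phi> A \<longleftrightarrow> openin (xtop X) V \<and>
     homeomorphic_map (subtopology (xtop X) V) (top_of_set A) \<phi> \<and>
     (\<forall>V' h. openin (xtop X) V' \<and> V' \<subseteq> V \<longrightarrow>
        (h \<in> hol X V' \<longleftrightarrow> (\<forall>x\<in>V'. \<exists>N H. \<phi> x \<in> N \<and> holomorphic_several H N \<and>
           (\<forall>y\<in>V'. \<phi> y \<in> N \<longrightarrow> h y = H (\<phi> y)))))"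

definition reduced_complex_space :: "'n::finite itself \<Rightarrow> ('b, 'x) family \<Rightarrow> bool" where
  "reduced_complex_space _ X \<longleftrightarrow> Hausdorff_space (xtop X) \<and>
     (\<forall>V h. openin (xtop X) V \<longrightarrow> (h \<in> hol X V \<longleftrightarrow>
        (\<forall>x\<in>V. \<exists>V'. openin (xtop X) V' \<and> x \<in> V' \<and> V' \<subseteq> V \<and> h \<in> hol X V'))) \<and>
     (\<forall>x\<in>topspace (xtop X). \<exists>V (\<phi> :: 'x \<Rightarrow> complex ^ 'n) D \<G>. x \<in> V \<and> open D \<and> finite \<G> \<and>
        (\<forall>G\<in>\<G>. holomorphic_several G D) \<and> model_chart X V \<phi> {z \<in> D. \<forall>G\<in>\<G>. G z = 0})"

definition fibre0 :: "('b, 'x) family \<Rightarrow> 'x set" where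
  "fibre0 X = {x \<in> topspace (xtop X). tpar X x = 0}"

text \<open>Over the smooth curve \<open>\<complex>\<close>, flatness of the reduced space means that no fibre contains a nonempty
  open subset.\<close>

definition flat_family :: "('b, 'x) family \<Rightarrow> bool" where
  "flat_family X \<longleftrightarrow> tpar X \<in> hol X (topspace (xtop X)) \<and>
     (\<forall>V c. openin (xtop X) V \<and> (\<forall>x\<in>V. tpar X x = c) \<longrightarrow> V = {})"

definition real_structure :: "('b, 'x) family \<Rightarrow> bool" where
  "real_structure X \<longleftrightarrow>
     homeomorphic_map (xtop X) (xtop X) (rconj X) \<and>
     (\<forall>x\<in>topspace (xtop X). rconj X (rconj X x) = x \<and> tpar X (rconj X x) = cnj (tpar X x)) \<and>
     (\<forall>V h. openin (xtop X) V \<and> h \<in> hol X V \<longrightarrow> (\<lambda>x. cnj (h (rconj X x))) \<in> hol X (rconj X ` V))"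

definition cong_t :: "nat \<Rightarrow> ('b, 'x) family \<Rightarrow> 'x set \<Rightarrow> ('x \<Rightarrow> complex) \<Rightarrow> ('x \<Rightarrow> complex) \<Rightarrow> bool" where
  "cong_t k X V a b \<longleftrightarrow> (\<forall>x\<in>V. \<exists>V' g. openin (xtop X) V' \<and> x \<in> V' \<and> V' \<subseteq> V \<and> g \<in> hol X V' \<and>
     (\<forall>y\<in>V'. a y - b y = tpar X y ^ Suc k * g y))"

definition rel_map :: "('b, 'x) family \<Rightarrow> ('x \<Rightarrow> complex) \<Rightarrow> ('x \<Rightarrow> complex) \<Rightarrow> 'x \<Rightarrow> complex ^ 3" where
  "rel_map X a b x = vector [a x, b x, tpar X x]"

definition rel_coords :: "('b, 'x) family \<Rightarrow> 'x set \<Rightarrow> ('x \<Rightarrow> complex) \<Rightarrow> ('x \<Rightarrow> complex) \<Rightarrow> bool" where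
  "rel_coords X V a b \<longleftrightarrow> (\<exists>D. open D \<and> model_chart X V (rel_map X a b) D)"

definition rel_partial :: "('b, 'x) family \<Rightarrow> 'x set \<Rightarrow> ('x \<Rightarrow> complex) \<Rightarrow> ('x \<Rightarrow> complex) \<Rightarrow>
    ('x \<Rightarrow> complex) \<Rightarrow> 3 \<Rightarrow> 'x \<Rightarrow> complex" where
  "rel_partial X V a b c i x =
     deriv (\<lambda>\<zeta>. c (inv_into V (rel_map X a b) (rel_map X a b x + \<zeta> *s axis i 1))) 0"

definition rel_jacobian :: "('b, 'x) family \<Rightarrow> 'x set \<Rightarrow> ('x \<Rightarrow> complex) \<Rightarrow> ('x \<Rightarrow> complex) \<Rightarrow>
    ('x \<Rightarrow> complex) \<Rightarrow> ('x \<Rightarrow> complex) \<Rightarrow> 'x \<Rightarrow> complex" where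
  "rel_jacobian X V a b a' b' x =
     rel_partial X V a b a' 1 x * rel_partial X V a b b' 2 x -
     rel_partial X V a b a' 2 x * rel_partial X V a b b' 1 x"

definition relative_2form :: "('b, 'x) family \<Rightarrow> bool" where
  "relative_2form X \<longleftrightarrow> (\<forall>V a b. rel_coords X V a b \<longrightarrow>
     (\<lambda>x. form2 X x a b) \<in> hol X V \<and>
     (\<forall>V' a' b'. rel_coords X V' a' b' \<longrightarrow>
        (\<forall>x\<in>V \<inter> V'. form2 X x a b = rel_jacobian X V a b a' b' x * form2 X x a' b')))"


section \<open>The analytic family of a wall structure\<close>

text \<open>
  \<open>(Z\<^sub>+, Z\<^sub>-, z\<^sup>d, t)\<close> identifies \<open>V\<close> with the hypersurface
  \<open>Z\<^sub>+ Z\<^sub>- = f(z\<^sup>d, t) t\<^sup>\<kappa> + t\<^sup>k\<^sup>+\<^sup>1 G\<close> in an open subset \<open>D\<close> of \<open>\<complex>\<^sup>4\<close>. Modulo \<open>t\<^sup>k\<^sup>+\<^sup>1\<close> this is the spectrum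
  of the slab ring of \<open>p\<close>, glued to the charts of the adjacent chambers \<open>\<uu>\<close> and \<open>\<uu>'\<close>. Here \<open>d\<close>
  generates \<open>\<Lambda>\<^sub>\<rho>\<close> and \<open>\<xi>\<close> completes it to a basis, both in the chart of the cell containing \<open>\<uu>\<close>.
\<close>

definition slab_chart :: "nat \<Rightarrow> 'b cyl_surface \<Rightarrow> 'b wall_str \<Rightarrow> ('b, 'x) family \<Rightarrow> 'b wall \<Rightarrow> 'b set \<Rightarrow> 'b set \<Rightarrow>
    zvec \<Rightarrow> zvec \<Rightarrow> 'x set \<Rightarrow> ('x \<Rightarrow> complex) \<Rightarrow> ('x \<Rightarrow> complex) \<Rightarrow> ('x \<Rightarrow> complex) \<Rightarrow>
    (complex ^ 4) set \<Rightarrow> (complex ^ 4 \<Rightarrow> complex) \<Rightarrow> bool" where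
  "slab_chart k S W X p \<uu> \<uu>' d \<xi> V Zp Zm zd D G \<longleftrightarrow>
     (let \<sigma> = cell_of S \<uu>; \<sigma>' = cell_of S \<uu>'; \<rho> = slab_edge S p; A = glin S \<sigma> \<rho> \<sigma>';
          n = conormal S \<sigma> \<rho> \<sigma>
      in adjacent W \<uu> p \<uu>' \<and> primitive_vec d \<and> pairing n d = 0 \<and> pairing n \<xi> = 1 \<and>
         holomorphic_several G D \<and> D \<subseteq> {z. z $ 3 \<noteq> 0} \<and>
         {z. z $ 1 * z $ 2 = 0 \<and> z $ 3 \<noteq> 0 \<and> z $ 4 = 0} \<subseteq> D \<and>
         model_chart X V (\<lambda>x. vector [Zp x, Zm x, zd x, tpar X x] :: complex ^ 4)
           {z \<in> D. z $ 1 * z $ 2 =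
              ser_eval k (\<lambda>m. (z $ 3) powi zcoord d m) (z $ 4) (wfun_in S p \<sigma>) * (z $ 4) ^ kink W \<rho>
              + (z $ 4) ^ Suc k * G z} \<and>
         V \<inter> fibre0 X = orbit X \<sigma> \<union> orbit X \<rho> \<union> orbit X \<sigma>' \<and>
         orbit X \<sigma> = {x \<in> V \<inter> fibre0 X. Zp x \<noteq> 0} \<and>
         orbit X \<sigma>' = {x \<in> V \<inter> fibre0 X. Zm x \<noteq> 0} \<and>
         cong_t k X (V \<inter> cham X \<uu>) Zp (zmono X \<uu> \<xi>) \<and>
         cong_t k X (V \<inter> cham X \<uu>) zd (zmono X \<uu> d) \<and>
         cong_t k X (V \<inter> cham X \<uu>') Zm (zmono X \<uu>' (- A \<xi>)) \<and>
         cong_t k X (V \<inter> cham X \<uu>') zd (zmono X \<uu>' (A d)))"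

text \<open>
  Agreement modulo \<open>t\<^sup>k\<^sup>+\<^sup>1\<close> with the scheme of the wall structure: the central fibre is the union of
  toric surfaces given by the cells, and away from its zero-dimensional strata the family is
  covered by charts that modulo \<open>t\<^sup>k\<^sup>+\<^sup>1\<close> are the spectra of the chamber rings and of the slab rings, glued by
  wall crossing. (The structure sheaf of the scheme is determined by its restriction to the
  complement of the zero-dimensional strata.)
\<close>

definition agrees_with_scheme :: "nat \<Rightarrow> 'b cyl_surface \<Rightarrow> 'b wall_str \<Rightarrow> ('b, 'x) family \<Rightarrow> bool" where
  "agrees_with_scheme k S W X \<longleftrightarrow>
     fibre0 X = (\<Union>\<tau>\<in>cells S. orbit X \<tau>) \<and> disjoint_family_on (orbit X) (cells S) \<and>
     (\<forall>\<sigma>\<in>Pmax S. (xtop X) closure_of (orbit X \<sigma>) = (\<Union>\<tau>\<in>{\<tau>. is_face S \<sigma> \<tau>}. orbit X \<tau>)) \<and>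
     (\<forall>v\<in>vertices S. \<exists>x. orbit X {v} = {x}) \<and>
     (\<forall>\<uu>\<in>chambers W. cham X \<uu> \<inter> fibre0 X = orbit X (cell_of S \<uu>) \<and>
        rconj X ` cham X \<uu> = cham X \<uu> \<and>
        (\<forall>x\<in>cham X \<uu>. zmono X \<uu> 0 x = 1 \<and>
           (\<forall>m m'. zmono X \<uu> (m + m') x = zmono X \<uu> m x * zmono X \<uu> m' x)) \<and>
        (\<forall>m. cong_t k X (cham X \<uu>) (\<lambda>x. cnj (zmono X \<uu> m (rconj X x))) (zmono X \<uu> m)) \<and>
        (\<exists>D. open D \<and> {z. z $ 1 \<noteq> 0 \<and> z $ 2 \<noteq> 0 \<and> z $ 3 = 0} \<subseteq> D \<and>
           model_chart X (cham X \<uu>) (rel_map X (zmono X \<uu> (1, 0)) (zmono X \<uu> (0, 1))) D) \<and>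
        cong_t k X (cham X \<uu>) (\<lambda>x. form2 X x (zmono X \<uu> (1, 0)) (zmono X \<uu> (0, 1)))
          (\<lambda>x. 1 / (zmono X \<uu> (1, 0) x * zmono X \<uu> (0, 1) x))) \<and>
     (\<forall>\<uu> p \<uu>' m. adjacent W \<uu> p \<uu>' \<and> \<not> slab S p \<longrightarrow>
        cong_t k X (cham X \<uu> \<inter> cham X \<uu>') (zmono X \<uu> m)
          (\<lambda>x. ser_eval k (\<lambda>m'. zmono X \<uu>' m' x) (tpar X x)
                 (ser_pow k (wfun p) (pairing (conormal S (cell_of S \<uu>) (seg p) \<uu>) m))
               * zmono X \<uu>' m x)) \<and>
     (\<forall>p\<in>walls W. slab S p \<longrightarrow>
        (\<exists>\<uu> \<uu>' d \<xi> V Zp Zm zd D G. slab_chart k S W X p \<uu> \<uu>' d \<xi> V Zp Zm zd D G))"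

text \<open>The union of the irreducible components of the central fibre for bounded cells.\<close>

definition X_bounded :: "'b cyl_surface \<Rightarrow> ('b, 'x) family \<Rightarrow> 'x set" where
  "X_bounded S X = (\<Union>\<sigma>\<in>{\<sigma> \<in> Pmax S. compactin (spc S) \<sigma>}. (xtop X) closure_of (orbit X \<sigma>))"

text \<open>
  The coordinates on the end. The chart \<open>U\<^sub>i\<close> is the slab chart of the unbounded slab \<open>\<bb>\<^sub>i\<close> with
  \<open>Z\<^sub>+ = u\<^sub>i\<close>, \<open>Z\<^sub>- = v\<^sub>i\<close>, \<open>z\<^sup>d = w\<close> and no correction term, so \<open>u\<^sub>i v\<^sub>i = f\<^sub>\<bb>\<^sub>i(w,t) t\<^sup>\<kappa>\<^sub>i\<close> on \<open>U\<^sub>i\<close>. If there are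
  only two unbounded edges then \<open>U\<^sub>0 \<inter> U\<^sub>1\<close> consists of two overlaps, along the two unbounded
  components of the central fibre.
\<close>

definition cylindrical_end :: "nat \<Rightarrow> 'b cyl_surface \<Rightarrow> 'b wall_str \<Rightarrow> ('b, 'x) family \<Rightarrow> bool" where
  "cylindrical_end k S W X \<longleftrightarrow>
     openin (xtop X) (wdom X) \<and> fibre0 X - X_bounded S X \<subseteq> wdom X \<and> wfct X \<in> hol X (wdom X) \<and>
     rconj X ` wdom X = wdom X \<and> (\<forall>x\<in>wdom X. wfct X (rconj X x) = cnj (wfct X x)) \<and>
     fibre0 X - X_bounded S X \<subseteq> (\<Union>i\<le>emax S. Uset X i) \<and>
     (\<forall>i\<le>emax S.
        Uset X i \<subseteq> wdom X \<and> rconj X ` Uset X i = Uset X i \<and>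
        (\<forall>x\<in>Uset X i. ufct X i (rconj X x) = cnj (ufct X i x) \<and> vfct X i (rconj X x) = cnj (vfct X i x)) \<and>
        (\<exists>\<uu> \<uu>' D. cell_of S \<uu> = ucell S i \<and>
           slab_chart k S W X (unbounded_slab S W i) \<uu> \<uu>' (udir S i) (uxi S i)
             (Uset X i) (ufct X i) (vfct X i) (wfct X) D (\<lambda>_. 0)) \<and>
        (\<forall>x\<in>Uset X i. ufct X i x \<noteq> 0 \<longrightarrow>
           form2 X x (wfct X) (ufct X i) = 1 / (wfct X x * ufct X i x))) \<and>
     (\<forall>i\<le>emax S. openin (xtop X) (overlap X i) \<and> orbit X (ucell S i) \<subseteq> overlap X i \<and>
        (\<forall>x\<in>overlap X i. ufct X i x * vfct X (nxt S i) x * glue X i (vector [wfct X x, tpar X x]) = 1) \<and>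
        (\<exists>E g. holomorphic_several (glue X i) E \<and> holomorphic_several g E \<and>
           E \<subseteq> {z. z $ 1 \<noteq> 0} \<and> {z. z $ 1 \<noteq> 0 \<and> z $ 2 = 0} \<subseteq> E \<and>
           (\<forall>x\<in>overlap X i. vector [wfct X x, tpar X x] \<in> E) \<and>
           (\<forall>z\<in>E. glue X i z =
              (if i = emax S then (z $ 1) powi (- shear S) else 1)
                * (\<Prod>p\<in>walls_between S W i. out_eval k (out_fun S p) (z $ 1) (z $ 2))
              + (z $ 2) ^ Suc k * g z))) \<and>
     (2 \<le> emax S \<longrightarrow> (\<forall>i\<le>emax S. overlap X i = Uset X i \<inter> Uset X (nxt S i))) \<and>
     (emax S = 1 \<longrightarrow> overlap X 0 \<union> overlap X 1 = Uset X 0 \<inter> Uset X 1 \<and> overlap X 0 \<inter> overlap X 1 = {})"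

definition analytic_family :: "'n::finite itself \<Rightarrow> nat \<Rightarrow> 'b cyl_surface \<Rightarrow> 'b wall_str \<Rightarrow> ('b, 'x) family \<Rightarrow> bool" where
  "analytic_family N k S W X \<longleftrightarrow>
     reduced_complex_space N X \<and> flat_family X \<and> real_structure X \<and> relative_2form X \<and>
     agrees_with_scheme k S W X \<and> cylindrical_end k S W X"


section \<open>Positive real cylinders and integration\<close>

definition pos_fibre0 :: "'b cyl_surface \<Rightarrow> 'b wall_str \<Rightarrow> ('b, 'x) family \<Rightarrow> 'x set" where
  "pos_fibre0 S W X = (\<Union>\<sigma>\<in>Pmax S. (xtop X) closure_of
     {x \<in> orbit X \<sigma>. \<forall>\<uu>\<in>chambers W. \<uu> \<subseteq> \<sigma> \<longrightarrow> (\<forall>m. \<exists>r>0. zmono X \<uu> m x = of_real r)})"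

definition double_locus :: "'b cyl_surface \<Rightarrow> ('b, 'x) family \<Rightarrow> 'x set" where
  "double_locus S X = fibre0 X - (\<Union>\<sigma>\<in>Pmax S. orbit X \<sigma>)"

text \<open>
  The cylinder is cut out by the connected component of the real locus that contains the positive
  real locus of the central fibre. This component is formed over the parameter interval \<open>[0,t]\<close> and
  over \<open>w \<in> [s\<^sub>0,s\<^sub>1]\<close>, with the double locus of the central fibre removed: near a point with
  \<open>u = v = 0\<close> the real locus \<open>u v = f t\<^sup>\<kappa>\<close> also contains points with \<open>u, v < 0\<close>, which do not
  belong to the cylinder but are connected to it through the double locus.
\<close>

definition real_part :: "'b cyl_surface \<Rightarrow> ('b, 'x) family \<Rightarrow> real \<Rightarrow> real \<Rightarrow> real \<Rightarrow> 'x set" where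
  "real_part S X s\<^sub>0 s\<^sub>1 t = {x \<in> wdom X. rconj X x = x \<and> tpar X x \<in> of_real ` {0..t} \<and>
     wfct X x \<in> of_real ` {s\<^sub>0..s\<^sub>1}} - double_locus S X"

definition Gamma_cyl :: "'b cyl_surface \<Rightarrow> 'b wall_str \<Rightarrow> ('b, 'x) family \<Rightarrow> real \<Rightarrow> real \<Rightarrow> real \<Rightarrow> 'x set" where
  "Gamma_cyl S W X s\<^sub>0 s\<^sub>1 t = {y. tpar X y = of_real t \<and>
     (\<exists>x \<in> pos_fibre0 S W X - X_bounded S X.
        connected_component_of (subtopology (xtop X) (real_part S X s\<^sub>0 s\<^sub>1 t)) x y)}"

text \<open>
  The integral of the 2-form over a surface \<open>\<Gamma>\<close> in a fibre, oriented by coordinate systems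
  \<open>(a i, b i)\<close>, real-valued on \<open>\<Gamma>\<close> and defined on \<open>V i\<close>, for \<open>i \<le> m\<close>: cut \<open>\<Gamma>\<close> into measurable pieces
  \<open>Q i\<close> inside the \<open>V i\<close> and integrate the coefficient of \<open>da \<and> db\<close> over each piece in its coordinates.
\<close>

definition real_coords :: "('x \<Rightarrow> complex) \<Rightarrow> ('x \<Rightarrow> complex) \<Rightarrow> 'x \<Rightarrow> real \<times> real" where
  "real_coords a b x = (Re (a x), Re (b x))"

definition has_form_integral :: "('b, 'x) family \<Rightarrow> nat \<Rightarrow> (nat \<Rightarrow> 'x set) \<Rightarrow> (nat \<Rightarrow> 'x \<Rightarrow> complex) \<Rightarrow>
    (nat \<Rightarrow> 'x \<Rightarrow> complex) \<Rightarrow> 'x set \<Rightarrow> complex \<Rightarrow> bool" where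
  "has_form_integral X m V a b \<Gamma> I \<longleftrightarrow> (\<exists>Q.
     disjoint_family_on Q {..m} \<and> (\<Union>i\<le>m. Q i) = \<Gamma> \<and>
     (\<forall>i\<le>m. Q i \<subseteq> V i \<and> (\<forall>x\<in>Q i. a i x \<in> \<real> \<and> b i x \<in> \<real>) \<and>
        inj_on (real_coords (a i) (b i)) (Q i) \<and>
        real_coords (a i) (b i) ` Q i \<in> sets lebesgue \<and>
        (\<lambda>z. form2 X (inv_into (Q i) (real_coords (a i) (b i)) z) (a i) (b i))
           absolutely_integrable_on (real_coords (a i) (b i) ` Q i)) \<and>
     I = (\<Sum>i\<le>m. integral (real_coords (a i) (b i) ` Q i)
            (\<lambda>z. form2 X (inv_into (Q i) (real_coords (a i) (b i)) z) (a i) (b i))))"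

text \<open>The cylinder is oriented by the coordinates \<open>(w, u\<^sub>i)\<close>, \<open>u\<^sub>i > 0\<close>.\<close>

definition Gamma_has_integral :: "'b cyl_surface \<Rightarrow> 'b wall_str \<Rightarrow> ('b, 'x) family \<Rightarrow> real \<Rightarrow> real \<Rightarrow> real \<Rightarrow> complex \<Rightarrow> bool" where
  "Gamma_has_integral S W X s\<^sub>0 s\<^sub>1 t I \<longleftrightarrow>
     has_form_integral X (emax S) (\<lambda>i. {x \<in> Uset X i. \<exists>r>0. ufct X i x = of_real r}) (\<lambda>_. wfct X) (ufct X)
       (Gamma_cyl S W X s\<^sub>0 s\<^sub>1 t) I"

definition Gamma_integral :: "'b cyl_surface \<Rightarrow> 'b wall_str \<Rightarrow> ('b, 'x) family \<Rightarrow> real \<Rightarrow> real \<Rightarrow> real \<Rightarrow> complex" where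
  "Gamma_integral S W X s\<^sub>0 s\<^sub>1 t = (THE I. Gamma_has_integral S W X s\<^sub>0 s\<^sub>1 t I)"

end

theory Submission imports Defs begin

text \<open>
  On the chart \<open>U\<^sub>i\<close> the 2-form is \<open>d log w \<and> d log u\<^sub>i\<close>. So the part of the cylinder where \<open>u\<^sub>i\<close> runs from \<open>a\<^sub>i(w)\<close>
  to \<open>1\<close> has the integral of \<open>- log a\<^sub>i(s) d log s\<close>. The cylinder \<open>\<Gamma>\<^sub>t\<close> is cut along the curves \<open>u\<^sub>i = 1\<close> into
  pieces, one in each chart. The relations \<open>u\<^sub>i v\<^sub>i = f\<^sub>\<bb>\<^sub>i t\<^sup>\<kappa>\<^sub>i\<close> and \<open>u\<^sub>i\<^sub>-\<^sub>1 v\<^sub>i f\<^sub>i\<^sub>-\<^sub>1 = 1\<close> show that the curve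
  \<open>u\<^sub>i\<^sub>-\<^sub>1 = 1\<close> is given by \<open>u\<^sub>i = f\<^sub>\<bb>\<^sub>i t\<^sup>\<kappa>\<^sub>i f\<^sub>i\<^sub>-\<^sub>1\<close>, which is the lower end \<open>a\<^sub>i\<close> of the piece in \<open>U\<^sub>i\<close>. Going
  around the cylinder, the integral over \<open>\<Gamma>\<^sub>t\<close> is exactly that of minus the logarithm of
  \<open>t\<^sup>\<kappa> \<Prod>\<^sub>i f\<^sub>\<bb>\<^sub>i \<Prod>\<^sub>i f\<^sub>i\<close> (\<open>Gamma_has_integral_iff\<close> and \<open>log_lower_u\<close>). Modulo \<open>t\<^sup>k\<^sup>+\<^sup>1\<close> the product of the
  \<open>f\<^sub>\<bb>\<^sub>i\<close> and \<open>f\<^sub>i\<close> is \<open>s\<^sup>-\<^sup>e f\<^sub>o\<^sub>u\<^sub>t\<close> (\<open>glued_prod_cong\<close>), and since it has a positive lower bound, the same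
  holds for the logarithms (\<open>partition_sum_asymptotics\<close>).

  Three points need care. First, the cylinder is defined as a part of a connected component of the real locus.
  It is the union of the pieces (\<open>Gamma_eq\<close>): a point of a piece is joined to the positive locus of the
  central fibre by a path inside its chart, and conversely the union \<open>real_end\<close> of compact boxes
  \<open>0 \<le> u\<^sub>i, v\<^sub>i \<le> R\<close> is open and closed in the real locus over \<open>w \<in> [s\<^sub>0, s\<^sub>1]\<close> and small \<open>t\<close>, outside of the double
  locus, because a large \<open>u\<^sub>i\<close> in one chart means a moderate \<open>v\<^sub>i\<^sub>+\<^sub>1\<close> in the next one. Positivity on the central fibre refers to all chambers of a maximal cell,
  which are connected through walls that act trivially modulo \<open>t\<close> (\<open>chamber_induct\<close>).

  Second, the integral does not depend on the way in which the cylinder is cut (\<open>partition_integral_eq\<close>). The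
  coordinate change between two charts preserves \<open>w\<close>, and comparing the coefficients of the 2-form shows that
  its Jacobian is \<open>u\<^sub>j / u\<^sub>i\<close> (\<open>transition_derivative\<close>); so it preserves the density \<open>1 / (w u)\<close>.

  Third, \<open>f\<^sub>o\<^sub>u\<^sub>t\<close> is a product over all unbounded walls. These are one slab in each unbounded edge and the walls
  between the edges (\<open>prod_unbounded_walls\<close>), by the geometry of the cylindrical end, where every unbounded edge
  is a ray.
\<close>

section \<open>Convex sets\<close>

lemma interior_aff_dim2:
  fixes P :: "(real \<times> real) set"
  assumes "interior P \<noteq> {}"
  shows "aff_dim P = 2"
  using aff_dim_nonempty_interior[OF assms] by simp

text \<open>On a line, the middle one of three points is in the relative interior.\<close>

lemma three_points_rel_interior:
  fixes C :: "'a::euclidean_space set"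
  assumes "convex C" "aff_dim C = 1" "a \<in> C" "b \<in> C" "c \<in> C" "a \<noteq> b" "b \<noteq> c" "a \<noteq> c"
  shows "a \<in> rel_interior C \<or> b \<in> rel_interior C \<or> c \<in> rel_interior C"
proof -
  have in_rel: "y \<in> rel_interior C" if "x \<in> C" "z \<in> C" "y \<in> open_segment x z" for x y z
  proof -
    have xz: "x \<noteq> z" using that by auto
    have "aff_dim {x, z} = 1" using xz by (simp add: aff_dim_2)
    then have "affine hull {x, z} = affine hull C"
      using that assms(2) by (intro affine_dim_equal hull_mono affine_affine_hull)
        (auto simp: affine_hull_eq_empty)
    then have "affine hull (closed_segment x z) = affine hull C"
      by (simp add: segment_convex_hull affine_hull_convex_hull)
    then have "rel_interior (closed_segment x z) \<subseteq> rel_interior C"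
      using that \<open>convex C\<close> by (intro subset_rel_interior) (auto simp: closed_segment_subset)
    then show ?thesis using that xz by (auto simp: rel_interior_closed_segment)
  qed
  have "aff_dim {a, b, c} \<le> aff_dim C" using assms by (intro aff_dim_subset) auto
  then have "collinear {a, b, c}"
    using assms by (simp add: collinear_aff_dim)
  then have "between (b, c) a \<or> between (c, a) b \<or> between (a, b) c"
    by (simp add: collinear_between_cases)
  then show ?thesis
    using in_rel assms by (auto simp: between_mem_segment open_segment_def)
qed

lemma finite_minus_rel_interior:
  fixes C :: "'a::euclidean_space set"
  assumes "convex C" "aff_dim C = 1"
  shows "finite (C - rel_interior C)"
proof (rule ccontr)
  assume inf: "infinite (C - rel_interior C)"
  obtain T where T: "finite T" "card T = 3" "T \<subseteq> C - rel_interior C"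
    using infinite_arbitrarily_large[OF inf] by blast
  then obtain a b c where "T = {a, b, c}" "a \<noteq> b" "b \<noteq> c" "a \<noteq> c"
    using card_3_iff by metis
  then show False using three_points_rel_interior[OF assms, of a b c] T by blast
qed

text \<open>Only finitely many points of a one-dimensional face lie outside its relative interior, so some common
  point of the two faces lies in both relative interiors; a proper face of a polygon through such a point
  is the face itself. This applies both to the edges of maximal cells and to walls, which are faces of
  chambers.\<close>

lemma one_dim_faces_eq:
  fixes c\<^sub>1 c\<^sub>2 :: "'b \<Rightarrow> real \<times> real"
  assumes "inj_on c\<^sub>1 K\<^sub>1" "inj_on c\<^sub>2 K\<^sub>2" "convex (c\<^sub>1 ` K\<^sub>1)" "convex (c\<^sub>2 ` K\<^sub>2)"
    and "aff_dim (c\<^sub>1 ` K\<^sub>1) = 2" "aff_dim (c\<^sub>2 ` K\<^sub>2) = 2"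
    and meet: "K\<^sub>1 = K\<^sub>2 \<and> c\<^sub>1 = c\<^sub>2 \<or>
      K\<^sub>1 \<inter> K\<^sub>2 = \<Union>{\<tau>. \<tau> \<noteq> {} \<and> \<tau> \<subseteq> K\<^sub>1 \<and> c\<^sub>1 ` \<tau> face_of c\<^sub>1 ` K\<^sub>1 \<and> \<tau> \<subseteq> K\<^sub>2 \<and> c\<^sub>2 ` \<tau> face_of c\<^sub>2 ` K\<^sub>2
         \<and> \<tau> \<noteq> K\<^sub>1 \<and> \<tau> \<noteq> K\<^sub>2}"
    and \<tau>\<^sub>1: "\<tau>\<^sub>1 \<subseteq> K\<^sub>1" "c\<^sub>1 ` \<tau>\<^sub>1 face_of c\<^sub>1 ` K\<^sub>1" "aff_dim (c\<^sub>1 ` \<tau>\<^sub>1) = 1"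
    and \<tau>\<^sub>2: "\<tau>\<^sub>2 \<subseteq> K\<^sub>2" "c\<^sub>2 ` \<tau>\<^sub>2 face_of c\<^sub>2 ` K\<^sub>2" "aff_dim (c\<^sub>2 ` \<tau>\<^sub>2) = 1"
    and inf: "infinite (\<tau>\<^sub>1 \<inter> \<tau>\<^sub>2)"
  shows "\<tau>\<^sub>1 = \<tau>\<^sub>2"
proof -
  have fin1: "finite {x\<in>\<tau>\<^sub>1. c\<^sub>1 x \<notin> rel_interior (c\<^sub>1 ` \<tau>\<^sub>1)}"
  proof (rule inj_on_finite)
    show "inj_on c\<^sub>1 {x\<in>\<tau>\<^sub>1. c\<^sub>1 x \<notin> rel_interior (c\<^sub>1 ` \<tau>\<^sub>1)}"
      using assms(1) \<tau>\<^sub>1(1) by (auto intro: inj_on_subset)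
    show "finite (c\<^sub>1 ` \<tau>\<^sub>1 - rel_interior (c\<^sub>1 ` \<tau>\<^sub>1))"
      using finite_minus_rel_interior \<tau>\<^sub>1 face_of_imp_convex by blast
  qed auto
  have fin2: "finite {x\<in>\<tau>\<^sub>2. c\<^sub>2 x \<notin> rel_interior (c\<^sub>2 ` \<tau>\<^sub>2)}"
  proof (rule inj_on_finite)
    show "inj_on c\<^sub>2 {x\<in>\<tau>\<^sub>2. c\<^sub>2 x \<notin> rel_interior (c\<^sub>2 ` \<tau>\<^sub>2)}"
      using assms(2) \<tau>\<^sub>2(1) by (auto intro: inj_on_subset)
    show "finite (c\<^sub>2 ` \<tau>\<^sub>2 - rel_interior (c\<^sub>2 ` \<tau>\<^sub>2))"
      using finite_minus_rel_interior \<tau>\<^sub>2 face_of_imp_convex by blast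
  qed auto
  obtain x where x: "x \<in> \<tau>\<^sub>1" "x \<in> \<tau>\<^sub>2" "c\<^sub>1 x \<in> rel_interior (c\<^sub>1 ` \<tau>\<^sub>1)" "c\<^sub>2 x \<in> rel_interior (c\<^sub>2 ` \<tau>\<^sub>2)"
  proof -
    have "\<not> \<tau>\<^sub>1 \<inter> \<tau>\<^sub>2 \<subseteq> {x\<in>\<tau>\<^sub>1. c\<^sub>1 x \<notin> rel_interior (c\<^sub>1 ` \<tau>\<^sub>1)} \<union> {x\<in>\<tau>\<^sub>2. c\<^sub>2 x \<notin> rel_interior (c\<^sub>2 ` \<tau>\<^sub>2)}"
      using inf fin1 fin2 finite_subset by blast
    then show thesis using that by blast
  qed
  have same: "\<sigma> = \<tau>" if "inj_on c K" "convex (c ` K)" "aff_dim (c ` K) = 2" "\<sigma> \<subseteq> K" "c ` \<sigma> face_of c ` K"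
      "aff_dim (c ` \<sigma>) = 1" "\<tau> \<subseteq> K" "c ` \<tau> face_of c ` K" "\<tau> \<noteq> K" "x \<in> \<tau>" "c x \<in> rel_interior (c ` \<sigma>)"
    for c :: "'b \<Rightarrow> real \<times> real" and K \<sigma> \<tau>
  proof -
    have sub: "c ` \<sigma> \<subseteq> c ` \<tau>"
      by (rule subset_of_face_of[OF that(8) image_mono[OF that(4)]]) (use that(10,11) in blast)
    have "c ` \<tau> \<noteq> c ` K"
      using inj_on_image_eq_iff[OF that(1,7) order_refl] that(9) by blast
    then have lt: "aff_dim (c ` \<tau>) < 2"
      using face_of_aff_dim_lt[OF that(2,8)] that(3) by linarith
    have face: "c ` \<sigma> face_of c ` \<tau>"
      by (rule face_of_subset[OF that(5) sub image_mono[OF that(7)]])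
    have "c ` \<sigma> = c ` \<tau>"
      using face_of_aff_dim_lt[OF face_of_imp_convex[OF that(8)] face] that(6) lt by linarith
    then show ?thesis using inj_on_image_eq_iff[OF that(1,4,7)] by blast
  qed
  have ne2: "\<tau>\<^sub>2 \<noteq> K\<^sub>2" using assms(6) \<tau>\<^sub>2(3) by auto
  show ?thesis
  proof (cases "K\<^sub>1 = K\<^sub>2 \<and> c\<^sub>1 = c\<^sub>2")
    case True
    then show ?thesis
      using same[OF assms(1,3,5) \<tau>\<^sub>1, of \<tau>\<^sub>2] \<tau>\<^sub>2(1,2) ne2 x by simp
  next
    case False
    have "x \<in> K\<^sub>1 \<inter> K\<^sub>2" using x(1,2) \<tau>\<^sub>1(1) \<tau>\<^sub>2(1) by auto
    also have "K\<^sub>1 \<inter> K\<^sub>2 = \<Union>{\<tau>. \<tau> \<noteq> {} \<and> \<tau> \<subseteq> K\<^sub>1 \<and> c\<^sub>1 ` \<tau> face_of c\<^sub>1 ` K\<^sub>1 \<and> \<tau> \<subseteq> K\<^sub>2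
        \<and> c\<^sub>2 ` \<tau> face_of c\<^sub>2 ` K\<^sub>2 \<and> \<tau> \<noteq> K\<^sub>1 \<and> \<tau> \<noteq> K\<^sub>2}"
      using meet False by argo
    finally obtain \<tau> where \<tau>: "x \<in> \<tau>" "\<tau> \<subseteq> K\<^sub>1" "c\<^sub>1 ` \<tau> face_of c\<^sub>1 ` K\<^sub>1" "\<tau> \<subseteq> K\<^sub>2" "c\<^sub>2 ` \<tau> face_of c\<^sub>2 ` K\<^sub>2" "\<tau> \<noteq> K\<^sub>1" "\<tau> \<noteq> K\<^sub>2"
      unfolding Union_iff mem_Collect_eq by (elim bexE conjE CollectE) (rule that)
    have "\<tau>\<^sub>1 = \<tau>" using same[OF assms(1,3,5) \<tau>\<^sub>1 \<tau>(2,3,6,1) x(3)] .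
    moreover have "\<tau>\<^sub>2 = \<tau>" using same[OF assms(2,4,6) \<tau>\<^sub>2 \<tau>(4,5,7,1) x(4)] .
    ultimately show ?thesis by simp
  qed
qed

text \<open>The point of the segment from \<open>x\<close> to \<open>p + n d\<close> that divides it in the ratio \<open>1 : n - 1\<close> tends to \<open>x + d\<close>.\<close>

lemma closed_convex_ray_recession:
  fixes P :: "'a::real_normed_vector set"
  assumes "closed P" "convex P" "\<And>s. s \<ge> 0 \<Longrightarrow> p + s *\<^sub>R d \<in> P" "x \<in> P"
  shows "x + d \<in> P"
proof -
  define f where "f n = (1 - 1 / real (Suc n)) *\<^sub>R x + (1 / real (Suc n)) *\<^sub>R (p + real (Suc n) *\<^sub>R d)" for n
  have "f n \<in> P" for n
    unfolding f_def using assms(3)[of "real (Suc n)"] by (intro convexD[OF \<open>convex P\<close>] assms) auto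
  moreover have "f n = x + d + (1 / real (Suc n)) *\<^sub>R (p - x)" for n
  proof -
    have "(1 / real (Suc n)) *\<^sub>R (p + real (Suc n) *\<^sub>R d) = (1 / real (Suc n)) *\<^sub>R p + d"
      by (simp add: scaleR_add_right del: of_nat_Suc)
    then show ?thesis unfolding f_def by (simp add: algebra_simps del: of_nat_Suc)
  qed
  then have "f = (\<lambda>n. x + d + (1 / real (Suc n)) *\<^sub>R (p - x))" by auto
  moreover have "(\<lambda>n. x + d + (1 / real (Suc n)) *\<^sub>R (p - x)) \<longlonglongrightarrow> x + d + 0 *\<^sub>R (p - x)"
    using LIMSEQ_inverse_real_of_nat by (intro tendsto_intros) (simp add: inverse_eq_divide)
  ultimately show ?thesis
    using closed_sequentially[OF \<open>closed P\<close>, of f "x + d"] by auto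
qed

text \<open>Otherwise the extreme point \<open>e\<close> would be the midpoint of \<open>e - d\<close> and \<open>e + d\<close>.\<close>

lemma no_line_if_extreme_point:
  fixes P :: "'a::real_normed_vector set"
  assumes "closed P" "convex P" "e extreme_point_of P" "\<And>s. p + s *\<^sub>R d \<in> P"
  shows "d = 0"
proof (rule ccontr)
  assume d: "d \<noteq> 0"
  have e: "e \<in> P" using assms(3) by (auto simp: extreme_point_of_def)
  have "e + d \<in> P" using closed_convex_ray_recession[of P p d e] assms e by auto
  moreover have "e + - d \<in> P"
  proof (rule closed_convex_ray_recession[OF assms(1,2) _ e])
    show "p + s *\<^sub>R - d \<in> P" for s using assms(4)[of "- s"] by simp
  qed
  moreover have "e \<in> open_segment (e + - d) (e + d)"
  proof -
    have "d + d \<noteq> 0" using d by (simp flip: scaleR_2)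
    then have "e - d \<noteq> e + d" by (simp add: diff_eq_eq add.assoc)
    moreover have "e = (1 - 1/2) *\<^sub>R (e + - d) + (1/2) *\<^sub>R (e + d)"
      by (simp add: algebra_simps flip: scaleR_left_distrib)
    ultimately show ?thesis
      unfolding in_segment by (intro conjI exI[of _ "1/2"]) auto
  qed
  ultimately show False using assms(3) by (auto simp: extreme_point_of_def)
qed

lemma integral_polygonD:
  assumes "integral_polygon P"
  shows "closed P" "convex P" "interior P \<noteq> {}" "\<exists>x. x extreme_point_of P" "aff_dim P = 2"
proof -
  obtain V D where VD: "finite V" "finite D"
    "P = {x + y | x y. x \<in> convex hull (rvec ` V) \<and> y \<in> convex_cone hull (rvec ` D)}"
    using assms unfolding integral_polygon_def by blast
  have P: "P = (\<Union>x\<in>convex hull (rvec ` V). \<Union>y\<in>convex_cone hull (rvec ` D). {x + y})"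
    unfolding VD(3) by blast
  show "closed P" unfolding P using VD
    by (intro compact_closed_sums) (auto simp: compact_convex_hull finite_imp_compact closed_convex_cone_hull)
  show "convex P" unfolding P
    by (intro convex_sums) (auto simp: convex_convex_cone_hull)
  show "interior P \<noteq> {}" "\<exists>x. x extreme_point_of P" using assms unfolding integral_polygon_def by auto
  then show "aff_dim P = 2" by (simp add: interior_aff_dim2)
qed

text \<open>The parameters of the points of \<open>C\<close> on the ray form an interval, which is not bounded above because
  \<open>C\<close> is not compact. Hence two unbounded walls in the same unbounded edge overlap.\<close>

lemma unbounded_connected_in_ray:
  fixes d :: "'a::euclidean_space"
  assumes C: "closed C" "connected C" "\<not> compact C" and d: "d \<noteq> 0"
    and sub: "C \<subseteq> {p + x *\<^sub>R d | x. x \<ge> c}"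
  shows "\<exists>x\<^sub>0. \<forall>x\<ge>x\<^sub>0. p + x *\<^sub>R d \<in> C"
proof -
  define D where "D = {x. p + x *\<^sub>R d \<in> C}"
  have g: "x = ((p + x *\<^sub>R d - p) \<bullet> d) / (d \<bullet> d)" for x using d by simp
  have "D = (\<lambda>y. ((y - p) \<bullet> d) / (d \<bullet> d)) ` C"
  proof (intro set_eqI iffI)
    fix x assume "x \<in> D"
    then have "p + x *\<^sub>R d \<in> C" unfolding D_def by simp
    then show "x \<in> (\<lambda>y. ((y - p) \<bullet> d) / (d \<bullet> d)) ` C" by (rule rev_image_eqI) (rule g)
  next
    fix x assume "x \<in> (\<lambda>y. ((y - p) \<bullet> d) / (d \<bullet> d)) ` C"
    then obtain y where y: "y \<in> C" "x = ((y - p) \<bullet> d) / (d \<bullet> d)" by auto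
    then obtain z where z: "y = p + z *\<^sub>R d" using sub by auto
    have "x = z" unfolding y(2) z by (rule g[symmetric])
    then show "x \<in> D" using y z unfolding D_def by simp
  qed
  moreover have "connected ((\<lambda>y. ((y - p) \<bullet> d) / (d \<bullet> d)) ` C)"
    using C d by (intro connected_continuous_image continuous_intros) auto
  ultimately have con: "connected D" by simp
  have CD: "C = (\<lambda>x. p + x *\<^sub>R d) ` D" unfolding D_def using sub by auto
  have "\<not> bdd_above D"
  proof
    assume "bdd_above D"
    then obtain B where B: "\<And>x. x \<in> D \<Longrightarrow> x \<le> B" by (auto simp: bdd_above_def)
    have "C \<subseteq> (\<lambda>x. p + x *\<^sub>R d) ` {c..B}"
    proof
      fix y assume "y \<in> C"
      then obtain x where x: "x \<ge> c" "y = p + x *\<^sub>R d" using sub by auto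
      then have "x \<in> D" using \<open>y \<in> C\<close> D_def by auto
      then show "y \<in> (\<lambda>x. p + x *\<^sub>R d) ` {c..B}" using B x by auto
    qed
    moreover have "compact ((\<lambda>x. p + x *\<^sub>R d) ` {c..B})"
      by (intro compact_continuous_image continuous_intros) auto
    ultimately show False using C(1,3) by (metis compact_Int_closed inf.absorb_iff2)
  qed
  moreover obtain x\<^sub>0 where "x\<^sub>0 \<in> D"
    using C(3) CD by force
  ultimately have "x \<in> D" if "x \<ge> x\<^sub>0" for x
  proof -
    obtain y where "y \<in> D" "y > x" using \<open>\<not> bdd_above D\<close> by (auto simp: bdd_above_def not_le)
    then show ?thesis using con \<open>x\<^sub>0 \<in> D\<close> that by (meson connected_iff_interval less_imp_le)
  qed
  then show ?thesis unfolding D_def by auto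
qed

section \<open>Cells and edges of the surface\<close>

locale affine_end =
  fixes k :: nat and S :: "'b cyl_surface" and W :: "'b wall_str"
  assumes asymp: "asymptotically_cylindrical S"
    and wall: "wall_structure k S W"
    and outg: "outgoing S W"
begin

abbreviation "\<sigma> \<equiv> ucell S"
abbreviation "b \<equiv> uedge S"
abbreviation "d \<equiv> udir S"
abbreviation "\<xi> \<equiv> uxi S"
abbreviation "M \<equiv> emax S"

lemma surface: "integral_affine_surface S"
  using asymp unfolding asymptotically_cylindrical_def by (rule conjunct1)

lemma cell_topspace: "\<tau> \<in> Pmax S \<Longrightarrow> \<tau> \<subseteq> topspace (spc S)"
  and cell_closed: "\<tau> \<in> Pmax S \<Longrightarrow> closedin (spc S) \<tau>"
  and cell_polygon: "\<tau> \<in> Pmax S \<Longrightarrow> integral_polygon (chart S \<tau> ` \<tau>)"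
  and cell_homeo: "\<tau> \<in> Pmax S \<Longrightarrow>
    homeomorphic_map (subtopology (spc S) \<tau>) (top_of_set (chart S \<tau> ` \<tau>)) (chart S \<tau>)"
  and cell_Int: "\<lbrakk>\<tau> \<in> Pmax S; \<tau>' \<in> Pmax S; \<tau> \<noteq> \<tau>'\<rbrakk> \<Longrightarrow>
    \<tau> \<inter> \<tau>' = \<Union>{\<rho>. is_face S \<tau> \<rho> \<and> is_face S \<tau>' \<rho> \<and> \<rho> \<noteq> \<tau> \<and> \<rho> \<noteq> \<tau>'}"
  and two_cells: "\<rho> \<in> edges S \<Longrightarrow> card {\<tau>\<in>Pmax S. \<rho> \<subseteq> \<tau>} = 2"
  and cells_finite: "finite (Pmax S)"
proof -
  have *: "\<forall>\<sigma>\<in>Pmax S. closedin (spc S) \<sigma> \<and> integral_polygon (chart S \<sigma> ` \<sigma>) \<and>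
        homeomorphic_map (subtopology (spc S) \<sigma>) (top_of_set (chart S \<sigma> ` \<sigma>)) (chart S \<sigma>)"
    using surface unfolding integral_affine_surface_def by (elim conjE) assumption
  show cl: "\<tau> \<in> Pmax S \<Longrightarrow> closedin (spc S) \<tau>" using * by blast
  then show "\<tau> \<in> Pmax S \<Longrightarrow> \<tau> \<subseteq> topspace (spc S)" by (simp add: closedin_subset)
  show "\<tau> \<in> Pmax S \<Longrightarrow> integral_polygon (chart S \<tau> ` \<tau>)" using * by blast
  show "\<tau> \<in> Pmax S \<Longrightarrow>
    homeomorphic_map (subtopology (spc S) \<tau>) (top_of_set (chart S \<tau> ` \<tau>)) (chart S \<tau>)" using * by blast
  have **: "\<forall>\<sigma>\<in>Pmax S. \<forall>\<sigma>'\<in>Pmax S. \<sigma> \<noteq> \<sigma>' \<longrightarrow>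
        \<sigma> \<inter> \<sigma>' = \<Union>{\<tau>. is_face S \<sigma> \<tau> \<and> is_face S \<sigma>' \<tau> \<and> \<tau> \<noteq> \<sigma> \<and> \<tau> \<noteq> \<sigma>'}"
    using surface unfolding integral_affine_surface_def by (elim conjE) assumption
  show "\<lbrakk>\<tau> \<in> Pmax S; \<tau>' \<in> Pmax S; \<tau> \<noteq> \<tau>'\<rbrakk> \<Longrightarrow>
    \<tau> \<inter> \<tau>' = \<Union>{\<rho>. is_face S \<tau> \<rho> \<and> is_face S \<tau>' \<rho> \<and> \<rho> \<noteq> \<tau> \<and> \<rho> \<noteq> \<tau>'}"
    by (rule **[rule_format])
  have "\<forall>\<rho>\<in>edges S. card {\<sigma>\<in>Pmax S. \<rho> \<subseteq> \<sigma>} = 2"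
    using surface unfolding integral_affine_surface_def by (elim conjE) assumption
  then show "\<rho> \<in> edges S \<Longrightarrow> card {\<tau>\<in>Pmax S. \<rho> \<subseteq> \<tau>} = 2" by blast
  show "finite (Pmax S)"
    using surface unfolding integral_affine_surface_def by (elim conjE) assumption
qed

lemma glin_facts:
  assumes "\<rho> \<in> edges S" "\<tau> \<in> Pmax S" "\<tau>' \<in> Pmax S" "\<rho> \<subseteq> \<tau>" "\<rho> \<subseteq> \<tau>'" "\<tau> \<noteq> \<tau>'"
  shows "is_face S \<tau> \<rho>" "SL2Z (glin S \<tau> \<rho> \<tau>')" "glin S \<tau>' \<rho> \<tau> (glin S \<tau> \<rho> \<tau>' m) = m"
proof -
  have "\<forall>\<rho>\<in>edges S. \<forall>\<sigma>\<in>Pmax S. \<forall>\<sigma>'\<in>Pmax S. \<rho> \<subseteq> \<sigma> \<and> \<rho> \<subseteq> \<sigma>' \<and> \<sigma> \<noteq> \<sigma>' \<longrightarrow>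
        is_face S \<sigma> \<rho> \<and> is_face S \<sigma>' \<rho> \<and>
        SL2Z (glin S \<sigma> \<rho> \<sigma>') \<and>
        (\<forall>m. glin S \<sigma>' \<rho> \<sigma> (glin S \<sigma> \<rho> \<sigma>' m) = m) \<and>
        (\<forall>p\<in>\<rho>. \<forall>q\<in>\<rho>. chart S \<sigma>' p - chart S \<sigma>' q =
             rlin (glin S \<sigma> \<rho> \<sigma>') (chart S \<sigma> p - chart S \<sigma> q)) \<and>
        (\<forall>m. pairing (conormal S \<sigma>' \<rho> \<sigma>') (glin S \<sigma> \<rho> \<sigma>' m) = - pairing (conormal S \<sigma> \<rho> \<sigma>) m)"
    using surface unfolding integral_affine_surface_def by (elim conjE) assumption
  note * = this[rule_format, OF assms(1-3) conjI[OF assms(4) conjI[OF assms(5,6)]]]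
  show "is_face S \<tau> \<rho>" using * by (elim conjE) assumption
  show "SL2Z (glin S \<tau> \<rho> \<tau>')" using * by (elim conjE) assumption
  have "\<forall>m. glin S \<tau>' \<rho> \<tau> (glin S \<tau> \<rho> \<tau>' m) = m" using * by (elim conjE) assumption
  then show "glin S \<tau>' \<rho> \<tau> (glin S \<tau> \<rho> \<tau>' m) = m" ..
qed

lemma chart_inj: "\<tau> \<in> Pmax S \<Longrightarrow> inj_on (chart S \<tau>) \<tau>"
  using cell_homeo[of \<tau>] cell_topspace[of \<tau>]
  by (auto simp: homeomorphic_eq_everything_map topspace_subtopology Int_absorb1)

lemma chart_convex: "\<tau> \<in> Pmax S \<Longrightarrow> convex (chart S \<tau> ` \<tau>)"
  and chart_aff_dim: "\<tau> \<in> Pmax S \<Longrightarrow> aff_dim (chart S \<tau> ` \<tau>) = 2"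
  and chart_interior: "\<tau> \<in> Pmax S \<Longrightarrow> interior (chart S \<tau> ` \<tau>) \<noteq> {}"
  and chart_closed: "\<tau> \<in> Pmax S \<Longrightarrow> closed (chart S \<tau> ` \<tau>)"
  using cell_polygon integral_polygonD by blast+

lemma compact_chart_iff:
  assumes "\<tau> \<in> Pmax S" "A \<subseteq> \<tau>"
  shows "compactin (spc S) A \<longleftrightarrow> compact (chart S \<tau> ` A)"
proof -
  have "compactin (spc S) A \<longleftrightarrow> compactin (subtopology (spc S) \<tau>) A"
    using assms by (simp add: compactin_subtopology)
  also have "\<dots> \<longleftrightarrow> compactin (top_of_set (chart S \<tau> ` \<tau>)) (chart S \<tau> ` A)"
    using cell_homeo[OF assms(1)] cell_topspace[OF assms(1)] assms
    by (intro homeomorphic_map_compactness_eq[symmetric] | simp add: topspace_subtopology Int_absorb1 homeomorphic_map_compactness)+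
  also have "\<dots> \<longleftrightarrow> compact (chart S \<tau> ` A)"
    using assms by (simp add: compactin_subtopology image_mono)
  finally show ?thesis .
qed

lemma closed_chart_iff:
  assumes "\<tau> \<in> Pmax S" "A \<subseteq> \<tau>"
  shows "closedin (spc S) A \<longleftrightarrow> closed (chart S \<tau> ` A)"
proof -
  have "closedin (spc S) A \<longleftrightarrow> closedin (subtopology (spc S) \<tau>) A"
    using assms cell_closed[OF assms(1)] by (simp add: closedin_closed_subtopology)
  also have "\<dots> \<longleftrightarrow> closedin (top_of_set (chart S \<tau> ` \<tau>)) (chart S \<tau> ` A)"
    using cell_homeo[OF assms(1)] cell_topspace[OF assms(1)] assms
    by (simp add: homeomorphic_map_closedness_eq[symmetric] topspace_subtopology Int_absorb1 homeomorphic_map_closedness)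
  also have "\<dots> \<longleftrightarrow> closed (chart S \<tau> ` A)"
    using assms chart_closed[OF assms(1)] by (simp add: closedin_closed_eq image_mono)
  finally show ?thesis .
qed

lemma connected_chart_iff:
  assumes "\<tau> \<in> Pmax S" "A \<subseteq> \<tau>"
  shows "connectedin (spc S) A \<longleftrightarrow> connected (chart S \<tau> ` A)"
proof -
  have "connectedin (spc S) A \<longleftrightarrow> connectedin (subtopology (spc S) \<tau>) A"
    using assms by (simp add: connectedin_subtopology)
  also have "\<dots> \<longleftrightarrow> connectedin (top_of_set (chart S \<tau> ` \<tau>)) (chart S \<tau> ` A)"
    using cell_homeo[OF assms(1)] cell_topspace[OF assms(1)] assms
    by (simp add: topspace_subtopology Int_absorb1 homeomorphic_map_connectedness)
  also have "\<dots> \<longleftrightarrow> connected (chart S \<tau> ` A)"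
    using assms by (simp add: connectedin_subtopology image_mono)
  finally show ?thesis .
qed

lemma cell_self_face: "\<tau> \<in> Pmax S \<Longrightarrow> is_face S \<tau> \<tau>"
  unfolding is_face_def using chart_convex[of \<tau>] chart_interior[of \<tau>] by (auto simp: face_of_refl)

lemma cell_in_cells: "\<tau> \<in> Pmax S \<Longrightarrow> \<tau> \<in> cells S"
  unfolding cells_def using cell_self_face by blast

lemma edge_in_cells: "\<rho> \<in> edges S \<Longrightarrow> \<rho> \<in> cells S"
  unfolding cells_def edges_def by blast

text \<open>Distinct maximal cells meet in proper faces, which contain no interior points.\<close>

lemma interior_unique_cell:
  assumes "\<tau> \<in> Pmax S" "x \<in> \<tau>" "chart S \<tau> x \<in> interior (chart S \<tau> ` \<tau>)" "\<tau>' \<in> Pmax S" "x \<in> \<tau>'"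
  shows "\<tau>' = \<tau>"
proof (rule ccontr)
  assume "\<tau>' \<noteq> \<tau>"
  then obtain \<rho> where \<rho>: "x \<in> \<rho>" "is_face S \<tau> \<rho>" "\<rho> \<noteq> \<tau>"
    using cell_Int[of \<tau> \<tau>'] assms by blast
  then have "chart S \<tau> ` \<rho> \<noteq> chart S \<tau> ` \<tau>"
    using inj_on_image_eq_iff[OF chart_inj[OF assms(1)], of \<rho> \<tau>] unfolding is_face_def by blast
  then show False
    using face_of_disjoint_interior[of "chart S \<tau> ` \<rho>" "chart S \<tau> ` \<tau>"] \<rho> assms(3) unfolding is_face_def by blast
qed

lemma edge_not_cell:
  assumes "\<rho> \<in> edges S" shows "\<rho> \<notin> Pmax S"
proof
  assume P: "\<rho> \<in> Pmax S"
  obtain \<tau> where \<tau>: "\<tau> \<in> Pmax S" "is_face S \<tau> \<rho>" "aff_dim (chart S \<tau> ` \<rho>) = 1"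
    using assms unfolding edges_def by blast
  obtain x where "x \<in> \<rho>" "chart S \<rho> x \<in> interior (chart S \<rho> ` \<rho>)"
    using chart_interior[OF P] interior_subset by blast
  then have "\<tau> = \<rho>" using interior_unique_cell[OF P] \<tau> unfolding is_face_def by blast
  then show False using \<tau> chart_aff_dim[OF P] by simp
qed

lemma faces_eq_if_infinite:
  assumes "\<tau> \<in> Pmax S" "\<tau>' \<in> Pmax S" "is_face S \<tau> \<rho>" "aff_dim (chart S \<tau> ` \<rho>) = 1"
    "is_face S \<tau>' \<rho>'" "aff_dim (chart S \<tau>' ` \<rho>') = 1" "infinite (\<rho> \<inter> \<rho>')"
  shows "\<rho> = \<rho>'"
proof (rule one_dim_faces_eq[OF chart_inj[OF assms(1)] chart_inj[OF assms(2)] chart_convex[OF assms(1)] chart_convex[OF assms(2)]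
      chart_aff_dim[OF assms(1)] chart_aff_dim[OF assms(2)]])
  show "\<tau> = \<tau>' \<and> chart S \<tau> = chart S \<tau>' \<or>
    \<tau> \<inter> \<tau>' = \<Union> {\<theta>. \<theta> \<noteq> {} \<and> \<theta> \<subseteq> \<tau> \<and> chart S \<tau> ` \<theta> face_of chart S \<tau> ` \<tau> \<and>
         \<theta> \<subseteq> \<tau>' \<and> chart S \<tau>' ` \<theta> face_of chart S \<tau>' ` \<tau>' \<and> \<theta> \<noteq> \<tau> \<and> \<theta> \<noteq> \<tau>'}"
    using cell_Int[OF assms(1,2)] unfolding is_face_def by (simp add: conj_ac) metis
qed (use assms in \<open>auto simp: is_face_def\<close>)

lemma edges_eq_if_infinite: "\<rho> \<in> edges S \<Longrightarrow> \<rho>' \<in> edges S \<Longrightarrow> infinite (\<rho> \<inter> \<rho>') \<Longrightarrow> \<rho> = \<rho>'"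
  unfolding edges_def using faces_eq_if_infinite by blast

text \<open>All but finitely many points of an edge lie in its relative interior, and a face that contains such a
  point contains the edge.\<close>

lemma edge_sub_if_infinite:
  assumes "\<rho> \<in> edges S" "\<tau> \<in> Pmax S" "infinite (\<rho> \<inter> \<tau>)"
  shows "\<rho> \<subseteq> \<tau>"
proof -
  obtain \<tau>' where \<tau>': "\<tau>' \<in> Pmax S" "is_face S \<tau>' \<rho>" "aff_dim (chart S \<tau>' ` \<rho>) = 1"
    using assms unfolding edges_def by blast
  show ?thesis
  proof (cases "\<tau>' = \<tau>")
    case True then show ?thesis using \<tau>' unfolding is_face_def by blast
  next
    case False
    have sub: "\<rho> \<subseteq> \<tau>'" using \<tau>' unfolding is_face_def by blast
    have "finite (chart S \<tau>' ` \<rho> - rel_interior (chart S \<tau>' ` \<rho>))"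
      using \<tau>' unfolding is_face_def by (intro finite_minus_rel_interior) (auto dest: face_of_imp_convex)
    then have "finite {x\<in>\<rho>. chart S \<tau>' x \<notin> rel_interior (chart S \<tau>' ` \<rho>)}"
      by (rule inj_on_finite[rotated 2, where f = "chart S \<tau>'"]) (use chart_inj[OF \<tau>'(1)] sub in \<open>auto intro: inj_on_subset\<close>)
    then have "\<not> \<rho> \<inter> \<tau> \<subseteq> {x\<in>\<rho>. chart S \<tau>' x \<notin> rel_interior (chart S \<tau>' ` \<rho>)}"
      using assms(3) finite_subset by blast
    then obtain x where x: "x \<in> \<rho>" "x \<in> \<tau>" "chart S \<tau>' x \<in> rel_interior (chart S \<tau>' ` \<rho>)" by blast
    then obtain \<theta> where \<theta>: "x \<in> \<theta>" "is_face S \<tau>' \<theta>" "is_face S \<tau> \<theta>"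
      using cell_Int[OF \<tau>'(1) assms(2) False] sub by blast
    have "chart S \<tau>' ` \<rho> \<subseteq> chart S \<tau>' ` \<theta>"
    proof (rule subset_of_face_of[OF _ image_mono[OF sub]])
      show "chart S \<tau>' ` \<theta> face_of chart S \<tau>' ` \<tau>'" using \<theta>(2) unfolding is_face_def by blast
      show "chart S \<tau>' ` \<theta> \<inter> rel_interior (chart S \<tau>' ` \<rho>) \<noteq> {}" using \<theta>(1) x(3) by blast
    qed
    then have "\<rho> \<subseteq> \<theta>" using inj_on_image_subset_iff[OF chart_inj[OF \<tau>'(1)] sub] \<theta>(2) unfolding is_face_def by blast
    then show ?thesis using \<theta>(3) unfolding is_face_def by blast
  qed
qed

subsection \<open>Unbounded cells and edges\<close>

lemma M_pos: "1 \<le> M"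
  and ucell_bij: "bij_betw \<sigma> {..M} {\<tau> \<in> Pmax S. \<not> compactin (spc S) \<tau>}"
  and uedge_bij: "bij_betw b {..M} {\<rho> \<in> edges S. \<not> compactin (spc S) \<rho>}"
  and ucell_faces: "i \<le> M \<Longrightarrow> is_face S (\<sigma> i) (b i) \<and> is_face S (\<sigma> i) (b (nxt S i))"
  and uedge_ray: "\<lbrakk>i \<le> M; \<rho> \<in> {b i, b (nxt S i)}; p \<in> \<rho>; s \<ge> 0\<rbrakk> \<Longrightarrow>
        chart S (\<sigma> i) p + s *\<^sub>R rvec (d i) \<in> chart S (\<sigma> i) ` \<rho>"
  and zdet_basis: "i \<le> M \<Longrightarrow> zdet (d i) (\<xi> i) = 1"
proof -
  show "1 \<le> M"
    using asymp unfolding asymptotically_cylindrical_def Let_def by (elim conjE) assumption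
  show "bij_betw \<sigma> {..M} {\<tau> \<in> Pmax S. \<not> compactin (spc S) \<tau>}"
    using asymp unfolding asymptotically_cylindrical_def Let_def by (elim conjE) assumption
  show "bij_betw b {..M} {\<rho> \<in> edges S. \<not> compactin (spc S) \<rho>}"
    using asymp unfolding asymptotically_cylindrical_def Let_def by (elim conjE) assumption
  have "\<forall>i\<le>M. is_face S (\<sigma> i) (b i) \<and> is_face S (\<sigma> i) (b (nxt S i))"
    using asymp unfolding asymptotically_cylindrical_def Let_def by (elim conjE) assumption
  then show "i \<le> M \<Longrightarrow> is_face S (\<sigma> i) (b i) \<and> is_face S (\<sigma> i) (b (nxt S i))" by blast
  have "\<forall>i\<le>M. \<forall>\<rho>\<in>{b i, b (nxt S i)}. \<forall>p\<in>\<rho>. \<forall>s\<ge>0.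
        chart S (\<sigma> i) p + s *\<^sub>R rvec (d i) \<in> chart S (\<sigma> i) ` \<rho>"
    using asymp unfolding asymptotically_cylindrical_def Let_def by (elim conjE) assumption
  then show "\<lbrakk>i \<le> M; \<rho> \<in> {b i, b (nxt S i)}; p \<in> \<rho>; s \<ge> 0\<rbrakk> \<Longrightarrow>
        chart S (\<sigma> i) p + s *\<^sub>R rvec (d i) \<in> chart S (\<sigma> i) ` \<rho>" by blast
  have "\<forall>i\<le>M. zdet (d i) (\<xi> i) = 1"
    using asymp unfolding asymptotically_cylindrical_def Let_def by (elim conjE) assumption
  then show "i \<le> M \<Longrightarrow> zdet (d i) (\<xi> i) = 1" by blast
qed

lemma glin_d: "i < M \<Longrightarrow> glin S (\<sigma> i) (b (Suc i)) (\<sigma> (Suc i)) (d i) = d (Suc i)"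
  "glin S (\<sigma> M) (b 0) (\<sigma> 0) (d M) = d 0"
proof -
  have "\<forall>i<M. glin S (\<sigma> i) (b (Suc i)) (\<sigma> (Suc i)) (d i) = d (Suc i) \<and>
             glin S (\<sigma> i) (b (Suc i)) (\<sigma> (Suc i)) (\<xi> i) = \<xi> (Suc i)"
    using asymp unfolding asymptotically_cylindrical_def Let_def by (elim conjE) assumption
  then show "i < M \<Longrightarrow> glin S (\<sigma> i) (b (Suc i)) (\<sigma> (Suc i)) (d i) = d (Suc i)" by blast
  show "glin S (\<sigma> M) (b 0) (\<sigma> 0) (d M) = d 0"
    using asymp unfolding asymptotically_cylindrical_def Let_def by (elim conjE) assumption
qed

lemma nxt_le: "nxt S i \<le> M" unfolding nxt_def by (simp add: Suc_leI less_Suc_eq_le mod_less_divisor)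

lemma glin_nxt: "i \<le> M \<Longrightarrow> glin S (\<sigma> i) (b (nxt S i)) (\<sigma> (nxt S i)) (d i) = d (nxt S i)"
  using glin_d unfolding nxt_def by (cases "i = M") auto

lemma nxt_neq: "i \<le> M \<Longrightarrow> nxt S i \<noteq> i"
  using M_pos unfolding nxt_def by (cases "i = M") auto

lemma nxt_bij: "bij_betw (nxt S) {..M} {..M}"
proof -
  have "inj_on (nxt S) {..M}"
    unfolding nxt_def inj_on_def
  proof (intro ballI impI)
    fix i j assume "i \<in> {..M}" "j \<in> {..M}" "Suc i mod Suc M = Suc j mod Suc M"
    then show "i = j" by (cases "i = M"; cases "j = M") auto
  qed
  moreover have "nxt S ` {..M} = {..M}"
    using nxt_le \<open>inj_on (nxt S) {..M}\<close> by (intro endo_inj_surj) auto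
  ultimately show ?thesis by (simp add: bij_betw_def)
qed

lemma nxt_cases: assumes "i \<le> M" obtains j where "j \<le> M" "i = nxt S j"
  using nxt_bij assms unfolding bij_betw_def by (metis atMost_iff imageE)

lemma ucell_Pmax: "i \<le> M \<Longrightarrow> \<sigma> i \<in> Pmax S"
  and ucell_noncompact: "i \<le> M \<Longrightarrow> \<not> compactin (spc S) (\<sigma> i)"
  using ucell_bij unfolding bij_betw_def by auto

lemma ucell_inj: "i \<le> M \<Longrightarrow> j \<le> M \<Longrightarrow> \<sigma> i = \<sigma> j \<longleftrightarrow> i = j"
  using ucell_bij unfolding bij_betw_def inj_on_def by auto

lemma uedge_edges: "i \<le> M \<Longrightarrow> b i \<in> edges S"
  and uedge_noncompact: "i \<le> M \<Longrightarrow> \<not> compactin (spc S) (b i)"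
  using uedge_bij unfolding bij_betw_def by auto

lemma uedge_inj: "i \<le> M \<Longrightarrow> j \<le> M \<Longrightarrow> b i = b j \<longleftrightarrow> i = j"
  using uedge_bij unfolding bij_betw_def inj_on_def by auto

lemma noncompact_cell:
  assumes "\<tau> \<in> Pmax S" "\<not> compactin (spc S) \<tau>" obtains i where "i \<le> M" "\<tau> = \<sigma> i"
proof -
  have "\<tau> \<in> \<sigma> ` {..M}" using assms ucell_bij unfolding bij_betw_def by auto
  then show thesis using that by auto
qed

lemma noncompact_edge:
  assumes "\<rho> \<in> edges S" "\<not> compactin (spc S) \<rho>" obtains i where "i \<le> M" "\<rho> = b i"
proof -
  have "\<rho> \<in> b ` {..M}" using assms uedge_bij unfolding bij_betw_def by auto
  then show thesis using that by auto
qed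

lemma wdir_ucell: "i \<le> M \<Longrightarrow> wdir S (\<sigma> i) = d i"
  unfolding wdir_def using ucell_inj by (metis (mono_tags, lifting) the_equality)

lemma uedge_sub: "i \<le> M \<Longrightarrow> b i \<subseteq> \<sigma> i" "i \<le> M \<Longrightarrow> b (nxt S i) \<subseteq> \<sigma> i"
  using ucell_faces unfolding is_face_def by auto

text \<open>An edge lies in exactly two maximal cells, and \<open>\<sigma> i\<close>, \<open>\<sigma> (i+1)\<close> are two different ones.\<close>

lemma cells_at_uedge:
  assumes "i \<le> M" "\<tau> \<in> Pmax S" "b (nxt S i) \<subseteq> \<tau>"
  shows "\<tau> = \<sigma> i \<or> \<tau> = \<sigma> (nxt S i)"
proof -
  let ?A = "{\<tau>\<in>Pmax S. b (nxt S i) \<subseteq> \<tau>}"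
  have A: "finite ?A" "card ?A = 2" using cells_finite two_cells uedge_edges nxt_le by auto
  have "{\<sigma> i, \<sigma> (nxt S i)} \<subseteq> ?A" using assms uedge_sub nxt_le ucell_Pmax by auto
  moreover have "card {\<sigma> i, \<sigma> (nxt S i)} = 2"
    using ucell_inj[of i "nxt S i"] nxt_neq[of i] nxt_le assms by auto
  ultimately have "{\<sigma> i, \<sigma> (nxt S i)} = ?A" using A by (metis card_subset_eq)
  then show ?thesis using assms by blast
qed

lemma closed_noncompact_sub:
  assumes "closedin (spc S) A" "A \<subseteq> B" "\<not> compactin (spc S) A"
  shows "\<not> compactin (spc S) B"
  using assms closed_compactin by blast

lemma zdet_nonzero: "zdet u v = 1 \<Longrightarrow> rvec u \<noteq> 0" unfolding zdet_def rvec_def by (auto simp: zero_prod_def)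

lemma d_nonzero: "i \<le> M \<Longrightarrow> d i \<noteq> 0" "i \<le> M \<Longrightarrow> rvec (d i) \<noteq> 0"
  using zdet_basis[of i] zdet_nonzero[of "d i" "\<xi> i"] by (auto simp: zdet_def zero_prod_def)

text \<open>The edge is one-dimensional and contains a ray in direction \<open>d i\<close>, so it lies on a line with this
  direction. It does not extend indefinitely backwards, because a polygon with an extreme point contains
  no line.\<close>

lemma edge_in_ray:
  assumes "i \<le> M" "\<rho> \<in> {b i, b (nxt S i)}"
  shows "\<exists>p c. chart S (\<sigma> i) ` \<rho> \<subseteq> {p + x *\<^sub>R rvec (d i) | x. x \<ge> c}"
proof -
  let ?P = "chart S (\<sigma> i) ` \<sigma> i" and ?R = "chart S (\<sigma> i) ` \<rho>" and ?d = "rvec (d i)"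
  have \<sigma>: "\<sigma> i \<in> Pmax S" using assms ucell_Pmax by auto
  have \<rho>: "\<rho> \<in> edges S" "is_face S (\<sigma> i) \<rho>" using assms uedge_edges nxt_le ucell_faces by auto
  obtain \<tau> where \<tau>: "\<tau> \<in> Pmax S" "is_face S \<tau> \<rho>" "aff_dim (chart S \<tau> ` \<rho>) = 1"
    using \<rho> unfolding edges_def by blast
  have face: "?R face_of ?P" "\<rho> \<subseteq> \<sigma> i" "\<rho> \<noteq> {}" using \<rho> unfolding is_face_def by auto
  have "\<rho> \<noteq> \<sigma> i" using edge_not_cell[OF \<rho>(1)] \<sigma> by auto
  then have "?R \<noteq> ?P" using inj_on_image_eq_iff[OF chart_inj[OF \<sigma>] face(2)] by blast
  then have "aff_dim ?R \<le> 1" using face_of_aff_dim_lt[OF chart_convex[OF \<sigma>] face(1)] chart_aff_dim[OF \<sigma>] by simp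
  then have col: "collinear ?R" by (simp add: collinear_aff_dim)
  obtain p where p: "p \<in> ?R" using face by blast
  have ray: "q + s *\<^sub>R ?d \<in> ?R" if "q \<in> ?R" "s \<ge> 0" for q s
    using uedge_ray[OF assms] that by auto
  have line: "\<exists>x. q = p + x *\<^sub>R ?d" if "q \<in> ?R" for q
  proof -
    have "collinear {p, p + ?d, q}" using col p ray[of p 1] that by (auto intro: collinear_subset)
    then have "collinear {p + ?d, p, q}" by (simp add: insert_commute)
    from iffD1[OF collinear_3[of "p + ?d" p q, unfolded NO_MATCH_def, OF TrueI] this]
    have "collinear {0, ?d, q - p}" unfolding add_diff_cancel_left' .
    then have "q - p = 0 \<or> (\<exists>c. q - p = c *\<^sub>R ?d)"
      unfolding collinear_lemma using d_nonzero(2)[OF assms(1)] by blast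
    then obtain c where "q - p = c *\<^sub>R ?d" using scaleR_zero_left[of ?d] by metis
    then have "q = p + c *\<^sub>R ?d" by (simp add: diff_eq_eq add.commute)
    then show ?thesis by blast
  qed
  have "\<exists>c. \<forall>x. p + x *\<^sub>R ?d \<in> ?R \<longrightarrow> x \<ge> c"
  proof (rule ccontr)
    assume "\<not> ?thesis"
    then have H: "\<exists>x. p + x *\<^sub>R ?d \<in> ?R \<and> x < c" for c by (metis not_le)
    have "p + s *\<^sub>R ?d \<in> ?P" for s
    proof -
      obtain x where x: "p + x *\<^sub>R ?d \<in> ?R" "x < s" using H by blast
      have "p + x *\<^sub>R ?d + (s - x) *\<^sub>R ?d \<in> ?R" using ray x by simp
      moreover have "p + x *\<^sub>R ?d + (s - x) *\<^sub>R ?d = p + s *\<^sub>R ?d" by (simp add: algebra_simps)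
      ultimately show ?thesis using face_of_imp_subset[OF face(1)] by auto
    qed
    moreover obtain e where "e extreme_point_of ?P" using integral_polygonD(4)[OF cell_polygon[OF \<sigma>]] by blast
    ultimately have "?d = 0" using no_line_if_extreme_point[OF chart_closed[OF \<sigma>] chart_convex[OF \<sigma>]] by blast
    then show False using d_nonzero(2)[OF assms(1)] by blast
  qed
  then obtain c where c: "\<And>x. p + x *\<^sub>R ?d \<in> ?R \<Longrightarrow> x \<ge> c" by blast
  have "?R \<subseteq> {p + x *\<^sub>R ?d | x. x \<ge> c}"
  proof
    fix q assume q: "q \<in> ?R"
    obtain x where x: "q = p + x *\<^sub>R ?d" using line[OF q] by blast
    then show "q \<in> {p + x *\<^sub>R ?d | x. x \<ge> c}" using c[of x] q by auto
  qed
  then show ?thesis by (intro exI)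
qed

text \<open>Both sets contain a subray of the ray that contains the edge.\<close>

lemma unbounded_parts_meet:
  assumes "i \<le> M"
    and "A \<subseteq> b i" "closedin (spc S) A" "connectedin (spc S) A" "\<not> compactin (spc S) A"
    and "B \<subseteq> b i" "closedin (spc S) B" "connectedin (spc S) B" "\<not> compactin (spc S) B"
  shows "infinite (A \<inter> B)"
proof -
  let ?c = "chart S (\<sigma> i)"
  have \<sigma>: "\<sigma> i \<in> Pmax S" using assms ucell_Pmax by auto
  have sub: "A \<subseteq> \<sigma> i" "B \<subseteq> \<sigma> i" using assms uedge_sub by auto
  obtain p c where pc: "?c ` b i \<subseteq> {p + x *\<^sub>R rvec (d i) | x. x \<ge> c}" using edge_in_ray[OF assms(1), of "b i"] by auto
  have AB: "closed (?c ` A)" "connected (?c ` A)" "\<not> compact (?c ` A)" "closed (?c ` B)" "connected (?c ` B)" "\<not> compact (?c ` B)"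
    using assms sub by (auto simp: closed_chart_iff[OF \<sigma>] connected_chart_iff[OF \<sigma>] compact_chart_iff[OF \<sigma>])
  obtain x1 where x1: "\<And>x. x \<ge> x1 \<Longrightarrow> p + x *\<^sub>R rvec (d i) \<in> ?c ` A"
    using unbounded_connected_in_ray[OF AB(1-3) d_nonzero(2)[OF assms(1)]] pc assms(2) by (meson image_mono subset_trans)
  obtain x2 where x2: "\<And>x. x \<ge> x2 \<Longrightarrow> p + x *\<^sub>R rvec (d i) \<in> ?c ` B"
    using unbounded_connected_in_ray[OF AB(4-6) d_nonzero(2)[OF assms(1)]] pc assms(6) by (meson image_mono subset_trans)
  have "(\<lambda>x. p + x *\<^sub>R rvec (d i)) ` {max x1 x2..} \<subseteq> ?c ` A \<inter> ?c ` B" using x1 x2 by auto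
  also have "\<dots> = ?c ` (A \<inter> B)" using inj_on_image_Int[OF chart_inj[OF \<sigma>] sub] by simp
  finally have "(\<lambda>x. p + x *\<^sub>R rvec (d i)) ` {max x1 x2..} \<subseteq> ?c ` (A \<inter> B)" .
  moreover have "infinite ((\<lambda>x. p + x *\<^sub>R rvec (d i)) ` {max x1 x2..})"
    using d_nonzero(2)[OF assms(1)] by (subst finite_image_iff) (auto simp: inj_on_def infinite_Ici)
  ultimately show ?thesis by (meson finite_imageI finite_subset)
qed

section \<open>Chambers and unbounded walls\<close>

lemma walls_finite: "finite (walls W)"
  and seg_inj: "inj_on seg (walls W)"
  and chambers_finite: "finite (chambers W)"
  and chambers_topspace: "\<Union>(chambers W) = topspace (spc S)"
  and walls_seg: "seg ` walls W = {\<tau>. \<exists>\<uu>\<in>chambers W. chamber_face S \<uu> \<tau> \<and>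
        aff_dim (chart S (cell_of S \<uu>) ` \<tau>) = 1}"
  and kink_pos: "\<forall>\<rho>\<in>edges S. 1 \<le> kink W \<rho>"
  by (use wall in \<open>unfold wall_structure_def, elim conjE\<close>, assumption)+

lemma wall_home: "p \<in> walls W \<Longrightarrow> home p \<in> Pmax S" "p \<in> walls W \<Longrightarrow> seg p \<subseteq> home p"
  and wall_one: "p \<in> walls W \<Longrightarrow> \<not> slab S p \<Longrightarrow> fps_nth (wfun p) 0 = 1"
proof -
  have *: "\<forall>p\<in>walls W. home p \<in> Pmax S \<and> seg p \<subseteq> home p \<and>
        fps_cutoff (Suc k) (wfun p) = wfun p \<and>
        (\<exists>d. rational_segment (chart S (home p) ` seg p) d \<and>
           (\<forall>h. \<forall>m\<in>Poly_Mapping.keys (fps_nth (wfun p) h). \<exists>j. m = zscale j d)) \<and>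
        (\<not> slab S p \<longrightarrow> fps_nth (wfun p) 0 = 1) \<and>
        (\<forall>\<rho>\<in>edges S. \<forall>y\<in>seg p \<inter> \<rho> - vertices S. \<rho> \<subseteq> home p \<longrightarrow>
           (\<forall>h. \<forall>m\<in>Poly_Mapping.keys (fps_nth (wfun p) h).
              int h \<ge> - int (kink W \<rho>) * pairing (conormal S (home p) \<rho> (home p)) m))"
    using wall unfolding wall_structure_def by (elim conjE) assumption
  have **: "home p \<in> Pmax S \<and> seg p \<subseteq> home p \<and> (\<not> slab S p \<longrightarrow> fps_nth (wfun p) 0 = 1)" if "p \<in> walls W"
    by (use bspec[OF * that] in \<open>elim conjE, intro conjI\<close>; assumption)
  show "p \<in> walls W \<Longrightarrow> home p \<in> Pmax S" "p \<in> walls W \<Longrightarrow> seg p \<subseteq> home p"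
    "p \<in> walls W \<Longrightarrow> \<not> slab S p \<Longrightarrow> fps_nth (wfun p) 0 = 1"
    using ** by simp_all
qed

lemma chamber_in_cell:
  "\<forall>\<uu>\<in>chambers W. \<exists>\<tau>\<in>Pmax S. \<uu> \<subseteq> \<tau> \<and> polyhedron (chart S \<tau> ` \<uu>) \<and> interior (chart S \<tau> ` \<uu>) \<noteq> {}"
  using wall unfolding wall_structure_def by (elim conjE) assumption

lemma chamber_Int:
  assumes "\<uu> \<in> chambers W" "\<uu>' \<in> chambers W" "\<uu> \<noteq> \<uu>'"
  shows "\<uu> \<inter> \<uu>' = \<Union>{\<tau>. chamber_face S \<uu> \<tau> \<and> chamber_face S \<uu>' \<tau> \<and> \<tau> \<noteq> \<uu> \<and> \<tau> \<noteq> \<uu>'}"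
proof -
  have "\<forall>\<uu>\<in>chambers W. \<forall>\<uu>'\<in>chambers W. \<uu> \<noteq> \<uu>' \<longrightarrow>
        \<uu> \<inter> \<uu>' = \<Union>{\<tau>. chamber_face S \<uu> \<tau> \<and> chamber_face S \<uu>' \<tau> \<and> \<tau> \<noteq> \<uu> \<and> \<tau> \<noteq> \<uu>'}"
    using wall unfolding wall_structure_def by (elim conjE) assumption
  then show ?thesis using assms by simp
qed

text \<open>A chamber contains interior points of the cell in which it lies, and these determine the cell.\<close>

lemma cell_of_eq:
  assumes "\<uu> \<in> chambers W" "\<tau> \<in> Pmax S" "\<uu> \<subseteq> \<tau>"
  shows "cell_of S \<uu> = \<tau>"
proof -
  obtain \<tau>\<^sub>0 where \<tau>\<^sub>0: "\<tau>\<^sub>0 \<in> Pmax S" "\<uu> \<subseteq> \<tau>\<^sub>0" "interior (chart S \<tau>\<^sub>0 ` \<uu>) \<noteq> {}"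
    using chamber_in_cell assms(1) by blast
  have "\<exists>x\<in>\<uu>. chart S \<tau>\<^sub>0 x \<in> interior (chart S \<tau>\<^sub>0 ` \<tau>\<^sub>0)"
  proof -
    obtain y where "y \<in> interior (chart S \<tau>\<^sub>0 ` \<uu>)" using \<tau>\<^sub>0(3) by blast
    then obtain x where "x \<in> \<uu>" "y = chart S \<tau>\<^sub>0 x" using interior_subset by blast
    then show ?thesis using \<open>y \<in> _\<close> interior_mono[OF image_mono[OF \<tau>\<^sub>0(2)]] by blast
  qed
  then obtain x where x: "x \<in> \<uu>" "chart S \<tau>\<^sub>0 x \<in> interior (chart S \<tau>\<^sub>0 ` \<tau>\<^sub>0)" by blast
  have uniq: "\<tau>' = \<tau>\<^sub>0" if "\<tau>' \<in> Pmax S" "\<uu> \<subseteq> \<tau>'" for \<tau>'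
    using interior_unique_cell[OF \<tau>\<^sub>0(1) _ x(2) that(1)] x(1) \<tau>\<^sub>0(2) that(2) by blast
  have "cell_of S \<uu> = \<tau>\<^sub>0"
    unfolding cell_of_def
    by (rule the_equality, rule conjI[OF \<tau>\<^sub>0(1,2)], elim conjE, rule uniq)
  then show ?thesis using uniq[OF assms(2,3)] by simp
qed

lemma chamber_cell:
  assumes "\<uu> \<in> chambers W"
  shows "cell_of S \<uu> \<in> Pmax S" "\<uu> \<subseteq> cell_of S \<uu>" "polyhedron (chart S (cell_of S \<uu>) ` \<uu>)"
    "interior (chart S (cell_of S \<uu>) ` \<uu>) \<noteq> {}"
proof -
  obtain \<tau> where \<tau>: "\<tau> \<in> Pmax S" "\<uu> \<subseteq> \<tau>" "polyhedron (chart S \<tau> ` \<uu>)" "interior (chart S \<tau> ` \<uu>) \<noteq> {}"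
    using chamber_in_cell assms by blast
  have "cell_of S \<uu> = \<tau>" using cell_of_eq[OF assms \<tau>(1,2)] .
  then show "cell_of S \<uu> \<in> Pmax S" "\<uu> \<subseteq> cell_of S \<uu>" "polyhedron (chart S (cell_of S \<uu>) ` \<uu>)"
    "interior (chart S (cell_of S \<uu>) ` \<uu>) \<noteq> {}" using \<tau> by simp_all
qed

text \<open>A chamber with a point in the interior of the cell lies in the cell. The finitely many chambers in the
  cell form a closed set, which therefore contains the closure of the interior of the cell.\<close>

lemma cell_chambers_cover:
  assumes "\<tau> \<in> Pmax S" "x \<in> \<tau>"
  obtains \<uu> where "\<uu> \<in> chambers W" "\<uu> \<subseteq> \<tau>" "x \<in> \<uu>"
proof -
  let ?c = "chart S \<tau>"
  define A where "A = {\<uu> \<in> chambers W. \<uu> \<subseteq> \<tau>}"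
  have "polyhedron (?c ` \<uu>)" if "\<uu> \<in> A" for \<uu>
    using chamber_cell(3)[of \<uu>] cell_of_eq[of \<uu> \<tau>] that assms unfolding A_def by simp
  then have "closed (\<Union>\<uu>\<in>A. ?c ` \<uu>)"
    using chambers_finite by (intro closed_UN) (auto simp: A_def polyhedron_imp_closed)
  moreover have "interior (?c ` \<tau>) \<subseteq> (\<Union>\<uu>\<in>A. ?c ` \<uu>)"
  proof
    fix y assume y: "y \<in> interior (?c ` \<tau>)"
    then obtain z where z: "z \<in> \<tau>" "y = ?c z" using interior_subset by blast
    then have "z \<in> topspace (spc S)" using cell_topspace assms by blast
    then obtain \<uu> where \<uu>: "\<uu> \<in> chambers W" "z \<in> \<uu>" using chambers_topspace by blast
    then have "cell_of S \<uu> = \<tau>"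
      using interior_unique_cell[OF assms(1) z(1) _ chamber_cell(1)[OF \<uu>(1)]] y z chamber_cell(2) by blast
    then have "\<uu> \<in> A" using chamber_cell(2)[OF \<uu>(1)] \<uu> unfolding A_def by auto
    then show "y \<in> (\<Union>\<uu>\<in>A. ?c ` \<uu>)" using z \<uu> by auto
  qed
  ultimately have "closure (interior (?c ` \<tau>)) \<subseteq> (\<Union>\<uu>\<in>A. ?c ` \<uu>)" by (simp add: closure_minimal)
  moreover have "closure (interior (?c ` \<tau>)) = ?c ` \<tau>"
    using convex_closure_interior[OF chart_convex[OF assms(1)] chart_interior[OF assms(1)]] chart_closed[OF assms(1)]
    by simp
  ultimately have "?c x \<in> (\<Union>\<uu>\<in>A. ?c ` \<uu>)" using assms(2) by blast
  then obtain \<uu> y where "\<uu> \<in> A" "y \<in> \<uu>" "?c x = ?c y" by auto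
  then have "x \<in> \<uu>" using chart_inj[OF assms(1)] assms(2) unfolding A_def inj_on_def by blast
  then show thesis using that \<open>\<uu> \<in> A\<close> unfolding A_def by blast
qed

lemma wall_face:
  assumes "p \<in> walls W"
  obtains \<uu> where "\<uu> \<in> chambers W" "chamber_face S \<uu> (seg p)" "aff_dim (chart S (cell_of S \<uu>) ` seg p) = 1"
proof -
  have "seg p \<in> seg ` walls W" using assms by simp
  then show thesis unfolding walls_seg using that by blast
qed

lemma seg_closed_connected:
  assumes "p \<in> walls W"
  shows "closedin (spc S) (seg p)" "connectedin (spc S) (seg p)"
proof -
  obtain \<uu> where \<uu>: "\<uu> \<in> chambers W" "chamber_face S \<uu> (seg p)" using wall_face[OF assms] by blast
  note C = chamber_cell[OF \<uu>(1)]
  have sub: "seg p \<subseteq> cell_of S \<uu>" and face: "chart S (cell_of S \<uu>) ` seg p face_of chart S (cell_of S \<uu>) ` \<uu>"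
    using \<uu>(2) C(2) unfolding chamber_face_def by blast+
  show "closedin (spc S) (seg p)"
    unfolding closed_chart_iff[OF C(1) sub]
    by (rule face_of_imp_closed[OF polyhedron_imp_convex[OF C(3)] polyhedron_imp_closed[OF C(3)] face])
  show "connectedin (spc S) (seg p)"
    unfolding connected_chart_iff[OF C(1) sub]
    by (rule convex_connected[OF face_of_imp_convex[OF face]])
qed

lemma walls_eq_if_infinite:
  assumes "p \<in> walls W" "p' \<in> walls W" "infinite (seg p \<inter> seg p')"
  shows "p = p'"
proof -
  obtain \<uu> where \<uu>: "\<uu> \<in> chambers W" "chamber_face S \<uu> (seg p)" "aff_dim (chart S (cell_of S \<uu>) ` seg p) = 1"
    using wall_face[OF assms(1)] by blast
  obtain \<uu>' where \<uu>': "\<uu>' \<in> chambers W" "chamber_face S \<uu>' (seg p')" "aff_dim (chart S (cell_of S \<uu>') ` seg p') = 1"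
    using wall_face[OF assms(2)] by blast
  note C = chamber_cell[OF \<uu>(1)] and C' = chamber_cell[OF \<uu>'(1)]
  have "seg p = seg p'"
  proof (rule one_dim_faces_eq[OF inj_on_subset[OF chart_inj[OF C(1)] C(2)] inj_on_subset[OF chart_inj[OF C'(1)] C'(2)]
        polyhedron_imp_convex[OF C(3)] polyhedron_imp_convex[OF C'(3)]
        interior_aff_dim2[OF C(4)] interior_aff_dim2[OF C'(4)] _ _ _ \<uu>(3) _ _ \<uu>'(3) assms(3)])
    show "\<uu> = \<uu>' \<and> chart S (cell_of S \<uu>) = chart S (cell_of S \<uu>') \<or>
      \<uu> \<inter> \<uu>' = \<Union> {\<theta>. \<theta> \<noteq> {} \<and> \<theta> \<subseteq> \<uu> \<and> chart S (cell_of S \<uu>) ` \<theta> face_of chart S (cell_of S \<uu>) ` \<uu> \<and>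
           \<theta> \<subseteq> \<uu>' \<and> chart S (cell_of S \<uu>') ` \<theta> face_of chart S (cell_of S \<uu>') ` \<uu>' \<and> \<theta> \<noteq> \<uu> \<and> \<theta> \<noteq> \<uu>'}"
      using chamber_Int[OF \<uu>(1) \<uu>'(1)] unfolding chamber_face_def by (simp add: conj_ac) metis
  qed (use \<uu>(2) \<uu>'(2) in \<open>auto simp: chamber_face_def\<close>)
  then show ?thesis using seg_inj assms unfolding inj_on_def by blast
qed

lemma interior_not_on_edge:
  assumes "\<tau> \<in> Pmax S" "x \<in> \<tau>" "chart S \<tau> x \<in> interior (chart S \<tau> ` \<tau>)" "\<rho> \<in> edges S"
  shows "x \<notin> \<rho>"
proof
  assume x: "x \<in> \<rho>"
  obtain \<tau>' where \<tau>': "\<tau>' \<in> Pmax S" "is_face S \<tau>' \<rho>" using assms(4) unfolding edges_def by blast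
  then have sub: "\<rho> \<subseteq> \<tau>'" and face: "chart S \<tau>' ` \<rho> face_of chart S \<tau>' ` \<tau>'" unfolding is_face_def by auto
  have eq: "\<tau>' = \<tau>" using interior_unique_cell[OF assms(1-3) \<tau>'(1)] x sub by blast
  have "\<rho> \<noteq> \<tau>" using edge_not_cell[OF assms(4)] assms(1) by blast
  then have "chart S \<tau> ` \<rho> \<noteq> chart S \<tau> ` \<tau>"
    using inj_on_image_eq_iff[OF chart_inj[OF assms(1)], of \<rho> \<tau>] sub eq by blast
  then show False using face_of_disjoint_interior[of "chart S \<tau> ` \<rho>" "chart S \<tau> ` \<tau>"] face x assms(3) unfolding eq by blast
qed

text \<open>The interior of the cell stays connected when the finitely many vertices of chambers are removed. Two
  chambers that meet in one of the remaining points have a one-dimensional face in common. It is a wall,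
  and not a slab because edges do not enter the interior of the cell. So a property that is inherited by
  the neighbour across a wall of the cell spreads from one chamber to all chambers of the cell.\<close>

lemma chamber_induct:
  assumes "\<tau> \<in> Pmax S" "\<uu>\<^sub>0 \<in> chambers W" "\<uu>\<^sub>0 \<subseteq> \<tau>" "P \<uu>\<^sub>0"
    and step: "\<And>\<uu> p \<uu>'. \<lbrakk>adjacent W \<uu> p \<uu>'; \<not> slab S p; \<uu> \<subseteq> \<tau>; \<uu>' \<subseteq> \<tau>; P \<uu>\<rbrakk> \<Longrightarrow> P \<uu>'"
    and \<uu>\<^sub>1: "\<uu>\<^sub>1 \<in> chambers W" "\<uu>\<^sub>1 \<subseteq> \<tau>"
  shows "P \<uu>\<^sub>1"
proof (rule ccontr)
  assume nP: "\<not> P \<uu>\<^sub>1"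
  let ?c = "chart S \<tau>"
  define A where "A = {\<uu> \<in> chambers W. \<uu> \<subseteq> \<tau> \<and> P \<uu>}"
  define B where "B = {\<uu> \<in> chambers W. \<uu> \<subseteq> \<tau> \<and> \<not> P \<uu>}"
  \<comment> \<open>\<open>a\<close> and \<open>b'\<close> are closed, cover \<open>I - Z\<close> and would disconnect it\<close>
  define a where "a = (\<Union>\<uu>\<in>A. ?c ` \<uu>)"
  define b' where "b' = (\<Union>\<uu>\<in>B. ?c ` \<uu>)"
  define I where "I = interior (?c ` \<tau>)"
  define Z where "Z = (\<Union>\<uu>\<in>A. {z. z extreme_point_of (?c ` \<uu>)})"
  have fin: "finite A" "finite B" using chambers_finite unfolding A_def B_def by auto
  have poly: "polyhedron (?c ` \<uu>)" "interior (?c ` \<uu>) \<noteq> {}" if "\<uu> \<in> chambers W" "\<uu> \<subseteq> \<tau>" for \<uu>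
    using chamber_cell(3,4)[OF that(1)] cell_of_eq[OF that(1) assms(1) that(2)] by auto
  have cl: "closed a" "closed b'" unfolding a_def b'_def
    by (intro closed_UN fin ballI polyhedron_imp_closed poly(1); auto simp: A_def B_def)+
  have finZ: "finite Z" unfolding Z_def
    by (intro finite_UN_I fin(1) finite_polyhedron_extreme_points poly(1)) (auto simp: A_def)
  have "convex I" unfolding I_def by (intro convex_interior chart_convex assms(1))
  then have con: "connected (I - Z)"
    using finZ unfolding I_def by (intro connected_open_delete_finite) (auto intro: convex_connected)
  have cov: "I - Z \<subseteq> a \<union> b'"
  proof
    fix y assume "y \<in> I - Z"
    then obtain x where x: "x \<in> \<tau>" "y = ?c x" unfolding I_def using interior_subset by blast
    obtain \<uu> where "\<uu> \<in> chambers W" "\<uu> \<subseteq> \<tau>" "x \<in> \<uu>" using cell_chambers_cover[OF assms(1) x(1)] by blast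
    then show "y \<in> a \<union> b'" unfolding a_def b'_def A_def B_def x(2) by blast
  qed
  have dis: "a \<inter> b' \<inter> (I - Z) = {}"
  proof (rule ccontr)
    assume "a \<inter> b' \<inter> (I - Z) \<noteq> {}"
    then obtain y where y: "y \<in> a" "y \<in> b'" "y \<in> I" "y \<notin> Z" by blast
    obtain \<uu> x where \<uu>: "\<uu> \<in> A" "x \<in> \<uu>" "y = ?c x" using y(1) unfolding a_def by blast
    obtain \<uu>' x' where \<uu>': "\<uu>' \<in> B" "x' \<in> \<uu>'" "y = ?c x'" using y(2) unfolding b'_def by blast
    have xx: "x' = x"
    proof (rule inj_onD[OF chart_inj[OF assms(1)]])
      show "?c x' = ?c x" using \<uu>(3) \<uu>'(3) by simp
    qed (use \<uu> \<uu>' in \<open>auto simp: A_def B_def\<close>)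
    have ne: "\<uu> \<noteq> \<uu>'" and ch: "\<uu> \<in> chambers W" "\<uu>' \<in> chambers W" and sub: "\<uu> \<subseteq> \<tau>" "\<uu>' \<subseteq> \<tau>" and Ps: "P \<uu>" "\<not> P \<uu>'"
      using \<uu> \<uu>' unfolding A_def B_def by auto
    have "x \<in> \<uu> \<inter> \<uu>'" using \<uu> \<uu>' xx by blast
    then obtain \<theta> where \<theta>: "x \<in> \<theta>" "chamber_face S \<uu> \<theta>" "chamber_face S \<uu>' \<theta>" "\<theta> \<noteq> \<uu>"
      unfolding chamber_Int[OF ch ne] by blast
    note co = cell_of_eq[OF ch(1) assms(1) sub(1)]
    have face: "\<theta> \<subseteq> \<uu>" "?c ` \<theta> face_of ?c ` \<uu>" using \<theta>(2) unfolding chamber_face_def co by auto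
    have sub': "\<theta> \<subseteq> \<uu>'" using \<theta>(3) unfolding chamber_face_def by auto
    have "?c ` \<theta> \<noteq> ?c ` \<uu>"
      using inj_on_image_eq_iff[OF chart_inj[OF assms(1)], of \<theta> \<uu>] face(1) sub(1) \<theta>(4) by blast
    then have lt: "aff_dim (?c ` \<theta>) < 2"
      using face_of_aff_dim_lt[OF polyhedron_imp_convex[OF poly(1)[OF ch(1) sub(1)]] face(2)]
        interior_aff_dim2[OF poly(2)[OF ch(1) sub(1)]] by simp
    have "aff_dim (?c ` \<theta>) \<noteq> 1"
    proof
      assume "aff_dim (?c ` \<theta>) = 1"
      then have "\<theta> \<in> seg ` walls W" unfolding walls_seg using ch(1) \<theta>(2) co by auto
      then obtain p where p: "p \<in> walls W" "seg p = \<theta>" by blast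
      have "adjacent W \<uu> p \<uu>'" using ch ne p face(1) sub' unfolding adjacent_def by blast
      moreover have "\<not> slab S p"
      proof
        assume "slab S p"
        then obtain \<rho> where "\<rho> \<in> edges S" "\<theta> \<subseteq> \<rho>" unfolding slab_def p(2) by blast
        then show False using interior_not_on_edge[OF assms(1), of x \<rho>] y(3) \<uu>(2,3) sub(1) \<theta>(1) unfolding I_def by blast
      qed
      ultimately show False using step[of \<uu> p \<uu>'] sub Ps by blast
    qed
    moreover have "aff_dim (?c ` \<theta>) \<noteq> -1" using \<theta>(1) aff_dim_empty[of "?c ` \<theta>"] by blast
    ultimately have "aff_dim (?c ` \<theta>) = 0" using lt aff_dim_geq[of "?c ` \<theta>"] by linarith
    then obtain z where "?c ` \<theta> = {z}" unfolding aff_dim_eq_0 by blast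
    then have "?c ` \<theta> = {y}" using imageI[OF \<theta>(1), of ?c] \<uu>(3) by auto
    then have "y extreme_point_of (?c ` \<uu>)" using face(2) by (simp add: face_of_singleton)
    then show False using y(4) \<uu>(1) unfolding Z_def by blast
  qed
  have ne: "(\<Union>\<uu>\<in>C. ?c ` \<uu>) \<inter> (I - Z) \<noteq> {}" if "\<uu> \<in> C" "\<uu> \<in> chambers W" "\<uu> \<subseteq> \<tau>" for \<uu> C
  proof -
    have "infinite (interior (?c ` \<uu>))"
      using poly(2)[OF that(2,3)] by (metis finite_imp_not_open open_interior)
    then have "\<not> interior (?c ` \<uu>) \<subseteq> Z" using finZ finite_subset by blast
    then obtain y where y: "y \<in> interior (?c ` \<uu>)" "y \<notin> Z" by blast
    have "interior (?c ` \<uu>) \<subseteq> I" unfolding I_def by (intro interior_mono image_mono that)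
    moreover have "interior (?c ` \<uu>) \<subseteq> (\<Union>\<uu>\<in>C. ?c ` \<uu>)"
      by (rule order_trans[OF interior_subset UN_upper[OF that(1)]])
    ultimately have "y \<in> (\<Union>\<uu>\<in>C. ?c ` \<uu>) \<inter> (I - Z)" using y by (intro IntI DiffI) (erule (1) subsetD)+
    then show ?thesis by (metis empty_iff)
  qed
  have "a \<inter> (I - Z) \<noteq> {}" unfolding a_def by (rule ne[of \<uu>\<^sub>0]) (use assms in \<open>auto simp: A_def\<close>)
  moreover have "b' \<inter> (I - Z) \<noteq> {}" unfolding b'_def by (rule ne[of \<uu>\<^sub>1]) (use \<uu>\<^sub>1 nP in \<open>auto simp: B_def\<close>)
  ultimately show False
    using connected_closedD[OF con dis cov cl] by blast
qed

abbreviation "uslab \<equiv> unbounded_slab S W"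

lemma unbounded_wall: "p \<in> unbounded_walls S W \<Longrightarrow> p \<in> walls W" "p \<in> unbounded_walls S W \<Longrightarrow> \<not> compactin (spc S) (seg p)"
  unfolding unbounded_walls_def by auto

lemma noncompact_infinite:
  assumes "\<not> compactin (spc S) A" "A \<subseteq> topspace (spc S)" shows "infinite A"
  using assms finite_imp_compactin by blast

lemma unbounded_seg_infinite: "p \<in> unbounded_walls S W \<Longrightarrow> infinite (seg p)"
  using noncompact_infinite unbounded_wall wall_home cell_topspace by (meson subset_trans)

text \<open>Two unbounded walls in the same unbounded edge have infinitely many points in common.\<close>

lemma unbounded_slab_unique:
  assumes "i \<le> M" "p \<in> unbounded_walls S W" "seg p \<subseteq> b i" "p' \<in> unbounded_walls S W" "seg p' \<subseteq> b i"
  shows "p = p'"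
  by (rule walls_eq_if_infinite[OF unbounded_wall(1)[OF assms(2)] unbounded_wall(1)[OF assms(4)]],
      rule unbounded_parts_meet[OF assms(1,3) seg_closed_connected[OF unbounded_wall(1)[OF assms(2)]] unbounded_wall(2)[OF assms(2)]
        assms(5) seg_closed_connected[OF unbounded_wall(1)[OF assms(4)]] unbounded_wall(2)[OF assms(4)]])

text \<open>One of the finitely many chambers in \<open>\<sigma> i\<close> meets the edge in a noncompact set. This is a face of the
  chamber of dimension one, and such faces are walls.\<close>

lemma unbounded_slab_exists:
  assumes i: "i \<le> M"
  obtains p where "p \<in> unbounded_walls S W" "seg p \<subseteq> b i"
proof -
  let ?c = "chart S (\<sigma> i)"
  note \<sigma> = ucell_Pmax[OF i]
  have bsub: "b i \<subseteq> \<sigma> i" and bface: "?c ` b i face_of ?c ` \<sigma> i"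
    using ucell_faces[OF i] unfolding is_face_def by auto
  define A where "A = {\<uu> \<in> chambers W. \<uu> \<subseteq> \<sigma> i}"
  have "b i = (\<Union>\<uu>\<in>A. \<uu> \<inter> b i)"
  proof (intro equalityI subsetI)
    fix x assume x: "x \<in> b i"
    obtain \<uu> where "\<uu> \<in> chambers W" "\<uu> \<subseteq> \<sigma> i" "x \<in> \<uu>"
      using cell_chambers_cover[OF \<sigma>] x bsub by blast
    then show "x \<in> (\<Union>\<uu>\<in>A. \<uu> \<inter> b i)" using x unfolding A_def by blast
  qed auto
  moreover have "finite A" unfolding A_def using chambers_finite by auto
  ultimately have "\<exists>\<uu>\<in>A. \<not> compactin (spc S) (\<uu> \<inter> b i)"
    using uedge_noncompact[OF i] compactin_Union[of "(\<lambda>\<uu>. \<uu> \<inter> b i) ` A" "spc S"] by auto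
  then obtain \<uu> where \<uu>: "\<uu> \<in> chambers W" "\<uu> \<subseteq> \<sigma> i" "\<not> compactin (spc S) (\<uu> \<inter> b i)" unfolding A_def by blast
  note co = cell_of_eq[OF \<uu>(1) \<sigma> \<uu>(2)]
  have poly: "polyhedron (?c ` \<uu>)" using chamber_cell(3)[OF \<uu>(1)] unfolding co .
  have im: "?c ` (\<uu> \<inter> b i) = ?c ` b i \<inter> ?c ` \<uu>"
    using inj_on_image_Int[OF chart_inj[OF \<sigma>] \<uu>(2) bsub] by blast
  have "(?c ` b i \<inter> ?c ` \<uu>) face_of (?c ` \<sigma> i \<inter> ?c ` \<uu>)"
    by (rule face_of_slice[OF bface polyhedron_imp_convex[OF poly]])
  then have face: "?c ` (\<uu> \<inter> b i) face_of ?c ` \<uu>" using \<uu>(2) im by (simp add: Int_absorb1 image_mono)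
  have inf: "infinite (\<uu> \<inter> b i)"
    using noncompact_infinite[OF \<uu>(3)] \<uu>(2) cell_topspace[OF \<sigma>] by blast
  have inf': "infinite (?c ` (\<uu> \<inter> b i))"
    using inf finite_image_iff[of ?c "\<uu> \<inter> b i"] inj_on_subset[OF chart_inj[OF \<sigma>]] \<uu>(2) by blast
  have "aff_dim (?c ` (\<uu> \<inter> b i)) \<le> aff_dim (?c ` b i)" by (intro aff_dim_subset) auto
  also have "b i \<noteq> \<sigma> i" using edge_not_cell[OF uedge_edges[OF i]] \<sigma> by metis
  then have "?c ` b i \<noteq> ?c ` \<sigma> i" using inj_on_image_eq_iff[OF chart_inj[OF \<sigma>] bsub order_refl] by blast
  then have "aff_dim (?c ` b i) < 2"
    using face_of_aff_dim_lt[OF chart_convex[OF \<sigma>] bface] chart_aff_dim[OF \<sigma>] by simp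
  finally have "aff_dim (?c ` (\<uu> \<inter> b i)) < 2" .
  moreover have "aff_dim (?c ` (\<uu> \<inter> b i)) \<noteq> -1" using inf' aff_dim_empty[of "?c ` (\<uu> \<inter> b i)"] by force
  moreover have "aff_dim (?c ` (\<uu> \<inter> b i)) \<noteq> 0" using inf' unfolding aff_dim_eq_0 by force
  ultimately have "aff_dim (?c ` (\<uu> \<inter> b i)) = 1" using aff_dim_geq[of "?c ` (\<uu> \<inter> b i)"] by linarith
  moreover have "chamber_face S \<uu> (\<uu> \<inter> b i)" unfolding chamber_face_def co using face inf by auto
  ultimately have "\<uu> \<inter> b i \<in> seg ` walls W" unfolding walls_seg using \<uu>(1) co by auto
  then obtain p where "p \<in> walls W" "seg p = \<uu> \<inter> b i" by blast
  then show thesis using that[of p] \<uu>(3) unfolding unbounded_walls_def by auto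
qed

lemma unbounded_slab:
  assumes "i \<le> M"
  shows "uslab i \<in> unbounded_walls S W" "seg (uslab i) \<subseteq> b i"
proof -
  obtain p where p: "p \<in> unbounded_walls S W" "seg p \<subseteq> b i" using unbounded_slab_exists[OF assms] by blast
  have "uslab i = p"
    unfolding unbounded_slab_def
    by (rule the_equality, rule conjI[OF p], elim conjE, rule unbounded_slab_unique[OF assms _ _ p])
  then show "uslab i \<in> unbounded_walls S W" "seg (uslab i) \<subseteq> b i" using p by simp_all
qed

lemma unbounded_slab_eq: "i \<le> M \<Longrightarrow> p \<in> unbounded_walls S W \<Longrightarrow> seg p \<subseteq> b i \<Longrightarrow> uslab i = p"
  using unbounded_slab unbounded_slab_unique by blast

lemma unbounded_slab_is_slab: "i \<le> M \<Longrightarrow> slab S (uslab i)"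
  unfolding slab_def using unbounded_slab(2) uedge_edges by blast

lemma slab_edge_uslab:
  assumes "i \<le> M" shows "slab_edge S (uslab i) = b i"
proof -
  note s = unbounded_slab[OF assms]
  have "\<rho> = b i" if "\<rho> \<in> edges S" "seg (uslab i) \<subseteq> \<rho>" for \<rho>
    using edges_eq_if_infinite[OF that(1) uedge_edges[OF assms]] unbounded_seg_infinite[OF s(1)] that(2) s(2)
      infinite_super[of "seg (uslab i)" "\<rho> \<inter> b i"] by blast
  then show ?thesis unfolding slab_edge_def
    by (intro the_equality conjI uedge_edges[OF assms] s(2)) (elim conjE)
qed

lemma uslab_inj: "i \<le> M \<Longrightarrow> j \<le> M \<Longrightarrow> uslab i = uslab j \<Longrightarrow> i = j"
  using slab_edge_uslab uedge_inj by metis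

lemma unbounded_home:
  assumes "p \<in> unbounded_walls S W"
  obtains j where "j \<le> M" "home p = \<sigma> j"
proof (rule noncompact_cell)
  show "home p \<in> Pmax S" using assms unbounded_wall wall_home by blast
  show "\<not> compactin (spc S) (home p)"
    using closed_noncompact_sub[OF seg_closed_connected(1)] unbounded_wall[OF assms] wall_home(2) by blast
qed

text \<open>The home cell has infinitely many points in common with the edge and hence contains it.\<close>

lemma uslab_home:
  assumes "j \<le> M"
  shows "home (uslab (nxt S j)) = \<sigma> j \<or> home (uslab (nxt S j)) = \<sigma> (nxt S j)"
proof (rule cells_at_uedge[OF assms])
  note s = unbounded_slab[OF nxt_le[of j]]
  note w = unbounded_wall(1)[OF s(1)]
  show h: "home (uslab (nxt S j)) \<in> Pmax S" by (rule wall_home(1)[OF w])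
  show "b (nxt S j) \<subseteq> home (uslab (nxt S j))"
    by (rule edge_sub_if_infinite[OF uedge_edges[OF nxt_le] h])
      (use infinite_super[OF _ unbounded_seg_infinite[OF s(1)]] s(2) wall_home(2)[OF w] in blast)
qed

text \<open>Closed subsets of compact cells are compact. So an unbounded wall lies in an unbounded edge if it is a
  slab, and its home is an unbounded maximal cell otherwise.\<close>

lemma unbounded_walls_split:
  "unbounded_walls S W = uslab ` {..M} \<union> (\<Union>i\<le>M. walls_between S W i)"
proof (intro equalityI subsetI)
  fix p assume p: "p \<in> unbounded_walls S W"
  show "p \<in> uslab ` {..M} \<union> (\<Union>i\<le>M. walls_between S W i)"
  proof (cases "slab S p")
    case True
    then obtain \<rho> where \<rho>: "\<rho> \<in> edges S" "seg p \<subseteq> \<rho>" unfolding slab_def by blast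
    have "\<not> compactin (spc S) \<rho>"
      using closed_noncompact_sub[OF seg_closed_connected(1) \<rho>(2)] unbounded_wall[OF p] by blast
    then obtain i where "i \<le> M" "\<rho> = b i" using noncompact_edge[OF \<rho>(1)] by blast
    then show ?thesis using unbounded_slab_eq[of i p] p \<rho> by blast
  next
    case False
    obtain j where "j \<le> M" "home p = \<sigma> j" using unbounded_home[OF p] by blast
    then have "p \<in> walls_between S W j" unfolding walls_between_def using p False by blast
    then show ?thesis using \<open>j \<le> M\<close> by blast
  qed
next
  fix p assume "p \<in> uslab ` {..M} \<union> (\<Union>i\<le>M. walls_between S W i)"
  then show "p \<in> unbounded_walls S W" using unbounded_slab unfolding walls_between_def by blast
qed

lemma finite_walls_between: "finite (walls_between S W i)"
  unfolding walls_between_def unbounded_walls_def using walls_finite by auto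

lemma prod_unbounded_walls:
  fixes F :: "'b wall \<Rightarrow> 'c::comm_monoid_mult"
  shows "(\<Prod>p\<in>unbounded_walls S W. F p) = (\<Prod>i\<le>M. F (uslab i)) * (\<Prod>i\<le>M. \<Prod>p\<in>walls_between S W i. F p)"
proof -
  have 1: "uslab ` {..M} \<inter> (\<Union>i\<le>M. walls_between S W i) = {}"
    using unbounded_slab_is_slab unfolding walls_between_def by auto
  have "(\<Prod>p\<in>unbounded_walls S W. F p) = (\<Prod>p\<in>uslab ` {..M}. F p) * (\<Prod>p\<in>(\<Union>i\<le>M. walls_between S W i). F p)"
    unfolding unbounded_walls_split by (intro prod.union_disjoint 1) (auto simp: finite_walls_between)
  also have "(\<Prod>p\<in>uslab ` {..M}. F p) = (\<Prod>i\<le>M. F (uslab i))"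
    by (subst prod.reindex) (auto simp: inj_on_def uslab_inj)
  also have "(\<Prod>p\<in>(\<Union>i\<le>M. walls_between S W i). F p) = (\<Prod>i\<le>M. \<Prod>p\<in>walls_between S W i. F p)"
    using ucell_inj by (intro prod.UNION_disjoint ballI finite_walls_between) (auto simp: walls_between_def)
  finally show ?thesis .
qed

end

section \<open>Functions of unbounded walls\<close>

definition coeff_eval :: "(zvec \<Rightarrow> complex) \<Rightarrow> laurent \<Rightarrow> complex" where
  "coeff_eval c g = (\<Sum>m\<in>Poly_Mapping.keys g. of_real (Poly_Mapping.lookup g m) * c m)"

lemma ser_eval_coeff: "ser_eval k c t F = (\<Sum>h\<le>k. coeff_eval c (fps_nth F h) * t ^ h)"
  unfolding ser_eval_def coeff_eval_def by (simp add: sum_distrib_right)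

lemma coeff_eval_superset:
  assumes "finite K" "Poly_Mapping.keys g \<subseteq> K"
  shows "coeff_eval c g = (\<Sum>m\<in>K. of_real (Poly_Mapping.lookup g m) * c m)"
  unfolding coeff_eval_def using assms
  by (intro sum.mono_neutral_left) (auto simp: in_keys_iff)

lemma coeff_eval_add: "coeff_eval c (f + g) = coeff_eval c f + coeff_eval c g"
proof -
  let ?K = "Poly_Mapping.keys f \<union> Poly_Mapping.keys g"
  have "Poly_Mapping.keys (f + g) \<subseteq> ?K" by (rule Poly_Mapping.keys_add)
  then show ?thesis
    by (simp add: coeff_eval_superset[of ?K] lookup_add algebra_simps sum.distrib)
qed

lemma coeff_eval_single: "coeff_eval c (Poly_Mapping.single m a) = of_real a * c m"
  unfolding coeff_eval_def by (cases "a = 0") auto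

lemma coeff_eval_sum: "finite A \<Longrightarrow> coeff_eval c (\<Sum>x\<in>A. f x) = (\<Sum>x\<in>A. coeff_eval c (f x))"
  by (induction A rule: finite_induct) (auto simp: coeff_eval_add, simp add: coeff_eval_def)

lemma coeff_eval_ser_map:
  "coeff_eval c (fps_nth (ser_map A F) h) = coeff_eval (\<lambda>m. c (A m)) (fps_nth F h)"
  unfolding ser_map_def by (simp add: coeff_eval_sum coeff_eval_single) (simp add: coeff_eval_def)

definition out_coeff :: "real poly \<Rightarrow> 'a::real_field \<Rightarrow> 'a" where
  "out_coeff p s = poly (map_poly of_real p) (inverse s)"

lemma out_eval_coeff: "out_eval k F s t = (\<Sum>h\<le>k. out_coeff (fps_nth F h) s * t ^ h)"
  unfolding out_eval_def out_coeff_def ..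

lemma out_coeff_add: "out_coeff (p + q) s = out_coeff p s + out_coeff q s"
proof -
  have "map_poly of_real (p + q) = map_poly of_real p + (map_poly of_real q :: 'a poly)"
    by (intro poly_eqI) (simp add: coeff_map_poly)
  then show ?thesis unfolding out_coeff_def by simp
qed

lemma out_coeff_0 [simp]: "out_coeff 0 s = 0"
  unfolding out_coeff_def by simp

lemma out_coeff_1 [simp]: "out_coeff 1 s = 1"
  unfolding out_coeff_def by (simp add: map_poly_1)

lemma out_coeff_sum: "finite A \<Longrightarrow> out_coeff (\<Sum>x\<in>A. f x) s = (\<Sum>x\<in>A. out_coeff (f x) s)"
  by (induction A rule: finite_induct) (auto simp: out_coeff_add)

lemma out_coeff_monom: "out_coeff (monom a n) s = of_real a * inverse s ^ n"
  unfolding out_coeff_def by (simp add: map_poly_monom poly_monom)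

lemma out_coeff_of_real: "out_coeff p (of_real s) = of_real (out_coeff p (s::real))"
proof -
  have "poly (map_poly of_real p) (of_real x) = (of_real (poly p x) :: 'a)" for x :: real
    by (induction p) (auto simp: map_poly_pCons)
  moreover have "map_poly of_real p = p" by (simp add: of_real_def map_poly_idI)
  ultimately show ?thesis unfolding out_coeff_def by (simp flip: of_real_inverse)
qed

lemma out_coeff_mult: "out_coeff (p * q) (s::real) = out_coeff p s * out_coeff q s"
proof -
  have "map_poly of_real p = (p :: real poly)" for p by (simp add: of_real_def map_poly_idI)
  then show ?thesis unfolding out_coeff_def by simp
qed

lemma out_eval_of_real: "out_eval k F (of_real s) (of_real t) = of_real (out_eval k F s (t::real))"
  unfolding out_eval_coeff by (simp add: out_coeff_of_real)

lemma out_eval_0: "out_eval k F s 0 = out_coeff (fps_nth F 0) s"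
  unfolding out_eval_coeff by (subst sum.atMost_shift) (simp add: power_0_left)

lemma out_eval_cutoff: "out_eval k (fps_cutoff (Suc k) F) s t = out_eval k F s t"
  unfolding out_eval_coeff by (intro sum.cong) auto

lemma continuous_out_eval [continuous_intros]:
  fixes f g :: "'b::topological_space \<Rightarrow> 'a::real_normed_field"
  assumes "continuous_on A f" "continuous_on A g" "\<And>x. x \<in> A \<Longrightarrow> f x \<noteq> 0"
  shows "continuous_on A (\<lambda>x. out_eval k F (f x) (g x))"
  unfolding out_eval_def using assms by (intro continuous_intros) auto

text \<open>The analytic counterpart of congruence modulo \<open>t\<^sup>k\<^sup>+\<^sup>1\<close>: divisibility is replaced by a bound that is uniform
  for \<open>s\<close> in a compact interval.\<close>

definition cong_mod :: "nat \<Rightarrow> real \<Rightarrow> real \<Rightarrow> real \<Rightarrow> (real \<Rightarrow> real \<Rightarrow> real) \<Rightarrow> (real \<Rightarrow> real \<Rightarrow> real) \<Rightarrow> bool" where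
  "cong_mod k a b \<delta> f g \<longleftrightarrow> (\<exists>C. \<forall>s\<in>{a..b}. \<forall>t\<in>{0..\<delta>}. \<bar>f s t - g s t\<bar> \<le> C * t ^ Suc k)"

definition bounded_fun :: "real \<Rightarrow> real \<Rightarrow> real \<Rightarrow> (real \<Rightarrow> real \<Rightarrow> real) \<Rightarrow> bool" where
  "bounded_fun a b \<delta> f \<longleftrightarrow> (\<exists>C. \<forall>s\<in>{a..b}. \<forall>t\<in>{0..\<delta>}. \<bar>f s t\<bar> \<le> C)"

lemma cong_mod_refl: "cong_mod k a b \<delta> f f"
  unfolding cong_mod_def by (intro exI[of _ 0]) auto

lemma cong_mod_sym: "cong_mod k a b \<delta> f g \<Longrightarrow> cong_mod k a b \<delta> g f"
  unfolding cong_mod_def by (simp add: abs_minus_commute)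

lemma cong_mod_trans:
  assumes "cong_mod k a b \<delta> f g" "cong_mod k a b \<delta> g h"
  shows "cong_mod k a b \<delta> f h"
proof -
  obtain C D where C: "\<And>s t. s \<in> {a..b} \<Longrightarrow> t \<in> {0..\<delta>} \<Longrightarrow> \<bar>f s t - g s t\<bar> \<le> C * t ^ Suc k"
    and D: "\<And>s t. s \<in> {a..b} \<Longrightarrow> t \<in> {0..\<delta>} \<Longrightarrow> \<bar>g s t - h s t\<bar> \<le> D * t ^ Suc k"
    using assms unfolding cong_mod_def by metis
  have "\<bar>f s t - h s t\<bar> \<le> (C + D) * t ^ Suc k" if "s \<in> {a..b}" "t \<in> {0..\<delta>}" for s t
    using C[OF that] D[OF that] unfolding distrib_right by linarith
  then show ?thesis unfolding cong_mod_def by blast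
qed

lemma bounded_fun_mult:
  assumes "bounded_fun a b \<delta> f" "bounded_fun a b \<delta> g"
  shows "bounded_fun a b \<delta> (\<lambda>s t. f s t * g s t)"
proof -
  obtain C D where "\<And>s t. s \<in> {a..b} \<Longrightarrow> t \<in> {0..\<delta>} \<Longrightarrow> \<bar>f s t\<bar> \<le> C"
    and "\<And>s t. s \<in> {a..b} \<Longrightarrow> t \<in> {0..\<delta>} \<Longrightarrow> \<bar>g s t\<bar> \<le> D"
    using assms unfolding bounded_fun_def by metis
  then have "\<bar>f s t * g s t\<bar> \<le> C * D" if "s \<in> {a..b}" "t \<in> {0..\<delta>}" for s t
    unfolding abs_mult using that by (intro mult_mono) (auto intro: order_trans[OF abs_ge_zero])
  then show ?thesis unfolding bounded_fun_def by blast
qed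

lemma cong_mod_mult:
  assumes fg: "cong_mod k a b \<delta> f g" and fg': "cong_mod k a b \<delta> f' g'"
    and bd: "bounded_fun a b \<delta> f'" "bounded_fun a b \<delta> g"
  shows "cong_mod k a b \<delta> (\<lambda>s t. f s t * f' s t) (\<lambda>s t. g s t * g' s t)"
proof -
  obtain C D where C: "\<And>s t. s \<in> {a..b} \<Longrightarrow> t \<in> {0..\<delta>} \<Longrightarrow> \<bar>f s t - g s t\<bar> \<le> C * t ^ Suc k"
    and D: "\<And>s t. s \<in> {a..b} \<Longrightarrow> t \<in> {0..\<delta>} \<Longrightarrow> \<bar>f' s t - g' s t\<bar> \<le> D * t ^ Suc k"
    using fg fg' unfolding cong_mod_def by metis
  obtain E F where E: "\<And>s t. s \<in> {a..b} \<Longrightarrow> t \<in> {0..\<delta>} \<Longrightarrow> \<bar>f' s t\<bar> \<le> E"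
    and F: "\<And>s t. s \<in> {a..b} \<Longrightarrow> t \<in> {0..\<delta>} \<Longrightarrow> \<bar>g s t\<bar> \<le> F"
    using bd unfolding bounded_fun_def by metis
  have "\<bar>f s t * f' s t - g s t * g' s t\<bar> \<le> (C * E + F * D) * t ^ Suc k" if st: "s \<in> {a..b}" "t \<in> {0..\<delta>}" for s t
  proof -
    have "f s t * f' s t - g s t * g' s t = (f s t - g s t) * f' s t + g s t * (f' s t - g' s t)"
      by (simp add: algebra_simps)
    also have "\<bar>\<dots>\<bar> \<le> \<bar>f s t - g s t\<bar> * \<bar>f' s t\<bar> + \<bar>g s t\<bar> * \<bar>f' s t - g' s t\<bar>"
      by (metis abs_triangle_ineq abs_mult)
    also have "\<dots> \<le> (C * t ^ Suc k) * E + F * (D * t ^ Suc k)"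
      using C[OF st] D[OF st] E[OF st] F[OF st]
      by (intro add_mono mult_mono) (auto intro: order_trans[OF abs_ge_zero])
    finally show ?thesis by (simp add: algebra_simps)
  qed
  then show ?thesis unfolding cong_mod_def by blast
qed

lemma bounded_fun_continuous:
  assumes "continuous_on ({a..b} \<times> {0..\<delta>}) (\<lambda>z. f (fst z) (snd z))"
  shows "bounded_fun a b \<delta> f"
proof -
  have "compact ((\<lambda>z. f (fst z) (snd z)) ` ({a..b} \<times> {0..\<delta>}))"
    using assms by (intro compact_continuous_image compact_Times) auto
  from compact_imp_bounded[OF this]
  obtain B where B: "\<forall>y\<in>(\<lambda>z. f (fst z) (snd z)) ` ({a..b} \<times> {0..\<delta>}). norm y \<le> B"
    unfolding bounded_iff by blast
  have "\<bar>f s t\<bar> \<le> B" if "s \<in> {a..b}" "t \<in> {0..\<delta>}" for s t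
    using bspec[OF B imageI[of "(s, t)"]] that by simp
  then show ?thesis unfolding bounded_fun_def by blast
qed

lemma bounded_fun_out_eval: "0 < a \<Longrightarrow> bounded_fun a b \<delta> (out_eval k F)"
  by (intro bounded_fun_continuous continuous_intros) auto

text \<open>The product of two truncations differs from the truncation of the product by terms with \<open>t\<close>-exponent
  larger than \<open>k\<close>, which are bounded multiples of \<open>t\<^sup>k\<^sup>+\<^sup>1\<close> for \<open>t \<le> 1\<close>.\<close>

lemma cong_mod_out_eval_mult:
  assumes "0 < a" "\<delta> \<le> 1"
  shows "cong_mod k a b \<delta> (out_eval k (F * G)) (\<lambda>s t. out_eval k F s t * out_eval k G s t)"
proof -
  let ?f = "\<lambda>i. out_coeff (fps_nth F i)" and ?g = "\<lambda>i. out_coeff (fps_nth G i)"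
  define I where "I = {(i, j). i \<le> k \<and> j \<le> k \<and> k < i + j}"
  have finI: "finite I" by (rule finite_subset[of _ "{..k} \<times> {..k}"]) (auto simp: I_def)
  have diff: "out_eval k F s t * out_eval k G s t - out_eval k (F * G) s t = (\<Sum>(i,j)\<in>I. ?f i s * ?g j s * t ^ (i + j))"
    for s t :: real
  proof -
    have "out_eval k F s t * out_eval k G s t = (\<Sum>(i,j)\<in>{..k} \<times> {..k}. ?f i s * ?g j s * t ^ (i + j))"
      unfolding out_eval_coeff by (simp add: sum_product sum.cartesian_product power_add mult_ac)
    also have "{..k} \<times> {..k} = {(i, j). i + j \<le> k} \<union> I" unfolding I_def by auto
    also have "(\<Sum>(i,j)\<in>\<dots>. ?f i s * ?g j s * t ^ (i + j)) =
        (\<Sum>(i,j)\<in>{(i, j). i + j \<le> k}. ?f i s * ?g j s * t ^ (i + j)) + (\<Sum>(i,j)\<in>I. ?f i s * ?g j s * t ^ (i + j))"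
      by (intro sum.union_disjoint finI finite_subset[of "{(i, j). i + j \<le> k}" "{..k} \<times> {..k}"]) (auto simp: I_def)
    also have "(\<Sum>(i,j)\<in>{(i, j). i + j \<le> k}. ?f i s * ?g j s * t ^ (i + j)) =
        (\<Sum>h\<le>k. \<Sum>i\<le>h. ?f i s * ?g (h - i) s * t ^ (i + (h - i)))"
      by (rule sum.triangle_reindex_eq)
    also have "\<dots> = out_eval k (F * G) s t"
      unfolding out_eval_coeff fps_mult_nth
      by (simp add: out_coeff_sum out_coeff_mult sum_distrib_right atLeast0AtMost)
    finally show ?thesis by simp
  qed
  have "bounded_fun a b \<delta> (\<lambda>s t. \<Sum>(i,j)\<in>I. \<bar>?f i s * ?g j s\<bar>)"
    unfolding out_coeff_def using assms
    by (intro bounded_fun_continuous) (auto simp: case_prod_unfold intro!: continuous_intros)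
  then obtain C where C: "\<And>s t. s \<in> {a..b} \<Longrightarrow> t \<in> {0..\<delta>} \<Longrightarrow> \<bar>\<Sum>(i,j)\<in>I. \<bar>?f i s * ?g j s\<bar>\<bar> \<le> C"
    unfolding bounded_fun_def by blast
  have "\<bar>out_eval k (F * G) s t - out_eval k F s t * out_eval k G s t\<bar> \<le> C * t ^ Suc k"
    if st: "s \<in> {a..b}" "t \<in> {0..\<delta>}" for s t
  proof -
    have t: "0 \<le> t" "t \<le> 1" using st assms by auto
    have "\<bar>out_eval k (F * G) s t - out_eval k F s t * out_eval k G s t\<bar> = \<bar>\<Sum>(i,j)\<in>I. ?f i s * ?g j s * t ^ (i + j)\<bar>"
      by (simp flip: diff)
    also have "\<dots> \<le> (\<Sum>(i,j)\<in>I. \<bar>?f i s * ?g j s * t ^ (i + j)\<bar>)"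
      by (rule order_trans[OF sum_abs]) (simp add: case_prod_unfold)
    also have "\<dots> \<le> (\<Sum>(i,j)\<in>I. \<bar>?f i s * ?g j s\<bar> * t ^ Suc k)"
    proof (rule sum_mono, clarify)
      fix i j assume "(i, j) \<in> I"
      then have "t ^ (i + j) \<le> t ^ Suc k" using t unfolding I_def by (intro power_decreasing) auto
      then show "\<bar>?f i s * ?g j s * t ^ (i + j)\<bar> \<le> \<bar>?f i s * ?g j s\<bar> * t ^ Suc k"
        using t by (simp add: abs_mult mult_left_mono)
    qed
    also have "\<dots> = (\<Sum>(i,j)\<in>I. \<bar>?f i s * ?g j s\<bar>) * t ^ Suc k"
      by (simp add: sum_distrib_right case_prod_unfold)
    also have "\<dots> \<le> C * t ^ Suc k"
      using C[OF st] t by (intro mult_right_mono) auto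
    finally show ?thesis .
  qed
  then show ?thesis unfolding cong_mod_def by blast
qed

lemma bounded_fun_prod:
  assumes "finite A" "\<And>x. x \<in> A \<Longrightarrow> bounded_fun a b \<delta> (f x)"
  shows "bounded_fun a b \<delta> (\<lambda>s t. \<Prod>x\<in>A. f x s t)"
  using assms
proof (induction A rule: finite_induct)
  case empty then show ?case unfolding bounded_fun_def by (intro exI[of _ 1]) auto
next
  case (insert x A) then show ?case by (simp add: bounded_fun_mult)
qed

lemma cong_mod_prod:
  assumes "finite A" "\<And>x. x \<in> A \<Longrightarrow> cong_mod k a b \<delta> (f x) (g x)"
    "\<And>x. x \<in> A \<Longrightarrow> bounded_fun a b \<delta> (f x)" "\<And>x. x \<in> A \<Longrightarrow> bounded_fun a b \<delta> (g x)"
  shows "cong_mod k a b \<delta> (\<lambda>s t. \<Prod>x\<in>A. f x s t) (\<lambda>s t. \<Prod>x\<in>A. g x s t)"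
  using assms
proof (induction A rule: finite_induct)
  case empty then show ?case by (simp add: cong_mod_refl)
next
  case (insert x A) then show ?case by (simp add: cong_mod_mult bounded_fun_prod)
qed

lemma cong_mod_out_eval_prod:
  assumes "finite A" "0 < a" "\<delta> \<le> 1"
  shows "cong_mod k a b \<delta> (out_eval k (\<Prod>x\<in>A. F x)) (\<lambda>s t. \<Prod>x\<in>A. out_eval k (F x) s t)"
  using assms(1)
proof (induction A rule: finite_induct)
  case empty
  have "out_eval k 1 s t = 1" for s t :: real
    unfolding out_eval_coeff by (subst sum.atMost_shift) auto
  then show ?case by (simp add: cong_mod_refl)
next
  case (insert x A)
  have "cong_mod k a b \<delta> (\<lambda>s t. out_eval k (F x) s t * out_eval k (prod F A) s t)
     (\<lambda>s t. out_eval k (F x) s t * (\<Prod>x\<in>A. out_eval k (F x) s t))"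
    using insert assms by (intro cong_mod_mult cong_mod_refl bounded_fun_out_eval) auto
  then show ?case
    using cong_mod_trans[OF cong_mod_out_eval_mult[OF assms(2,3)]] insert by simp
qed

context affine_end begin

lemma zcoord_zscale: "v \<noteq> 0 \<Longrightarrow> zcoord v (zscale j v) = j"
  unfolding zcoord_def
  by (rule the_equality) (auto simp: zscale_def zero_prod_def prod_eq_iff)

lemma zscale_additive:
  assumes "\<And>x y. A (x + y) = A x + A (y :: zvec)"
  shows "A (zscale j v) = zscale j (A v)"
proof -
  have A0: "A 0 = 0" using assms[of 0 0] by simp
  have Am: "A (- x) = - A x" for x
    using assms[of x "- x"] A0 by (simp add: eq_neg_iff_add_eq_0 add.commute)
  have nat: "A (zscale (int n) v) = zscale (int n) (A v)" for n
  proof (induction n)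
    case 0 then show ?case using A0 by (simp add: zscale_def zero_prod_def)
  next
    case (Suc n)
    have *: "zscale (int (Suc n)) v = zscale (int n) v + v" for v
      by (simp add: zscale_def prod_eq_iff algebra_simps)
    show ?case unfolding * assms Suc ..
  qed
  show ?thesis
  proof (cases "j \<ge> 0")
    case True then show ?thesis using nat[of "nat j"] by simp
  next
    case False
    have "zscale j v = - zscale (int (nat (- j))) v" for v using False by (simp add: zscale_def prod_eq_iff)
    then show ?thesis using nat[of "nat (-j)"] Am by simp
  qed
qed

lemma outgoing_key:
  assumes "p \<in> unbounded_walls S W" "j \<le> M" "home p = \<sigma> j" "m \<in> Poly_Mapping.keys (fps_nth (wfun p) h)"
  obtains n where "m = zscale (- int n) (d j)"
  using outg assms wdir_ucell unfolding outgoing_def by metis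

text \<open>The exponents are the multiples \<open>- n d j\<close>, and in another chart, related by the linear map \<open>A\<close>, they are
  \<open>- n v\<close>. Hence either chart gives the same polynomial in \<open>w\<^sup>-\<^sup>1\<close>.\<close>

lemma out_coeff_out_fun:
  fixes z :: complex
  assumes p: "p \<in> unbounded_walls S W" "j \<le> M" "home p = \<sigma> j" and v: "v \<noteq> 0" and A: "A = id \<or> (\<forall>x y. A (x + y) = A x + A y)" "A (d j) = v"
  shows "out_coeff (fps_nth (out_fun S p) h) z = coeff_eval (\<lambda>m. z powi zcoord v (A m)) (fps_nth (wfun p) h)"
proof -
  have "out_coeff (fps_nth (out_fun S p) h) z = (\<Sum>m\<in>Poly_Mapping.keys (fps_nth (wfun p) h).
      of_real (Poly_Mapping.lookup (fps_nth (wfun p) h) m) * inverse z ^ nat (- zcoord (d j) m))"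
    unfolding out_fun_def using p wdir_ucell by (simp add: out_coeff_sum out_coeff_monom)
  also have "\<dots> = coeff_eval (\<lambda>m. z powi zcoord v (A m)) (fps_nth (wfun p) h)"
    unfolding coeff_eval_def
  proof (rule sum.cong[OF refl])
    fix m assume "m \<in> Poly_Mapping.keys (fps_nth (wfun p) h)"
    then obtain n where n: "m = zscale (- int n) (d j)" using outgoing_key[OF p] by blast
    have "A m = zscale (- int n) v" unfolding n A(2)[symmetric]
      using A(1) zscale_additive[of A] by (metis id_apply)
    then have "zcoord v (A m) = - int n" using zcoord_zscale[OF v] by simp
    moreover have "zcoord (d j) m = - int n" using n zcoord_zscale d_nonzero(1)[OF p(2)] by simp
    ultimately show "of_real (Poly_Mapping.lookup (fps_nth (wfun p) h) m) * inverse z ^ nat (- zcoord (d j) m) =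
       of_real (Poly_Mapping.lookup (fps_nth (wfun p) h) m) * z powi zcoord v (A m)"
      by (simp add: power_int_minus power_inverse)
  qed
  finally show ?thesis .
qed

text \<open>The slab may have either of the two adjacent cells as its home, while the chart \<open>U\<^sub>i\<close> uses \<open>\<sigma> i\<close>. The
  directions \<open>d\<close> of the two cells correspond under the change of charts.\<close>

lemma ser_eval_unbounded_slab:
  assumes i: "i \<le> M"
  shows "ser_eval k (\<lambda>m. z powi zcoord (d i) m) t (wfun_in S (uslab i) (\<sigma> i)) = out_eval k (out_fun S (uslab i)) z t"
proof -
  note p = unbounded_slab(1)[OF i]
  obtain j where j: "j \<le> M" "i = nxt S j" using nxt_cases[OF i] by blast
  show ?thesis
  proof (cases "home (uslab i) = \<sigma> i")
    case True
    then show ?thesis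
      unfolding ser_eval_coeff out_eval_coeff wfun_in_def
      by (simp add: out_coeff_out_fun[OF p i True d_nonzero(1)[OF i], of id])
  next
    case False
    then have home: "home (uslab i) = \<sigma> j" using uslab_home[OF j(1)] j by auto
    have bs: "b i \<subseteq> \<sigma> j" "b i \<subseteq> \<sigma> i" using uedge_sub i j by auto
    have ne: "\<sigma> j \<noteq> \<sigma> i" using False home by simp
    let ?A = "glin S (\<sigma> j) (b i) (\<sigma> i)"
    have add: "\<forall>x y. ?A (x + y) = ?A x + ?A y"
      using glin_facts(2)[OF uedge_edges[OF i] ucell_Pmax[OF j(1)] ucell_Pmax[OF i] bs ne] unfolding SL2Z_def by blast
    have A: "?A (d j) = d i" using glin_nxt[OF j(1)] j(2) by simp
    have "wfun_in S (uslab i) (\<sigma> i) = ser_map ?A (wfun (uslab i))"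
      unfolding wfun_in_def using False home slab_edge_uslab[OF i] by simp
    then show ?thesis
      unfolding ser_eval_coeff out_eval_coeff
      by (simp add: coeff_eval_ser_map out_coeff_out_fun[OF p j(1) home d_nonzero(1)[OF i] disjI2[OF add] A])
  qed
qed

text \<open>Walls that are not slabs have functions congruent to \<open>1\<close> modulo \<open>t\<close>.\<close>

lemma out_eval_between_0:
  assumes "p \<in> walls_between S W i" "i \<le> M"
  shows "out_eval k (out_fun S p) (s::'c::real_field) 0 = 1"
proof -
  have p: "p \<in> unbounded_walls S W" "\<not> slab S p" "home p = \<sigma> i" using assms unfolding walls_between_def by auto
  have "fps_nth (wfun p) 0 = 1" using wall_one unbounded_wall p by blast
  moreover have "zcoord (d i) 0 = 0" using zcoord_zscale[of "d i" 0] d_nonzero assms by (simp add: zscale_def zero_prod_def)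
  ultimately have "fps_nth (out_fun S p) 0 = 1"
    unfolding out_fun_def using p wdir_ucell[OF assms(2)] by (simp add: monom_0 one_pCons)
  then show ?thesis by (simp add: out_eval_0)
qed

end

section \<open>Holomorphic functions of several variables\<close>

lemma has_derivative_vec_lambda:
  fixes F :: "'a::real_normed_vector \<Rightarrow> complex ^ 'm::finite"
  assumes "\<And>i. ((\<lambda>z. F z $ i) has_derivative D i) (at x within S)"
  shows "(F has_derivative (\<lambda>y. \<chi> i. D i y)) (at x within S)"
proof (subst has_derivative_componentwise_within, rule ballI)
  fix e :: "complex ^ 'm" assume "e \<in> Basis"
  then obtain j b where e: "e = axis j b" unfolding Basis_vec_def by blast
  show "((\<lambda>z. F z \<bullet> e) has_derivative (\<lambda>y. (\<chi> i. D i y) \<bullet> e)) (at x within S)"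
    using has_derivative_inner_left[OF assms[of j], of b] unfolding e inner_axis by simp
qed

lemma holomorphic_several_open: "holomorphic_several F D \<Longrightarrow> open D"
  unfolding holomorphic_several_def by blast

lemma holomorphic_severalE:
  assumes "holomorphic_several F D" "z \<in> D"
  obtains F' where "(F has_derivative F') (at z)" "\<And>c y. F' (c *s y) = c * F' y"
  using assms unfolding holomorphic_several_def by blast

text \<open>The derivative of the composition is complex linear because both derivatives are.\<close>

lemma holomorphic_several_compose:
  fixes F :: "complex ^ 'm::finite \<Rightarrow> complex ^ 'n::finite"
  assumes H: "holomorphic_several H N" and F: "\<And>i. holomorphic_several (\<lambda>z. F z $ i) P"
  shows "holomorphic_several (\<lambda>z. H (F z)) {z \<in> P. F z \<in> N}"
proof -
  have der: "\<exists>F'. (F has_derivative F') (at z) \<and> (\<forall>c y. F' (c *s y) = c *s F' y)" if "z \<in> P" for z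
  proof -
    have "\<exists>D. ((\<lambda>z. F z $ i) has_derivative D) (at z) \<and> (\<forall>c y. D (c *s y) = c * D y)" for i
      using F[of i] that unfolding holomorphic_several_def by blast
    then obtain D where D: "\<And>i. ((\<lambda>z. F z $ i) has_derivative D i) (at z)" "\<And>i c y. D i (c *s y) = c * D i y"
      by metis
    show ?thesis
      by (rule exI[of _ "\<lambda>y. \<chi> i. D i y"]) (auto intro: has_derivative_vec_lambda[OF D(1)] simp: D(2) vec_eq_iff)
  qed
  have "open P" "open N" using F H holomorphic_several_open by blast+
  moreover have "continuous_on P F"
    using der by (intro continuous_at_imp_continuous_on ballI) (metis has_derivative_continuous)
  ultimately have "open (P \<inter> F -` N)" by (intro continuous_open_preimage)
  moreover have "P \<inter> F -` N = {z \<in> P. F z \<in> N}" by auto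
  ultimately have "open {z \<in> P. F z \<in> N}" by simp
  then show ?thesis
    unfolding holomorphic_several_def
  proof (intro conjI ballI)
    fix z assume z: "z \<in> {z \<in> P. F z \<in> N}"
    then obtain F' where F': "(F has_derivative F') (at z)" "\<And>c y. F' (c *s y) = c *s F' y" using der by blast
    obtain H' where H': "(H has_derivative H') (at (F z))" "\<And>c y. H' (c *s y) = c * H' y"
      using holomorphic_severalE[OF H, of "F z"] z by blast
    show "\<exists>G'. ((\<lambda>z. H (F z)) has_derivative G') (at z) \<and> (\<forall>c y. G' (c *s y) = c * G' y)"
      using has_derivative_compose[OF F'(1) H'(1)] by (intro exI[of _ "\<lambda>y. H' (F' y)"]) (auto simp: F'(2) H'(2))
  qed
qed

lemma holomorphic_several_subset: "holomorphic_several F D \<Longrightarrow> open D' \<Longrightarrow> D' \<subseteq> D \<Longrightarrow> holomorphic_several F D'"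
  unfolding holomorphic_several_def by blast

lemma holomorphic_several_const: "open D \<Longrightarrow> holomorphic_several (\<lambda>_. c) D"
  unfolding holomorphic_several_def by (auto intro!: exI[of _ "\<lambda>_. 0"])

lemma holomorphic_several_nth: "open D \<Longrightarrow> holomorphic_several (\<lambda>z. z $ i) D"
  unfolding holomorphic_several_def
  by (auto intro!: exI[of _ "\<lambda>z. z $ i"] bounded_linear_imp_has_derivative bounded_linear_vec_nth)

lemma holomorphic_several_add:
  assumes "holomorphic_several F D" "holomorphic_several G D"
  shows "holomorphic_several (\<lambda>z. F z + G z) D"
  unfolding holomorphic_several_def
proof (intro conjI ballI)
  show "open D" by (rule holomorphic_several_open[OF assms(1)])
  fix z assume z: "z \<in> D"
  obtain F' where F': "(F has_derivative F') (at z)" "\<And>c y. F' (c *s y) = c * F' y" using holomorphic_severalE[OF assms(1) z] by blast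
  obtain G' where G': "(G has_derivative G') (at z)" "\<And>c y. G' (c *s y) = c * G' y" using holomorphic_severalE[OF assms(2) z] by blast
  show "\<exists>K. ((\<lambda>z. F z + G z) has_derivative K) (at z) \<and> (\<forall>c y. K (c *s y) = c * K y)"
    using has_derivative_add[OF F'(1) G'(1)] by (intro exI[of _ "\<lambda>y. F' y + G' y"]) (auto simp: F'(2) G'(2) algebra_simps)
qed

lemma holomorphic_several_mult:
  assumes "holomorphic_several F D" "holomorphic_several G D"
  shows "holomorphic_several (\<lambda>z. F z * G z) D"
  unfolding holomorphic_several_def
proof (intro conjI ballI)
  show "open D" by (rule holomorphic_several_open[OF assms(1)])
  fix z assume z: "z \<in> D"
  obtain F' where F': "(F has_derivative F') (at z)" "\<And>c y. F' (c *s y) = c * F' y" using holomorphic_severalE[OF assms(1) z] by blast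
  obtain G' where G': "(G has_derivative G') (at z)" "\<And>c y. G' (c *s y) = c * G' y" using holomorphic_severalE[OF assms(2) z] by blast
  show "\<exists>K. ((\<lambda>z. F z * G z) has_derivative K) (at z) \<and> (\<forall>c y. K (c *s y) = c * K y)"
    using has_derivative_mult[OF F'(1) G'(1)]
    by (intro exI[of _ "\<lambda>y. F z * G' y + F' y * G z"]) (auto simp: F'(2) G'(2) algebra_simps)
qed

lemma holomorphic_several_inverse:
  assumes "holomorphic_several F D" "\<And>z. z \<in> D \<Longrightarrow> F z \<noteq> 0"
  shows "holomorphic_several (\<lambda>z. inverse (F z)) D"
  unfolding holomorphic_several_def
proof (intro conjI ballI)
  show "open D" by (rule holomorphic_several_open[OF assms(1)])
  fix z assume z: "z \<in> D"
  obtain F' where F': "(F has_derivative F') (at z)" "\<And>c y. F' (c *s y) = c * F' y" using holomorphic_severalE[OF assms(1) z] by blast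
  have "((\<lambda>z. inverse (F z)) has_derivative (\<lambda>y. - (inverse (F z) * F' y * inverse (F z)))) (at z)"
    by (rule Deriv.has_derivative_inverse[OF assms(2)[OF z] F'(1)])
  then show "\<exists>K. ((\<lambda>z. inverse (F z)) has_derivative K) (at z) \<and> (\<forall>c y. K (c *s y) = c * K y)"
    by (intro exI[of _ "\<lambda>y. - (inverse (F z) * F' y * inverse (F z))"]) (simp add: F'(2))
qed

lemma holomorphic_several_power: "holomorphic_several F D \<Longrightarrow> holomorphic_several (\<lambda>z. F z ^ n) D"
  by (induction n) (auto intro: holomorphic_several_const holomorphic_several_mult holomorphic_several_open)

lemma holomorphic_several_sum:
  assumes "finite I" "open D" "\<And>i. i \<in> I \<Longrightarrow> holomorphic_several (F i) D"
  shows "holomorphic_several (\<lambda>z. \<Sum>i\<in>I. F i z) D"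
  using assms(1,3)
  by (induction I rule: finite_induct) (auto intro: holomorphic_several_const[OF assms(2)] holomorphic_several_add)

lemma holomorphic_several_poly: "holomorphic_several F D \<Longrightarrow> holomorphic_several (\<lambda>z. poly p (F z)) D"
  unfolding poly_altdef
  by (intro holomorphic_several_sum holomorphic_several_mult holomorphic_several_const holomorphic_several_power)
    (auto dest: holomorphic_several_open)

lemma holomorphic_several_out_eval:
  assumes "holomorphic_several F D" "holomorphic_several G D" "\<And>z. z \<in> D \<Longrightarrow> F z \<noteq> 0"
  shows "holomorphic_several (\<lambda>z. out_eval k f (F z) (G z)) D"
  unfolding out_eval_def
  by (intro holomorphic_several_sum holomorphic_several_mult holomorphic_several_poly holomorphic_several_inverse
      holomorphic_several_power assms holomorphic_several_open[OF assms(1)]) auto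

section \<open>Integration of the logarithmic area form\<close>

text \<open>Change of variables is applied on \<open>real ^ 2\<close>, whereas the coordinates \<open>(w, u\<^sub>i)\<close> take values in pairs. The
  following identification preserves boxes and their areas, hence integrals.\<close>

definition vec_pair :: "real ^ 2 \<Rightarrow> real \<times> real" where "vec_pair x = (x $ 1, x $ 2)"
definition pair_vec :: "real \<times> real \<Rightarrow> real ^ 2" where "pair_vec z = vector [fst z, snd z]"

lemma vec_pair_inverse [simp]: "vec_pair (pair_vec z) = z" "pair_vec (vec_pair x) = x"
  unfolding vec_pair_def pair_vec_def by (auto simp: vec_eq_iff forall_2)

lemma norm_vec_pair [simp]: "norm (vec_pair x) = norm x" "norm (pair_vec z) = norm z"
proof -
  show *: "norm (vec_pair x) = norm x" for x
    unfolding vec_pair_def norm_Pair norm_vec_def L2_set_def by (simp add: sum_2)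
  show "norm (pair_vec z) = norm z" using *[of "pair_vec z"] by simp
qed

lemma linear_vec_pair: "linear vec_pair" "linear pair_vec"
  unfolding vec_pair_def pair_vec_def by (auto intro!: linearI simp: vec_eq_iff forall_2)

lemma bounded_linear_vec_pair: "bounded_linear vec_pair" "bounded_linear pair_vec"
  using linear_vec_pair by (simp_all add: linear_conv_bounded_linear)

lemma vec_pair_image: "vec_pair ` S = {z. pair_vec z \<in> S}" "pair_vec ` S' = {x. vec_pair x \<in> S'}"
  by (auto simp: image_iff) (metis vec_pair_inverse)+

lemma vec_pair_cbox: "vec_pair ` cbox u v = cbox (vec_pair u) (vec_pair v)"
  "pair_vec ` cbox p q = cbox (pair_vec p) (pair_vec q)"
proof -
  show *: "vec_pair ` cbox u v = cbox (vec_pair u) (vec_pair v)" for u v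
    unfolding vec_pair_image by (auto simp: vec_pair_def pair_vec_def mem_box_cart forall_2 cbox_Pair_eq)
  show "pair_vec ` cbox p q = cbox (pair_vec p) (pair_vec q)"
    using *[of "pair_vec p" "pair_vec q"] by (metis (no_types, lifting) image_image image_cong image_ident vec_pair_inverse)
qed

lemma vec_pair_box_image: "\<exists>w z. vec_pair ` cbox u v = cbox w z" "\<exists>w z. pair_vec ` cbox p q = cbox w z"
  by (rule exI, rule exI, rule vec_pair_cbox)+

lemma content_vec_pair: "measure lborel (vec_pair ` cbox u v) = measure lborel (cbox u v)"
proof -
  have "measure lborel (vec_pair ` cbox u v) = measure lborel (cbox (u $ 1) (v $ 1)) * measure lborel (cbox (u $ 2) (v $ 2))"
    unfolding vec_pair_cbox by (simp add: vec_pair_def content_Pair)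
  also have "\<dots> = measure lborel (cbox u v)"
  proof -
    have "cbox u v = {} \<longleftrightarrow> v $ 1 < u $ 1 \<or> v $ 2 < u $ 2"
      unfolding interval_eq_empty_cart using forall_2[of "\<lambda>i. \<not> v $ i < u $ i"] by blast
    then show ?thesis by (auto simp: content_cbox_if_cart UNIV_2)
  qed
  finally show ?thesis .
qed

lemma vec_pair_ball: "ball 0 B \<subseteq> cbox u v \<longleftrightarrow> ball 0 B \<subseteq> cbox (vec_pair u) (vec_pair v)"
proof -
  have "ball 0 B \<subseteq> cbox u v \<longleftrightarrow> vec_pair ` ball 0 B \<subseteq> vec_pair ` cbox u v"
    by (metis (no_types, lifting) image_mono inj_image_subset_iff inj_on_inverseI vec_pair_inverse(2))
  also have "vec_pair ` ball 0 B = ball 0 B" unfolding vec_pair_image by auto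
  finally show ?thesis unfolding vec_pair_cbox .
qed

lemma has_integral_vec_pair:
  fixes f :: "real \<times> real \<Rightarrow> real"
  shows "((\<lambda>x. f (vec_pair x)) has_integral i) (pair_vec ` S) \<longleftrightarrow> (f has_integral i) S"
proof -
  let ?r = "\<lambda>z. if z \<in> S then f z else 0"
  have restr: "(if x \<in> pair_vec ` S then f (vec_pair x) else 0) = ?r (vec_pair x)" for x
    unfolding vec_pair_image by simp
  have cont: "continuous (at x) vec_pair" "continuous (at z) pair_vec" for x z
    using bounded_linear_vec_pair by (auto intro: linear_continuous_at)
  have box: "((\<lambda>x. ?r (vec_pair x)) has_integral z) (cbox u v) \<longleftrightarrow> (?r has_integral z) (cbox (vec_pair u) (vec_pair v))"
    for z u v
  proof
    assume "(?r has_integral z) (cbox (vec_pair u) (vec_pair v))"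
    then have "((\<lambda>x. ?r (vec_pair x)) has_integral (1 / 1) *\<^sub>R z) (pair_vec ` cbox (vec_pair u) (vec_pair v))"
    proof (intro has_integral_twiddle cont)
      show "\<exists>w z. vec_pair ` cbox u v = cbox w z" for u v by (rule vec_pair_box_image)
      show "\<exists>w z. pair_vec ` cbox p q = cbox w z" for p q by (rule vec_pair_box_image)
    qed (auto simp: content_vec_pair)
    then show "((\<lambda>x. ?r (vec_pair x)) has_integral z) (cbox u v)" by (simp add: vec_pair_cbox)
  next
    assume *: "((\<lambda>x. ?r (vec_pair x)) has_integral z) (cbox u v)"
    have "((\<lambda>y. ?r (vec_pair (pair_vec y))) has_integral (1 / 1) *\<^sub>R z) (vec_pair ` cbox u v)"
    proof (rule has_integral_twiddle[OF _ _ _ _ _ _ _ *])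
      show "measure lborel (pair_vec ` cbox p q) = 1 * measure lborel (cbox p q)" for p q
        using content_vec_pair[of "pair_vec p" "pair_vec q"] by (simp add: vec_pair_cbox)
      show "\<exists>w z. vec_pair ` cbox u v = cbox w z" for u v by (rule vec_pair_box_image)
      show "\<exists>w z. pair_vec ` cbox p q = cbox w z" for p q by (rule vec_pair_box_image)
    qed (auto simp: cont)
    then show "(?r has_integral z) (cbox (vec_pair u) (vec_pair v))" unfolding vec_pair_cbox vec_pair_inverse by simp
  qed
  have all: "(\<forall>p q. P p q) \<longleftrightarrow> (\<forall>u v. P (vec_pair u) (vec_pair v))" for P
  proof (intro iffI allI)
    fix p q assume "\<forall>u v. P (vec_pair u) (vec_pair v)"
    then have "P (vec_pair (pair_vec p)) (vec_pair (pair_vec q))" by blast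
    then show "P p q" by simp
  next
    fix u v assume *: "\<forall>p q. P p q"
    show "P (vec_pair u) (vec_pair v)" by (rule *[THEN spec, THEN spec])
  qed
  have restrf: "(\<lambda>x. if x \<in> pair_vec ` S then f (vec_pair x) else 0) = (\<lambda>x. ?r (vec_pair x))"
    by (rule ext) (rule restr)
  have eq: "(\<forall>u v. ball 0 B \<subseteq> cbox u v \<longrightarrow>
        (\<exists>z. ((\<lambda>x. ?r (vec_pair x)) has_integral z) (cbox u v) \<and> norm (z - i) < e)) \<longleftrightarrow>
      (\<forall>p q. ball 0 B \<subseteq> cbox p q \<longrightarrow> (\<exists>z. (?r has_integral z) (cbox p q) \<and> norm (z - i) < e))" for B e
    unfolding box vec_pair_ball by (rule all[symmetric])
  have "((\<lambda>x. f (vec_pair x)) has_integral i) (pair_vec ` S) \<longleftrightarrow>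
     (\<forall>e>0. \<exists>B>0. \<forall>u v. ball 0 B \<subseteq> cbox u v \<longrightarrow>
        (\<exists>z. ((\<lambda>x. ?r (vec_pair x)) has_integral z) (cbox u v) \<and> norm (z - i) < e))"
    using has_integral'[of "\<lambda>x. f (vec_pair x)" i "pair_vec ` S"] unfolding restrf .
  also have "\<dots> \<longleftrightarrow> (\<forall>e>0. \<exists>B>0. \<forall>p q. ball 0 B \<subseteq> cbox p q \<longrightarrow>
        (\<exists>z. (?r has_integral z) (cbox p q) \<and> norm (z - i) < e))"
    unfolding eq ..
  also have "\<dots> \<longleftrightarrow> (f has_integral i) S" by (rule has_integral'[symmetric])
  finally show ?thesis .
qed

text \<open>The density of \<open>d log s \<and> d log u\<close>.\<close>

definition log_density :: "real \<times> real \<Rightarrow> real" where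
  "log_density z = 1 / (fst z * snd z)"

text \<open>The Jacobian determinant of \<open>T\<close> at \<open>z\<close> is the quotient of the second coordinates of \<open>T z\<close> and \<open>z\<close>. As the
  first coordinates agree, this is also the quotient of the densities at \<open>z\<close> and \<open>T z\<close>.\<close>

lemma transition_has_integral:
  fixes T :: "real \<times> real \<Rightarrow> real \<times> real"
  assumes A: "A \<in> sets lebesgue" and pos: "\<And>z. z \<in> A \<Longrightarrow> fst z > 0 \<and> snd z > 0" and inj: "inj_on T A"
    and der: "\<And>z. z \<in> A \<Longrightarrow>
      (T has_derivative (\<lambda>v. (fst v, \<alpha> z * fst v + snd (T z) / snd z * snd v))) (at z within A)"
    and T: "\<And>z. z \<in> A \<Longrightarrow> fst (T z) = fst z \<and> snd (T z) > 0"
    and I: "(log_density has_integral I) A"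
  shows "(log_density has_integral I) (T ` A)"
proof -
  define g where "g x = pair_vec (T (vec_pair x))" for x
  define g' where "g' x v = pair_vec ((\<lambda>v. (fst v, \<alpha> (vec_pair x) * fst v + snd (T (vec_pair x)) / snd (vec_pair x) * snd v))
     (vec_pair v))" for x v
  define f :: "real ^ 2 \<Rightarrow> real ^ 1" where "f x = vec (log_density (vec_pair x))" for x
  let ?S = "pair_vec ` A"
  have S: "?S \<in> sets lebesgue"
    using A linear_imp_differentiable_on[OF linear_vec_pair(2)] by (intro differentiable_image_in_sets_lebesgue) auto
  have der': "(g has_derivative g' x) (at x within ?S)" if "x \<in> ?S" for x
  proof -
    have v: "vec_pair x \<in> A" "vec_pair ` ?S = A" using that by (auto simp: image_image)
    have 1: "(vec_pair has_derivative vec_pair) (at x within ?S)"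
      using bounded_linear_vec_pair(1) by (rule bounded_linear_imp_has_derivative)
    have 2: "(pair_vec has_derivative pair_vec) (at (T (vec_pair x)))"
      using bounded_linear_vec_pair(2) by (rule bounded_linear_imp_has_derivative)
    have "((\<lambda>x. T (vec_pair x)) has_derivative (\<lambda>v. (\<lambda>v. (fst v, \<alpha> (vec_pair x) * fst v + snd (T (vec_pair x)) / snd (vec_pair x) * snd v))
     (vec_pair v))) (at x within ?S)"
      using has_derivative_in_compose[OF 1, of T] der[OF v(1)] unfolding v(2) by blast
    from has_derivative_compose[OF this 2] show ?thesis unfolding g_def g'_def .
  qed
  have inj': "inj_on g ?S"
  proof (rule inj_onI)
    fix x y assume "x \<in> ?S" "y \<in> ?S" "g x = g y"
    then show "x = y" unfolding g_def using inj
      by (metis (no_types, lifting) imageE inj_on_contraD vec_pair_inverse)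
  qed
  have gS: "g ` ?S = pair_vec ` (T ` A)" unfolding g_def by (auto simp: image_image)
  have jac: "\<bar>det (matrix (g' x))\<bar> *\<^sub>R f (g x) = f x" if x: "x \<in> ?S" for x
  proof -
    have v: "vec_pair x \<in> A" using x by auto
    have "det (matrix (g' x)) = snd (T (vec_pair x)) / snd (vec_pair x)"
      unfolding det_2 matrix_def g'_def by (simp add: pair_vec_def vec_pair_def axis_def)
    moreover have "snd (T (vec_pair x)) / snd (vec_pair x) > 0" using T[OF v] pos[OF v] by simp
    moreover have "snd (T (vec_pair x)) / snd (vec_pair x) * log_density (T (vec_pair x)) = log_density (vec_pair x)"
      using T[OF v] pos[OF v] unfolding log_density_def by (simp add: field_simps)
    ultimately have "\<bar>det (matrix (g' x))\<bar> * log_density (T (vec_pair x)) = log_density (vec_pair x)"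
      by (simp only: abs_of_pos)
    then show ?thesis unfolding f_def g_def by (simp add: vec_eq_iff)
  qed
  have "(\<lambda>x. f x $ 1) absolutely_integrable_on ?S \<and> integral ?S (\<lambda>x. f x $ 1) = I"
  proof -
    have "((\<lambda>x. f x $ 1) has_integral I) ?S" unfolding f_def using I has_integral_vec_pair by simp
    moreover have "f x $ 1 \<ge> 0" if "x \<in> ?S" for x
      using that pos unfolding f_def log_density_def by (auto simp: less_imp_le)
    ultimately show ?thesis
      by (simp add: absolutely_integrable_on_iff_nonneg has_integral_iff)
  qed
  then have "f absolutely_integrable_on ?S \<and> integral ?S f = vec I"
    by (simp add: absolutely_integrable_on_1_iff integral_on_1_eq)
  moreover have "f absolutely_integrable_on ?S \<longleftrightarrow> (\<lambda>x. \<bar>det (matrix (g' x))\<bar> *\<^sub>R f (g x)) absolutely_integrable_on ?S"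
    by (rule absolutely_integrable_spike_eq[of "{}"]) (auto simp: jac)
  moreover have "integral ?S f = integral ?S (\<lambda>x. \<bar>det (matrix (g' x))\<bar> *\<^sub>R f (g x))"
    by (rule integral_cong) (simp add: jac)
  ultimately have "f absolutely_integrable_on g ` ?S \<and> integral (g ` ?S) f = vec I"
    using has_absolute_integral_change_of_variables[OF S der' inj', of f "vec I"] by simp
  then have "(\<lambda>x. f x $ 1) absolutely_integrable_on pair_vec ` (T ` A) \<and> integral (pair_vec ` (T ` A)) (\<lambda>x. f x $ 1) = I"
    unfolding gS by (simp add: absolutely_integrable_on_1_iff integral_on_1_eq vec_eq_iff)
  then have "((\<lambda>x. f x $ 1) has_integral I) (pair_vec ` (T ` A))"
    by (simp add: absolutely_integrable_on_def has_integral_iff)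
  then show ?thesis unfolding f_def using has_integral_vec_pair by simp
qed

text \<open>On an intersection \<open>Q i \<inter> Q0 j\<close> the coordinates \<open>c i\<close> and \<open>c j\<close> give the same integral, by the preceding
  lemma. The sum of these integrals over \<open>j\<close> is the integral over \<open>Q i\<close>, and the sum over \<open>i\<close> is the
  integral over \<open>Q0 j\<close>. So the integral does not depend on the way in which the surface is cut.\<close>

lemma partition_integral_eq:
  fixes c :: "nat \<Rightarrow> 'x \<Rightarrow> real \<times> real"
  assumes inj: "\<And>i. i \<le> m \<Longrightarrow> inj_on (c i) (\<Gamma> \<inter> V i)"
    and pos: "\<And>i x. i \<le> m \<Longrightarrow> x \<in> \<Gamma> \<inter> V i \<Longrightarrow> fst (c i x) > 0 \<and> snd (c i x) > 0"
    and fst: "\<And>i j x. i \<le> m \<Longrightarrow> j \<le> m \<Longrightarrow> x \<in> \<Gamma> \<inter> V i \<inter> V j \<Longrightarrow> fst (c j x) = fst (c i x)"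
    and der: "\<And>i j x. i \<le> m \<Longrightarrow> j \<le> m \<Longrightarrow> x \<in> \<Gamma> \<inter> V i \<inter> V j \<Longrightarrow>
      \<exists>a. ((\<lambda>z. c j (inv_into (\<Gamma> \<inter> V i) (c i) z)) has_derivative
        (\<lambda>v. (fst v, a * fst v + snd (c j x) / snd (c i x) * snd v))) (at (c i x) within c i ` (\<Gamma> \<inter> V i \<inter> V j))"
    and meas: "\<And>i j. i \<le> m \<Longrightarrow> j \<le> m \<Longrightarrow> c i ` (\<Gamma> \<inter> V i \<inter> V j) \<in> sets borel"
    and Q0: "disjoint_family_on Q0 {..m}" "(\<Union>i\<le>m. Q0 i) = \<Gamma>" "\<And>i. i \<le> m \<Longrightarrow> Q0 i \<subseteq> V i"
      "\<And>i. i \<le> m \<Longrightarrow> c i ` Q0 i \<in> sets borel"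
      "\<And>i. i \<le> m \<Longrightarrow> (log_density has_integral I0 i) (c i ` Q0 i)"
    and Q: "disjoint_family_on Q {..m}" "(\<Union>i\<le>m. Q i) = \<Gamma>" "\<And>i. i \<le> m \<Longrightarrow> Q i \<subseteq> V i"
      "\<And>i. i \<le> m \<Longrightarrow> c i ` Q i \<in> sets lebesgue"
      "\<And>i. i \<le> m \<Longrightarrow> log_density absolutely_integrable_on c i ` Q i"
  shows "(\<Sum>i\<le>m. integral (c i ` Q i) log_density) = (\<Sum>i\<le>m. I0 i)"
proof -
  define T where "T i j z = c j (inv_into (\<Gamma> \<inter> V i) (c i) z)" for i j z
  define A where "A i j = c i ` (Q i \<inter> Q0 j)" for i j
  define K where "K i j = integral (A i j) log_density" for i j
  have T: "T i j (c i x) = c j x" if "i \<le> m" "x \<in> \<Gamma> \<inter> V i" for i j x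
    unfolding T_def using inv_into_f_f[OF inj[OF that(1)] that(2)] by simp
  have sub: "Q i \<inter> Q0 j \<subseteq> \<Gamma> \<inter> V i \<inter> V j" if "i \<le> m" "j \<le> m" for i j
    using that Q(2,3) Q0(2,3) by blast
  have der': "\<exists>a. (T i j has_derivative (\<lambda>v. (fst v, a * fst v + snd (c j x) / snd (c i x) * snd v)))
      (at (c i x) within c i ` (\<Gamma> \<inter> V i \<inter> V j))" if "i \<le> m" "j \<le> m" "x \<in> \<Gamma> \<inter> V i \<inter> V j" for i j x
    using der[OF that] unfolding T_def .
  have A_leb: "A i j \<in> sets lebesgue" if ij: "i \<le> m" "j \<le> m" for i j
  proof -
    let ?\<Omega> = "c i ` (\<Gamma> \<inter> V i \<inter> V j)"
    have cont: "continuous_on ?\<Omega> (T i j)"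
      unfolding continuous_on_eq_continuous_within
    proof
      fix z assume "z \<in> ?\<Omega>"
      then obtain x where "x \<in> \<Gamma> \<inter> V i \<inter> V j" "z = c i x" by blast
      then show "continuous (at z within ?\<Omega>) (T i j)" using der'[OF ij] has_derivative_continuous by blast
    qed
    have "T i j -` (c j ` Q0 j) \<inter> ?\<Omega> \<in> sets (restrict_space borel ?\<Omega>)"
      using measurable_sets[OF borel_measurable_continuous_on_restrict[OF cont] Q0(4)[OF ij(2)]]
      by (simp add: space_restrict_space)
    then have "T i j -` (c j ` Q0 j) \<inter> ?\<Omega> \<in> sets borel"
      using meas[OF ij] by (auto simp: sets_restrict_space)
    moreover have "A i j = c i ` Q i \<inter> (T i j -` (c j ` Q0 j) \<inter> ?\<Omega>)"
    proof (intro equalityI subsetI)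
      fix z assume "z \<in> A i j"
      then obtain x where x: "x \<in> Q i" "x \<in> Q0 j" "z = c i x" unfolding A_def by blast
      then have x': "x \<in> \<Gamma> \<inter> V i \<inter> V j" using sub[OF ij] by blast
      then have "T i j z = c j x" using T[OF ij(1), of x] x by blast
      then show "z \<in> c i ` Q i \<inter> (T i j -` (c j ` Q0 j) \<inter> ?\<Omega>)" using x x' by blast
    next
      fix z assume z: "z \<in> c i ` Q i \<inter> (T i j -` (c j ` Q0 j) \<inter> ?\<Omega>)"
      then obtain x where x: "x \<in> Q i" "z = c i x" by blast
      obtain x' where x': "x' \<in> \<Gamma> \<inter> V i \<inter> V j" "z = c i x'" using z by blast
      have "x \<in> \<Gamma> \<inter> V i" using x ij Q(2,3) by blast
      then have xx: "x' = x" using inj_onD[OF inj[OF ij(1)], of x' x] x x' by simp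
      obtain y where y: "y \<in> Q0 j" "T i j z = c j y" using z by blast
      then have "c j x = c j y" using T[OF ij(1), of x' j] x' xx by simp
      moreover have "y \<in> \<Gamma> \<inter> V j" using y ij Q0(2,3) by blast
      ultimately have "x = y" using inj_onD[OF inj[OF ij(2)], of x y] x' xx by blast
      then show "z \<in> A i j" unfolding A_def using x y by blast
    qed
    ultimately show ?thesis using Q(4)[OF ij(1)] by (simp add: sets.Int)
  qed
  have Aint: "(log_density has_integral K i j) (A i j)" if ij: "i \<le> m" "j \<le> m" for i j
  proof -
    have "log_density absolutely_integrable_on A i j"
      using set_integrable_subset[OF Q(5)[OF ij(1)] A_leb[OF ij]] unfolding A_def by blast
    then show ?thesis unfolding K_def
      using set_lebesgue_integral_eq_integral(1) integrable_integral by blast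
  qed
  have inj_sub: "c i ` X \<inter> c i ` Y = {}" if "i \<le> m" "X \<subseteq> \<Gamma> \<inter> V i" "Y \<subseteq> \<Gamma> \<inter> V i" "X \<inter> Y = {}" for i X Y
    using inj_on_image_Int[OF inj[OF that(1)] that(2,3)] that(4) by simp
  have "integral (c i ` Q i) log_density = (\<Sum>j\<le>m. K i j)" if i: "i \<le> m" for i
  proof -
    have "(log_density has_integral (\<Sum>j\<le>m. K i j)) (\<Union>j\<in>{..m}. A i j)"
    proof (rule has_integral_UN)
      show "pairwise (\<lambda>j j'. negligible (A i j \<inter> A i j')) {..m}"
      proof (rule pairwiseI)
        fix j j' assume j: "j \<in> {..m}" "j' \<in> {..m}" "j \<noteq> j'"
        then have "Q0 j \<inter> Q0 j' = {}" using Q0(1) unfolding disjoint_family_on_def by blast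
        then have "A i j \<inter> A i j' = {}" unfolding A_def using sub[OF i, of j] sub[OF i, of j'] j
          by (intro inj_sub[OF i]) auto
        then show "negligible (A i j \<inter> A i j')" by simp
      qed
    qed (use Aint i in auto)
    moreover have "(\<Union>j\<in>{..m}. A i j) = c i ` Q i" unfolding A_def using Q(2) Q0(2) i by blast
    ultimately show ?thesis using integral_unique by metis
  qed
  then have "(\<Sum>i\<le>m. integral (c i ` Q i) log_density) = (\<Sum>i\<le>m. \<Sum>j\<le>m. K i j)" by simp
  also have "\<dots> = (\<Sum>j\<le>m. \<Sum>i\<le>m. K i j)" by (rule sum.swap)
  also have "\<dots> = (\<Sum>j\<le>m. I0 j)"
  proof (rule sum.cong[OF refl])
    fix j assume "j \<in> {..m}" then have j: "j \<le> m" by simp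
    have "(log_density has_integral (\<Sum>i\<le>m. K i j)) (\<Union>i\<in>{..m}. c j ` (Q i \<inter> Q0 j))"
    proof (rule has_integral_UN)
      show "pairwise (\<lambda>i i'. negligible (c j ` (Q i \<inter> Q0 j) \<inter> c j ` (Q i' \<inter> Q0 j))) {..m}"
      proof (rule pairwiseI)
        fix i i' assume i: "i \<in> {..m}" "i' \<in> {..m}" "i \<noteq> i'"
        then have "Q i \<inter> Q i' = {}" using Q(1) unfolding disjoint_family_on_def by blast
        then have "c j ` (Q i \<inter> Q0 j) \<inter> c j ` (Q i' \<inter> Q0 j) = {}" using sub[of i j] sub[of i' j] i j
          by (intro inj_sub[OF j]) auto
        then show "negligible (c j ` (Q i \<inter> Q0 j) \<inter> c j ` (Q i' \<inter> Q0 j))" by simp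
      qed
    next
      fix i assume "i \<in> {..m}" then have i: "i \<le> m" by simp
      let ?a = "\<lambda>z. SOME a. (T i j has_derivative (\<lambda>v. (fst v, a * fst v + snd (T i j z) / snd z * snd v)))
          (at z within c i ` (\<Gamma> \<inter> V i \<inter> V j))"
      have pt: "\<exists>x. x \<in> \<Gamma> \<inter> V i \<inter> V j \<and> z = c i x \<and> T i j z = c j x" if "z \<in> A i j" for z
      proof -
        obtain x where x: "x \<in> Q i \<inter> Q0 j" "z = c i x" using \<open>z \<in> A i j\<close> unfolding A_def by blast
        then have "x \<in> \<Gamma> \<inter> V i \<inter> V j" using sub[OF i j] by blast
        then show ?thesis using T[OF i, of x j] x(2) by blast
      qed
      have "(log_density has_integral K i j) (T i j ` A i j)"
      proof (rule transition_has_integral[OF A_leb[OF i j] _ _ _ _ Aint[OF i j]])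
        fix z assume z: "z \<in> A i j"
        obtain x where x: "x \<in> \<Gamma> \<inter> V i \<inter> V j" "z = c i x" "T i j z = c j x" using pt[OF z] by blast
        show "fst z > 0 \<and> snd z > 0" using pos[OF i, of x] x by simp
        show "fst (T i j z) = fst z \<and> 0 < snd (T i j z)" using pos[OF j, of x] fst[OF i j x(1)] x by simp
        have "(T i j has_derivative (\<lambda>v. (fst v, ?a z * fst v + snd (T i j z) / snd z * snd v)))
          (at z within c i ` (\<Gamma> \<inter> V i \<inter> V j))"
          using someI_ex[OF der'[OF i j x(1)]] unfolding x(3) unfolding x(2) .
        then show "(T i j has_derivative (\<lambda>v. (fst v, ?a z * fst v + snd (T i j z) / snd z * snd v))) (at z within A i j)"
          by (rule has_derivative_subset) (use sub[OF i j] in \<open>auto simp: A_def\<close>)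
      next
        show "inj_on (T i j) (A i j)"
        proof (rule inj_onI)
          fix z z' assume "z \<in> A i j" "z' \<in> A i j" and eq: "T i j z = T i j z'"
          then obtain x x' where x: "x \<in> \<Gamma> \<inter> V i \<inter> V j" "z = c i x" "T i j z = c j x"
            "x' \<in> \<Gamma> \<inter> V i \<inter> V j" "z' = c i x'" "T i j z' = c j x'" using pt by metis
          then have "x = x'" using inj_onD[OF inj[OF j], of x x'] eq by auto
          then show "z = z'" using x by simp
        qed
      qed
      moreover have "T i j ` A i j = c j ` (Q i \<inter> Q0 j)"
        unfolding A_def image_image using T[OF i] sub[OF i j] by (intro image_cong) auto
      ultimately show "(log_density has_integral K i j) (c j ` (Q i \<inter> Q0 j))" by simp
    qed auto
    moreover have "(\<Union>i\<in>{..m}. c j ` (Q i \<inter> Q0 j)) = c j ` Q0 j" using Q(2) Q0(2) j by blast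
    ultimately show "(\<Sum>i\<le>m. K i j) = I0 j" using has_integral_unique[OF _ Q0(5)[OF j]] by metis
  qed
  finally show ?thesis .
qed

text \<open>By Fubini, since the integral of \<open>1 / (s u)\<close> over \<open>a s < u \<le> 1\<close> equals \<open>- ln (a s) / s\<close>.\<close>

lemma region_integral:
  fixes a :: "real \<Rightarrow> real"
  assumes s: "0 < s\<^sub>0" "s\<^sub>0 \<le> s\<^sub>1" and cont: "continuous_on {s\<^sub>0..s\<^sub>1} a"
    and a: "\<And>s. s \<in> {s\<^sub>0..s\<^sub>1} \<Longrightarrow> 0 < a s \<and> a s \<le> 1"
  defines "B \<equiv> {z. fst z \<in> {s\<^sub>0..s\<^sub>1} \<and> a (fst z) < snd z \<and> snd z \<le> 1}"
  shows "B \<in> sets borel" "(log_density has_integral integral {s\<^sub>0..s\<^sub>1} (\<lambda>s. - ln (a s) / s)) B"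
proof -
  \<comment> \<open>clamping to the interval extends \<open>a\<close> to a continuous function on the whole line\<close>
  define r where "r s = max s\<^sub>0 (min s\<^sub>1 s)" for s
  have r: "r s \<in> {s\<^sub>0..s\<^sub>1}" "s \<in> {s\<^sub>0..s\<^sub>1} \<Longrightarrow> r s = s" for s using s unfolding r_def by auto
  have "continuous_on UNIV (\<lambda>s. a (r s))"
    using r unfolding r_def by (intro continuous_on_compose2[OF cont] continuous_intros) auto
  then have meas_a: "(\<lambda>s. a (r s)) \<in> borel_measurable borel" by (rule borel_measurable_continuous_onI)
  have B: "B = {z. s\<^sub>0 \<le> fst z \<and> fst z \<le> s\<^sub>1 \<and> a (r (fst z)) < snd z \<and> snd z \<le> 1}"
    unfolding B_def using r by auto
  have [measurable]: "fst \<in> borel_measurable (borel :: (real \<times> real) measure)"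
    "snd \<in> borel_measurable (borel :: (real \<times> real) measure)"
    by (intro borel_measurable_continuous_onI continuous_intros)+
  have [measurable]: "(\<lambda>z. a (r (fst z))) \<in> borel_measurable (borel :: (real \<times> real) measure)"
    by (rule measurable_compose[OF _ meas_a]) measurable
  have "{z \<in> space borel. s\<^sub>0 \<le> fst z \<and> fst z \<le> s\<^sub>1 \<and> a (r (fst z)) < snd z \<and> snd z \<le> (1::real)} \<in> sets borel"
    by measurable
  then show Bm: "B \<in> sets borel" unfolding B by simp
  let ?h = "\<lambda>s. - ln (a s) / s"
  have h_cont: "continuous_on {s\<^sub>0..s\<^sub>1} ?h"
    by (intro continuous_intros cont ballI) (use a s in \<open>force+\<close>)
  have h_nonneg: "0 \<le> ?h s" if "s \<in> {s\<^sub>0..s\<^sub>1}" for s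
  proof (rule divide_nonneg_pos)
    show "0 \<le> - ln (a s)" using a[OF that] ln_le_zero_iff[of "a s"] by simp
    show "0 < s" using that s by simp
  qed
  let ?K = "integral {s\<^sub>0..s\<^sub>1} ?h"
  have hK: "(?h has_integral ?K) {s\<^sub>0..s\<^sub>1}"
    by (rule integrable_integral[OF integrable_continuous_real[OF h_cont]])
  let ?f = "\<lambda>z. log_density z * indicator B z"
  have f_meas: "?f \<in> borel_measurable borel" unfolding log_density_def using Bm by measurable
  have f_nonneg: "0 \<le> ?f z" for z
  proof (cases "z \<in> B")
    case True
    then have "fst z \<in> {s\<^sub>0..s\<^sub>1}" "a (fst z) < snd z" unfolding B_def by auto
    then have "0 < fst z" "0 < snd z" using a[of "fst z"] s by auto
    then show ?thesis unfolding log_density_def by simp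
  qed simp
  have inner: "(\<integral>\<^sup>+u. ennreal (?f (s, u)) \<partial>lborel) = ennreal (?h s) * indicator {s\<^sub>0..s\<^sub>1} s" for s
  proof (cases "s \<in> {s\<^sub>0..s\<^sub>1}")
    case True
    then have as: "0 < a s" "a s \<le> 1" "s > 0" using a s by auto
    have "((\<lambda>u. 1 / (s * u)) has_integral (ln 1 / s - ln (a s) / s)) {a s..1}"
      using as by (intro fundamental_theorem_of_calculus)
        (auto intro!: derivative_eq_intros simp: field_simps simp flip: has_real_derivative_iff_has_vector_derivative)
    then have "((\<lambda>u. 1 / (s * u)) has_integral ?h s) {a s..1}" by simp
    moreover have "negligible {u \<in> {a s..1} - {a s<..1}. 1 / (s * u) \<noteq> 0}"
      by (rule negligible_subset[of "{a s}"]) auto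
    moreover have "negligible {u \<in> {a s<..1} - {a s..1}. 1 / (s * u) \<noteq> 0}"
      by (rule negligible_subset[of "{a s}"]) auto
    ultimately have "((\<lambda>u. 1 / (s * u)) has_integral ?h s) {a s<..1}"
      using has_integral_spike_set_eq[of "{a s..1}" "{a s<..1}" "\<lambda>u. 1 / (s * u)" "?h s"] by blast
    moreover have "0 \<le> 1 / (s * u)" if "u \<in> {a s<..1}" for u using that as by simp
    ultimately have "(\<integral>\<^sup>+u. ennreal (1 / (s * u)) * indicator {a s<..1} u \<partial>lborel) = ennreal (?h s)"
      by (intro nn_integral_has_integral_lebesgue') auto
    moreover have "ennreal (?f (s, u)) = ennreal (1 / (s * u)) * indicator {a s<..1} u" for u
      using True unfolding B_def log_density_def by (simp add: indicator_def)
    ultimately show ?thesis using True by simp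
  next
    case False
    then have "(s, u) \<notin> B" for u unfolding B_def by auto
    then have "?f (s, u) = 0" for u by simp
    then have "(\<integral>\<^sup>+u. ennreal (?f (s, u)) \<partial>lborel) = (\<integral>\<^sup>+(u::real). 0 \<partial>lborel)" by (intro nn_integral_cong) (simp only: ennreal_0)
    then show ?thesis using False by simp
  qed
  have "(\<integral>\<^sup>+z. ennreal (?f z) \<partial>lborel) = (\<integral>\<^sup>+z. ennreal (?f z) \<partial>(lborel \<Otimes>\<^sub>M lborel))" by (simp add: lborel_prod)
  also have "\<dots> = (\<integral>\<^sup>+s. \<integral>\<^sup>+u. ennreal (?f (s, u)) \<partial>lborel \<partial>lborel)"
  proof (rule lborel.nn_integral_fst[symmetric])
    have sets: "sets (lborel \<Otimes>\<^sub>M lborel :: (real \<times> real) measure) = sets borel" by (simp only: lborel_prod sets_lborel)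
    have "(\<lambda>z. ennreal (?f z)) \<in> borel_measurable borel" using f_meas by measurable
    then show "(\<lambda>z. ennreal (?f z)) \<in> borel_measurable (lborel \<Otimes>\<^sub>M lborel)"
      unfolding measurable_cong_sets[OF sets refl] .
  qed
  also have "\<dots> = (\<integral>\<^sup>+s. ennreal (?h s) * indicator {s\<^sub>0..s\<^sub>1} s \<partial>lborel)" by (simp add: inner)
  also have "\<dots> = ennreal ?K" by (rule nn_integral_has_integral_lebesgue'[OF h_nonneg hK])
  finally have eq: "(\<integral>\<^sup>+z. ennreal (?f z) \<partial>lborel) = ennreal ?K" .
  have "0 \<le> ?K" by (rule has_integral_nonneg[OF hK]) (rule h_nonneg)
  then have "(?f has_integral ?K) UNIV" by (rule nn_integral_has_integral[of ?f, OF f_meas f_nonneg eq])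
  moreover have "?f = (\<lambda>z. if z \<in> B then log_density z else 0)" by (rule ext) simp
  ultimately have "((\<lambda>z. if z \<in> B then log_density z else 0) has_integral ?K) UNIV" by simp
  then show "(log_density has_integral ?K) B" unfolding has_integral_restrict_UNIV .
qed

section \<open>The charts of the cylindrical end\<close>

lemma vector4: "(vector [a, b, c, d] :: 'a::zero ^ 4) $ 1 = a" "(vector [a, b, c, d] :: 'a ^ 4) $ 2 = b"
  "(vector [a, b, c, d] :: 'a ^ 4) $ 3 = c" "(vector [a, b, c, d] :: 'a ^ 4) $ 4 = d"
  unfolding vector_def by simp_all

lemma vec4_eq: "(x :: 'a ^ 4) = y \<longleftrightarrow> x $ 1 = y $ 1 \<and> x $ 2 = y $ 2 \<and> x $ 3 = y $ 3 \<and> x $ 4 = y $ 4"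
  by (simp add: vec_eq_iff forall_4)

locale cyl_family = affine_end k S W
  for k :: nat and S :: "'b cyl_surface" and W :: "'b wall_str" +
  fixes X :: "('b, 'x) family" and s\<^sub>0 s\<^sub>1 :: real
  assumes haus: "Hausdorff_space (xtop X)"
    and real: "real_structure X"
    and form: "relative_2form X"
    and agr: "agrees_with_scheme k S W X"
    and cyl: "cylindrical_end k S W X"
    and pos_slabs: "positive_slabs k S W"
    and s0: "0 < s\<^sub>0" and s01: "s\<^sub>0 < s\<^sub>1"
begin

abbreviation "U \<equiv> Uset X"
abbreviation "u \<equiv> ufct X"
abbreviation "v \<equiv> vfct X"
abbreviation "w \<equiv> wfct X"
abbreviation "tp \<equiv> tpar X"
abbreviation "ov \<equiv> overlap X"
abbreviation "\<kappa> i \<equiv> kink W (b i)"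
abbreviation "slabf i \<equiv> out_eval k (out_fun S (uslab i))"

definition coords :: "nat \<Rightarrow> 'x \<Rightarrow> complex ^ 4" where
  "coords i x = vector [u i x, v i x, w x, tp x]"

lemma coords_nth: "coords i x $ 1 = u i x" "coords i x $ 2 = v i x" "coords i x $ 3 = w x" "coords i x $ 4 = tp x"
  unfolding coords_def vector4 by simp_all

subsection \<open>Strata of the central fibre\<close>

lemma fibre0_orbits: "fibre0 X = (\<Union>\<tau>\<in>cells S. orbit X \<tau>)"
  and orbit_disjoint: "disjoint_family_on (orbit X) (cells S)"
  and orbit_closure: "\<forall>\<tau>\<in>Pmax S. (xtop X) closure_of (orbit X \<tau>) = (\<Union>\<rho>\<in>{\<rho>. is_face S \<tau> \<rho>}. orbit X \<rho>)"
  by (use agr in \<open>unfold agrees_with_scheme_def, elim conjE\<close>, assumption)+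

lemma orbit_eq: "\<tau> \<in> cells S \<Longrightarrow> \<tau>' \<in> cells S \<Longrightarrow> x \<in> orbit X \<tau> \<Longrightarrow> x \<in> orbit X \<tau>' \<Longrightarrow> \<tau> = \<tau>'"
  using orbit_disjoint unfolding disjoint_family_on_def by blast

lemma chamber_facts:
  assumes "\<uu> \<in> chambers W"
  shows "cham X \<uu> \<inter> fibre0 X = orbit X (cell_of S \<uu>)"
    and "x \<in> cham X \<uu> \<Longrightarrow> zmono X \<uu> 0 x = 1"
    and "x \<in> cham X \<uu> \<Longrightarrow> zmono X \<uu> (m + m') x = zmono X \<uu> m x * zmono X \<uu> m' x"
proof -
  have "\<forall>\<uu>\<in>chambers W. cham X \<uu> \<inter> fibre0 X = orbit X (cell_of S \<uu>) \<and>
        rconj X ` cham X \<uu> = cham X \<uu> \<and>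
        (\<forall>x\<in>cham X \<uu>. zmono X \<uu> 0 x = 1 \<and>
           (\<forall>m m'. zmono X \<uu> (m + m') x = zmono X \<uu> m x * zmono X \<uu> m' x)) \<and>
        (\<forall>m. cong_t k X (cham X \<uu>) (\<lambda>x. cnj (zmono X \<uu> m (rconj X x))) (zmono X \<uu> m)) \<and>
        (\<exists>D. open D \<and> {z. z $ 1 \<noteq> 0 \<and> z $ 2 \<noteq> 0 \<and> z $ 3 = 0} \<subseteq> D \<and>
           model_chart X (cham X \<uu>) (rel_map X (zmono X \<uu> (1, 0)) (zmono X \<uu> (0, 1))) D) \<and>
        cong_t k X (cham X \<uu>) (\<lambda>x. form2 X x (zmono X \<uu> (1, 0)) (zmono X \<uu> (0, 1)))
          (\<lambda>x. 1 / (zmono X \<uu> (1, 0) x * zmono X \<uu> (0, 1) x))"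
    using agr unfolding agrees_with_scheme_def by (elim conjE) assumption
  note * = bspec[OF this assms]
  show "cham X \<uu> \<inter> fibre0 X = orbit X (cell_of S \<uu>)" using * by (elim conjE) assumption
  have **: "\<forall>x\<in>cham X \<uu>. zmono X \<uu> 0 x = 1 \<and>
           (\<forall>m m'. zmono X \<uu> (m + m') x = zmono X \<uu> m x * zmono X \<uu> m' x)"
    using * by (elim conjE) assumption
  show "x \<in> cham X \<uu> \<Longrightarrow> zmono X \<uu> 0 x = 1"
    "x \<in> cham X \<uu> \<Longrightarrow> zmono X \<uu> (m + m') x = zmono X \<uu> m x * zmono X \<uu> m' x"
    using ** by blast+
qed

lemma wall_crossing:
  assumes "adjacent W \<uu> p \<uu>'" "\<not> slab S p"
  shows "cong_t k X (cham X \<uu> \<inter> cham X \<uu>') (zmono X \<uu> m)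
          (\<lambda>x. ser_eval k (\<lambda>m'. zmono X \<uu>' m' x) (tpar X x)
                 (ser_pow k (wfun p) (pairing (conormal S (cell_of S \<uu>) (seg p) \<uu>) m))
               * zmono X \<uu>' m x)"
proof -
  have "\<forall>\<uu> p \<uu>' m. adjacent W \<uu> p \<uu>' \<and> \<not> slab S p \<longrightarrow>
        cong_t k X (cham X \<uu> \<inter> cham X \<uu>') (zmono X \<uu> m)
          (\<lambda>x. ser_eval k (\<lambda>m'. zmono X \<uu>' m' x) (tpar X x)
                 (ser_pow k (wfun p) (pairing (conormal S (cell_of S \<uu>) (seg p) \<uu>) m))
               * zmono X \<uu>' m x)"
    using agr unfolding agrees_with_scheme_def by (elim conjE) assumption
  then show ?thesis using assms by blast
qed

lemma cong_t_at_0: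
  assumes "cong_t k X V a c" "x \<in> V" "tp x = 0" shows "a x = c x"
proof -
  obtain V' g where "x \<in> V'" "\<forall>y\<in>V'. a y - c y = tp y ^ Suc k * g y"
    using assms(1,2) unfolding cong_t_def by blast
  then have "a x - c x = tp x ^ Suc k * g x" by blast
  then show ?thesis using assms(3) by simp
qed

lemma fibre0_tp: "x \<in> fibre0 X \<longleftrightarrow> x \<in> topspace (xtop X) \<and> tp x = 0"
  unfolding fibre0_def by simp

subsection \<open>Unpacking the charts\<close>

definition slab_data :: "nat \<Rightarrow> 'b set \<Rightarrow> 'b set \<Rightarrow> (complex ^ 4) set \<Rightarrow> bool" where
  "slab_data i \<uu> \<uu>' D \<longleftrightarrow> cell_of S \<uu> = \<sigma> i \<and>
     slab_chart k S W X (uslab i) \<uu> \<uu>' (d i) (\<xi> i) (U i) (u i) (v i) w D (\<lambda>_. 0)"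

text \<open>The ambient open subset of \<open>\<complex>\<^sup>4\<close> in the chart \<open>U\<^sub>i\<close>; the family provides some such set, and any choice will do.\<close>

definition Dom :: "nat \<Rightarrow> (complex ^ 4) set" where
  "Dom i = (SOME D. \<exists>\<uu> \<uu>'. slab_data i \<uu> \<uu>' D)"

lemma end_charts: "\<forall>i\<le>M.
        U i \<subseteq> wdom X \<and> rconj X ` U i = U i \<and>
        (\<forall>x\<in>U i. u i (rconj X x) = cnj (u i x) \<and> v i (rconj X x) = cnj (v i x)) \<and>
        (\<exists>\<uu> \<uu>' D. cell_of S \<uu> = \<sigma> i \<and>
           slab_chart k S W X (uslab i) \<uu> \<uu>' (d i) (\<xi> i) (U i) (u i) (v i) w D (\<lambda>_. 0)) \<and>
        (\<forall>x\<in>U i. u i x \<noteq> 0 \<longrightarrow> form2 X x w (u i) = 1 / (w x * u i x))"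
  and w_real: "\<forall>x\<in>wdom X. w (rconj X x) = cnj (w x)"
  and end_cover: "fibre0 X - X_bounded S X \<subseteq> (\<Union>i\<le>M. U i)"
  and end_overlaps: "\<forall>i\<le>M. openin (xtop X) (ov i) \<and> orbit X (\<sigma> i) \<subseteq> ov i \<and>
        (\<forall>x\<in>ov i. u i x * v (nxt S i) x * glue X i (vector [w x, tp x]) = 1) \<and>
        (\<exists>E g. holomorphic_several (glue X i) E \<and> holomorphic_several g E \<and>
           E \<subseteq> {z. z $ 1 \<noteq> 0} \<and> {z. z $ 1 \<noteq> 0 \<and> z $ 2 = 0} \<subseteq> E \<and>
           (\<forall>x\<in>ov i. vector [w x, tp x] \<in> E) \<and>
           (\<forall>z\<in>E. glue X i z =
              (if i = M then (z $ 1) powi (- shear S) else 1)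
                * (\<Prod>p\<in>walls_between S W i. out_eval k (out_fun S p) (z $ 1) (z $ 2))
              + (z $ 2) ^ Suc k * g z))"
  and end_ov2: "2 \<le> M \<longrightarrow> (\<forall>i\<le>M. ov i = U i \<inter> U (nxt S i))"
  and end_ov1: "M = 1 \<longrightarrow> ov 0 \<union> ov 1 = U 0 \<inter> U 1 \<and> ov 0 \<inter> ov 1 = {}"
  by (use cyl in \<open>unfold cylindrical_end_def, elim conjE\<close>, assumption)+

lemma U_wdom: "i \<le> M \<Longrightarrow> U i \<subseteq> wdom X"
  and U_rconj: "i \<le> M \<Longrightarrow> rconj X ` U i = U i"
  and uv_real: "i \<le> M \<Longrightarrow> x \<in> U i \<Longrightarrow> u i (rconj X x) = cnj (u i x) \<and> v i (rconj X x) = cnj (v i x)"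
  and form_u: "i \<le> M \<Longrightarrow> x \<in> U i \<Longrightarrow> u i x \<noteq> 0 \<Longrightarrow> form2 X x w (u i) = 1 / (w x * u i x)"
proof -
  assume i: "i \<le> M"
  note * = mp[OF spec[OF end_charts, of i] i]
  show "U i \<subseteq> wdom X" using * by (elim conjE) assumption
  show "rconj X ` U i = U i" using * by (elim conjE) assumption
  have "\<forall>x\<in>U i. u i (rconj X x) = cnj (u i x) \<and> v i (rconj X x) = cnj (v i x)"
    using * by (elim conjE) assumption
  then show "x \<in> U i \<Longrightarrow> u i (rconj X x) = cnj (u i x) \<and> v i (rconj X x) = cnj (v i x)" by blast
  have "\<forall>x\<in>U i. u i x \<noteq> 0 \<longrightarrow> form2 X x w (u i) = 1 / (w x * u i x)"
    using * by (elim conjE) assumption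
  then show "x \<in> U i \<Longrightarrow> u i x \<noteq> 0 \<Longrightarrow> form2 X x w (u i) = 1 / (w x * u i x)" by blast
qed

lemma slab_data: assumes "i \<le> M" obtains \<uu> \<uu>' where "slab_data i \<uu> \<uu>' (Dom i)"
proof -
  have "\<exists>\<uu> \<uu>' D. cell_of S \<uu> = \<sigma> i \<and>
           slab_chart k S W X (uslab i) \<uu> \<uu>' (d i) (\<xi> i) (U i) (u i) (v i) w D (\<lambda>_. 0)"
    using mp[OF spec[OF end_charts, of i] assms] by (elim conjE) assumption
  then have "\<exists>D. \<exists>\<uu> \<uu>'. slab_data i \<uu> \<uu>' D" unfolding slab_data_def by (elim exE) (intro exI)
  from someI_ex[OF this] show thesis using that unfolding Dom_def by blast
qed

lemma slab_dataD:
  assumes "i \<le> M" "slab_data i \<uu> \<uu>' D"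
  shows "adjacent W \<uu> (uslab i) \<uu>'" "open D" "D \<subseteq> {z. z $ 3 \<noteq> 0}" "{z. z $ 1 * z $ 2 = 0 \<and> z $ 3 \<noteq> 0 \<and> z $ 4 = 0} \<subseteq> D"
    "model_chart X (U i) (coords i) {z \<in> D. z $ 1 * z $ 2 = slabf i (z $ 3) (z $ 4) * (z $ 4) ^ \<kappa> i}"
    "U i \<inter> fibre0 X = orbit X (\<sigma> i) \<union> orbit X (b i) \<union> orbit X (cell_of S \<uu>')"
    "orbit X (\<sigma> i) = {x \<in> U i \<inter> fibre0 X. u i x \<noteq> 0}"
    "orbit X (cell_of S \<uu>') = {x \<in> U i \<inter> fibre0 X. v i x \<noteq> 0}"
    "cong_t k X (U i \<inter> cham X \<uu>) (u i) (zmono X \<uu> (\<xi> i))"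
    "cong_t k X (U i \<inter> cham X \<uu>) w (zmono X \<uu> (d i))"
    "cell_of S \<uu> = \<sigma> i"
proof -
  note co = assms(2)[unfolded slab_data_def, THEN conjunct1]
  note sc = assms(2)[unfolded slab_data_def, THEN conjunct2, unfolded slab_chart_def Let_def co slab_edge_uslab[OF assms(1)]
      ser_eval_unbounded_slab[OF assms(1)] mult_zero_right add_0_right]
  show "adjacent W \<uu> (uslab i) \<uu>'" using sc by (elim conjE) assumption
  have "holomorphic_several (\<lambda>_. 0 :: complex) D" using sc by (elim conjE) assumption
  then show "open D" unfolding holomorphic_several_def by blast
  show "D \<subseteq> {z. z $ 3 \<noteq> 0}" using sc by (elim conjE) assumption
  show "{z. z $ 1 * z $ 2 = 0 \<and> z $ 3 \<noteq> 0 \<and> z $ 4 = 0} \<subseteq> D" using sc by (elim conjE) assumption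
  have "coords i = (\<lambda>x. vector [u i x, v i x, w x, tp x])" unfolding coords_def by (rule ext) simp
  then show "model_chart X (U i) (coords i) {z \<in> D. z $ 1 * z $ 2 = slabf i (z $ 3) (z $ 4) * (z $ 4) ^ \<kappa> i}"
    using sc by (elim conjE) simp
  show "U i \<inter> fibre0 X = orbit X (\<sigma> i) \<union> orbit X (b i) \<union> orbit X (cell_of S \<uu>')" using sc by (elim conjE) assumption
  show "orbit X (\<sigma> i) = {x \<in> U i \<inter> fibre0 X. u i x \<noteq> 0}" using sc by (elim conjE) assumption
  show "orbit X (cell_of S \<uu>') = {x \<in> U i \<inter> fibre0 X. v i x \<noteq> 0}" using sc by (elim conjE) assumption
  show "cong_t k X (U i \<inter> cham X \<uu>) (u i) (zmono X \<uu> (\<xi> i))" using sc by (elim conjE) assumption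
  show "cong_t k X (U i \<inter> cham X \<uu>) w (zmono X \<uu> (d i))" using sc by (elim conjE) assumption
  show "cell_of S \<uu> = \<sigma> i" by (rule co)
qed

definition model :: "nat \<Rightarrow> (complex ^ 4) set" where
  "model i = {z \<in> Dom i. z $ 1 * z $ 2 = slabf i (z $ 3) (z $ 4) * (z $ 4) ^ \<kappa> i}"

lemma Dom_open: "i \<le> M \<Longrightarrow> open (Dom i)"
  and Dom_w: "i \<le> M \<Longrightarrow> z \<in> Dom i \<Longrightarrow> z $ 3 \<noteq> 0"
  and Dom_central: "i \<le> M \<Longrightarrow> z $ 1 * z $ 2 = 0 \<Longrightarrow> z $ 3 \<noteq> 0 \<Longrightarrow> z $ 4 = 0 \<Longrightarrow> z \<in> Dom i"
  and chart_model: "i \<le> M \<Longrightarrow> model_chart X (U i) (coords i) (model i)"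
  and orbit_u: "i \<le> M \<Longrightarrow> orbit X (\<sigma> i) = {x \<in> U i \<inter> fibre0 X. u i x \<noteq> 0}"
proof -
  assume i: "i \<le> M"
  obtain \<uu> \<uu>' where sd: "slab_data i \<uu> \<uu>' (Dom i)" using slab_data[OF i] by blast
  note D = slab_dataD[OF i sd]
  show "open (Dom i)" by (rule D(2))
  show "z \<in> Dom i \<Longrightarrow> z $ 3 \<noteq> 0" using D(3) by blast
  show "z $ 1 * z $ 2 = 0 \<Longrightarrow> z $ 3 \<noteq> 0 \<Longrightarrow> z $ 4 = 0 \<Longrightarrow> z \<in> Dom i" using D(4) by blast
  show "model_chart X (U i) (coords i) (model i)" using D(5) unfolding model_def .
  show "orbit X (\<sigma> i) = {x \<in> U i \<inter> fibre0 X. u i x \<noteq> 0}" by (rule D(7))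
qed

lemma U_open: "i \<le> M \<Longrightarrow> openin (xtop X) (U i)"
  and coords_homeo: "i \<le> M \<Longrightarrow> homeomorphic_map (subtopology (xtop X) (U i)) (top_of_set (model i)) (coords i)"
proof -
  assume "i \<le> M"
  note * = chart_model[OF this, unfolded model_chart_def]
  show "openin (xtop X) (U i)" using * by (elim conjE) assumption
  show "homeomorphic_map (subtopology (xtop X) (U i)) (top_of_set (model i)) (coords i)"
    using * by (elim conjE) assumption
qed

lemma U_topspace: "i \<le> M \<Longrightarrow> U i \<subseteq> topspace (xtop X)"
  by (rule openin_subset[OF U_open])

lemma coords_inj: "i \<le> M \<Longrightarrow> inj_on (coords i) (U i)"
  and coords_image: "i \<le> M \<Longrightarrow> coords i ` U i = model i"
  using coords_homeo[of i] U_topspace[of i]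
  by (auto simp: homeomorphic_eq_everything_map topspace_subtopology Int_absorb1)

lemma uv_eq:
  assumes "i \<le> M" "x \<in> U i" shows "u i x * v i x = slabf i (w x) (tp x) * tp x ^ \<kappa> i" and "w x \<noteq> 0"
proof -
  have "coords i x \<in> model i" using coords_image assms by blast
  then show "u i x * v i x = slabf i (w x) (tp x) * tp x ^ \<kappa> i" "w x \<noteq> 0"
    using Dom_w[OF assms(1), of "coords i x"] unfolding model_def by (auto simp: coords_nth)
qed

lemma kink_ge1: "i \<le> M \<Longrightarrow> 1 \<le> \<kappa> i"
  using bspec[OF kink_pos uedge_edges] .

lemma kink_power_0: "i \<le> M \<Longrightarrow> (0::'c::semiring_1) ^ \<kappa> i = 0"
  using kink_ge1[of i] by (simp add: power_0_left)

lemma model_point: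
  assumes "i \<le> M" "z \<in> model i" obtains x where "x \<in> U i" "coords i x = z"
proof -
  have "z \<in> coords i ` U i" using assms(2) unfolding coords_image[OF assms(1)] .
  then show thesis by (elim imageE) (rule that, simp_all)
qed

lemma central_point:
  assumes "i \<le> M" "a * c = 0" "s \<noteq> 0"
  obtains x where "x \<in> U i" "u i x = a" "v i x = c" "w x = s" "tp x = 0"
proof -
  have "vector [a, c, s, 0] \<in> model i"
    unfolding model_def using assms(2,3) Dom_central[OF assms(1), of "vector [a, c, s, 0]"]
    by (simp add: vector4 kink_power_0[OF assms(1)])
  then obtain x where x: "x \<in> U i" "coords i x = vector [a, c, s, 0]" using model_point[OF assms(1)] by blast
  have "coords i x $ j = vector [a, c, s, 0] $ j" for j using x(2) by simp
  from this[of 1] this[of 2] this[of 3] this[of 4] show thesis using that[OF x(1)] by (simp add: coords_nth vector4)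
qed

lemma overlap_facts:
  assumes "i \<le> M"
  shows "openin (xtop X) (ov i)" "orbit X (\<sigma> i) \<subseteq> ov i"
    "x \<in> ov i \<Longrightarrow> u i x * v (nxt S i) x * glue X i (vector [w x, tp x]) = 1"
proof -
  note * = mp[OF spec[OF end_overlaps, of i] assms]
  show "openin (xtop X) (ov i)" using * by (elim conjE) assumption
  show "orbit X (\<sigma> i) \<subseteq> ov i" using * by (elim conjE) assumption
  have "\<forall>x\<in>ov i. u i x * v (nxt S i) x * glue X i (vector [w x, tp x]) = 1" using * by (elim conjE) assumption
  then show "x \<in> ov i \<Longrightarrow> u i x * v (nxt S i) x * glue X i (vector [w x, tp x]) = 1" by blast
qed

lemma nxt_01: "M = 1 \<Longrightarrow> nxt S 0 = 1" "M = 1 \<Longrightarrow> nxt S 1 = 0"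
  "M = 1 \<Longrightarrow> nxt S (Suc 0) = 0"
  unfolding nxt_def by simp_all

lemma overlap_sub: assumes "i \<le> M" shows "ov i \<subseteq> U i" "ov i \<subseteq> U (nxt S i)"
proof -
  have "ov i \<subseteq> U i \<inter> U (nxt S i)"
  proof (cases "M = 1")
    case True
    then have "ov 0 \<union> ov 1 = U 0 \<inter> U 1" using end_ov1 by blast
    moreover have "i = 0 \<or> i = 1" using assms(1) True by linarith
    ultimately show ?thesis using nxt_01(1,2)[OF True] by (elim disjE) (simp; blast)+
  next
    case False
    then have "2 \<le> M" using M_pos by simp
    then show ?thesis using end_ov2 assms by blast
  qed
  then show "ov i \<subseteq> U i" "ov i \<subseteq> U (nxt S i)" by auto
qed

lemma adjacent_overlap:
  assumes "i \<le> M" "x \<in> U i" "x \<in> U (nxt S i)"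
  shows "x \<in> ov i \<or> x \<in> ov (nxt S i) \<and> nxt S (nxt S i) = i"
proof (cases "M = 1")
  case True
  then have "ov 0 \<union> ov 1 = U 0 \<inter> U 1" using end_ov1 by blast
  moreover have "i = 0 \<or> i = 1" using assms(1) True by linarith
  ultimately show ?thesis using assms(2,3) nxt_01[OF True] by (elim disjE) (simp; blast)+
next
  case False
  then have "2 \<le> M" using M_pos by simp
  then show ?thesis using end_ov2 assms by blast
qed

text \<open>The points of the stratum of \<open>\<sigma> i\<close> lie in the overlap, and there \<open>v\<^sub>i\<^sub>+\<^sub>1\<close> is invertible. This identifies
  the second cell in the slab chart of \<open>U\<^sub>i\<^sub>+\<^sub>1\<close> as \<open>\<sigma> i\<close>.\<close>

lemma orbit_v:
  assumes "i \<le> M"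
  shows "orbit X (\<sigma> i) = {x \<in> U (nxt S i) \<inter> fibre0 X. v (nxt S i) x \<noteq> 0}"
    "U (nxt S i) \<inter> fibre0 X = orbit X (\<sigma> (nxt S i)) \<union> orbit X (b (nxt S i)) \<union> orbit X (\<sigma> i)"
proof -
  note n = nxt_le[of i]
  obtain \<uu> \<uu>' where sd: "slab_data (nxt S i) \<uu> \<uu>' (Dom (nxt S i))" using slab_data[OF n] by blast
  note D = slab_dataD[OF n sd]
  have u': "\<uu>' \<in> chambers W" using D(1) unfolding adjacent_def by blast
  obtain x where x: "x \<in> U i" "u i x = 1" "tp x = 0" using central_point[OF assms, of 1 0 1] by auto
  have "x \<in> fibre0 X" using x U_topspace[OF assms] unfolding fibre0_tp by blast
  then have xo: "x \<in> orbit X (\<sigma> i)" using orbit_u[OF assms] x by simp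
  then have xov: "x \<in> ov i" using overlap_facts(2)[OF assms] by blast
  then have "v (nxt S i) x \<noteq> 0" using overlap_facts(3)[OF assms xov] by auto
  moreover have "x \<in> U (nxt S i)" using overlap_sub(2)[OF assms] xov by blast
  ultimately have "x \<in> orbit X (cell_of S \<uu>')" using D(8) \<open>x \<in> fibre0 X\<close> by blast
  then have "cell_of S \<uu>' = \<sigma> i"
    using orbit_eq[OF cell_in_cells[OF chamber_cell(1)[OF u']] cell_in_cells[OF ucell_Pmax[OF assms]]] xo by blast
  then show "orbit X (\<sigma> i) = {x \<in> U (nxt S i) \<inter> fibre0 X. v (nxt S i) x \<noteq> 0}"
    "U (nxt S i) \<inter> fibre0 X = orbit X (\<sigma> (nxt S i)) \<union> orbit X (b (nxt S i)) \<union> orbit X (\<sigma> i)"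
    using D(6,8) by simp_all
qed

lemma orbit_double:
  assumes "i \<le> M" "x \<in> U i" "tp x = 0" "u i x = 0" "v i x = 0"
  shows "x \<in> orbit X (b i)"
proof -
  obtain j where j: "j \<le> M" "i = nxt S j" using nxt_cases[OF assms(1)] by blast
  have x0: "x \<in> fibre0 X" using assms U_topspace[OF assms(1)] unfolding fibre0_tp by blast
  then have "x \<notin> orbit X (\<sigma> i)" "x \<notin> orbit X (\<sigma> j)"
    using orbit_u[OF assms(1)] orbit_v(1)[OF j(1)] assms(4,5) j(2) by simp_all
  then show ?thesis using orbit_v(2)[OF j(1)] x0 assms(2) j(2) by blast
qed

text \<open>The chart is injective and intertwines the involution of the family with complex conjugation.\<close>

lemma real_point_iff:
  assumes "i \<le> M" "x \<in> U i"
  shows "rconj X x = x \<longleftrightarrow> u i x \<in> \<real> \<and> v i x \<in> \<real> \<and> w x \<in> \<real> \<and> tp x \<in> \<real>"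
proof -
  have xt: "x \<in> topspace (xtop X)" using assms U_topspace by blast
  have t: "tp (rconj X x) = cnj (tp x)"
  proof -
    have "\<forall>x\<in>topspace (xtop X). rconj X (rconj X x) = x \<and> tp (rconj X x) = cnj (tp x)"
      using real unfolding real_structure_def by (elim conjE) assumption
    then show ?thesis using xt by blast
  qed
  have ww: "w (rconj X x) = cnj (w x)" using w_real U_wdom assms by blast
  note uv = uv_real[OF assms]
  have rU: "rconj X x \<in> U i" using U_rconj[OF assms(1)] assms(2) by blast
  have "rconj X x = x \<longleftrightarrow> coords i (rconj X x) = coords i x"
    using inj_on_eq_iff[OF coords_inj[OF assms(1)] rU assms(2)] by simp
  also have "\<dots> \<longleftrightarrow> u i x \<in> \<real> \<and> v i x \<in> \<real> \<and> w x \<in> \<real> \<and> tp x \<in> \<real>"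
    unfolding vec4_eq coords_nth t ww using uv by (simp add: Reals_cnj_iff)
  finally show ?thesis .
qed

end

section \<open>Uniform bounds near the central fibre\<close>

lemma eventually_at_right_0I:
  fixes P :: "real \<Rightarrow> bool"
  assumes "0 < \<delta>\<^sub>0" "P \<delta>\<^sub>0" "\<And>\<delta> \<delta>'. 0 < \<delta> \<Longrightarrow> \<delta> \<le> \<delta>' \<Longrightarrow> P \<delta>' \<Longrightarrow> P \<delta>"
  shows "\<forall>\<^sub>F \<delta> in at_right 0. P \<delta>"
  unfolding eventually_at_right_field using assms(1,2) assms(3)[of _ \<delta>\<^sub>0] by (intro exI[of _ \<delta>\<^sub>0]) auto

lemma compact_positive_bound:
  fixes f :: "'a::topological_space \<Rightarrow> real"
  assumes "compact K" "continuous_on K f" "\<And>x. x \<in> K \<Longrightarrow> 0 < f x"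
  shows "\<exists>\<delta>>0. \<forall>x\<in>K. \<delta> < f x"
proof (cases "K = {}")
  case True then show ?thesis by (intro exI[of _ 1]) auto
next
  case False
  obtain x where x: "x \<in> K" "\<And>y. y \<in> K \<Longrightarrow> f x \<le> f y" using continuous_attains_inf[OF assms(1) False assms(2)] by blast
  then have "\<forall>y\<in>K. f x / 2 < f y" using assms(3)[OF x(1)] by force
  then show ?thesis using assms(3)[OF x(1)] by (intro exI[of _ "f x / 2"]) auto
qed

lemma holomorphic_several_continuous:
  assumes "holomorphic_several F D" shows "continuous_on D F"
proof (rule continuous_at_imp_continuous_on, rule ballI)
  fix z assume "z \<in> D"
  then obtain F' where "(F has_derivative F') (at z)" using assms unfolding holomorphic_several_def by blast
  then show "isCont F z" by (rule has_derivative_continuous)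
qed

lemma vector4_lambda: "(vector [a, b, c, d] :: 'a::zero ^ 4) = (\<chi> i. if i = 1 then a else if i = 2 then b else if i = 3 then c else d)"
  unfolding vec4_eq by (simp add: vector4)

lemma vector2_lambda: "(vector [a, b] :: 'a::zero ^ 2) = (\<chi> i. if i = 1 then a else b)"
  by (simp add: vec_eq_iff forall_2)

lemma vector3_lambda: "(vector [a, b, c] :: 'a::zero ^ 3) = (\<chi> i. if i = 1 then a else if i = 2 then b else c)"
  by (simp add: vec_eq_iff forall_3)

lemma continuous_on_vector4 [continuous_intros]:
  fixes f :: "'a::topological_space \<Rightarrow> 'c::{topological_space,zero}"
  assumes "continuous_on A f" "continuous_on A g" "continuous_on A h" "continuous_on A l"
  shows "continuous_on A (\<lambda>x. vector [f x, g x, h x, l x] :: 'c ^ 4)"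
proof -
  have "continuous_on A (\<lambda>x. if i = 1 then f x else if i = 2 then g x else if i = 3 then h x else l x)" for i :: 4
    using assms by (cases "i = 1"; cases "i = 2"; cases "i = 3") simp_all
  then show ?thesis unfolding vector4_lambda by (rule continuous_on_vec_lambda)
qed

lemma continuous_on_vector2 [continuous_intros]:
  fixes f :: "'a::topological_space \<Rightarrow> 'c::{topological_space,zero}"
  assumes "continuous_on A f" "continuous_on A g"
  shows "continuous_on A (\<lambda>x. vector [f x, g x] :: 'c ^ 2)"
proof -
  have "continuous_on A (\<lambda>x. if i = 1 then f x else g x)" for i :: 2
    using assms by (cases "i = 1") simp_all
  then show ?thesis unfolding vector2_lambda by (rule continuous_on_vec_lambda)
qed

lemma continuous_on_vector3 [continuous_intros]:
  fixes f :: "'a::topological_space \<Rightarrow> 'c::{topological_space,zero}"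
  assumes "continuous_on A f" "continuous_on A g" "continuous_on A h"
  shows "continuous_on A (\<lambda>x. vector [f x, g x, h x] :: 'c ^ 3)"
proof -
  have "continuous_on A (\<lambda>x. if i = 1 then f x else if i = 2 then g x else h x)" for i :: 3
    using assms by (cases "i = 1"; cases "i = 2") simp_all
  then show ?thesis unfolding vector3_lambda by (rule continuous_on_vec_lambda)
qed

text \<open>The points of the strip where one of the bounds fails form a compact set. If the bounds hold on \<open>\<tau> = 0\<close>,
  then \<open>\<tau>\<close> is bounded below on this set by a positive number. The further arguments for small \<open>t\<close> follow
  the same pattern.\<close>

lemma positive_tube:
  fixes f :: "real \<Rightarrow> real \<Rightarrow> real"
  assumes cont: "continuous_on ({a..b} \<times> {0..\<delta>\<^sub>0}) (\<lambda>z. f (fst z) (snd z))" and "0 < \<delta>\<^sub>0" and pos: "\<And>s. s \<in> {a..b} \<Longrightarrow> 0 < f s 0"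
  shows "\<exists>A\<^sub>0>1. \<forall>A\<ge>A\<^sub>0. \<forall>\<^sub>F \<delta> in at_right 0. \<forall>s\<in>{a..b}. \<forall>\<tau>\<in>{0..\<delta>}. 1 / A < f s \<tau> \<and> f s \<tau> < A"
proof -
  have c0: "continuous_on {a..b} (\<lambda>s. f s 0)"
    by (rule continuous_on_compose2[OF cont, where f = "\<lambda>s. (s, 0)", simplified])
      (use \<open>0 < \<delta>\<^sub>0\<close> in \<open>auto intro!: continuous_intros\<close>)
  obtain \<epsilon> where \<epsilon>: "\<epsilon> > 0" "\<And>s. s \<in> {a..b} \<Longrightarrow> \<epsilon> < f s 0"
    using compact_positive_bound[OF compact_Icc c0] pos by blast
  have "compact ((\<lambda>s. f s 0) ` {a..b})" by (intro compact_continuous_image c0) auto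
  from compact_imp_bounded[OF this] obtain B where "\<forall>y\<in>(\<lambda>s. f s 0) ` {a..b}. norm y \<le> B"
    unfolding bounded_iff by blast
  then have B: "\<And>s. s \<in> {a..b} \<Longrightarrow> \<bar>f s 0\<bar> \<le> B" by simp
  \<comment> \<open>the summands exceed \<open>1\<close>, the inverse of the minimum and the maximum on \<open>\<tau> = 0\<close>\<close>
  define A\<^sub>0 where "A\<^sub>0 = 2 + 1 / \<epsilon> + \<bar>B\<bar>"
  have "\<forall>\<^sub>F \<delta> in at_right 0. \<forall>s\<in>{a..b}. \<forall>\<tau>\<in>{0..\<delta>}. 1 / A < f s \<tau> \<and> f s \<tau> < A" if A: "A \<ge> A\<^sub>0" for A
  proof -
    have e1: "0 < 1 / \<epsilon>" using \<epsilon>(1) by simp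
    have A_gt: "A > 1 / \<epsilon>" "A > \<bar>B\<bar>" "A > 0" using A e1 abs_ge_zero[of B] unfolding A\<^sub>0_def by linarith+
    have lo: "1 / A < \<epsilon>" using A_gt \<epsilon>(1) by (simp add: field_simps)
    define K where "K = {z \<in> {a..b} \<times> {0..\<delta>\<^sub>0}. f (fst z) (snd z) \<in> {..1 / A} \<union> {A..}}"
    have "compact K"
    proof -
      have "closed ({a..b} \<times> {0..\<delta>\<^sub>0})" by (intro closed_Times) auto
      from continuous_closed_preimage[OF cont this, of "{..1 / A} \<union> {A..}"]
      have "closed K" unfolding K_def by (simp add: closed_Un vimage_def Int_def)
      moreover have "compact ({a..b} \<times> {0..\<delta>\<^sub>0})" by (intro compact_Times) auto
      ultimately show ?thesis using compact_Int_closed[of "{a..b} \<times> {0..\<delta>\<^sub>0}" K] unfolding K_def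
        by (metis (no_types, lifting) inf.absorb_iff2 mem_Collect_eq subsetI)
    qed
    moreover have "continuous_on K snd" by (intro continuous_intros)
    moreover have "0 < snd z" if "z \<in> K" for z
    proof (rule ccontr)
      assume "\<not> 0 < snd z"
      then have "snd z = 0" "fst z \<in> {a..b}" using that unfolding K_def by auto
      then have "f (fst z) 0 \<in> {..1 / A} \<union> {A..}" "\<epsilon> < f (fst z) 0" "\<bar>f (fst z) 0\<bar> \<le> B"
        using that \<epsilon>(2) B unfolding K_def by auto
      then show False using lo A_gt by auto
    qed
    ultimately obtain \<delta> where \<delta>: "\<delta> > 0" "\<forall>z\<in>K. \<delta> < snd z" using compact_positive_bound by blast
    show ?thesis
    proof (rule eventually_at_right_0I)
      show "0 < min \<delta> \<delta>\<^sub>0" using \<delta> \<open>0 < \<delta>\<^sub>0\<close> by simp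
      show "\<forall>s\<in>{a..b}. \<forall>\<tau>\<in>{0..min \<delta> \<delta>\<^sub>0}. 1 / A < f s \<tau> \<and> f s \<tau> < A"
      proof (intro ballI)
        fix s \<tau> assume st: "s \<in> {a..b}" "\<tau> \<in> {0..min \<delta> \<delta>\<^sub>0}"
        then have "(s, \<tau>) \<notin> K" using \<delta>(2) by force
        then show "1 / A < f s \<tau> \<and> f s \<tau> < A" using st unfolding K_def by (simp add: not_le)
      qed
    qed auto
  qed
  moreover have "0 < 1 / \<epsilon>" using \<epsilon>(1) by simp
  then have "1 < A\<^sub>0" using abs_ge_zero[of B] unfolding A\<^sub>0_def by linarith
  ultimately show ?thesis by blast
qed

context cyl_family begin

abbreviation rbox :: "real \<Rightarrow> (real \<times> real) set" where "rbox \<delta> \<equiv> {s\<^sub>0..s\<^sub>1} \<times> {0..\<delta>}"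

definition gr :: "nat \<Rightarrow> real \<Rightarrow> real \<Rightarrow> real" where
  "gr i s \<tau> = Re (glue X i (vector [of_real s, of_real \<tau>]))"

definition gr_mod :: "nat \<Rightarrow> real \<Rightarrow> real \<Rightarrow> real" where
  "gr_mod i s \<tau> = (if i = M then s powi (- shear S) else 1) * (\<Prod>p\<in>walls_between S W i. out_eval k (out_fun S p) s \<tau>)"

text \<open>On the line \<open>\<tau> = 0\<close> at most the monodromy factor \<open>s\<^sup>-\<^sup>e\<close> remains, which is positive. The domain of the gluing
  function contains this line and hence a strip around the compact interval.\<close>

lemma gr_tube:
  assumes i: "i \<le> M"
  shows "\<forall>\<^sub>F \<delta> in at_right 0. continuous_on (rbox \<delta>) (\<lambda>z. gr i (fst z) (snd z)) \<and> cong_mod k s\<^sub>0 s\<^sub>1 \<delta> (gr i) (gr_mod i)"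
    and "s \<in> {s\<^sub>0..s\<^sub>1} \<Longrightarrow> 0 < gr i s 0"
proof -
  have "\<exists>E g. holomorphic_several (glue X i) E \<and> holomorphic_several g E \<and>
           E \<subseteq> {z. z $ 1 \<noteq> 0} \<and> {z. z $ 1 \<noteq> 0 \<and> z $ 2 = 0} \<subseteq> E \<and>
           (\<forall>x\<in>ov i. vector [w x, tp x] \<in> E) \<and>
           (\<forall>z\<in>E. glue X i z =
              (if i = M then (z $ 1) powi (- shear S) else 1)
                * (\<Prod>p\<in>walls_between S W i. out_eval k (out_fun S p) (z $ 1) (z $ 2))
              + (z $ 2) ^ Suc k * g z)"
    using mp[OF spec[OF end_overlaps, of i] i] by (elim conjE) assumption
  then obtain E g where E: "holomorphic_several (glue X i) E" "holomorphic_several g E"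
      "{z. z $ 1 \<noteq> 0 \<and> z $ 2 = 0} \<subseteq> E"
    and eq: "\<forall>z\<in>E. glue X i z =
              (if i = M then (z $ 1) powi (- shear S) else 1)
                * (\<Prod>p\<in>walls_between S W i. out_eval k (out_fun S p) (z $ 1) (z $ 2))
              + (z $ 2) ^ Suc k * g z" by (elim exE conjE) (rule that)
  define vz :: "real \<times> real \<Rightarrow> complex ^ 2" where "vz z = vector [of_real (fst z), of_real (snd z)]" for z
  have vz_cont: "continuous_on A vz" for A unfolding vz_def by (intro continuous_intros)
  have openE: "open E" using E(1) unfolding holomorphic_several_def by blast
  have gr_eq: "gr i s \<tau> = gr_mod i s \<tau> + \<tau> ^ Suc k * Re (g (vz (s, \<tau>)))" if "vz (s, \<tau>) \<in> E" for s \<tau>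
  proof -
    have "glue X i (vz (s, \<tau>)) = of_real (gr_mod i s \<tau>) + of_real (\<tau> ^ Suc k) * g (vz (s, \<tau>))"
      using bspec[OF eq that] unfolding gr_mod_def by (simp add: vz_def out_eval_of_real of_real_power_int)
    moreover have "Re (of_real a + of_real c * z) = a + c * Re z" for a c z by simp
    ultimately have "Re (glue X i (vz (s, \<tau>))) = gr_mod i s \<tau> + \<tau> ^ Suc k * Re (g (vz (s, \<tau>)))"
      by (simp only:)
    then show ?thesis unfolding gr_def vz_def by simp
  qed
  have vz0: "vz (s, 0) \<in> E" if "s \<in> {s\<^sub>0..s\<^sub>1}" for s
    using E(3) that s0 unfolding vz_def by auto
  define K where "K = {z \<in> rbox 1. vz z \<in> - E}"
  have "compact K"
  proof -
    have "closed (rbox 1)" by (intro closed_Times) auto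
    from continuous_closed_preimage[OF vz_cont this, of "- E"]
    have "closed K" unfolding K_def using openE by (simp add: closed_Compl vimage_def Int_def)
    moreover have "compact (rbox 1)" by (intro compact_Times) auto
    moreover have "K \<subseteq> rbox 1" unfolding K_def by auto
    ultimately show ?thesis using compact_Int_closed[of "rbox 1" K] by (simp add: Int_absorb1)
  qed
  moreover have "continuous_on K snd" by (intro continuous_intros)
  moreover have "0 < snd z" if z: "z \<in> K" for z
  proof (rule ccontr)
    assume "\<not> 0 < snd z"
    then have "snd z = 0" "fst z \<in> {s\<^sub>0..s\<^sub>1}" using z unfolding K_def by auto
    then have "vz z \<in> E" using vz0[of "fst z"] by (cases z) simp
    then show False using z unfolding K_def by simp
  qed
  ultimately obtain \<delta> where \<delta>: "\<delta> > 0" "\<forall>z\<in>K. \<delta> < snd z" using compact_positive_bound by blast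
  define \<delta>\<^sub>1 where "\<delta>\<^sub>1 = min \<delta> 1"
  have inE: "vz z \<in> E" if "z \<in> rbox \<delta>\<^sub>1" for z
  proof (rule ccontr)
    assume "vz z \<notin> E"
    then have "z \<in> K" using that unfolding K_def \<delta>\<^sub>1_def by auto
    then show False using \<delta>(2) that unfolding \<delta>\<^sub>1_def by auto
  qed
  have cont: "continuous_on (rbox \<delta>\<^sub>1) (\<lambda>z. gr i (fst z) (snd z))"
  proof -
    have "continuous_on (rbox \<delta>\<^sub>1) (\<lambda>z. Re (glue X i (vz z)))"
      by (intro continuous_intros continuous_on_compose2[OF holomorphic_several_continuous[OF E(1)] vz_cont])
        (auto intro: inE)
    then show ?thesis unfolding gr_def vz_def .
  qed
  have "continuous_on (rbox \<delta>\<^sub>1) (\<lambda>z. Re (g (vz z)))"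
    by (intro continuous_intros continuous_on_compose2[OF holomorphic_several_continuous[OF E(2)] vz_cont])
      (auto intro: inE)
  then have gcont: "continuous_on (rbox \<delta>\<^sub>1) (\<lambda>z. Re (g (vz (fst z, snd z))))" by simp
  obtain C where C: "\<And>s \<tau>. s \<in> {s\<^sub>0..s\<^sub>1} \<Longrightarrow> \<tau> \<in> {0..\<delta>\<^sub>1} \<Longrightarrow> \<bar>Re (g (vz (s, \<tau>)))\<bar> \<le> C"
    using bounded_fun_continuous[OF gcont] unfolding bounded_fun_def by blast
  have cong: "cong_mod k s\<^sub>0 s\<^sub>1 \<delta>\<^sub>1 (gr i) (gr_mod i)"
    unfolding cong_mod_def
  proof (intro exI ballI)
    fix s \<tau> assume st: "s \<in> {s\<^sub>0..s\<^sub>1}" "\<tau> \<in> {0..\<delta>\<^sub>1}"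
    have "gr i s \<tau> - gr_mod i s \<tau> = \<tau> ^ Suc k * Re (g (vz (s, \<tau>)))"
      using gr_eq[OF inE[of "(s, \<tau>)"]] st by auto
    then show "\<bar>gr i s \<tau> - gr_mod i s \<tau>\<bar> \<le> C * \<tau> ^ Suc k"
      using mult_left_mono[OF C[OF st], of "\<tau> ^ Suc k"] st by (simp add: abs_mult mult.commute)
  qed
  show "\<forall>\<^sub>F \<delta> in at_right 0. continuous_on (rbox \<delta>) (\<lambda>z. gr i (fst z) (snd z)) \<and> cong_mod k s\<^sub>0 s\<^sub>1 \<delta> (gr i) (gr_mod i)"
  proof (rule eventually_at_right_0I[of \<delta>\<^sub>1])
    show "0 < \<delta>\<^sub>1" using \<delta> unfolding \<delta>\<^sub>1_def by simp
    show "continuous_on (rbox \<delta>\<^sub>1) (\<lambda>z. gr i (fst z) (snd z)) \<and> cong_mod k s\<^sub>0 s\<^sub>1 \<delta>\<^sub>1 (gr i) (gr_mod i)" using cont cong by blast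
    fix \<delta> \<delta>' :: real
    assume d: "0 < \<delta>" "\<delta> \<le> \<delta>'" and *: "continuous_on (rbox \<delta>') (\<lambda>z. gr i (fst z) (snd z)) \<and> cong_mod k s\<^sub>0 s\<^sub>1 \<delta>' (gr i) (gr_mod i)"
    have "continuous_on (rbox \<delta>) (\<lambda>z. gr i (fst z) (snd z))"
      by (rule continuous_on_subset[OF conjunct1[OF *]]) (use d in auto)
    moreover have "cong_mod k s\<^sub>0 s\<^sub>1 \<delta> (gr i) (gr_mod i)"
    proof -
      obtain C where "\<forall>s\<in>{s\<^sub>0..s\<^sub>1}. \<forall>\<tau>\<in>{0..\<delta>'}. \<bar>gr i s \<tau> - gr_mod i s \<tau>\<bar> \<le> C * \<tau> ^ Suc k"
        using conjunct2[OF *] unfolding cong_mod_def by blast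
      then show ?thesis unfolding cong_mod_def using d by (intro exI[of _ C]) auto
    qed
    ultimately show "continuous_on (rbox \<delta>) (\<lambda>z. gr i (fst z) (snd z)) \<and> cong_mod k s\<^sub>0 s\<^sub>1 \<delta> (gr i) (gr_mod i)" by blast
  qed
  show "0 < gr i s 0" if "s \<in> {s\<^sub>0..s\<^sub>1}"
  proof -
    have "gr i s 0 = gr_mod i s 0" using gr_eq[OF vz0[OF that]] by simp
    also have "\<dots> = (if i = M then s powi (- shear S) else 1)"
      unfolding gr_mod_def using out_eval_between_0[OF _ i, of _ s] by simp
    also have "\<dots> > 0" using that s0 by simp
    finally show ?thesis .
  qed
qed

lemma slabf_pos: "i \<le> M \<Longrightarrow> s > 0 \<Longrightarrow> 0 < slabf i s (0::real)"
  using pos_slabs unfolding positive_slabs_def by simp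

lemma slabf_cont: "continuous_on (rbox \<delta>) (\<lambda>z. slabf i (fst z) (snd z) :: real)"
  using s0 by (intro continuous_intros) auto

definition bounds :: "real \<Rightarrow> real \<Rightarrow> bool" where
  "bounds A \<delta> \<longleftrightarrow> (\<forall>i\<le>M. \<forall>s\<in>{s\<^sub>0..s\<^sub>1}. \<forall>\<tau>\<in>{0..\<delta>}. 1 / A < gr i s \<tau> \<and> gr i s \<tau> < A \<and> 1 / A < slabf i s \<tau> \<and> slabf i s \<tau> < A)"

lemma bounds_exist: "\<exists>A>1. \<forall>\<^sub>F \<delta> in at_right 0. bounds A \<delta>"
proof -
  have one: "\<exists>A\<^sub>0>1. \<forall>A\<ge>A\<^sub>0. \<forall>\<^sub>F \<delta> in at_right 0. \<forall>s\<in>{s\<^sub>0..s\<^sub>1}. \<forall>\<tau>\<in>{0..\<delta>}.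
      1 / A < gr i s \<tau> \<and> gr i s \<tau> < A \<and> 1 / A < slabf i s \<tau> \<and> slabf i s \<tau> < A" if i: "i \<le> M" for i
  proof -
    have "\<exists>\<delta>\<^sub>0>0. continuous_on (rbox \<delta>\<^sub>0) (\<lambda>z. gr i (fst z) (snd z))"
    proof -
      have "\<forall>\<^sub>F \<delta> in at_right (0::real). 0 < \<delta> \<and> continuous_on (rbox \<delta>) (\<lambda>z. gr i (fst z) (snd z))"
        using eventually_conj[OF eventually_at_right_less[of 0] gr_tube(1)[OF i]] by (rule eventually_mono) blast
      from eventually_happens[OF this] show ?thesis by (auto simp: trivial_limit_at_right_real)
    qed
    then obtain \<delta>\<^sub>0 where \<delta>\<^sub>0: "\<delta>\<^sub>0 > 0" "continuous_on (rbox \<delta>\<^sub>0) (\<lambda>z. gr i (fst z) (snd z))" by blast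
    obtain A\<^sub>1 where A1: "A\<^sub>1 > 1" "\<And>A. A \<ge> A\<^sub>1 \<Longrightarrow> \<forall>\<^sub>F \<delta> in at_right 0. \<forall>s\<in>{s\<^sub>0..s\<^sub>1}. \<forall>\<tau>\<in>{0..\<delta>}. 1 / A < gr i s \<tau> \<and> gr i s \<tau> < A"
      using positive_tube[OF \<delta>\<^sub>0(2,1) gr_tube(2)[OF i]] by blast
    have sp: "0 < slabf i s 0" if "s \<in> {s\<^sub>0..s\<^sub>1}" for s :: real using slabf_pos[OF i, of s] that s0 by simp
    obtain A\<^sub>2 where A2: "A\<^sub>2 > 1" "\<And>A. A \<ge> A\<^sub>2 \<Longrightarrow> \<forall>\<^sub>F \<delta> in at_right 0. \<forall>s\<in>{s\<^sub>0..s\<^sub>1}. \<forall>\<tau>\<in>{0..\<delta>}. 1 / A < slabf i s \<tau> \<and> slabf i s \<tau> < A"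
      using positive_tube[OF slabf_cont[of 1 i] zero_less_one sp] by blast
    show ?thesis
    proof (intro exI[of _ "max A\<^sub>1 A\<^sub>2"] conjI allI impI)
      fix A assume "max A\<^sub>1 A\<^sub>2 \<le> A"
      then show "\<forall>\<^sub>F \<delta> in at_right 0. \<forall>s\<in>{s\<^sub>0..s\<^sub>1}. \<forall>\<tau>\<in>{0..\<delta>}.
          1 / A < gr i s \<tau> \<and> gr i s \<tau> < A \<and> 1 / A < slabf i s \<tau> \<and> slabf i s \<tau> < A"
        using eventually_conj[OF A1(2)[of A] A2(2)[of A]] by (auto elim: eventually_mono)
    qed (use A1 in auto)
  qed
  define a where "a i = (SOME A\<^sub>0. A\<^sub>0 > 1 \<and> (\<forall>A\<ge>A\<^sub>0. \<forall>\<^sub>F \<delta> in at_right 0. \<forall>s\<in>{s\<^sub>0..s\<^sub>1}. \<forall>\<tau>\<in>{0..\<delta>}.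
      1 / A < gr i s \<tau> \<and> gr i s \<tau> < A \<and> 1 / A < slabf i s \<tau> \<and> slabf i s \<tau> < A))" for i
  have a: "a i > 1 \<and> (\<forall>A\<ge>a i. \<forall>\<^sub>F \<delta> in at_right 0. \<forall>s\<in>{s\<^sub>0..s\<^sub>1}. \<forall>\<tau>\<in>{0..\<delta>}.
      1 / A < gr i s \<tau> \<and> gr i s \<tau> < A \<and> 1 / A < slabf i s \<tau> \<and> slabf i s \<tau> < A)" if "i \<le> M" for i
    unfolding a_def using someI_ex[OF one[OF that]] .
  define A where "A = Max (a ` {..M})"
  have Ai: "a i \<le> A" if "i \<le> M" for i unfolding A_def using that by (intro Max_ge) auto
  have "A > 1" using a[of 0] Ai[of 0] by simp
  moreover have "\<forall>\<^sub>F \<delta> in at_right 0. \<forall>i\<in>{..M}. \<forall>s\<in>{s\<^sub>0..s\<^sub>1}. \<forall>\<tau>\<in>{0..\<delta>}.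
      1 / A < gr i s \<tau> \<and> gr i s \<tau> < A \<and> 1 / A < slabf i s \<tau> \<and> slabf i s \<tau> < A"
    by (rule eventually_ball_finite[OF finite_atMost]) (use a Ai in auto)
  then have "\<forall>\<^sub>F \<delta> in at_right 0. bounds A \<delta>"
    by (rule eventually_mono) (simp add: bounds_def)
  ultimately show ?thesis by blast
qed

subsection \<open>Compact pieces of the real locus\<close>

definition real_pt :: "nat \<Rightarrow> 'x \<Rightarrow> real \<Rightarrow> real \<Rightarrow> real \<Rightarrow> real \<Rightarrow> bool" where
  "real_pt i x a c s \<tau> \<longleftrightarrow> x \<in> U i \<and> u i x = of_real a \<and> v i x = of_real c \<and> w x = of_real s \<and> tp x = of_real \<tau>"

definition emb :: "real \<times> real \<times> real \<times> real \<Rightarrow> complex ^ 4" where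
  "emb = (\<lambda>(a, c, s, \<tau>). vector [of_real a, of_real c, of_real s, of_real \<tau>])"

lemma real_pt_emb: "real_pt i x a c s \<tau> \<longleftrightarrow> x \<in> U i \<and> coords i x = emb (a, c, s, \<tau>)"
  unfolding real_pt_def emb_def vec4_eq coords_nth by (simp add: vector4)

lemma continuous_emb: "continuous_on A emb"
  unfolding emb_def case_prod_unfold by (intro continuous_intros)

lemma real_pt_eq: assumes "i \<le> M" "real_pt i x a c s \<tau>" shows "a * c = slabf i s \<tau> * \<tau> ^ \<kappa> i"
proof -
  have "of_real a * of_real c = slabf i (of_real s) (of_real \<tau>) * (of_real \<tau> :: complex) ^ \<kappa> i"
    using uv_eq(1)[OF assms(1), of x] assms(2) unfolding real_pt_def by simp
  then have "complex_of_real (a * c) = of_real (slabf i s \<tau> * \<tau> ^ \<kappa> i)" by (simp add: out_eval_of_real)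
  then show ?thesis by (simp only: of_real_eq_iff)
qed

lemma real_pt_real: "i \<le> M \<Longrightarrow> real_pt i x a c s \<tau> \<Longrightarrow> rconj X x = x"
  using real_point_iff unfolding real_pt_def by auto

lemma real_pt_real_obtain:
  assumes "i \<le> M" "x \<in> U i" "rconj X x = x"
  obtains a c s \<tau> where "real_pt i x a c s \<tau>"
proof -
  have "u i x \<in> \<real>" "v i x \<in> \<real>" "w x \<in> \<real>" "tp x \<in> \<real>" using real_point_iff[OF assms(1,2)] assms(3) by auto
  then show thesis using that assms(2) unfolding real_pt_def by (elim Reals_cases) blast
qed

definition chart_inv :: "nat \<Rightarrow> complex ^ 4 \<Rightarrow> 'x" where
  "chart_inv i = (SOME g. homeomorphic_maps (subtopology (xtop X) (U i)) (top_of_set (model i)) (coords i) g)"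

lemma chart_inv: assumes "i \<le> M"
  shows "homeomorphic_maps (subtopology (xtop X) (U i)) (top_of_set (model i)) (coords i) (chart_inv i)"
proof -
  have "\<exists>g. homeomorphic_maps (subtopology (xtop X) (U i)) (top_of_set (model i)) (coords i) g"
    using coords_homeo[OF assms] by (simp add: homeomorphic_map_maps)
  then show ?thesis unfolding chart_inv_def by (rule someI_ex)
qed

lemma chart_inv_continuous: "i \<le> M \<Longrightarrow> continuous_map (top_of_set (model i)) (subtopology (xtop X) (U i)) (chart_inv i)"
  and coords_continuous: "i \<le> M \<Longrightarrow> continuous_map (subtopology (xtop X) (U i)) euclidean (coords i)"
  using chart_inv[of i] unfolding homeomorphic_maps_def by (auto simp: continuous_map_in_subtopology)

lemma chart_inv_point:
  assumes "i \<le> M" "z \<in> model i" shows "chart_inv i z \<in> U i" "coords i (chart_inv i z) = z"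
proof -
  have "chart_inv i z \<in> topspace (subtopology (xtop X) (U i))"
    using continuous_map_image_subset_topspace[OF chart_inv_continuous[OF assms(1)]] assms(2) by auto
  then show "chart_inv i z \<in> U i" by simp
  show "coords i (chart_inv i z) = z"
    using chart_inv[OF assms(1)] assms(2) unfolding homeomorphic_maps_def by simp
qed

lemma chart_inv_coords:
  assumes "i \<le> M" "x \<in> U i" shows "chart_inv i (coords i x) = x"
  using chart_inv[OF assms(1)] U_topspace[OF assms(1)] assms(2) unfolding homeomorphic_maps_def by auto

definition box_coords :: "nat \<Rightarrow> real \<Rightarrow> real \<Rightarrow> (real \<times> real \<times> real \<times> real) set" where
  "box_coords i R \<delta> = {z \<in> {0..R} \<times> {0..R} \<times> {s\<^sub>0..s\<^sub>1} \<times> {0..\<delta>}.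
     fst z * fst (snd z) - slabf i (fst (snd (snd z))) (snd (snd (snd z))) * snd (snd (snd z)) ^ \<kappa> i = 0}"

lemma box_coords_iff: "(a, c, s, \<tau>) \<in> box_coords i R \<delta> \<longleftrightarrow>
    0 \<le> a \<and> a \<le> R \<and> 0 \<le> c \<and> c \<le> R \<and> s \<in> {s\<^sub>0..s\<^sub>1} \<and> 0 \<le> \<tau> \<and> \<tau> \<le> \<delta> \<and> a * c = slabf i s \<tau> * \<tau> ^ \<kappa> i"
  unfolding box_coords_def by auto

lemma box_coords_mono: "\<delta> \<le> \<delta>' \<Longrightarrow> box_coords i R \<delta> \<subseteq> box_coords i R \<delta>'"
  unfolding box_coords_def by auto

lemma compact_box_coords: "compact (box_coords i R \<delta>)"
proof -
  let ?B = "{0..R} \<times> {0..R} \<times> {s\<^sub>0..s\<^sub>1} \<times> {0..\<delta>}"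
  have B: "compact ?B" by (intro compact_Times) auto
  have "closed (box_coords i R \<delta>)"
    unfolding box_coords_def
  proof (rule continuous_closed_preimage_constant)
    show "closed ?B" by (rule compact_imp_closed[OF B])
    show "continuous_on ?B (\<lambda>z. fst z * fst (snd z) - slabf i (fst (snd (snd z))) (snd (snd (snd z))) * snd (snd (snd z)) ^ \<kappa> i)"
      using s0 by (intro continuous_intros) auto
  qed
  moreover have "box_coords i R \<delta> \<subseteq> ?B" unfolding box_coords_def by (rule Collect_subset)
  ultimately show ?thesis using compact_Int_closed[OF B, of "box_coords i R \<delta>"] by (simp only: Int_absorb1)
qed

abbreviation "par_t z \<equiv> snd (snd (snd z))"

lemma par_t_cont: "continuous_on A (\<lambda>z :: real \<times> real \<times> real \<times> real. par_t z)"
  by (intro continuous_intros)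

lemma par_t_nonneg: "z \<in> box_coords i R \<delta> \<Longrightarrow> 0 \<le> par_t z \<and> par_t z \<le> \<delta>"
  unfolding box_coords_def by auto

lemma par_t_bound:
  assumes "compact K" "\<And>z. z \<in> K \<Longrightarrow> 0 < par_t z"
  shows "\<exists>\<delta>>0. \<forall>z\<in>K. \<delta> < par_t (z :: real \<times> real \<times> real \<times> real)"
  by (rule compact_positive_bound[OF assms(1) par_t_cont assms(2)])

lemma emb_model_iff: "(a, c, s, \<tau>) \<in> box_coords i R \<delta> \<Longrightarrow> emb (a, c, s, \<tau>) \<in> model i \<longleftrightarrow> emb (a, c, s, \<tau>) \<in> Dom i"
proof -
  assume "(a, c, s, \<tau>) \<in> box_coords i R \<delta>"
  then have "a * c = slabf i s \<tau> * \<tau> ^ \<kappa> i" unfolding box_coords_iff by blast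
  then have "complex_of_real (a * c) = of_real (slabf i s \<tau> * \<tau> ^ \<kappa> i)" by (simp only:)
  then show ?thesis unfolding model_def emb_def by (simp add: vector4 out_eval_of_real)
qed

lemma box_coords_model:
  assumes i: "i \<le> M"
  shows "\<forall>\<^sub>F \<delta> in at_right 0. emb ` box_coords i R \<delta> \<subseteq> model i"
proof -
  define K where "K = box_coords i R 1 \<inter> emb -` (- Dom i)"
  have "closed (emb -` (- Dom i))"
    by (rule closed_vimage[OF _ continuous_emb]) (simp add: Dom_open[OF i] closed_Compl)
  then have "compact K" unfolding K_def by (intro compact_Int_closed compact_box_coords)
  moreover have "0 < par_t z" if z: "z \<in> K" for z
  proof (rule ccontr)
    assume neg: "\<not> 0 < par_t z"
    obtain a c s \<tau> where zz: "z = (a, c, s, \<tau>)" by (cases z) auto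
    then have N: "(a, c, s, \<tau>) \<in> box_coords i R 1" using z unfolding K_def by simp
    then have "\<tau> = 0" using neg zz unfolding box_coords_iff by simp
    then have "a * c = 0" "s \<noteq> 0" using N s0 kink_power_0[OF i] unfolding box_coords_iff by auto
    then have "emb z \<in> Dom i" unfolding zz emb_def using \<open>\<tau> = 0\<close>
      by (intro Dom_central[OF i]) (auto simp: vector4)
    then show False using z unfolding K_def by simp
  qed
  ultimately obtain \<delta> where \<delta>: "\<delta> > 0" "\<forall>z\<in>K. \<delta> < par_t z" using par_t_bound by blast
  show ?thesis
  proof (rule eventually_at_right_0I)
    show "0 < min \<delta> 1" using \<delta> by simp
    show "emb ` box_coords i R (min \<delta> 1) \<subseteq> model i"
    proof (rule image_subsetI)
      fix z assume z: "z \<in> box_coords i R (min \<delta> 1)"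
      have "z \<notin> K" using par_t_nonneg[OF z] \<delta>(2) by force
      moreover have "z \<in> box_coords i R 1" using z box_coords_mono[of "min \<delta> 1" 1] by auto
      ultimately have "emb z \<in> Dom i" unfolding K_def by simp
      then show "emb z \<in> model i" using z emb_model_iff by (cases z) auto
    qed
    show "emb ` box_coords i R \<delta> \<subseteq> model i" if "\<delta> \<le> \<delta>'" "emb ` box_coords i R \<delta>' \<subseteq> model i" for \<delta> \<delta>'
      using image_mono[OF box_coords_mono[OF that(1)], of emb i R] that(2) by (rule order_trans)
  qed
qed

definition real_box :: "nat \<Rightarrow> real \<Rightarrow> real \<Rightarrow> 'x set" where
  "real_box i R \<delta> = {x. \<exists>a c s \<tau>. real_pt i x a c s \<tau> \<and> 0 \<le> a \<and> a \<le> R \<and> 0 \<le> c \<and> c \<le> R \<and> s \<in> {s\<^sub>0..s\<^sub>1} \<and> 0 \<le> \<tau> \<and> \<tau> \<le> \<delta>}"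

lemma box_coords_point:
  assumes "i \<le> M" "emb ` box_coords i R \<delta> \<subseteq> model i" "(a, c, s, \<tau>) \<in> box_coords i R \<delta>"
  shows "real_pt i (chart_inv i (emb (a, c, s, \<tau>))) a c s \<tau>"
proof -
  have "emb (a, c, s, \<tau>) \<in> model i" using assms(2,3) by (rule subsetD[OF _ imageI])
  then show ?thesis unfolding real_pt_emb using chart_inv_point[OF assms(1)] by simp
qed

lemma real_box_image:
  assumes "i \<le> M" "emb ` box_coords i R \<delta> \<subseteq> model i"
  shows "real_box i R \<delta> = (\<lambda>z. chart_inv i (emb z)) ` box_coords i R \<delta>"
proof (intro equalityI subsetI)
  fix x assume "x \<in> real_box i R \<delta>"
  then obtain a c s \<tau> where x: "real_pt i x a c s \<tau>" and b: "0 \<le> a \<and> a \<le> R \<and> 0 \<le> c \<and> c \<le> R \<and> s \<in> {s\<^sub>0..s\<^sub>1} \<and> 0 \<le> \<tau> \<and> \<tau> \<le> \<delta>"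
    unfolding real_box_def by blast
  have "(a, c, s, \<tau>) \<in> box_coords i R \<delta>" unfolding box_coords_iff using b real_pt_eq[OF assms(1) x] by blast
  moreover have "x = chart_inv i (emb (a, c, s, \<tau>))"
    using x chart_inv_coords[OF assms(1), of x] unfolding real_pt_emb by simp
  ultimately show "x \<in> (\<lambda>z. chart_inv i (emb z)) ` box_coords i R \<delta>" by (rule rev_image_eqI)
next
  fix x assume "x \<in> (\<lambda>z. chart_inv i (emb z)) ` box_coords i R \<delta>"
  then obtain z where z: "z \<in> box_coords i R \<delta>" "x = chart_inv i (emb z)" by blast
  obtain a c s \<tau> where zz: "z = (a, c, s, \<tau>)" by (cases z) auto
  have "real_pt i x a c s \<tau>" using box_coords_point[OF assms, of a c s \<tau>] z zz by simp
  then show "x \<in> real_box i R \<delta>" using z(1) unfolding zz box_coords_iff real_box_def by blast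
qed

lemma chart_inv_emb_continuous:
  assumes "i \<le> M" "emb ` A \<subseteq> model i"
  shows "continuous_map (top_of_set A) (xtop X) (\<lambda>z. chart_inv i (emb z))"
proof -
  have "continuous_map (top_of_set A) (top_of_set (model i)) emb"
    using continuous_emb assms(2) by (auto simp: continuous_map_in_subtopology)
  from continuous_map_compose[OF this chart_inv_continuous[OF assms(1)]]
  show ?thesis by (simp add: continuous_map_in_subtopology o_def)
qed

lemma compact_real_box:
  assumes "i \<le> M" "emb ` box_coords i R \<delta> \<subseteq> model i"
  shows "compactin (xtop X) (real_box i R \<delta>)"
  unfolding real_box_image[OF assms]
  by (rule image_compactin[OF _ chart_inv_emb_continuous[OF assms]])
    (simp add: compactin_subtopology compact_box_coords)

text \<open>The points of the compact box that are in \<open>C\<close> but are mapped to the complement of \<open>G\<close> form a compact set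
  disjoint from the central fibre.\<close>

lemma open_tube:
  assumes i: "i \<le> M" and open_G: "openin (xtop X) G" and C: "closed C"
    and central: "\<And>x a c s. \<lbrakk>real_pt i x a c s 0; 0 \<le> a; 0 \<le> c; s \<in> {s\<^sub>0..s\<^sub>1}; (a, c, s, 0) \<in> C\<rbrakk> \<Longrightarrow> x \<in> G"
  shows "\<forall>\<^sub>F \<delta> in at_right 0. \<forall>x a c s \<tau>. real_pt i x a c s \<tau> \<and> (a, c, s, \<tau>) \<in> box_coords i R \<delta> \<inter> C \<longrightarrow> x \<in> G"
proof -
  have "\<exists>\<delta>\<^sub>0>0. emb ` box_coords i R \<delta>\<^sub>0 \<subseteq> model i"
  proof -
    have "\<forall>\<^sub>F \<delta> in at_right (0::real). 0 < \<delta> \<and> emb ` box_coords i R \<delta> \<subseteq> model i"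
      using eventually_conj[OF eventually_at_right_less[of 0] box_coords_model[OF i]] .
    from eventually_happens[OF this] show ?thesis by (auto simp: trivial_limit_at_right_real)
  qed
  then obtain \<delta>\<^sub>0 where \<delta>\<^sub>0: "\<delta>\<^sub>0 > 0" "emb ` box_coords i R \<delta>\<^sub>0 \<subseteq> model i" by blast
  let ?\<psi> = "\<lambda>z. chart_inv i (emb z)"
  define K where "K = box_coords i R \<delta>\<^sub>0 \<inter> C - {z \<in> box_coords i R \<delta>\<^sub>0. ?\<psi> z \<in> G}"
  have "openin (top_of_set (box_coords i R \<delta>\<^sub>0)) {z \<in> topspace (top_of_set (box_coords i R \<delta>\<^sub>0)). ?\<psi> z \<in> G}"
    by (rule openin_continuous_map_preimage[OF chart_inv_emb_continuous[OF i \<delta>\<^sub>0(2)] open_G])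
  then obtain T where T: "open T" "{z \<in> box_coords i R \<delta>\<^sub>0. ?\<psi> z \<in> G} = box_coords i R \<delta>\<^sub>0 \<inter> T"
    unfolding openin_open by auto
  have "K = box_coords i R \<delta>\<^sub>0 \<inter> (C \<inter> - T)" unfolding K_def T(2) by blast
  then have "compact K" using compact_Int_closed[OF compact_box_coords, of "C \<inter> - T" i R \<delta>\<^sub>0] C T(1) by (simp add: closed_Int closed_Compl)
  moreover have "0 < par_t z" if z: "z \<in> K" for z
  proof (rule ccontr)
    assume neg: "\<not> 0 < par_t z"
    obtain a c s \<tau> where zz: "z = (a, c, s, \<tau>)" by (cases z) auto
    have N: "(a, c, s, \<tau>) \<in> box_coords i R \<delta>\<^sub>0" and inC: "(a, c, s, \<tau>) \<in> C" and nO: "?\<psi> z \<notin> G" using z unfolding K_def zz by auto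
    have t0: "\<tau> = 0" using N neg zz unfolding box_coords_iff by simp
    have "real_pt i (?\<psi> z) a c s \<tau>" using box_coords_point[OF i \<delta>\<^sub>0(2) N] zz by simp
    then have "?\<psi> z \<in> G" using central[of "?\<psi> z" a c s] N inC unfolding t0 box_coords_iff by blast
    then show False using nO by simp
  qed
  ultimately obtain \<delta> where \<delta>: "\<delta> > 0" "\<forall>z\<in>K. \<delta> < par_t z" using par_t_bound by blast
  show ?thesis
  proof (rule eventually_at_right_0I)
    show "0 < min \<delta> \<delta>\<^sub>0" using \<delta> \<delta>\<^sub>0 by simp
    show "\<forall>x a c s \<tau>. real_pt i x a c s \<tau> \<and> (a, c, s, \<tau>) \<in> box_coords i R (min \<delta> \<delta>\<^sub>0) \<inter> C \<longrightarrow> x \<in> G"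
    proof (intro allI impI)
      fix x a c s \<tau> assume *: "real_pt i x a c s \<tau> \<and> (a, c, s, \<tau>) \<in> box_coords i R (min \<delta> \<delta>\<^sub>0) \<inter> C"
      then have "(a, c, s, \<tau>) \<notin> K" using \<delta>(2) par_t_nonneg[of "(a, c, s, \<tau>)" i R "min \<delta> \<delta>\<^sub>0"] by force
      moreover have "(a, c, s, \<tau>) \<in> box_coords i R \<delta>\<^sub>0" using * box_coords_mono[of "min \<delta> \<delta>\<^sub>0" \<delta>\<^sub>0 i R] by auto
      ultimately have "?\<psi> (a, c, s, \<tau>) \<in> G" using * unfolding K_def by blast
      moreover have "?\<psi> (a, c, s, \<tau>) = x" using * chart_inv_coords[OF i, of x] unfolding real_pt_emb by metis
      ultimately show "x \<in> G" by simp
    qed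
    show "\<forall>x a c s \<tau>. real_pt i x a c s \<tau> \<and> (a, c, s, \<tau>) \<in> box_coords i R \<delta> \<inter> C \<longrightarrow> x \<in> G"
      if "\<delta> \<le> \<delta>'" "\<forall>x a c s \<tau>. real_pt i x a c s \<tau> \<and> (a, c, s, \<tau>) \<in> box_coords i R \<delta>' \<inter> C \<longrightarrow> x \<in> G" for \<delta> \<delta>'
      using that(2) box_coords_mono[OF that(1), of i R] by blast
  qed
qed

lemma real_pt_central:
  assumes "i \<le> M" "real_pt i x a c s 0"
  shows "x \<in> fibre0 X" "a * c = 0" "a \<noteq> 0 \<longleftrightarrow> x \<in> orbit X (\<sigma> i)"
proof -
  have x: "x \<in> U i" "u i x = of_real a" "tp x = 0" using assms(2) unfolding real_pt_def by auto
  show f: "x \<in> fibre0 X" using x U_topspace[OF assms(1)] unfolding fibre0_tp by blast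
  show "a * c = 0" using real_pt_eq[OF assms] by (simp add: kink_power_0[OF assms(1)])
  show "a \<noteq> 0 \<longleftrightarrow> x \<in> orbit X (\<sigma> i)" using orbit_u[OF assms(1)] f x by simp
qed

lemma real_pt_central_v:
  assumes "i \<le> M" "real_pt (nxt S i) x a c s 0"
  shows "c \<noteq> 0 \<longleftrightarrow> x \<in> orbit X (\<sigma> i)"
proof -
  have "x \<in> U (nxt S i)" "v (nxt S i) x = of_real c" using assms(2) unfolding real_pt_def by auto
  then show ?thesis using orbit_v(1)[OF assms(1)] real_pt_central(1)[OF nxt_le assms(2)] by simp
qed

text \<open>In the central fibre, \<open>u\<^sub>i \<noteq> 0\<close> and \<open>v\<^sub>i\<^sub>+\<^sub>1 \<noteq> 0\<close> both describe the open stratum of \<open>\<sigma> i\<close>, which is contained in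
  the overlap.\<close>

lemma overlap_tube:
  assumes i: "i \<le> M" and r: "0 < r"
  shows "\<forall>\<^sub>F \<delta> in at_right 0. \<forall>x a c s \<tau>. real_pt i x a c s \<tau> \<and> (a, c, s, \<tau>) \<in> box_coords i R \<delta> \<inter> {z. r \<le> fst z} \<longrightarrow> x \<in> ov i"
    and "\<forall>\<^sub>F \<delta> in at_right 0. \<forall>x a c s \<tau>. real_pt (nxt S i) x a c s \<tau> \<and> (a, c, s, \<tau>) \<in> box_coords (nxt S i) R \<delta> \<inter> {z. r \<le> fst (snd z)} \<longrightarrow> x \<in> ov i"
proof -
  have cl: "closed {z :: real \<times> real \<times> real \<times> real. r \<le> fst z}" "closed {z :: real \<times> real \<times> real \<times> real. r \<le> fst (snd z)}"
    by (intro closed_Collect_le continuous_intros)+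
  show "\<forall>\<^sub>F \<delta> in at_right 0. \<forall>x a c s \<tau>. real_pt i x a c s \<tau> \<and> (a, c, s, \<tau>) \<in> box_coords i R \<delta> \<inter> {z. r \<le> fst z} \<longrightarrow> x \<in> ov i"
  proof (rule open_tube[OF i overlap_facts(1)[OF i] cl(1)])
    fix x a c s assume "real_pt i x a c s 0" "(a, c, s, 0::real) \<in> {z. r \<le> fst z}"
    then show "x \<in> ov i" using real_pt_central(3)[OF i, of x a c s] overlap_facts(2)[OF i] r by auto
  qed
  show "\<forall>\<^sub>F \<delta> in at_right 0. \<forall>x a c s \<tau>. real_pt (nxt S i) x a c s \<tau> \<and> (a, c, s, \<tau>) \<in> box_coords (nxt S i) R \<delta> \<inter> {z. r \<le> fst (snd z)} \<longrightarrow> x \<in> ov i"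
  proof (rule open_tube[OF nxt_le overlap_facts(1)[OF i] cl(2)])
    fix x a c s assume "real_pt (nxt S i) x a c s 0" "(a, c, s, 0::real) \<in> {z. r \<le> fst (snd z)}"
    then show "x \<in> ov i" using real_pt_central_v[OF i, of x a c s] overlap_facts(2)[OF i] r by auto
  qed
qed

text \<open>In the central fibre \<open>U\<^sub>i\<close> consists of strata of \<open>\<sigma> (i-1)\<close>, \<open>b i\<close> and \<open>\<sigma> i\<close>. None of these belongs to a chart
  that is not a neighbour.\<close>

lemma separated_tube:
  assumes ij: "i \<le> M" "j \<le> M" "i \<noteq> j" "nxt S i \<noteq> j" "nxt S j \<noteq> i"
  shows "\<forall>\<^sub>F \<delta> in at_right 0. real_box i R \<delta> \<inter> real_box j R \<delta> = {}"
proof -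
  have "\<exists>\<delta>\<^sub>0>0. emb ` box_coords j R \<delta>\<^sub>0 \<subseteq> model j"
  proof -
    have "\<forall>\<^sub>F \<delta> in at_right (0::real). 0 < \<delta> \<and> emb ` box_coords j R \<delta> \<subseteq> model j"
      using eventually_conj[OF eventually_at_right_less[of 0] box_coords_model[OF ij(2)]] .
    from eventually_happens[OF this] show ?thesis by (auto simp: trivial_limit_at_right_real)
  qed
  then obtain \<delta>\<^sub>0 where \<delta>\<^sub>0: "\<delta>\<^sub>0 > 0" "emb ` box_coords j R \<delta>\<^sub>0 \<subseteq> model j" by blast
  let ?O = "topspace (xtop X) - real_box j R \<delta>\<^sub>0"
  have O: "openin (xtop X) ?O"
    using compactin_imp_closedin[OF haus compact_real_box[OF ij(2) \<delta>\<^sub>0(2)]] by (rule openin_diff[OF openin_topspace])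
  obtain i' where i': "i' \<le> M" "i = nxt S i'" using nxt_cases[OF ij(1)] by blast
  obtain j' where j': "j' \<le> M" "j = nxt S j'" using nxt_cases[OF ij(2)] by blast
  have "\<forall>\<^sub>F \<delta> in at_right 0. \<forall>x a c s \<tau>. real_pt i x a c s \<tau> \<and> (a, c, s, \<tau>) \<in> box_coords i R \<delta> \<inter> UNIV \<longrightarrow> x \<in> ?O"
  proof (rule open_tube[OF ij(1) O closed_UNIV])
    fix x a c s assume x: "real_pt i x a c s 0"
    note f = real_pt_central(1)[OF ij(1) x]
    have xU: "x \<in> U i" using x unfolding real_pt_def by blast
    have "x \<notin> U j"
    proof
      assume xj: "x \<in> U j"
      have "x \<in> orbit X (\<sigma> i) \<union> orbit X (b i) \<union> orbit X (\<sigma> i')"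
        using orbit_v(2)[OF i'(1)] f xU unfolding i'(2)[symmetric] by blast
      then obtain \<rho> where \<rho>: "\<rho> \<in> {\<sigma> i, b i, \<sigma> i'}" "x \<in> orbit X \<rho>" by blast
      have "x \<in> orbit X (\<sigma> j) \<union> orbit X (b j) \<union> orbit X (\<sigma> j')"
        using orbit_v(2)[OF j'(1)] f xj unfolding j'(2)[symmetric] by blast
      then obtain \<rho>' where \<rho>': "\<rho>' \<in> {\<sigma> j, b j, \<sigma> j'}" "x \<in> orbit X \<rho>'" by blast
      have cells: "\<sigma> i \<in> cells S" "\<sigma> i' \<in> cells S" "b i \<in> cells S" "\<sigma> j \<in> cells S" "\<sigma> j' \<in> cells S" "b j \<in> cells S"
        using cell_in_cells[OF ucell_Pmax] edge_in_cells[OF uedge_edges] ij i' j' by simp_all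
      then have "\<rho> = \<rho>'" using orbit_eq[OF _ _ \<rho>(2) \<rho>'(2)] \<rho>(1) \<rho>'(1) by blast
      moreover have "\<sigma> p \<noteq> b q" if "p \<le> M" "q \<le> M" for p q
        using edge_not_cell[OF uedge_edges[OF that(2)]] ucell_Pmax[OF that(1)] by metis
      moreover have "i' \<noteq> j'" "i' \<noteq> j" "i \<noteq> j'" using ij i' j' by auto
      ultimately show False using \<rho>(1) \<rho>'(1) ucell_inj uedge_inj ij i' j' by (metis empty_iff insert_iff)
    qed
    then show "x \<in> ?O" using U_topspace[OF ij(1)] xU unfolding real_box_def real_pt_def by blast
  qed
  moreover have "\<forall>\<^sub>F \<delta> in at_right 0. \<delta> \<le> \<delta>\<^sub>0"
    by (rule eventually_at_right_0I[OF \<delta>\<^sub>0(1)]) auto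
  ultimately show ?thesis
  proof eventually_elim
    case (elim \<delta>)
    show ?case
    proof (rule ccontr)
      assume "real_box i R \<delta> \<inter> real_box j R \<delta> \<noteq> {}"
      then obtain x where x: "x \<in> real_box i R \<delta>" "x \<in> real_box j R \<delta>" by blast
      have "x \<in> real_box j R \<delta>\<^sub>0" using x(2) elim(2) unfolding real_box_def by (elim CollectE exE conjE) (rule CollectI, intro exI conjI, (assumption | simp)+)
      moreover obtain a c s \<tau> where "real_pt i x a c s \<tau>" "(a, c, s, \<tau>) \<in> box_coords i R \<delta>"
        using x(1) real_pt_eq[OF ij(1)] unfolding real_box_def box_coords_iff by blast
      ultimately show False using elim(1) by blast
    qed
  qed
qed

subsection \<open>The 2-form and coordinate changes\<close>

definition Ustar :: "nat \<Rightarrow> 'x set" where "Ustar i = {x \<in> U i. u i x \<noteq> 0}"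

text \<open>Where \<open>u\<^sub>i \<noteq> 0\<close>, the remaining coordinate is \<open>v\<^sub>i = f t\<^sup>\<kappa> / u\<^sub>i\<close>, so \<open>(w, u\<^sub>i, t)\<close> are coordinates there.\<close>

definition lift :: "nat \<Rightarrow> complex ^ 3 \<Rightarrow> complex ^ 4" where
  "lift i z = vector [z $ 2, slabf i (z $ 1) (z $ 3) * z $ 3 ^ \<kappa> i / z $ 2, z $ 1, z $ 3]"

definition proj :: "complex ^ 4 \<Rightarrow> complex ^ 3" where
  "proj z = vector [z $ 3, z $ 1, z $ 4]"

definition Dom3 :: "nat \<Rightarrow> (complex ^ 3) set" where
  "Dom3 i = {z. z $ 1 \<noteq> 0 \<and> z $ 2 \<noteq> 0 \<and> lift i z \<in> Dom i}"

abbreviation "wut i \<equiv> rel_map X w (u i)"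

lemma wut_proj: "wut i x = proj (coords i x)"
  unfolding rel_map_def proj_def coords_nth ..

lemma wut_nth: "wut i x $ 1 = w x" "wut i x $ 2 = u i x" "wut i x $ 3 = tp x"
  unfolding rel_map_def by simp_all

lemma vec3_eq: "(x :: 'a ^ 3) = y \<longleftrightarrow> x $ 1 = y $ 1 \<and> x $ 2 = y $ 2 \<and> x $ 3 = y $ 3"
  by (simp add: vec_eq_iff forall_3)

definition torus3 :: "(complex ^ 3) set" where "torus3 = {z. z $ 1 \<noteq> 0 \<and> z $ 2 \<noteq> 0}"

lemma open_torus3: "open torus3"
proof -
  have eq: "torus3 = - {z. z $ 1 = 0} \<inter> - {z. z $ 2 = 0}" unfolding torus3_def by auto
  have cl: "closed {z :: complex ^ 3. z $ j = 0}" for j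
    by (intro closed_Collect_eq continuous_intros)
  show ?thesis unfolding eq by (intro open_Int open_Compl cl)
qed

lemma holomorphic_lift: "holomorphic_several (\<lambda>z. lift i z $ j) torus3"
proof -
  note o = open_torus3
  have "holomorphic_several (\<lambda>z. lift i z $ 2) torus3"
    unfolding lift_def vector4 divide_inverse
    by (intro holomorphic_several_mult holomorphic_several_out_eval holomorphic_several_power holomorphic_several_inverse
        holomorphic_several_nth o) (auto simp: torus3_def)
  moreover have "holomorphic_several (\<lambda>z. lift i z $ 1) torus3" "holomorphic_several (\<lambda>z. lift i z $ 3) torus3"
    "holomorphic_several (\<lambda>z. lift i z $ 4) torus3"
    unfolding lift_def vector4 by (intro holomorphic_several_nth o)+
  ultimately show ?thesis using exhaust_4[of j] by auto
qed

lemma holomorphic_proj: "holomorphic_several (\<lambda>z. proj z $ j) UNIV"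
proof -
  have "holomorphic_several (\<lambda>z. proj z $ 1) UNIV" "holomorphic_several (\<lambda>z. proj z $ 2) UNIV"
    "holomorphic_several (\<lambda>z. proj z $ 3) UNIV"
    unfolding proj_def vector_3 by (intro holomorphic_several_nth open_UNIV)+
  then show ?thesis using exhaust_3[of j] by auto
qed

lemma continuous_lift: "continuous_on torus3 (lift i)"
  unfolding lift_def by (intro continuous_intros) (auto simp: torus3_def)

lemma continuous_proj: "continuous_on A proj"
  unfolding proj_def by (intro continuous_intros)

lemma open_Dom3: assumes "i \<le> M" shows "open (Dom3 i)"
proof -
  have "open (torus3 \<inter> lift i -` Dom i)"
    by (rule continuous_open_preimage[OF continuous_lift open_torus3 Dom_open[OF assms]])
  moreover have "torus3 \<inter> lift i -` Dom i = Dom3 i" unfolding torus3_def Dom3_def by auto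
  ultimately show ?thesis by simp
qed

lemma lift_model: "z \<in> Dom3 i \<Longrightarrow> lift i z \<in> model i"
  unfolding model_def Dom3_def by (auto simp: lift_def vector4)

lemma proj_lift: "proj (lift i z) = z"
  unfolding proj_def lift_def vector4 by (simp add: vec3_eq)

lemma lift_wut:
  assumes i: "i \<le> M" and x: "x \<in> Ustar i" shows "lift i (wut i x) = coords i x" "wut i x \<in> Dom3 i"
proof -
  have xU: "x \<in> U i" and ux: "u i x \<noteq> 0" using x unfolding Ustar_def by auto
  show 1: "lift i (wut i x) = coords i x"
    unfolding vec4_eq lift_def vector4 coords_nth wut_nth using uv_eq(1)[OF i xU] ux by (simp add: field_simps)
  have "coords i x \<in> Dom i" using coords_image[OF i] xU unfolding model_def by blast
  then show "wut i x \<in> Dom3 i" unfolding Dom3_def using uv_eq(2)[OF i xU] ux 1 by (simp add: wut_nth)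
qed

lemma Ustar_open: assumes i: "i \<le> M" shows "openin (xtop X) (Ustar i)"
proof -
  let ?G = "{y \<in> topspace (subtopology (xtop X) (U i)). coords i y \<in> - {z. z $ 1 = 0}}"
  have "closed {z :: complex ^ 4. z $ 1 = 0}" by (intro closed_Collect_eq continuous_intros)
  then have "openin (subtopology (xtop X) (U i)) ?G"
    by (intro openin_continuous_map_preimage[OF coords_continuous[OF i]]) (simp add: open_Compl)
  then have "openin (xtop X) ?G" using U_open[OF i] openin_trans_full by blast
  moreover have "?G = Ustar i" unfolding Ustar_def using U_topspace[OF i] by (auto simp: coords_nth)
  ultimately show ?thesis by simp
qed

lemma Ustar_topspace: "i \<le> M \<Longrightarrow> topspace (subtopology (xtop X) (Ustar i)) = Ustar i"
  using openin_subset[OF Ustar_open] by (simp add: Int_absorb1)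

lemma Ustar_sub: "Ustar i \<subseteq> U i"
  unfolding Ustar_def by blast

lemma wut_homeo:
  assumes i: "i \<le> M"
  shows "homeomorphic_map (subtopology (xtop X) (Ustar i)) (top_of_set (Dom3 i)) (wut i)"
  unfolding homeomorphic_map_maps
proof (rule exI[of _ "\<lambda>z. chart_inv i (lift i z)"], unfold homeomorphic_maps_def, intro conjI ballI)
  have "continuous_map (subtopology (xtop X) (Ustar i)) euclidean (coords i)"
    using continuous_map_from_subtopology_mono[OF coords_continuous[OF i] Ustar_sub] .
  from continuous_map_compose[OF this, of euclidean proj]
  have "continuous_map (subtopology (xtop X) (Ustar i)) euclidean (wut i)"
    using continuous_proj[of UNIV] by (simp add: o_def wut_proj[abs_def])
  then show "continuous_map (subtopology (xtop X) (Ustar i)) (top_of_set (Dom3 i)) (wut i)"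
    using lift_wut(2)[OF i] Ustar_topspace[OF i] by (auto simp: continuous_map_in_subtopology)
  have inv: "chart_inv i (lift i z) \<in> Ustar i \<and> wut i (chart_inv i (lift i z)) = z" if z: "z \<in> Dom3 i" for z
  proof -
    note p = chart_inv_point[OF i lift_model[OF z]]
    have "wut i (chart_inv i (lift i z)) = z" unfolding wut_proj p(2) proj_lift ..
    moreover from this have "u i (chart_inv i (lift i z)) = z $ 2" using wut_nth(2)[of i "chart_inv i (lift i z)"] by simp
    moreover have "z $ 2 \<noteq> 0" using z unfolding Dom3_def by blast
    ultimately show ?thesis using p(1) unfolding Ustar_def by simp
  qed
  have "continuous_on (Dom3 i) (lift i)" by (rule continuous_on_subset[OF continuous_lift]) (auto simp: Dom3_def torus3_def)
  then have "continuous_map (top_of_set (Dom3 i)) (top_of_set (model i)) (lift i)"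
    using lift_model by (auto simp: continuous_map_in_subtopology)
  from continuous_map_compose[OF this chart_inv_continuous[OF i]]
  have "continuous_map (top_of_set (Dom3 i)) (xtop X) (\<lambda>z. chart_inv i (lift i z))"
    by (simp add: continuous_map_in_subtopology o_def)
  then show "continuous_map (top_of_set (Dom3 i)) (subtopology (xtop X) (Ustar i)) (\<lambda>z. chart_inv i (lift i z))"
    using inv by (auto simp: continuous_map_in_subtopology)
  show "chart_inv i (lift i (wut i x)) = x" if "x \<in> topspace (subtopology (xtop X) (Ustar i))" for x
  proof -
    have x: "x \<in> Ustar i" using that Ustar_topspace[OF i] by simp
    then show ?thesis using lift_wut(1)[OF i x] chart_inv_coords[OF i, of x] Ustar_sub by auto
  qed
  show "wut i (chart_inv i (lift i z)) = z" if "z \<in> topspace (top_of_set (Dom3 i))" for z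
    using inv that by simp
qed

text \<open>The maps \<open>lift\<close> and \<open>proj\<close> are holomorphic and inverse to each other on the part of the hypersurface with
  nonzero first coordinate. So being locally a holomorphic function of three or of four coordinates is the same.\<close>

lemma wut_model_chart:
  assumes i: "i \<le> M" shows "model_chart X (Ustar i) (wut i) (Dom3 i)"
  unfolding model_chart_def
proof (intro conjI allI impI Ustar_open[OF i] wut_homeo[OF i])
  fix V' h assume V': "openin (xtop X) V' \<and> V' \<subseteq> Ustar i"
  then have VU: "V' \<subseteq> U i" using Ustar_sub by blast
  have "\<forall>V' h. openin (xtop X) V' \<and> V' \<subseteq> U i \<longrightarrow>
        (h \<in> hol X V' \<longleftrightarrow> (\<forall>x\<in>V'. \<exists>N H. coords i x \<in> N \<and> holomorphic_several H N \<and>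
           (\<forall>y\<in>V'. coords i y \<in> N \<longrightarrow> h y = H (coords i y))))"
    using chart_model[OF i] unfolding model_chart_def by (elim conjE) assumption
  then have eq: "h \<in> hol X V' \<longleftrightarrow> (\<forall>x\<in>V'. \<exists>N H. coords i x \<in> N \<and> holomorphic_several H N \<and>
           (\<forall>y\<in>V'. coords i y \<in> N \<longrightarrow> h y = H (coords i y)))"
    using V' VU by simp
  show "h \<in> hol X V' \<longleftrightarrow> (\<forall>x\<in>V'. \<exists>N H. wut i x \<in> N \<and> holomorphic_several H N \<and>
           (\<forall>y\<in>V'. wut i y \<in> N \<longrightarrow> h y = H (wut i y)))"
    unfolding eq
  proof (rule ball_cong[OF refl], rule iffI)
    fix x assume x: "x \<in> V'"
    have r: "lift i (wut i y) = coords i y" "wut i y \<in> torus3" if "y \<in> V'" for y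
    proof -
      have y: "y \<in> Ustar i" using that V' by blast
      show "lift i (wut i y) = coords i y" by (rule lift_wut(1)[OF i y])
      show "wut i y \<in> torus3" using lift_wut(2)[OF i y] unfolding Dom3_def torus3_def by simp
    qed
    {
      assume "\<exists>N H. coords i x \<in> N \<and> holomorphic_several H N \<and> (\<forall>y\<in>V'. coords i y \<in> N \<longrightarrow> h y = H (coords i y))"
      then obtain N H where N: "coords i x \<in> N" "holomorphic_several H N" "\<forall>y\<in>V'. coords i y \<in> N \<longrightarrow> h y = H (coords i y)"
        by blast
      have "holomorphic_several (\<lambda>z. H (lift i z)) {z \<in> torus3. lift i z \<in> N}"
        by (rule holomorphic_several_compose[OF N(2) holomorphic_lift])
      then show "\<exists>N H. wut i x \<in> N \<and> holomorphic_several H N \<and> (\<forall>y\<in>V'. wut i y \<in> N \<longrightarrow> h y = H (wut i y))"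
        using N(1,3) r x by (intro exI[of _ "{z \<in> torus3. lift i z \<in> N}"] exI[of _ "\<lambda>z. H (lift i z)"]) auto
    }
    {
      assume "\<exists>N H. wut i x \<in> N \<and> holomorphic_several H N \<and> (\<forall>y\<in>V'. wut i y \<in> N \<longrightarrow> h y = H (wut i y))"
      then obtain N H where N: "wut i x \<in> N" "holomorphic_several H N" "\<forall>y\<in>V'. wut i y \<in> N \<longrightarrow> h y = H (wut i y)"
        by blast
      have "holomorphic_several (\<lambda>z. H (proj z)) {z \<in> UNIV. proj z \<in> N}"
        by (rule holomorphic_several_compose[OF N(2) holomorphic_proj])
      then show "\<exists>N H. coords i x \<in> N \<and> holomorphic_several H N \<and> (\<forall>y\<in>V'. coords i y \<in> N \<longrightarrow> h y = H (coords i y))"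
        using N(1,3) unfolding wut_proj
        by (intro exI[of _ "{z \<in> UNIV. proj z \<in> N}"] exI[of _ "\<lambda>z. H (proj z)"]) auto
    }
  qed
qed

lemma wut_rel_coords: "i \<le> M \<Longrightarrow> rel_coords X (Ustar i) w (u i)"
  unfolding rel_coords_def using open_Dom3 wut_model_chart by blast

lemma wut_inj: "i \<le> M \<Longrightarrow> inj_on (wut i) (Ustar i)"
  using wut_homeo[of i] Ustar_topspace[of i] by (simp add: homeomorphic_eq_everything_map)

lemma wut_open_image:
  assumes i: "i \<le> M" and G: "openin (xtop X) G" "G \<subseteq> Ustar i" shows "open (wut i ` G)"
proof -
  have "openin (subtopology (xtop X) (Ustar i)) G" using G by (simp add: openin_subset_topspace_eq openin_subtopology Int_absorb2) (metis inf.absorb_iff1)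
  then have "openin (top_of_set (Dom3 i)) (wut i ` G)"
    using homeomorphic_imp_open_map[OF wut_homeo[OF i]] unfolding open_map_def by blast
  then show ?thesis using open_Dom3[OF i] by (simp add: openin_open_eq)
qed

text \<open>The function \<open>u\<^sub>j\<close> is holomorphic on the intersection because it is one of the coordinates of the second
  chart. Therefore it is locally a holomorphic function of the coordinates of the first one.\<close>

lemma local_expression:
  assumes ij: "i \<le> M" "j \<le> M" and x: "x \<in> Ustar i \<inter> Ustar j"
  obtains N H where "open N" "wut i x \<in> N" "N \<subseteq> wut i ` (Ustar i \<inter> Ustar j)" "holomorphic_several H N"
    "\<And>y. y \<in> Ustar i \<inter> Ustar j \<Longrightarrow> wut i y \<in> N \<Longrightarrow> u j y = H (wut i y)"
proof -
  let ?W = "Ustar i \<inter> Ustar j"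
  have W: "openin (xtop X) ?W" using Ustar_open[OF ij(1)] Ustar_open[OF ij(2)] by (rule openin_Int)
  have h: "\<And>i V' h. i \<le> M \<Longrightarrow> openin (xtop X) V' \<and> V' \<subseteq> Ustar i \<Longrightarrow>
        (h \<in> hol X V' \<longleftrightarrow> (\<forall>x\<in>V'. \<exists>N H. wut i x \<in> N \<and> holomorphic_several H N \<and>
           (\<forall>y\<in>V'. wut i y \<in> N \<longrightarrow> h y = H (wut i y))))"
    using wut_model_chart unfolding model_chart_def by simp
  have "u j \<in> hol X ?W"
    unfolding h[OF ij(2) conjI[OF W Int_lower2]]
  proof
    fix y
    have "holomorphic_several (\<lambda>z::complex ^ 3. z $ 2) UNIV" by (rule holomorphic_several_nth[OF open_UNIV])
    then show "\<exists>N H. wut j y \<in> N \<and> holomorphic_several H N \<and> (\<forall>z\<in>?W. wut j z \<in> N \<longrightarrow> u j z = H (wut j z))"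
      by (intro exI[of _ UNIV] exI[of _ "\<lambda>z. z $ 2"]) (auto simp: wut_nth)
  qed
  then obtain N H where N: "wut i x \<in> N" "holomorphic_several H N" "\<forall>y\<in>?W. wut i y \<in> N \<longrightarrow> u j y = H (wut i y)"
    unfolding h[OF ij(1) conjI[OF W Int_lower1]] using x by blast
  let ?N = "N \<inter> wut i ` ?W"
  have o: "open ?N" using holomorphic_several_open[OF N(2)] wut_open_image[OF ij(1) W] by (intro open_Int) auto
  show thesis
    by (rule that[OF o _ _ holomorphic_several_subset[OF N(2) o]]) (use N(1,3) x in auto)
qed

lemma rel_partial_eq:
  assumes ij: "i \<le> M" and N: "open N" "wut i x \<in> N" "N \<subseteq> wut i ` W'" "W' \<subseteq> Ustar i"
    and f: "\<And>y. y \<in> W' \<Longrightarrow> wut i y \<in> N \<Longrightarrow> f y = H (wut i y)"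
    and H: "(H has_derivative H') (at (wut i x))" "\<And>c y. H' (c *s y) = c * H' y"
  shows "rel_partial X (Ustar i) w (u i) f l x = H' (axis l 1)"
proof -
  let ?z = "wut i x" and ?\<gamma> = "\<lambda>\<zeta>. wut i x + \<zeta> *s axis l (1::complex)"
  have eq: "f (inv_into (Ustar i) (wut i) z) = H z" if z: "z \<in> N" for z
  proof -
    obtain y where y: "y \<in> W'" "z = wut i y" using z N(3) by blast
    then have "inv_into (Ustar i) (wut i) z = y" using inv_into_f_f[OF wut_inj[OF ij]] N(4) by auto
    then show ?thesis using f[OF y(1)] z y(2) by simp
  qed
  have lin: "bounded_linear (\<lambda>\<zeta>. \<zeta> *s axis l (1::complex))"
    by (intro linear_conv_bounded_linear[THEN iffD1] linearI) (auto simp: vec_eq_iff algebra_simps)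
  have g: "(?\<gamma> has_derivative (\<lambda>\<zeta>. \<zeta> *s axis l 1)) (at 0)"
    using has_derivative_add[OF has_derivative_const bounded_linear_imp_has_derivative[OF lin]] by simp
  have "(H has_derivative H') (at (?\<gamma> 0))" using H(1) by simp
  from has_derivative_compose[OF g this]
  have "((\<lambda>\<zeta>. H (?\<gamma> \<zeta>)) has_derivative (\<lambda>\<zeta>. \<zeta> * H' (axis l 1))) (at 0)" by (simp only: H(2))
  then have "((\<lambda>\<zeta>. H (?\<gamma> \<zeta>)) has_field_derivative H' (axis l 1)) (at 0)"
    unfolding has_field_derivative_def using ext[of "\<lambda>\<zeta>. \<zeta> * H' (axis l 1)" "(*) (H' (axis l 1))", OF mult.commute]
    by (simp only:)
  note D = this
  have ev: "\<forall>\<^sub>F \<zeta> in nhds 0. H (?\<gamma> \<zeta>) = f (inv_into (Ustar i) (wut i) (?\<gamma> \<zeta>))"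
  proof -
    have "continuous_on UNIV ?\<gamma>"
      by (intro continuous_on_add continuous_on_const linear_continuous_on lin)
    then have "open (?\<gamma> -` N)" using N(1) by (intro open_vimage)
    moreover have "0 \<in> ?\<gamma> -` N" using N(2) by simp
    ultimately have "\<forall>\<^sub>F \<zeta> in nhds 0. \<zeta> \<in> ?\<gamma> -` N" by (rule eventually_nhds_in_open)
    then show ?thesis by (rule eventually_mono) (simp add: eq)
  qed
  have "((\<lambda>\<zeta>. f (inv_into (Ustar i) (wut i) (?\<gamma> \<zeta>))) has_field_derivative H' (axis l 1)) (at 0)"
    by (rule iffD1[OF DERIV_cong_ev[OF refl ev refl] D])
  then show ?thesis unfolding rel_partial_def by (rule DERIV_imp_deriv)
qed

text \<open>The coefficients of the 2-form in the two charts are \<open>1 / (w u\<^sub>i)\<close> and \<open>1 / (w u\<^sub>j)\<close>, and their quotient is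
  the relative Jacobian. It reduces to the derivative of \<open>u\<^sub>j\<close> by \<open>u\<^sub>i\<close> since \<open>w\<close> is a coordinate in both
  charts.\<close>

lemma transition_derivative:
  assumes ij: "i \<le> M" "j \<le> M" and x: "x \<in> Ustar i \<inter> Ustar j"
  obtains N H H' where "open N" "wut i x \<in> N" "(H has_derivative H') (at (wut i x))"
    "\<And>y. y \<in> Ustar i \<inter> Ustar j \<Longrightarrow> wut i y \<in> N \<Longrightarrow> u j y = H (wut i y)"
    "\<And>c y. H' (c *s y) = c * H' y" "H' (axis 2 1) = u j x / u i x"
proof -
  let ?W = "Ustar i \<inter> Ustar j"
  obtain N H where N: "open N" "wut i x \<in> N" "N \<subseteq> wut i ` ?W" and H: "holomorphic_several H N"
    and eq: "\<And>y. y \<in> ?W \<Longrightarrow> wut i y \<in> N \<Longrightarrow> u j y = H (wut i y)"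
    using local_expression[OF ij x] by blast
  obtain H' where H': "(H has_derivative H') (at (wut i x))" "\<And>c y. H' (c *s y) = c * H' y"
    using holomorphic_severalE[OF H N(2)] by blast
  have b: "rel_partial X (Ustar i) w (u i) (u j) 2 x = H' (axis 2 1)"
    by (rule rel_partial_eq[OF ij(1) N Int_lower1 eq H'])
  have w1: "rel_partial X (Ustar i) w (u i) w l x = axis l 1 $ 1" for l
    by (rule rel_partial_eq[OF ij(1) N Int_lower1, where H = "\<lambda>z. z $ 1" and H' = "\<lambda>z. z $ 1"])
      (auto simp: wut_nth intro: bounded_linear_imp_has_derivative bounded_linear_vec_nth)
  have jac: "rel_jacobian X (Ustar i) w (u i) w (u j) x = H' (axis 2 1)"
    unfolding rel_jacobian_def b w1 by (simp add: axis_def)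
  have "form2 X x w (u i) = rel_jacobian X (Ustar i) w (u i) w (u j) x * form2 X x w (u j)"
    using form wut_rel_coords ij x unfolding relative_2form_def by blast
  moreover have xx: "x \<in> U i" "x \<in> U j" "u i x \<noteq> 0" "u j x \<noteq> 0" using x unfolding Ustar_def by auto
  ultimately have "1 / (w x * u i x) = H' (axis 2 1) * (1 / (w x * u j x))"
    using form_u[OF ij(1) xx(1,3)] form_u[OF ij(2) xx(2,4)] jac by simp
  then have "H' (axis 2 1) = u j x / u i x" using xx uv_eq(2)[OF ij(1) xx(1)] by (simp add: field_simps)
  then show thesis using that N(1,2) H' eq by blast
qed

end

section \<open>Pieces of the positive real cylinder\<close>

context cyl_family begin

text \<open>The number \<open>A\<close> bounds the slab and gluing functions and their inverses on \<open>[s\<^sub>0, s\<^sub>1] \<times> [0, \<delta>]\<close>, and the boxes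
  \<open>0 \<le> u\<^sub>i, v\<^sub>i \<le> A\<^sup>2 + 1\<close> are used. Points of a box with \<open>u\<^sub>i \<ge> 1\<close> have \<open>v\<^sub>i\<^sub>+\<^sub>1 < A\<close>, and points with
  \<open>v\<^sub>i\<^sub>+\<^sub>1 \<ge> 1 / A\<close> have \<open>u\<^sub>i < A\<^sup>2\<close>. Thus a point on the rim of one box is an inner point of the next or of the
  previous box. The first conditions on \<open>\<delta>\<close> make the other coordinate of such a point smaller than \<open>1 / A\<close>.\<close>

definition adapted :: "real \<Rightarrow> real \<Rightarrow> bool" where
  "adapted A \<delta> \<longleftrightarrow> 0 < \<delta> \<and> \<delta> \<le> 1 \<and> A * A * A * (A * A + 1) * \<delta> < 1 \<and> bounds A \<delta> \<and>
     (\<forall>i\<in>{..M}. (continuous_on (rbox \<delta>) (\<lambda>z. gr i (fst z) (snd z)) \<and> cong_mod k s\<^sub>0 s\<^sub>1 \<delta> (gr i) (gr_mod i)) \<and>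
       emb ` box_coords i (A * A + 1) \<delta> \<subseteq> model i \<and>
       (\<forall>x a c s \<tau>. real_pt i x a c s \<tau> \<and> (a, c, s, \<tau>) \<in> box_coords i (A * A + 1) \<delta> \<inter> {z. 1 \<le> fst z} \<longrightarrow> x \<in> ov i) \<and>
       (\<forall>x a c s \<tau>. real_pt (nxt S i) x a c s \<tau> \<and> (a, c, s, \<tau>) \<in> box_coords (nxt S i) (A * A + 1) \<delta> \<inter> {z. 1 / A \<le> fst (snd z)} \<longrightarrow> x \<in> ov i)) \<and>
     (\<forall>i\<in>{..M}. \<forall>j\<in>{..M}. i \<noteq> j \<and> nxt S i \<noteq> j \<and> nxt S j \<noteq> i \<longrightarrow> real_box i (A * A + 1) \<delta> \<inter> real_box j (A * A + 1) \<delta> = {})"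

lemma adapted_exists: "\<exists>A \<delta>. 1 < A \<and> adapted A \<delta>"
proof -
  obtain A where A: "A > 1" "\<forall>\<^sub>F \<delta> in at_right 0. bounds A \<delta>" using bounds_exist by blast
  have small: "\<forall>\<^sub>F \<delta> in at_right 0. A * A * A * (A * A + 1) * \<delta> < 1"
  proof -
    define c where "c = A * A * A * (A * A + 1)"
    have c: "c > 0" unfolding c_def using A(1) by (intro mult_pos_pos add_pos_pos) auto
    show ?thesis unfolding c_def[symmetric]
    proof (rule eventually_at_right_0I)
      show "0 < 1 / (2 * c)" using c by simp
      show "c * (1 / (2 * c)) < 1" using c by simp
      show "c * \<delta> < 1" if "\<delta> \<le> \<delta>'" "c * \<delta>' < 1" for \<delta> \<delta>'
        using mult_left_mono[OF that(1), of c] c that(2) by linarith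
    qed
  qed
  have one: "\<forall>\<^sub>F \<delta> in at_right (0::real). \<delta> \<le> 1" by (rule eventually_at_right_0I[of 1]) auto
  have sep: "\<forall>\<^sub>F \<delta> in at_right 0. i \<noteq> j \<and> nxt S i \<noteq> j \<and> nxt S j \<noteq> i \<longrightarrow>
      real_box i (A * A + 1) \<delta> \<inter> real_box j (A * A + 1) \<delta> = {}" if "i \<le> M" "j \<le> M" for i j
  proof (cases "i \<noteq> j \<and> nxt S i \<noteq> j \<and> nxt S j \<noteq> i")
    case True
    then have "\<forall>\<^sub>F \<delta> in at_right 0. real_box i (A * A + 1) \<delta> \<inter> real_box j (A * A + 1) \<delta> = {}"
      by (intro separated_tube that) auto
    then show ?thesis by (rule eventually_mono) simp
  qed auto
  have "0 < 1 / A" using A(1) by simp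
  note ov = overlap_tube(1)[OF _ zero_less_one] overlap_tube(2)[OF _ this]
  have "\<forall>\<^sub>F \<delta> in at_right 0. adapted A \<delta>"
    unfolding adapted_def
    by (intro eventually_conj eventually_ball_finite finite_atMost ballI eventually_at_right_less
        A(2) small one gr_tube(1) box_coords_model ov sep) auto
  from eventually_happens[OF this] show ?thesis using A(1) by (auto simp: trivial_limit_at_right_real)
qed

definition prv :: "nat \<Rightarrow> nat" where "prv = inv_into {..M} (nxt S)"

lemma prv: "i \<le> M \<Longrightarrow> prv i \<le> M" "i \<le> M \<Longrightarrow> nxt S (prv i) = i" "i \<le> M \<Longrightarrow> prv (nxt S i) = i"
proof -
  have inj: "inj_on (nxt S) {..M}" and im: "nxt S ` {..M} = {..M}" using nxt_bij unfolding bij_betw_def by auto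
  show "i \<le> M \<Longrightarrow> prv (nxt S i) = i" unfolding prv_def using inv_into_f_f[OF inj, of i] by simp
  assume "i \<le> M"
  then have "i \<in> nxt S ` {..M}" unfolding im by simp
  then show "prv i \<le> M" "nxt S (prv i) = i" unfolding prv_def
    using inv_into_into[of i "nxt S" "{..M}"] f_inv_into_f[of i "nxt S" "{..M}"] by auto
qed

end

locale cyl_tube = cyl_family k S W X s\<^sub>0 s\<^sub>1
  for k :: nat and S :: "'b cyl_surface" and W :: "'b wall_str" and X :: "('b, 'x) family" and s\<^sub>0 s\<^sub>1 :: real +
  fixes A \<delta> :: real
  assumes A1: "1 < A" and adapted: "adapted A \<delta>"
begin

abbreviation "R \<equiv> A * A + 1"

lemma A0: "0 < A" using A1 by simp

lemma A_less_R: "A < R" "A * A < R" "1 < R"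
proof -
  have "A * 1 < A * A" using A1 by (intro mult_strict_left_mono) auto
  then show "A < R" "A * A < R" "1 < R" using A1 by linarith+
qed

lemma inv_A: "0 < 1 / A" "1 / A < 1" using A1 by auto

lemma \<delta>0: "0 < \<delta>" and \<delta>1: "\<delta> \<le> 1" and \<delta>_small: "A * A * A * R * \<delta> < 1"
  using adapted unfolding adapted_def by blast+

lemma gr_bounds: "i \<le> M \<Longrightarrow> s \<in> {s\<^sub>0..s\<^sub>1} \<Longrightarrow> \<tau> \<in> {0..\<delta>} \<Longrightarrow> 1 / A < gr i s \<tau> \<and> gr i s \<tau> < A"
  and slabf_bounds: "i \<le> M \<Longrightarrow> s \<in> {s\<^sub>0..s\<^sub>1} \<Longrightarrow> \<tau> \<in> {0..\<delta>} \<Longrightarrow> 1 / A < slabf i s \<tau> \<and> slabf i s \<tau> < A"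
proof -
  have "bounds A \<delta>" using adapted unfolding adapted_def by (elim conjE) assumption
  then show "i \<le> M \<Longrightarrow> s \<in> {s\<^sub>0..s\<^sub>1} \<Longrightarrow> \<tau> \<in> {0..\<delta>} \<Longrightarrow> 1 / A < gr i s \<tau> \<and> gr i s \<tau> < A"
    "i \<le> M \<Longrightarrow> s \<in> {s\<^sub>0..s\<^sub>1} \<Longrightarrow> \<tau> \<in> {0..\<delta>} \<Longrightarrow> 1 / A < slabf i s \<tau> \<and> slabf i s \<tau> < A"
    unfolding bounds_def by simp_all
qed

lemma gr_pos: "i \<le> M \<Longrightarrow> s \<in> {s\<^sub>0..s\<^sub>1} \<Longrightarrow> \<tau> \<in> {0..\<delta>} \<Longrightarrow> 0 < gr i s \<tau>"
  and slabf_pos': "i \<le> M \<Longrightarrow> s \<in> {s\<^sub>0..s\<^sub>1} \<Longrightarrow> \<tau> \<in> {0..\<delta>} \<Longrightarrow> 0 < slabf i s \<tau>"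
  using gr_bounds[of i s \<tau>] slabf_bounds[of i s \<tau>] inv_A(1) by linarith+

lemma gr_cont: "i \<le> M \<Longrightarrow> continuous_on (rbox \<delta>) (\<lambda>z. gr i (fst z) (snd z))"
  and gr_cong: "i \<le> M \<Longrightarrow> cong_mod k s\<^sub>0 s\<^sub>1 \<delta> (gr i) (gr_mod i)"
  and emb_model: "i \<le> M \<Longrightarrow> emb ` box_coords i R \<delta> \<subseteq> model i"
  and ov_u: "i \<le> M \<Longrightarrow> real_pt i x a c s \<tau> \<Longrightarrow> (a, c, s, \<tau>) \<in> box_coords i R \<delta> \<Longrightarrow> 1 \<le> a \<Longrightarrow> x \<in> ov i"
  and ov_v: "i \<le> M \<Longrightarrow> real_pt (nxt S i) x a c s \<tau> \<Longrightarrow> (a, c, s, \<tau>) \<in> box_coords (nxt S i) R \<delta> \<Longrightarrow> 1 / A \<le> c \<Longrightarrow> x \<in> ov i"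
proof -
  assume i: "i \<le> M"
  have *: "\<forall>i\<in>{..M}. (continuous_on (rbox \<delta>) (\<lambda>z. gr i (fst z) (snd z)) \<and> cong_mod k s\<^sub>0 s\<^sub>1 \<delta> (gr i) (gr_mod i)) \<and>
       emb ` box_coords i R \<delta> \<subseteq> model i \<and>
       (\<forall>x a c s \<tau>. real_pt i x a c s \<tau> \<and> (a, c, s, \<tau>) \<in> box_coords i R \<delta> \<inter> {z. 1 \<le> fst z} \<longrightarrow> x \<in> ov i) \<and>
       (\<forall>x a c s \<tau>. real_pt (nxt S i) x a c s \<tau> \<and> (a, c, s, \<tau>) \<in> box_coords (nxt S i) R \<delta> \<inter> {z. 1 / A \<le> fst (snd z)} \<longrightarrow> x \<in> ov i)"
    using adapted unfolding adapted_def by (elim conjE) assumption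
  have "i \<in> {..M}" using i by simp
  note * = bspec[OF * this]
  show "continuous_on (rbox \<delta>) (\<lambda>z. gr i (fst z) (snd z))" using * by (elim conjE) assumption
  show "cong_mod k s\<^sub>0 s\<^sub>1 \<delta> (gr i) (gr_mod i)" using * by (elim conjE) assumption
  show "emb ` box_coords i R \<delta> \<subseteq> model i" using * by (elim conjE) assumption
  have 1: "\<forall>x a c s \<tau>. real_pt i x a c s \<tau> \<and> (a, c, s, \<tau>) \<in> box_coords i R \<delta> \<inter> {z. 1 \<le> fst z} \<longrightarrow> x \<in> ov i"
    using * by (elim conjE) assumption
  show "real_pt i x a c s \<tau> \<Longrightarrow> (a, c, s, \<tau>) \<in> box_coords i R \<delta> \<Longrightarrow> 1 \<le> a \<Longrightarrow> x \<in> ov i"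
    by (rule 1[rule_format, of x a c s \<tau>]) simp
  have 2: "\<forall>x a c s \<tau>. real_pt (nxt S i) x a c s \<tau> \<and> (a, c, s, \<tau>) \<in> box_coords (nxt S i) R \<delta> \<inter> {z. 1 / A \<le> fst (snd z)} \<longrightarrow> x \<in> ov i"
    using * by (elim conjE) assumption
  show "real_pt (nxt S i) x a c s \<tau> \<Longrightarrow> (a, c, s, \<tau>) \<in> box_coords (nxt S i) R \<delta> \<Longrightarrow> 1 / A \<le> c \<Longrightarrow> x \<in> ov i"
    by (rule 2[rule_format, of x a c s \<tau>]) simp
qed

lemma real_box_separated: "i \<le> M \<Longrightarrow> j \<le> M \<Longrightarrow> i \<noteq> j \<Longrightarrow> nxt S i \<noteq> j \<Longrightarrow> nxt S j \<noteq> i \<Longrightarrow> real_box i R \<delta> \<inter> real_box j R \<delta> = {}"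
proof -
  have *: "\<forall>i\<in>{..M}. \<forall>j\<in>{..M}. i \<noteq> j \<and> nxt S i \<noteq> j \<and> nxt S j \<noteq> i \<longrightarrow> real_box i R \<delta> \<inter> real_box j R \<delta> = {}"
    using adapted unfolding adapted_def by (elim conjE) assumption
  show "i \<le> M \<Longrightarrow> j \<le> M \<Longrightarrow> i \<noteq> j \<Longrightarrow> nxt S i \<noteq> j \<Longrightarrow> nxt S j \<noteq> i \<Longrightarrow> real_box i R \<delta> \<inter> real_box j R \<delta> = {}"
    by (rule *[rule_format]) simp_all
qed

lemma real_box_iff: "i \<le> M \<Longrightarrow> x \<in> real_box i R \<delta> \<longleftrightarrow> (\<exists>a c s \<tau>. real_pt i x a c s \<tau> \<and> (a, c, s, \<tau>) \<in> box_coords i R \<delta>)"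
  unfolding real_box_def box_coords_iff using real_pt_eq by blast

lemma real_pt_unique:
  assumes "real_pt i x a c s \<tau>" "real_pt j x a' c' s' \<tau>'" shows "s' = s" "\<tau>' = \<tau>"
  using assms unfolding real_pt_def by (metis of_real_eq_iff)+

lemma real_pt_unique':
  assumes "real_pt i x a c s \<tau>" "real_pt i x a' c' s' \<tau>'" shows "a' = a" "c' = c"
  using assms unfolding real_pt_def by (metis of_real_eq_iff)+

lemma ov_real_pt:
  assumes i: "i \<le> M" "x \<in> ov i" and x: "real_pt i x a c s \<tau>" "real_pt (nxt S i) x a' c' s \<tau>"
  shows "a * c' * gr i s \<tau> = 1"
proof -
  have "of_real a * of_real c' * glue X i (vector [of_real s, of_real \<tau>]) = 1"
    using overlap_facts(3)[OF i] x unfolding real_pt_def by simp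
  then have "complex_of_real (a * c') * glue X i (vector [of_real s, of_real \<tau>]) = 1" by simp
  then have "Re (complex_of_real (a * c') * glue X i (vector [of_real s, of_real \<tau>])) = 1" by (simp only: one_complex.sel)
  moreover have "Re (of_real r * z) = r * Re z" for r z by simp
  ultimately show ?thesis unfolding gr_def by (simp only:)
qed

text \<open>If one coordinate is bounded below, then the other one is a product of this form. It is small
  because the kink is at least \<open>1\<close>.\<close>

lemma product_small:
  assumes "i \<le> M" "j \<le> M" "s \<in> {s\<^sub>0..s\<^sub>1}" "\<tau> \<in> {0..\<delta>}" "0 \<le> y" "y \<le> R"
  shows "0 \<le> slabf i s \<tau> * \<tau> ^ \<kappa> i * gr j s \<tau> * y" "slabf i s \<tau> * \<tau> ^ \<kappa> i * gr j s \<tau> * y < 1 / A"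
proof -
  note f = slabf_pos'[OF assms(1,3,4)] slabf_bounds[OF assms(1,3,4)] and g = gr_pos[OF assms(2-4)] gr_bounds[OF assms(2-4)]
  have \<tau>: "0 \<le> \<tau>" "\<tau> \<le> \<delta>" using assms by auto
  have "\<tau> ^ \<kappa> i \<le> \<tau> ^ 1" using kink_ge1[OF assms(1)] \<tau> \<delta>1 by (intro power_decreasing) auto
  then have tk: "0 \<le> \<tau> ^ \<kappa> i" "\<tau> ^ \<kappa> i \<le> \<delta>" using \<tau> by auto
  show "0 \<le> slabf i s \<tau> * \<tau> ^ \<kappa> i * gr j s \<tau> * y" using f g tk assms by simp
  have "slabf i s \<tau> * \<tau> ^ \<kappa> i * gr j s \<tau> * y \<le> A * \<delta> * A * R"
    using f g tk assms A0 \<delta>0 by (intro mult_mono) auto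
  also have "\<dots> = (A * A * A * R * \<delta>) / A" using A0 by (simp add: field_simps)
  also have "\<dots> < 1 / A" using \<delta>_small A0 by (intro divide_strict_right_mono)
  finally show "slabf i s \<tau> * \<tau> ^ \<kappa> i * gr j s \<tau> * y < 1 / A" .
qed

text \<open>The relation \<open>u\<^sub>i v\<^sub>i\<^sub>+\<^sub>1 f\<^sub>i = 1\<close> turns a large \<open>u\<^sub>i\<close> into a moderate \<open>v\<^sub>i\<^sub>+\<^sub>1\<close>, for passing to the next chart.\<close>

lemma step_up:
  assumes i: "i \<le> M" and x: "real_pt i x a c s \<tau>" and N: "(a, c, s, \<tau>) \<in> box_coords i R \<delta>" and a: "1 \<le> a"
  obtains a' c' where "x \<in> ov i" "real_pt (nxt S i) x a' c' s \<tau>" "a * c' * gr i s \<tau> = 1" "0 < c'" "c' < A" "0 \<le> a'" "a' < 1 / A"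
proof -
  note n = nxt_le[of i]
  have st: "s \<in> {s\<^sub>0..s\<^sub>1}" "\<tau> \<in> {0..\<delta>}" and aR: "a \<le> R" using N unfolding box_coords_iff by auto
  have xo: "x \<in> ov i" by (rule ov_u[OF i x N a])
  then have "x \<in> U (nxt S i)" using overlap_sub(2)[OF i] by blast
  then obtain a' c' s' \<tau>' where x0: "real_pt (nxt S i) x a' c' s' \<tau>'" using real_pt_real_obtain[OF n] real_pt_real[OF i x] by blast
  then have x': "real_pt (nxt S i) x a' c' s \<tau>" using real_pt_unique[OF x x0] by simp
  have eq: "a * c' * gr i s \<tau> = 1" by (rule ov_real_pt[OF i xo x x'])
  note g = gr_pos[OF i st] gr_bounds[OF i st]
  have c': "c' = 1 / (a * gr i s \<tau>)" using eq a g by (simp add: field_simps)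
  have "0 < c'" unfolding c' using a g by simp
  have "1 / A < a * gr i s \<tau>" using mult_right_mono[OF a, of "gr i s \<tau>"] g by linarith
  then have "1 < A * (a * gr i s \<tau>)" using A0 by (simp add: pos_divide_less_eq mult.commute)
  moreover have "0 < a * gr i s \<tau>" using a g by simp
  ultimately have "c' < A" unfolding c' by (simp only: pos_divide_less_eq)
  have "a' = a' * (a * c' * gr i s \<tau>)" using eq by simp
  also have "\<dots> = slabf (nxt S i) s \<tau> * \<tau> ^ \<kappa> (nxt S i) * gr i s \<tau> * a"
    using real_pt_eq[OF n x'] by (metis (no_types, opaque_lifting) mult.assoc mult.commute)
  finally have "0 \<le> a'" "a' < 1 / A" using product_small[OF n i st, of a] a aR by auto
  then show thesis using that xo x' eq \<open>0 < c'\<close> \<open>c' < A\<close> by blast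
qed

text \<open>The same relation, for passing to the previous chart.\<close>

lemma step_down:
  assumes i: "i \<le> M" and x: "real_pt (nxt S i) x a c s \<tau>" and N: "(a, c, s, \<tau>) \<in> box_coords (nxt S i) R \<delta>" and c: "1 / A \<le> c"
  obtains a' c' where "x \<in> ov i" "real_pt i x a' c' s \<tau>" "a' * c * gr i s \<tau> = 1" "0 < a'" "a' < A * A" "0 \<le> c'" "c' < 1 / A"
proof -
  note n = nxt_le[of i]
  have st: "s \<in> {s\<^sub>0..s\<^sub>1}" "\<tau> \<in> {0..\<delta>}" and cR: "c \<le> R" using N unfolding box_coords_iff by auto
  have xo: "x \<in> ov i" by (rule ov_v[OF i x N c])
  then have "x \<in> U i" using overlap_sub(1)[OF i] by blast
  then obtain a' c' s' \<tau>' where x0: "real_pt i x a' c' s' \<tau>'" using real_pt_real_obtain[OF i] real_pt_real[OF n x] by blast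
  then have x': "real_pt i x a' c' s \<tau>" using real_pt_unique[OF x x0] by simp
  have eq: "a' * c * gr i s \<tau> = 1" by (rule ov_real_pt[OF i xo x' x])
  note g = gr_pos[OF i st] gr_bounds[OF i st]
  have c0: "0 < c" using c inv_A by linarith
  have a': "a' = 1 / (c * gr i s \<tau>)" using eq c0 g by (simp add: field_simps)
  have "0 < a'" unfolding a' using c0 g by simp
  have "1 / A * (1 / A) < c * gr i s \<tau>"
    by (rule mult_le_less_imp_less) (use c g inv_A in auto)
  then have "a' < A * A" unfolding a' using A0 c0 g by (simp add: field_simps)
  have "c' = c' * (a' * c * gr i s \<tau>)" using eq by simp
  also have "\<dots> = slabf i s \<tau> * \<tau> ^ \<kappa> i * gr i s \<tau> * c"
    using real_pt_eq[OF i x'] by (metis (no_types, opaque_lifting) mult.assoc mult.commute)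
  finally have "0 \<le> c'" "c' < 1 / A" using product_small[OF i i st, of c] c0 cR by auto
  then show thesis using that xo x' eq \<open>0 < a'\<close> \<open>a' < A * A\<close> by blast
qed

text \<open>The piece ends where \<open>u\<^sub>i = 1\<close>. The condition on \<open>v\<^sub>i\<close> means \<open>u\<^sub>i\<^sub>-\<^sub>1 > 1\<close>, as \<open>u\<^sub>i\<^sub>-\<^sub>1 v\<^sub>i f\<^sub>i\<^sub>-\<^sub>1 = 1\<close>. It is stated in
  terms of \<open>v\<^sub>i\<close> in order to make sense outside of the overlap as well.\<close>

definition piece :: "nat \<Rightarrow> real \<Rightarrow> 'x set" where
  "piece i t = {x. \<exists>a c s. real_pt i x a c s t \<and> s \<in> {s\<^sub>0..s\<^sub>1} \<and> 0 < a \<and> a \<le> 1 \<and> c * gr (prv i) s t < 1}"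

lemma piece_box_coords:
  assumes i: "i \<le> M" and t: "0 < t" "t \<le> \<delta>"
    and x: "real_pt i x a c s t" "s \<in> {s\<^sub>0..s\<^sub>1}" "0 < a" "a \<le> 1" "c * gr (prv i) s t < 1"
  shows "(a, c, s, t) \<in> box_coords i R \<delta>" "0 < c" "c < A"
proof -
  have tt: "t \<in> {0..\<delta>}" using t by simp
  note g = gr_pos[OF prv(1)[OF i] x(2) tt] gr_bounds[OF prv(1)[OF i] x(2) tt]
  have "0 < a * c" unfolding real_pt_eq[OF i x(1)] using slabf_pos'[OF i x(2) tt] t by simp
  then show c: "0 < c" using x(3) by (simp add: zero_less_mult_iff)
  have "c * (1 / A) \<le> c * gr (prv i) s t" using c g by (intro mult_left_mono) auto
  then have "c * (1 / A) < 1" using x(5) by linarith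
  then show cA: "c < A" using A0 by (simp add: field_simps)
  have "a \<le> R" "c \<le> R" using x(4) cA A_less_R by linarith+
  then show "(a, c, s, t) \<in> box_coords i R \<delta>" unfolding box_coords_iff
    using x(2,3) c t real_pt_eq[OF i x(1)] by auto
qed

text \<open>A point with \<open>u\<^sub>i > 1\<close> belongs to the next piece, and a point with \<open>u\<^sub>i\<^sub>-\<^sub>1 \<le> 1\<close> to the previous one.\<close>

lemma piece_cover:
  assumes i: "i \<le> M" and t: "0 < t" "t \<le> \<delta>" and x: "real_pt i x a c s t" and N: "(a, c, s, t) \<in> box_coords i R \<delta>"
  shows "x \<in> (\<Union>j\<le>M. piece j t)"
proof -
  have st: "s \<in> {s\<^sub>0..s\<^sub>1}" "t \<in> {0..\<delta>}" and ac: "0 \<le> a" "0 \<le> c" using N unfolding box_coords_iff by auto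
  have "0 < a * c" unfolding real_pt_eq[OF i x] using slabf_pos'[OF i st] t by simp
  then have a0: "0 < a" using ac by (auto simp: zero_less_mult_iff)
  consider "1 < a" | "a \<le> 1" "c * gr (prv i) s t < 1" | "1 \<le> c * gr (prv i) s t" by linarith
  then show ?thesis
  proof cases
    case 1
    then have a1: "1 \<le> a" by simp
    obtain a' c' where y: "real_pt (nxt S i) x a' c' s t" "a * c' * gr i s t = 1" "0 < c'" "0 \<le> a'" "a' < 1 / A"
      using step_up[OF i x N a1] by metis
    have "0 < a' * c'" unfolding real_pt_eq[OF nxt_le y(1)] using slabf_pos'[OF nxt_le st] t by simp
    then have "0 < a'" using y(4) by (auto simp: zero_less_mult_iff)
    moreover have "c' * gr (prv (nxt S i)) s t < 1"
    proof -
      have "0 < c' * gr i s t" using y(3) gr_pos[OF i st] by simp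
      then have "1 * (c' * gr i s t) < a * (c' * gr i s t)" using 1 by (intro mult_strict_right_mono) auto
      then show ?thesis using y(2) prv(3)[OF i] by (simp add: mult.assoc)
    qed
    moreover have "a' \<le> 1" using y(5) inv_A by linarith
    ultimately have "x \<in> piece (nxt S i) t" unfolding piece_def using y(1) st by blast
    then show ?thesis using nxt_le by blast
  next
    case 2
    then have "x \<in> piece i t" unfolding piece_def using x st a0 by blast
    then show ?thesis using i by blast
  next
    case 3
    note p = prv(1)[OF i] and pn = prv(2)[OF i]
    note g = gr_pos[OF p st] gr_bounds[OF p st]
    have "1 / A \<le> c"
    proof (rule ccontr)
      assume "\<not> 1 / A \<le> c"
      then have "c * gr (prv i) s t < 1 / A * A" using g ac by (intro mult_strict_mono) auto
      then show False using 3 A0 by simp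
    qed
    then obtain a' c' where y: "real_pt (prv i) x a' c' s t" "a' * c * gr (prv i) s t = 1" "0 < a'" "0 \<le> c'" "c' < 1 / A"
      using step_down[OF p, unfolded pn, OF x N] by metis
    have "a' \<le> 1"
    proof (rule ccontr)
      assume "\<not> a' \<le> 1"
      then have "1 * (c * gr (prv i) s t) < a' * (c * gr (prv i) s t)" using 3 by (intro mult_strict_right_mono) auto
      then show False using y(2) 3 by (simp add: mult.assoc)
    qed
    moreover have "c' * gr (prv (prv i)) s t < 1"
    proof -
      note g' = gr_pos[OF prv(1)[OF p] st] gr_bounds[OF prv(1)[OF p] st]
      have "c' * gr (prv (prv i)) s t < 1 / A * A" using g' y(4,5) by (intro mult_strict_mono) auto
      then show ?thesis using A0 by simp
    qed
    ultimately have "x \<in> piece (prv i) t" unfolding piece_def using y st by blast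
    then show ?thesis using p by blast
  qed
qed

lemma piece_overlap:
  assumes i: "i \<le> M" and x: "x \<in> ov i" "x \<in> piece i t" "x \<in> piece (nxt S i) t" and t: "0 < t" "t \<le> \<delta>"
  shows False
proof -
  obtain a c s where y: "real_pt i x a c s t" "s \<in> {s\<^sub>0..s\<^sub>1}" "0 < a" "a \<le> 1" using x(2) unfolding piece_def by blast
  obtain a' c' s' where z: "real_pt (nxt S i) x a' c' s' t" "0 < a'" "a' \<le> 1" "c' * gr (prv (nxt S i)) s' t < 1"
    "s' \<in> {s\<^sub>0..s\<^sub>1}"
    using x(3) unfolding piece_def by blast
  have s': "s' = s" using real_pt_unique[OF y(1) z(1)] by simp
  have eq: "a * c' * gr i s t = 1" using ov_real_pt[OF i x(1) y(1)] z(1) s' by simp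
  have c: "0 < c'" using piece_box_coords(2)[OF nxt_le t z(1,5,2,3,4)] .
  have tt: "t \<in> {0..\<delta>}" using t by simp
  have g: "0 < c' * gr i s t" using c gr_pos[OF i y(2) tt] by simp
  have "a * (c' * gr i s t) \<le> 1 * (c' * gr i s t)" using y(4) g by (intro mult_right_mono) auto
  then show False using eq z(4) s' prv(3)[OF i] by (simp add: mult.assoc)
qed

text \<open>For neighbours the conditions \<open>u\<^sub>i \<le> 1\<close> and \<open>u\<^sub>i > 1\<close> exclude each other, and all other pieces lie in
  disjoint boxes. With only two charts, each is the next one of the other, along different overlaps.\<close>

lemma piece_disjoint:
  assumes t: "0 < t" "t \<le> \<delta>" shows "disjoint_family_on (\<lambda>i. piece i t) {..M}"
  unfolding disjoint_family_on_def
proof (intro ballI impI)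
  have sub: "x \<in> real_box i R \<delta>" "x \<in> U i" if i: "i \<le> M" and x: "x \<in> piece i t" for i x
  proof -
    obtain a c s where y: "real_pt i x a c s t" "s \<in> {s\<^sub>0..s\<^sub>1}" "0 < a" "a \<le> 1" "c * gr (prv i) s t < 1"
      using x unfolding piece_def by blast
    show "x \<in> real_box i R \<delta>" unfolding real_box_iff[OF i] using y(1) piece_box_coords(1)[OF i t y] by blast
    show "x \<in> U i" using y(1) unfolding real_pt_def by blast
  qed
  have adj: False if i: "i \<le> M" and x: "x \<in> piece i t" "x \<in> piece (nxt S i) t" for i x
  proof -
    have "x \<in> ov i \<or> x \<in> ov (nxt S i) \<and> nxt S (nxt S i) = i"
      using adjacent_overlap[OF i sub(2)[OF i x(1)] sub(2)[OF nxt_le x(2)]] .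
    then show False
    proof
      assume "x \<in> ov i" then show False using piece_overlap[OF i _ x t] by blast
    next
      assume *: "x \<in> ov (nxt S i) \<and> nxt S (nxt S i) = i"
      show False by (rule piece_overlap[OF nxt_le conjunct1[OF *] x(2) _ t]) (use * x(1) in simp)
    qed
  qed
  fix i j assume ij: "i \<in> {..M}" "j \<in> {..M}" "i \<noteq> j"
  show "piece i t \<inter> piece j t = {}"
  proof (rule ccontr)
    assume "piece i t \<inter> piece j t \<noteq> {}"
    then obtain x where x: "x \<in> piece i t" "x \<in> piece j t" by blast
    have ij': "i \<le> M" "j \<le> M" using ij by auto
    consider "nxt S i = j" | "nxt S j = i" | "nxt S i \<noteq> j" "nxt S j \<noteq> i" by blast
    then show False
    proof cases
      case 1 then show False using adj[OF ij'(1) x(1)] x(2) by simp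
    next
      case 2 then show False using adj[OF ij'(2) x(2)] x(1) by simp
    next
      case 3
      then show False using real_box_separated[OF ij' ij(3)] sub(1)[OF ij'(1) x(1)] sub(1)[OF ij'(2) x(2)] by blast
    qed
  qed
qed

subsection \<open>Connected components\<close>

text \<open>A finite union of compact boxes, so a closed set. Within the real part it is also open, because points on
  the rim of a box are inner points of a neighbouring box. Hence it contains the components that define the
  cylinder.\<close>

definition real_end :: "'x set" where "real_end = (\<Union>i\<le>M. real_box i R \<delta>)"

lemma closed_real_end: "closedin (xtop X) real_end"
  unfolding real_end_def
  by (intro closedin_Union finite_imageI finite_atMost)
    (auto intro!: compactin_imp_closedin[OF haus] compact_real_box emb_model)

abbreviation "rp t \<equiv> real_part S X s\<^sub>0 s\<^sub>1 t"

lemma real_part_iff: "x \<in> rp t \<longleftrightarrow> x \<in> wdom X \<and> rconj X x = x \<and> (\<exists>\<tau>\<in>{0..t}. tp x = of_real \<tau>) \<and>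
    (\<exists>s\<in>{s\<^sub>0..s\<^sub>1}. w x = of_real s) \<and> x \<notin> double_locus S X"
  unfolding real_part_def by auto

lemma real_part_rpt:
  assumes "i \<le> M" "x \<in> U i" "x \<in> rp t"
  obtains a c s \<tau> where "real_pt i x a c s \<tau>" "s \<in> {s\<^sub>0..s\<^sub>1}" "0 \<le> \<tau>" "\<tau> \<le> t"
proof -
  have *: "rconj X x = x" "\<exists>\<tau>\<in>{0..t}. tp x = of_real \<tau>" "\<exists>s\<in>{s\<^sub>0..s\<^sub>1}. w x = of_real s"
    using assms(3) unfolding real_part_iff by auto
  obtain \<tau>' s' where 1: "\<tau>' \<in> {0..t}" "tp x = of_real \<tau>'" "s' \<in> {s\<^sub>0..s\<^sub>1}" "w x = of_real s'" using *(2,3) by blast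
  obtain a c s \<tau> where 2: "real_pt i x a c s \<tau>" using real_pt_real_obtain[OF assms(1,2) *(1)] by blast
  have "s = s'" "\<tau> = \<tau>'" using 1 2 unfolding real_pt_def by (metis of_real_eq_iff)+
  then show thesis using that 1 2 by auto
qed

text \<open>Such a point would lie on the double locus.\<close>

lemma not_both_zero:
  assumes "i \<le> M" "real_pt i x a c s \<tau>" "x \<in> rp t" "s \<in> {s\<^sub>0..s\<^sub>1}" "\<tau> \<in> {0..\<delta>}"
  shows "a \<noteq> 0 \<or> c \<noteq> 0"
proof (rule ccontr)
  assume "\<not> (a \<noteq> 0 \<or> c \<noteq> 0)"
  then have ac: "a = 0" "c = 0" by auto
  then have "slabf i s \<tau> * \<tau> ^ \<kappa> i = 0" using real_pt_eq[OF assms(1,2)] by simp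
  then have \<tau>: "\<tau> = 0" using slabf_pos'[OF assms(1,4,5)] by simp
  have x: "x \<in> U i" "tp x = 0" "u i x = 0" "v i x = 0" using assms(2) ac \<tau> unfolding real_pt_def by auto
  have o: "x \<in> orbit X (b i)" using orbit_double[OF assms(1) x] .
  have f: "x \<in> fibre0 X" using x U_topspace[OF assms(1)] unfolding fibre0_tp by blast
  have "x \<notin> orbit X \<sigma>'" if "\<sigma>' \<in> Pmax S" for \<sigma>'
    using orbit_eq[OF edge_in_cells[OF uedge_edges[OF assms(1)]] cell_in_cells[OF that] o]
      edge_not_cell[OF uedge_edges[OF assms(1)]] that by metis
  then have "x \<in> double_locus S X" unfolding double_locus_def using f by blast
  then show False using assms(3) unfolding real_part_iff by blast
qed

text \<open>The product \<open>u\<^sub>i v\<^sub>i\<close> is nonnegative, so near a point where one factor is positive the other one is nonnegative.\<close>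

lemma real_box_neighbourhood:
  assumes i: "i \<le> M" and x: "real_pt i x a c s \<tau>" "a < R" "c < R" "0 < a \<or> 0 < c" and t: "t \<le> \<delta>"
  shows "\<exists>G. openin (xtop X) G \<and> x \<in> G \<and> (\<forall>y \<in> G \<inter> rp t. y \<in> real_end)"
proof -
  let ?T = "{z :: complex ^ 4. Re (z $ 1) < R} \<inter> {z. Re (z $ 2) < R} \<inter> ({z. 0 < Re (z $ 1)} \<union> {z. 0 < Re (z $ 2)})"
  let ?G = "{y \<in> topspace (subtopology (xtop X) (U i)). coords i y \<in> ?T}"
  have "open ?T" by (intro open_Int open_Un open_Collect_less continuous_intros)
  then have "openin (subtopology (xtop X) (U i)) ?G"
    by (intro openin_continuous_map_preimage[OF coords_continuous[OF i]]) simp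
  then have G: "openin (xtop X) ?G" using U_open[OF i] openin_trans_full by blast
  have "x \<in> ?G" using x U_topspace[OF i] unfolding real_pt_def by (auto simp: coords_nth)
  moreover have "y \<in> real_end" if y: "y \<in> ?G" "y \<in> rp t" for y
  proof -
    have yU: "y \<in> U i" using y(1) by auto
    obtain a' c' s' \<tau>' where y': "real_pt i y a' c' s' \<tau>'" "s' \<in> {s\<^sub>0..s\<^sub>1}" "0 \<le> \<tau>'" "\<tau>' \<le> t"
      using real_part_rpt[OF i yU y(2)] by blast
    have "a' < R" "c' < R" "0 < a' \<or> 0 < c'" using y(1) y'(1) unfolding real_pt_def by (auto simp: coords_nth)
    have "\<tau>' \<in> {0..\<delta>}" using y' t by simp
    then have "0 \<le> a' * c'" unfolding real_pt_eq[OF i y'(1)]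
      using less_imp_le[OF slabf_pos'[OF i y'(2) \<open>\<tau>' \<in> {0..\<delta>}\<close>]] y'(3) by simp
    then have "0 \<le> a'" "0 \<le> c'" using \<open>0 < a' \<or> 0 < c'\<close> by (auto simp: zero_le_mult_iff)
    then have "y \<in> real_box i R \<delta>" unfolding real_box_def
      using y' t \<open>a' < R\<close> \<open>c' < R\<close> by (intro CollectI exI[of _ a'] exI[of _ c'] exI[of _ s'] exI[of _ \<tau>']) auto
    then show ?thesis unfolding real_end_def using i by blast
  qed
  ultimately show ?thesis using G by blast
qed

lemma real_end_open:
  assumes x: "x \<in> real_end" "x \<in> rp t" and t: "t \<le> \<delta>"
  shows "\<exists>G. openin (xtop X) G \<and> x \<in> G \<and> (\<forall>y \<in> G \<inter> rp t. y \<in> real_end)"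
proof -
  obtain i where i: "i \<le> M" "x \<in> real_box i R \<delta>" using x(1) unfolding real_end_def by blast
  obtain a c s \<tau> where y: "real_pt i x a c s \<tau>" "(a, c, s, \<tau>) \<in> box_coords i R \<delta>" using i(2) unfolding real_box_iff[OF i(1)] by blast
  have st: "s \<in> {s\<^sub>0..s\<^sub>1}" "\<tau> \<in> {0..\<delta>}" and ac: "0 \<le> a" "0 \<le> c" "a \<le> R" "c \<le> R" using y(2) unfolding box_coords_iff by auto
  consider "a < R" "c < R" | "1 \<le> a" | "1 / A \<le> c" using A_less_R inv_A by linarith
  then show ?thesis
  proof cases
    case 1
    have "0 < a \<or> 0 < c" using not_both_zero[OF i(1) y(1) x(2) st] ac by auto
    then show ?thesis using real_box_neighbourhood[OF i(1) y(1) 1 _ t] by blast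
  next
    case 2
    obtain a' c' where z: "real_pt (nxt S i) x a' c' s \<tau>" "0 < c'" "c' < A" "0 \<le> a'" "a' < 1 / A"
      using step_up[OF i(1) y 2] by metis
    have "a' < R" "c' < R" using z A_less_R inv_A by linarith+
    then show ?thesis using real_box_neighbourhood[OF nxt_le z(1) _ _ disjI2[OF z(2)] t] by blast
  next
    case 3
    note p = prv(1)[OF i(1)] and pn = prv(2)[OF i(1)]
    obtain a' c' where z: "real_pt (prv i) x a' c' s \<tau>" "0 < a'" "a' < A * A" "0 \<le> c'" "c' < 1 / A"
      using step_down[OF p, unfolded pn, OF y 3] by metis
    have "a' < R" "c' < R" using z A_less_R inv_A by linarith+
    then show ?thesis using real_box_neighbourhood[OF p z(1) _ _ disjI1[OF z(2)] t] by blast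
  qed
qed

lemma real_part_topspace:
  assumes "x \<in> real_end" shows "x \<in> topspace (xtop X)"
  using closedin_subset[OF closed_real_end] assms by blast

lemma connected_in_real_end:
  assumes t: "t \<le> \<delta>" and x: "x \<in> real_end" and con: "connected_component_of (subtopology (xtop X) (rp t)) x y"
  shows "y \<in> real_end \<and> y \<in> rp t"
proof -
  let ?Y = "subtopology (xtop X) (rp t)"
  let ?F = "topspace ?Y \<inter> real_end"
  obtain T where T: "connectedin ?Y T" "x \<in> T" "y \<in> T" using con unfolding connected_component_of_def by blast
  have TY: "T \<subseteq> topspace ?Y" using connectedin_subset_topspace[OF T(1)] .
  have cl: "closedin ?Y ?F"
    unfolding closedin_subtopology using closed_real_end by (intro exI[of _ real_end]) (auto simp: real_part_topspace)
  have op: "openin ?Y ?F"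
  proof (subst openin_subopen, intro ballI)
    fix z assume z: "z \<in> ?F"
    then obtain G where G: "openin (xtop X) G" "z \<in> G" "\<forall>y \<in> G \<inter> rp t. y \<in> real_end" using real_end_open[OF _ _ t] by auto
    have "openin ?Y (G \<inter> rp t)" unfolding openin_subtopology using G(1) by blast
    moreover have "G \<inter> rp t \<subseteq> ?F" using G openin_subset[OF G(1)] by auto
    ultimately show "\<exists>T. openin ?Y T \<and> z \<in> T \<and> T \<subseteq> ?F" using z G(2) by (intro exI[of _ "G \<inter> rp t"]) auto
  qed
  have "T \<subseteq> ?F \<or> disjnt T ?F" using connectedin_clopen_cases[OF T(1) cl op] .
  then have "T \<subseteq> ?F" using T(2) TY x unfolding disjnt_def by blast
  then show ?thesis using T(3) TY by auto
qed

text \<open>On the central fibre \<open>u\<^sub>i\<close> agrees with a monomial, so it is positive on the positive locus. If \<open>u\<^sub>i\<close> exceeds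
  the size of the box, then \<open>v\<^sub>i\<^sub>+\<^sub>1\<close> is less than \<open>A\<close> and the point lies in the next box.\<close>

lemma positive_central_in_real_end:
  assumes x: "x \<in> pos_fibre0 S W X - X_bounded S X" "x \<in> rp t"
  shows "x \<in> real_end"
proof -
  obtain \<tau>\<^sub>1 where t1: "\<tau>\<^sub>1 \<in> Pmax S" and cl: "x \<in> (xtop X) closure_of
     {x \<in> orbit X \<tau>\<^sub>1. \<forall>\<uu>\<in>chambers W. \<uu> \<subseteq> \<tau>\<^sub>1 \<longrightarrow> (\<forall>m. \<exists>r>0. zmono X \<uu> m x = of_real r)}"
    using x(1) unfolding pos_fibre0_def by blast
  have "x \<in> (xtop X) closure_of (orbit X \<tau>\<^sub>1)"
    by (rule subsetD[OF closure_of_mono cl]) (rule Collect_subset)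
  then have "x \<in> (\<Union>\<rho>\<in>{\<rho>. is_face S \<tau>\<^sub>1 \<rho>}. orbit X \<rho>)" using bspec[OF orbit_closure t1] by simp
  then have f: "x \<in> fibre0 X" unfolding fibre0_orbits cells_def using t1 by blast
  then obtain i\<^sub>0 where i0: "i\<^sub>0 \<le> M" "x \<in> U i\<^sub>0" using end_cover x(1) by blast
  have tp0: "tp x = 0" using f unfolding fibre0_tp by blast
  obtain j where j: "j \<le> M" "i\<^sub>0 = nxt S j" using nxt_cases[OF i0(1)] by blast
  have "x \<notin> double_locus S X" using x(2) unfolding real_part_iff by blast
  then obtain \<tau>\<^sub>2 where t2: "\<tau>\<^sub>2 \<in> Pmax S" "x \<in> orbit X \<tau>\<^sub>2" using f unfolding double_locus_def by blast
  have "x \<notin> orbit X (b i\<^sub>0)"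
    using orbit_eq[OF edge_in_cells[OF uedge_edges[OF i0(1)]] cell_in_cells[OF t2(1)] _ t2(2)]
      edge_not_cell[OF uedge_edges[OF i0(1)]] t2(1) by metis
  then have "x \<in> orbit X (\<sigma> i\<^sub>0) \<or> x \<in> orbit X (\<sigma> j)" using orbit_v(2)[OF j(1)] f i0(2) j(2) by blast
  then obtain i where i: "i \<le> M" "x \<in> orbit X (\<sigma> i)" using i0 j by blast
  have xU: "x \<in> U i" and ux: "u i x \<noteq> 0" using i(2) orbit_u[OF i(1)] by auto
  obtain \<uu> \<uu>' where sd: "slab_data i \<uu> \<uu>' (Dom i)" using slab_data[OF i(1)] by blast
  note D = slab_dataD[OF i(1) sd]
  have uu: "\<uu> \<in> chambers W" using D(1) unfolding adjacent_def by blast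
  have uus: "\<uu> \<subseteq> \<sigma> i" using chamber_cell(2)[OF uu] D(11) by simp
  obtain a c s \<tau> where y: "real_pt i x a c s \<tau>" "s \<in> {s\<^sub>0..s\<^sub>1}" "0 \<le> \<tau>" "\<tau> \<le> t"
    using real_part_rpt[OF i(1) xU x(2)] by blast
  have \<tau>: "\<tau> = 0" using y(1) tp0 unfolding real_pt_def by simp
  have a: "0 < a"
  proof (rule ccontr)
    assume "\<not> 0 < a"
    then have neg: "a < 0" using ux y(1) unfolding real_pt_def by auto
    let ?G = "{y \<in> topspace (subtopology (xtop X) (U i)). coords i y \<in> {z. Re (z $ 1) < 0}}"
    have "open {z :: complex ^ 4. Re (z $ 1) < 0}" by (intro open_Collect_less continuous_intros)
    then have "openin (subtopology (xtop X) (U i)) ?G"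
      by (intro openin_continuous_map_preimage[OF coords_continuous[OF i(1)]]) simp
    then have G: "openin (xtop X) ?G" using U_open[OF i(1)] openin_trans_full by blast
    have "x \<in> ?G" using neg y(1) U_topspace[OF i(1)] unfolding real_pt_def by (auto simp: coords_nth)
    then have "\<exists>z. z \<in> {x \<in> orbit X \<tau>\<^sub>1. \<forall>\<uu>\<in>chambers W. \<uu> \<subseteq> \<tau>\<^sub>1 \<longrightarrow>
        (\<forall>m. \<exists>r>0. zmono X \<uu> m x = of_real r)} \<and> z \<in> ?G"
      by (intro mp[OF spec[OF conjunct2[OF cl[unfolded in_closure_of]]]] conjI G)
    then obtain z where z: "z \<in> ?G" "z \<in> orbit X \<tau>\<^sub>1"
      "\<forall>\<uu>\<in>chambers W. \<uu> \<subseteq> \<tau>\<^sub>1 \<longrightarrow> (\<forall>m. \<exists>r>0. zmono X \<uu> m z = of_real r)"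
      by (elim exE conjE) (rule that, assumption, (drule CollectD, elim conjE, assumption)+)
    have zU: "z \<in> U i" and uz: "Re (u i z) < 0" using z(1) by (auto simp: coords_nth)
    have zf: "z \<in> fibre0 X" unfolding fibre0_orbits using z(2) cell_in_cells[OF t1] by blast
    have "u i z \<noteq> 0" using uz by auto
    then have zo: "z \<in> orbit X (\<sigma> i)" using orbit_u[OF i(1)] zU zf by simp
    have "\<tau>\<^sub>1 = \<sigma> i" by (rule orbit_eq[OF cell_in_cells[OF t1] cell_in_cells[OF ucell_Pmax[OF i(1)]] z(2) zo])
    then obtain r where r: "r > 0" "zmono X \<uu> (\<xi> i) z = of_real r" using z(3) uu uus by blast
    have "z \<in> cham X \<uu>" using chamber_facts(1)[OF uu] zo D(11) by auto
    then have "u i z = zmono X \<uu> (\<xi> i) z" using cong_t_at_0[OF D(9), of z] zU zf unfolding fibre0_tp by blast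
    then show False using uz r by simp
  qed
  have y0: "real_pt i x a c s 0" using y(1) \<tau> by simp
  have c0: "c = 0" using real_pt_central(2)[OF i(1) y0] a by simp
  have st: "(0::real) \<in> {0..\<delta>}" using \<delta>0 by simp
  show ?thesis
  proof (cases "a \<le> R")
    case True
    then have "x \<in> real_box i R \<delta>" unfolding real_box_def using y0 y(2) a c0 A_less_R \<delta>0
      by (intro CollectI exI[of _ a] exI[of _ c] exI[of _ s] exI[of _ 0]) auto
    then show ?thesis unfolding real_end_def using i(1) by blast
  next
    case False
    have xo: "x \<in> ov i" using overlap_facts(2)[OF i(1)] i(2) by blast
    have xn: "x \<in> U (nxt S i)" using overlap_sub(2)[OF i(1)] xo by blast
    obtain a' c' s' \<tau>' where z0: "real_pt (nxt S i) x a' c' s' \<tau>'" using real_pt_real_obtain[OF nxt_le xn real_pt_real[OF i(1) y0]] by blast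
    have z: "real_pt (nxt S i) x a' c' s 0" using z0 real_pt_unique[OF y0 z0] by simp
    have eq: "a * c' * gr i s 0 = 1" by (rule ov_real_pt[OF i(1) xo y0 z])
    note g = gr_pos[OF i(1) y(2) st] gr_bounds[OF i(1) y(2) st]
    have c': "c' = 1 / (a * gr i s 0)" using eq a g by (simp add: field_simps)
    then have c'0: "0 < c'" using a g by simp
    have a'0: "a' = 0" using real_pt_central(2)[OF nxt_le z] c'0 by simp
    have "1 * (1 / A) < a * gr i s 0"
      by (rule mult_le_less_imp_less) (use False A_less_R g inv_A a in auto)
    then have "1 < A * (a * gr i s 0)" using A0 by (simp add: pos_divide_less_eq mult.commute)
    moreover have "0 < a * gr i s 0" using a g by simp
    ultimately have "c' < A" unfolding c' by (simp only: pos_divide_less_eq)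
    then have "x \<in> real_box (nxt S i) R \<delta>" unfolding real_box_def using z y(2) a'0 c'0 A_less_R \<delta>0
      by (intro CollectI exI[of _ a'] exI[of _ c'] exI[of _ s] exI[of _ 0]) auto
    then show ?thesis unfolding real_end_def using nxt_le by blast
  qed
qed

lemma Gamma_sub:
  assumes t: "0 < t" "t \<le> \<delta>" shows "Gamma_cyl S W X s\<^sub>0 s\<^sub>1 t \<subseteq> (\<Union>i\<le>M. piece i t)"
proof
  fix y assume "y \<in> Gamma_cyl S W X s\<^sub>0 s\<^sub>1 t"
  then obtain x where y: "tp y = of_real t" and x: "x \<in> pos_fibre0 S W X - X_bounded S X"
    "connected_component_of (subtopology (xtop X) (rp t)) x y" unfolding Gamma_cyl_def by blast
  have "x \<in> topspace (subtopology (xtop X) (rp t))" using conjunct1[OF connected_component_in_topspace[OF x(2)]] .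
  then have "x \<in> real_end" using positive_central_in_real_end[OF x(1), of t] by auto
  then have "y \<in> real_end" using connected_in_real_end[OF t(2) _ x(2)] by blast
  then obtain i where i: "i \<le> M" "y \<in> real_box i R \<delta>" unfolding real_end_def by blast
  then obtain a c s \<tau> where z: "real_pt i y a c s \<tau>" "(a, c, s, \<tau>) \<in> box_coords i R \<delta>" unfolding real_box_iff[OF i(1)] by blast
  have "\<tau> = t" using z(1) y unfolding real_pt_def by simp
  then show "y \<in> (\<Union>i\<le>M. piece i t)" using piece_cover[OF i(1) t, of y a c s] z by simp
qed

end

lemma ser_pow_constant_term:
  assumes "fps_nth F 0 = 1" shows "fps_nth (ser_pow k F n) 0 = 1"
proof -
  have p: "fps_nth (G ^ l) 0 = fps_nth G 0 ^ l" for G :: ser and l by (induction l) auto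
  have "fps_nth (\<Sum>j\<le>k. (1 - F) ^ j) 0 = (\<Sum>j\<le>k. 0 ^ j)" using assms by (simp add: fps_sum_nth p)
  also have "\<dots> = 1" by (subst sum.atMost_shift) simp
  finally show ?thesis unfolding ser_pow_def using assms by (simp add: p)
qed

lemma coeff_eval_1: "coeff_eval c 1 = c 0"
proof -
  have "(1 :: laurent) = Poly_Mapping.single 0 1" by (simp add: single_one)
  then show ?thesis using coeff_eval_single[of c 0 1] by simp
qed

lemma ser_eval_0: "ser_eval k c 0 F = coeff_eval c (fps_nth F 0)"
  unfolding ser_eval_coeff by (subst sum.atMost_shift) simp

context cyl_tube begin

text \<open>Positivity of a point in the chart of one chamber; the positive locus of a component of the central fibre
  requires this for all chambers of the cell.\<close>

definition pos_at :: "'x \<Rightarrow> 'b set \<Rightarrow> bool" where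
  "pos_at x \<uu> \<longleftrightarrow> (\<forall>m. \<exists>r>0. zmono X \<uu> m x = of_real r)"

lemma zspan:
  assumes "zdet p q = 1"
  shows "m = zscale (zdet m q) p + zscale (zdet p m) q"
proof -
  have d: "fst p * snd q - snd p * fst q = 1" using assms unfolding zdet_def .
  have "fst m = fst m * (fst p * snd q - snd p * fst q)" "snd m = snd m * (fst p * snd q - snd p * fst q)" using d by simp_all
  then have "fst m = (fst m * snd q - snd m * fst q) * fst p + (fst p * snd m - snd p * fst m) * fst q"
    "snd m = (fst m * snd q - snd m * fst q) * snd p + (fst p * snd m - snd p * fst m) * snd q"
    by (simp_all add: algebra_simps)
  then show ?thesis unfolding zdet_def zscale_def by (simp add: prod_eq_iff)
qed

lemma pos_at_basis:
  assumes u: "\<uu> \<in> chambers W" "x \<in> cham X \<uu>" and pq: "zdet p q = 1"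
    and pos: "\<exists>r>0. zmono X \<uu> p x = of_real r" "\<exists>r>0. zmono X \<uu> q x = of_real r"
  shows "pos_at x \<uu>"
proof -
  define H where "H m \<longleftrightarrow> (\<exists>r>0. zmono X \<uu> m x = of_real r)" for m
  have H0: "H 0" unfolding H_def using chamber_facts(2)[OF u] by (intro exI[of _ 1]) simp
  have Hadd: "H (m + m')" if HH: "H m" "H m'" for m m'
  proof -
    obtain r r' where "r > 0" "r' > 0" "zmono X \<uu> m x = of_real r" "zmono X \<uu> m' x = of_real r'"
      using HH unfolding H_def by blast
    then show ?thesis unfolding H_def chamber_facts(3)[OF u] by (intro exI[of _ "r * r'"]) simp
  qed
  have Hminus: "H (- m)" if HH: "H m" for m
  proof -
    obtain r where r: "r > 0" "zmono X \<uu> m x = of_real r" using HH unfolding H_def by blast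
    have "zmono X \<uu> m x * zmono X \<uu> (- m) x = 1"
      using chamber_facts(2)[OF u] chamber_facts(3)[OF u, of m "- m"] by simp
    then have "zmono X \<uu> (- m) x = of_real (1 / r)" using r by (simp add: field_simps)
    then show ?thesis unfolding H_def using r by (intro exI[of _ "1 / r"]) simp
  qed
  have Hnat: "H (zscale (int n) m)" if "H m" for n m
  proof (induction n)
    case 0 then show ?case using H0 by (simp add: zscale_def zero_prod_def)
  next
    case (Suc n)
    have "zscale (int (Suc n)) m = zscale (int n) m + m" by (simp add: zscale_def prod_eq_iff algebra_simps)
    then show ?case using Hadd[OF Suc that] by simp
  qed
  have Hz: "H (zscale l m)" if "H m" for l m
  proof (cases "l \<ge> 0")
    case True then show ?thesis using Hnat[OF that, of "nat l"] by simp
  next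
    case False
    have "zscale l m = - zscale (int (nat (- l))) m" using False by (simp add: zscale_def prod_eq_iff)
    then show ?thesis using Hminus[OF Hnat[OF that, of "nat (- l)"]] by simp
  qed
  have "H m" for m
    using Hadd[OF Hz Hz, of p q] pos unfolding H_def[symmetric] by (subst zspan[OF pq, of m])
  then show ?thesis unfolding pos_at_def H_def by blast
qed

text \<open>Crossing a wall that is not a slab does not change monomials on the central fibre, because the function of
  the wall is \<open>1\<close> there.\<close>

lemma pos_at_step:
  assumes "adjacent W \<uu> p \<uu>'" "\<not> slab S p" "x \<in> cham X \<uu>" "x \<in> cham X \<uu>'" "tp x = 0" "pos_at x \<uu>"
  shows "pos_at x \<uu>'"
  unfolding pos_at_def
proof
  fix m
  have adj': "adjacent W \<uu>' p \<uu>" using assms(1) unfolding adjacent_def by blast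
  have pw: "p \<in> walls W" and uw: "\<uu> \<in> chambers W" using assms(1) unfolding adjacent_def by blast+
  let ?n = "pairing (conormal S (cell_of S \<uu>') (seg p) \<uu>') m"
  have "x \<in> cham X \<uu>' \<inter> cham X \<uu>" using assms by blast
  from cong_t_at_0[OF wall_crossing[OF adj' assms(2), of m] this assms(5)]
  have "zmono X \<uu>' m x = ser_eval k (\<lambda>m'. zmono X \<uu> m' x) (tp x) (ser_pow k (wfun p) ?n) * zmono X \<uu> m x" .
  also have "ser_eval k (\<lambda>m'. zmono X \<uu> m' x) (tp x) (ser_pow k (wfun p) ?n) = 1"
    unfolding assms(5) ser_eval_0 ser_pow_constant_term[OF wall_one[OF pw assms(2)]] coeff_eval_1
    by (rule chamber_facts(2)[OF uw assms(3)])
  finally have "zmono X \<uu>' m x = zmono X \<uu> m x" by simp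
  then show "\<exists>r>0. zmono X \<uu>' m x = of_real r"
    using spec[OF assms(6)[unfolded pos_at_def], of m] by (simp only:)
qed

text \<open>The functions \<open>w\<close> and \<open>u\<^sub>i\<close> agree with a basis of the monomials of one chamber in \<open>\<sigma> i\<close>, so all monomials
  of this chamber are positive at \<open>x\<close>. This carries over to the other chambers in \<open>\<sigma> i\<close>.\<close>

lemma positive_point:
  assumes i: "i \<le> M" and x: "real_pt i x a c s 0" and a: "0 < a" and s: "s \<in> {s\<^sub>0..s\<^sub>1}"
  shows "x \<in> pos_fibre0 S W X - X_bounded S X"
proof -
  note f = real_pt_central(1)[OF i x]
  have xo: "x \<in> orbit X (\<sigma> i)" using real_pt_central(3)[OF i x] a by simp
  have xU: "x \<in> U i" and xt: "tp x = 0" using x unfolding real_pt_def by auto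
  obtain \<uu> \<uu>' where sd: "slab_data i \<uu> \<uu>' (Dom i)" using slab_data[OF i] by blast
  note D = slab_dataD[OF i sd]
  have uu: "\<uu> \<in> chambers W" using D(1) unfolding adjacent_def by blast
  have uus: "\<uu> \<subseteq> \<sigma> i" using chamber_cell(2)[OF uu] D(11) by simp
  have in_cham: "x \<in> cham X \<uu>\<^sub>1" if "\<uu>\<^sub>1 \<in> chambers W" "\<uu>\<^sub>1 \<subseteq> \<sigma> i" for \<uu>\<^sub>1
    using chamber_facts(1)[OF that(1)] cell_of_eq[OF that(1) ucell_Pmax[OF i] that(2)] xo by auto
  have xc: "x \<in> U i \<inter> cham X \<uu>" using in_cham[OF uu uus] xU by blast
  have "u i x = zmono X \<uu> (\<xi> i) x" "w x = zmono X \<uu> (d i) x"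
    using cong_t_at_0[OF D(9) xc xt] cong_t_at_0[OF D(10) xc xt] .
  then have "zmono X \<uu> (\<xi> i) x = of_real a" "zmono X \<uu> (d i) x = of_real s" using x unfolding real_pt_def by auto
  moreover have "0 < s" using s s0 by simp
  ultimately have base: "pos_at x \<uu>"
    by (intro pos_at_basis[OF uu in_cham[OF uu uus] zdet_basis[OF i]]) (use a in blast)+
  have "pos_at x \<uu>\<^sub>1" if u1: "\<uu>\<^sub>1 \<in> chambers W" "\<uu>\<^sub>1 \<subseteq> \<sigma> i" for \<uu>\<^sub>1
  proof (rule chamber_induct[where P = "pos_at x", OF ucell_Pmax[OF i] uu uus base _ u1])
    fix \<uu>\<^sub>2 p \<uu>\<^sub>3 assume *: "adjacent W \<uu>\<^sub>2 p \<uu>\<^sub>3" "\<not> slab S p" "\<uu>\<^sub>2 \<subseteq> \<sigma> i" "\<uu>\<^sub>3 \<subseteq> \<sigma> i" "pos_at x \<uu>\<^sub>2"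
    have ch: "\<uu>\<^sub>2 \<in> chambers W" "\<uu>\<^sub>3 \<in> chambers W" using *(1) unfolding adjacent_def by blast+
    show "pos_at x \<uu>\<^sub>3"
      by (rule pos_at_step[OF *(1,2) in_cham[OF ch(1) *(3)] in_cham[OF ch(2) *(4)] xt *(5)])
  qed
  then have "x \<in> {x \<in> orbit X (\<sigma> i). \<forall>\<uu>\<in>chambers W. \<uu> \<subseteq> \<sigma> i \<longrightarrow> (\<forall>m. \<exists>r>0. zmono X \<uu> m x = of_real r)}" (is "x \<in> ?P")
    using xo unfolding pos_at_def by blast
  moreover have "?P \<subseteq> topspace (xtop X)"
  proof -
    have "orbit X (\<sigma> i) \<subseteq> fibre0 X" unfolding fibre0_orbits using cell_in_cells[OF ucell_Pmax[OF i]] by blast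
    then show ?thesis unfolding fibre0_def by blast
  qed
  ultimately have "x \<in> (xtop X) closure_of ?P" using closure_of_subset by blast
  then have pos: "x \<in> pos_fibre0 S W X" unfolding pos_fibre0_def using ucell_Pmax[OF i] by blast
  have "x \<notin> X_bounded S X"
  proof
    assume "x \<in> X_bounded S X"
    then obtain \<tau> where \<tau>: "\<tau> \<in> Pmax S" "compactin (spc S) \<tau>" "x \<in> (xtop X) closure_of (orbit X \<tau>)"
      unfolding X_bounded_def by blast
    then have "x \<in> (\<Union>\<rho>\<in>{\<rho>. is_face S \<tau> \<rho>}. orbit X \<rho>)" using bspec[OF orbit_closure \<tau>(1)] by simp
    then obtain \<rho> where \<rho>: "is_face S \<tau> \<rho>" "x \<in> orbit X \<rho>" by blast
    have "\<rho> \<in> cells S" unfolding cells_def using \<rho>(1) \<tau>(1) by blast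
    then have "\<rho> = \<sigma> i" using orbit_eq[OF _ cell_in_cells[OF ucell_Pmax[OF i]] \<rho>(2) xo] by blast
    then have "\<sigma> i \<subseteq> \<tau>" using \<rho>(1) unfolding is_face_def by blast
    then have "compactin (spc S) (\<sigma> i)" by (rule closed_compactin[OF \<tau>(2) _ cell_closed[OF ucell_Pmax[OF i]]])
    then show False using ucell_noncompact[OF i] by blast
  qed
  then show ?thesis using pos by blast
qed

lemma not_double_locus:
  assumes i: "i \<le> M" and x: "real_pt i x a c s \<tau>" and "0 < a"
  shows "x \<notin> double_locus S X"
proof (cases "\<tau> = 0")
  case True
  then have "x \<in> orbit X (\<sigma> i)" using real_pt_central(3)[OF i] x assms(3) by blast
  then show ?thesis unfolding double_locus_def using ucell_Pmax[OF i] by blast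
next
  case False
  then have "x \<notin> fibre0 X" using x unfolding fibre0_tp real_pt_def by simp
  then show ?thesis unfolding double_locus_def by blast
qed

lemma real_pt_in_real_part:
  assumes i: "i \<le> M" and x: "real_pt i x a c s \<tau>" and "0 < a" "s \<in> {s\<^sub>0..s\<^sub>1}" "\<tau> \<in> {0..t}"
  shows "x \<in> rp t"
  unfolding real_part_iff
  using not_double_locus[OF i x assms(3)] real_pt_real[OF i x] assms(4,5) U_wdom[OF i] x unfolding real_pt_def by blast

text \<open>A point of the piece is joined to the positive locus of the central fibre by first increasing \<open>u\<^sub>i\<close> to \<open>1\<close>,
  with \<open>w\<close> and \<open>t\<close> fixed, and then decreasing \<open>t\<close> to \<open>0\<close>, with \<open>w\<close> and \<open>u\<^sub>i = 1\<close> fixed. This path avoids the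
  double locus because \<open>u\<^sub>i > 0\<close> on it.\<close>

lemma piece_sub_Gamma:
  assumes i: "i \<le> M" and t: "0 < t" "t \<le> \<delta>" shows "piece i t \<subseteq> Gamma_cyl S W X s\<^sub>0 s\<^sub>1 t"
proof
  fix x assume "x \<in> piece i t"
  then obtain a c s where x: "real_pt i x a c s t" "s \<in> {s\<^sub>0..s\<^sub>1}" "0 < a" "a \<le> 1" "c * gr (prv i) s t < 1"
    unfolding piece_def by blast
  note N = piece_box_coords[OF i t x]
  let ?f = "slabf i s"
  have f: "0 < ?f \<tau>" "?f \<tau> < A" if "\<tau> \<in> {0..t}" for \<tau>
    using slabf_pos'[OF i x(2), of \<tau>] slabf_bounds[OF i x(2), of \<tau>] that t by auto
  \<comment> \<open>\<open>L\<^sub>1\<close> raises \<open>u\<^sub>i\<close> to \<open>1\<close>, and \<open>L\<^sub>2\<close> lowers \<open>t\<close> to \<open>0\<close>\<close>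
  define L\<^sub>1 where "L\<^sub>1 = (\<lambda>a'. (a', ?f t * t ^ \<kappa> i / a', s, t)) ` {a..1}"
  define L\<^sub>2 where "L\<^sub>2 = (\<lambda>\<tau>. (1 :: real, ?f \<tau> * \<tau> ^ \<kappa> i, s, \<tau>)) ` {0..t}"
  have tt: "t \<in> {0..t}" using t by simp
  have L1: "L\<^sub>1 \<subseteq> box_coords i R \<delta>"
  proof -
    have "(a', ?f t * t ^ \<kappa> i / a', s, t) \<in> box_coords i R \<delta>" if a': "a' \<in> {a..1}" for a'
    proof -
      have "?f t * t ^ \<kappa> i / a' \<le> ?f t * t ^ \<kappa> i / a"
        using a' x(3) f(1)[OF tt] t by (intro divide_left_mono mult_pos_pos) auto
      also have "\<dots> = c" using real_pt_eq[OF i x(1)] x(3) by (simp add: field_simps)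
      also have "c \<le> R" using N(3) A_less_R by linarith
      finally have "?f t * t ^ \<kappa> i / a' \<le> R" .
      moreover have "0 \<le> ?f t * t ^ \<kappa> i / a'" using f(1)[OF tt] t a' x(3) by simp
      ultimately show ?thesis unfolding box_coords_iff using a' x(2,3) t A_less_R by auto
    qed
    then show ?thesis unfolding L\<^sub>1_def by (rule image_subsetI)
  qed
  have L2: "L\<^sub>2 \<subseteq> box_coords i R \<delta>"
  proof -
    have "(1, ?f \<tau> * \<tau> ^ \<kappa> i, s, \<tau>) \<in> box_coords i R \<delta>" if \<tau>: "\<tau> \<in> {0..t}" for \<tau>
    proof -
      have "\<tau> ^ \<kappa> i \<le> 1" using \<tau> t \<delta>1 by (intro power_le_one) auto
      then have "?f \<tau> * \<tau> ^ \<kappa> i \<le> A * 1" using f[OF \<tau>] \<tau> A0 by (intro mult_mono) auto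
      then have "?f \<tau> * \<tau> ^ \<kappa> i \<le> R" using A_less_R by linarith
      then show ?thesis unfolding box_coords_iff using f[OF \<tau>] \<tau> x(2) t A_less_R by auto
    qed
    then show ?thesis unfolding L\<^sub>2_def by (rule image_subsetI)
  qed
  have con: "connected (L\<^sub>1 \<union> L\<^sub>2)"
  proof (rule connected_Un)
    show "connected L\<^sub>1" unfolding L\<^sub>1_def using x(3)
      by (intro connected_continuous_image continuous_intros) auto
    have "continuous_on {0..t} ?f" using x(2) s0 by (intro continuous_intros) auto
    then show "connected L\<^sub>2" unfolding L\<^sub>2_def
      by (intro connected_continuous_image continuous_intros) (use x(2) s0 in auto)
    have "(1, ?f t * t ^ \<kappa> i, s, t) \<in> L\<^sub>1" unfolding L\<^sub>1_def using x(4) by (intro image_eqI[of _ _ 1]) auto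
    moreover have "(1, ?f t * t ^ \<kappa> i, s, t) \<in> L\<^sub>2" unfolding L\<^sub>2_def using t by (intro image_eqI[of _ _ t]) auto
    ultimately show "L\<^sub>1 \<inter> L\<^sub>2 \<noteq> {}" by blast
  qed
  let ?L = "L\<^sub>1 \<union> L\<^sub>2" and ?\<psi> = "\<lambda>z. chart_inv i (emb z)"
  have L: "?L \<subseteq> box_coords i R \<delta>" using L1 L2 by blast
  have Lpos: "0 < fst z \<and> par_t z \<in> {0..t}" if "z \<in> ?L" for z
    using that x(3) t unfolding L\<^sub>1_def L\<^sub>2_def by auto
  have mod: "emb ` ?L \<subseteq> model i" using emb_model[OF i] image_mono[OF L] by (rule order_trans[rotated])
  have "connectedin (xtop X) (?\<psi> ` ?L)"
    by (rule connectedin_continuous_map_image[OF chart_inv_emb_continuous[OF i mod]])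
      (simp add: connectedin_subtopology con)
  moreover have "?\<psi> z \<in> rp t" if z: "z \<in> ?L" for z
  proof -
    obtain a' c' s' \<tau>' where zz: "z = (a', c', s', \<tau>')" by (cases z) auto
    have n: "(a', c', s', \<tau>') \<in> box_coords i R \<delta>" using L z zz by blast
    show ?thesis unfolding zz
      by (rule real_pt_in_real_part[OF i box_coords_point[OF i emb_model[OF i] n]])
        (use n Lpos[OF z] in \<open>auto simp: zz box_coords_iff\<close>)
  qed
  ultimately have conY: "connectedin (subtopology (xtop X) (rp t)) (?\<psi> ` ?L)"
    unfolding connectedin_subtopology by (intro conjI image_subsetI)
  let ?y = "?\<psi> (1, 0, s, 0)"
  have "(1, 0, s, 0) \<in> L\<^sub>2" unfolding L\<^sub>2_def using t kink_power_0[OF i] by (intro image_eqI[of _ _ 0]) (auto simp: kink_power_0[OF i])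
  then have yL: "(1, 0, s, 0) \<in> ?L" by blast
  have "(1, 0, s, 0) \<in> box_coords i R \<delta>" using L yL by blast
  then have "real_pt i ?y 1 0 s 0" by (rule box_coords_point[OF i emb_model[OF i]])
  then have yp: "?y \<in> pos_fibre0 S W X - X_bounded S X" by (rule positive_point[OF i _ zero_less_one x(2)])
  have "(a, ?f t * t ^ \<kappa> i / a, s, t) \<in> L\<^sub>1" unfolding L\<^sub>1_def using x(4) by (intro image_eqI[of _ _ a]) auto
  moreover have "?f t * t ^ \<kappa> i / a = c" using real_pt_eq[OF i x(1)] x(3) by (simp add: field_simps)
  ultimately have xL: "(a, c, s, t) \<in> ?L" by simp
  have "?\<psi> (a, c, s, t) = x" using x(1) chart_inv_coords[OF i, of x] unfolding real_pt_emb by metis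
  then have "x \<in> ?\<psi> ` ?L" using xL by (metis imageI)
  then have "connected_component_of (subtopology (xtop X) (rp t)) ?y x"
    unfolding connected_component_of_def using conY imageI[OF yL, of ?\<psi>] by blast
  then show "x \<in> Gamma_cyl S W X s\<^sub>0 s\<^sub>1 t"
    unfolding Gamma_cyl_def using yp x(1) unfolding real_pt_def by blast
qed

lemma Gamma_eq: "0 < t \<Longrightarrow> t \<le> \<delta> \<Longrightarrow> Gamma_cyl S W X s\<^sub>0 s\<^sub>1 t = (\<Union>i\<le>M. piece i t)"
  using Gamma_sub[of t] piece_sub_Gamma[of _ t] by (intro equalityI UN_least) auto

section \<open>Independence of the partition\<close>

abbreviation "\<Gamma> t \<equiv> Gamma_cyl S W X s\<^sub>0 s\<^sub>1 t"
abbreviation "Upos i \<equiv> {x \<in> U i. \<exists>r>0. u i x = of_real r}"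
abbreviation "wu i \<equiv> real_coords w (u i)"

lemma real_pt_wu: "real_pt i x a c s \<tau> \<Longrightarrow> wu i x = (s, a)"
  unfolding real_pt_def real_coords_def by simp

lemma Upos_Ustar: "Upos i \<subseteq> Ustar i"
  unfolding Ustar_def by auto

lemma Gamma_point:
  assumes t: "0 < t" "t \<le> \<delta>" and x: "x \<in> \<Gamma> t" "i \<le> M" "x \<in> U i"
  obtains a c s where "real_pt i x a c s t" "s \<in> {s\<^sub>0..s\<^sub>1}"
proof -
  obtain j where j: "j \<le> M" "x \<in> piece j t" using x(1) unfolding Gamma_eq[OF t] by blast
  obtain a' c' s where y: "real_pt j x a' c' s t" "s \<in> {s\<^sub>0..s\<^sub>1}" using j(2) unfolding piece_def by blast
  obtain a c s' \<tau>' where z: "real_pt i x a c s' \<tau>'" using real_pt_real_obtain[OF x(2,3) real_pt_real[OF j(1) y(1)]] by blast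
  show thesis using that z y(2) real_pt_unique[OF y(1) z] by simp
qed

lemma Upos_point:
  assumes t: "0 < t" "t \<le> \<delta>" and x: "x \<in> \<Gamma> t \<inter> Upos i" "i \<le> M"
  obtains a c s where "real_pt i x a c s t" "s \<in> {s\<^sub>0..s\<^sub>1}" "0 < a"
proof -
  obtain r where xx: "x \<in> \<Gamma> t" "x \<in> U i" "0 < r" "u i x = of_real r" using x(1) by blast
  obtain a c s where y: "real_pt i x a c s t" "s \<in> {s\<^sub>0..s\<^sub>1}" using Gamma_point[OF t xx(1) x(2) xx(2)] by blast
  have "a = r" using y(1) xx(4) unfolding real_pt_def by simp
  then show thesis using that y xx(3) by simp
qed

lemma real_vec: "(vector [of_real p, of_real q, of_real r] :: complex ^ 3) =
    of_real p *s axis 1 1 + of_real q *s axis 2 1 + of_real r *s axis 3 1"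
  unfolding vec3_eq by (simp add: axis_def)

lemma real_pt_wut: "real_pt i x a c s t \<Longrightarrow> wut i x = vector [of_real s, of_real a, of_real t]"
  unfolding real_pt_def rel_map_def by simp

lemma wu_inj:
  assumes t: "0 < t" "t \<le> \<delta>" and i: "i \<le> M"
  shows "inj_on (wu i) (\<Gamma> t \<inter> Upos i)"
proof (rule inj_onI)
  fix x y assume xy: "x \<in> \<Gamma> t \<inter> Upos i" "y \<in> \<Gamma> t \<inter> Upos i" "wu i x = wu i y"
  obtain a c s where x: "real_pt i x a c s t" using Upos_point[OF t xy(1) i] by blast
  obtain a' c' s' where y: "real_pt i y a' c' s' t" using Upos_point[OF t xy(2) i] by blast
  have "wut i x = wut i y" using xy(3) real_pt_wu[OF x] real_pt_wu[OF y] real_pt_wut[OF x] real_pt_wut[OF y] by simp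
  moreover have "x \<in> Ustar i" "y \<in> Ustar i" using xy Upos_Ustar by auto
  ultimately show "x = y" by (rule inj_onD[OF wut_inj[OF i]])
qed

text \<open>On the cylinder \<open>t\<close> is constant, and \<open>w\<close>, \<open>u\<^sub>i\<close>, \<open>u\<^sub>j\<close> are real. So the real derivative is the restriction of the
  complex one, in which \<open>u\<^sub>j / u\<^sub>i\<close> is real.\<close>

lemma wu_transition:
  assumes t: "0 < t" "t \<le> \<delta>" and ij: "i \<le> M" "j \<le> M" and x: "x \<in> \<Gamma> t \<inter> Upos i \<inter> Upos j"
  shows "\<exists>a. ((\<lambda>z. wu j (inv_into (\<Gamma> t \<inter> Upos i) (wu i) z)) has_derivative
        (\<lambda>y. (fst y, a * fst y + snd (wu j x) / snd (wu i x) * snd y))) (at (wu i x) within wu i ` (\<Gamma> t \<inter> Upos i \<inter> Upos j))"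
proof -
  have xV: "x \<in> Ustar i \<inter> Ustar j" using x Upos_Ustar by blast
  obtain N H H' where N: "open N" "wut i x \<in> N" and H: "(H has_derivative H') (at (wut i x))"
    and eq: "\<And>y. y \<in> Ustar i \<inter> Ustar j \<Longrightarrow> wut i y \<in> N \<Longrightarrow> u j y = H (wut i y)"
    and lin: "\<And>c y. H' (c *s y) = c * H' y" "H' (axis 2 1) = u j x / u i x"
    using transition_derivative[OF ij xV] by blast
  have x': "x \<in> \<Gamma> t \<inter> Upos i" "x \<in> \<Gamma> t \<inter> Upos j" using x by auto
  obtain a c s where xi: "real_pt i x a c s t" using Upos_point[OF t x'(1) ij(1)] by blast
  obtain a' c' s' where xj: "real_pt j x a' c' s' t" using Upos_point[OF t x'(2) ij(2)] by blast
  define F :: "real \<times> real \<Rightarrow> complex ^ 3" where "F z = vector [of_real (fst z), of_real (snd z), of_real t]" for z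
  have F_wu: "F (wu i y) = wut i y" if y: "y \<in> \<Gamma> t \<inter> Upos i" for y
  proof -
    obtain a c s where "real_pt i y a c s t" using Upos_point[OF t y ij(1)] by blast
    then show ?thesis using real_pt_wu real_pt_wut unfolding F_def by simp
  qed
  have F': "(F has_derivative (\<lambda>y. of_real (fst y) *s axis 1 1 + of_real (snd y) *s axis 2 1)) (at z within B)" for z B
  proof -
    have bl: "bounded_linear (\<lambda>y :: real \<times> real. of_real (fst y) *s axis 1 1 + of_real (snd y) *s axis 2 (1::complex) :: complex ^ 3)"
      by (intro linear_conv_bounded_linear[THEN iffD1] linearI) (auto simp: vec_eq_iff algebra_simps scaleR_conv_of_real[where 'a = complex])
    have "((\<lambda>y. (of_real (fst y) *s axis 1 1 + of_real (snd y) *s axis 2 1) + of_real t *s axis 3 1 :: complex ^ 3) has_derivative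
       (\<lambda>y. of_real (fst y) *s axis 1 1 + of_real (snd y) *s axis 2 1)) (at z within B)"
      by (rule has_derivative_add_const[OF bounded_linear_imp_has_derivative[OF bl]])
    then show ?thesis unfolding F_def real_vec .
  qed
  let ?B = "wu i ` (\<Gamma> t \<inter> Upos i \<inter> Upos j)"
  have H2: "(H has_derivative H') (at (F (wu i x)))" using H F_wu[OF x'(1)] by simp
  have "((\<lambda>z. (fst z, Re (H (F z)))) has_derivative
      (\<lambda>y. (fst y, Re (H' (of_real (fst y) *s axis 1 1 + of_real (snd y) *s axis 2 1))))) (at (wu i x) within ?B)"
    by (intro has_derivative_Pair has_derivative_fst has_derivative_ident bounded_linear.has_derivative[OF bounded_linear_Re]
        has_derivative_compose[OF F' H2])
  moreover have "Re (H' (of_real p *s axis 1 1 + of_real q *s axis 2 1)) = Re (H' (axis 1 1)) * p + snd (wu j x) / snd (wu i x) * q" for p q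
  proof -
    have "H' (of_real p *s axis 1 1 + of_real q *s axis 2 1) = of_real p * H' (axis 1 1) + of_real q * (u j x / u i x)"
      using linear_add[OF has_derivative_linear[OF H]] lin by simp
    also have "u j x / u i x = of_real (a' / a)" using xi xj unfolding real_pt_def by simp
    finally show ?thesis using real_pt_wu[OF xi] real_pt_wu[OF xj] by (simp add: mult.commute)
  qed
  ultimately have D: "((\<lambda>z. (fst z, Re (H (F z)))) has_derivative
      (\<lambda>y. (fst y, Re (H' (axis 1 1)) * fst y + snd (wu j x) / snd (wu i x) * snd y))) (at (wu i x) within ?B)"
    by (simp only:)
  have contF: "isCont F (wu i x)" by (rule has_derivative_continuous[OF F'])
  have "F (wu i x) \<in> N" using F_wu[OF x'(1)] N(2) by simp
  then obtain r where r: "r > 0" "\<forall>y. dist y (F (wu i x)) < r \<longrightarrow> y \<in> N"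
    using N(1) unfolding open_dist by blast
  then obtain e where e': "e > 0" "\<forall>z. dist z (wu i x) < e \<longrightarrow> dist (F z) (F (wu i x)) < r"
    using contF unfolding continuous_at_eps_delta by blast
  have e: "e > 0" "\<And>z. dist z (wu i x) < e \<Longrightarrow> F z \<in> N" using e' r(2) by blast+
  show ?thesis
  proof (rule exI, rule has_derivative_transform_within[OF D e(1)])
    show "wu i x \<in> ?B" by (rule imageI[OF x])
    fix z assume z: "z \<in> ?B" "dist z (wu i x) < e"
    then obtain y where y: "y \<in> \<Gamma> t \<inter> Upos i \<inter> Upos j" "z = wu i y" by (elim imageE)
    have y': "y \<in> \<Gamma> t \<inter> Upos i" "y \<in> Ustar i \<inter> Ustar j" using y(1) Upos_Ustar by blast+
    have "inv_into (\<Gamma> t \<inter> Upos i) (wu i) z = y" using inv_into_f_f[OF wu_inj[OF t ij(1)] y'(1)] y(2) by simp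
    moreover have "u j y = H (F z)" using eq[OF y'(2)] e(2)[OF z(2)] F_wu[OF y'(1)] y(2) by simp
    moreover have "wu j y = (fst (wu i y), Re (u j y))" unfolding real_coords_def by simp
    ultimately show "(fst z, Re (H (F z))) = wu j (inv_into (\<Gamma> t \<inter> Upos i) (wu i) z)" using y(2) by simp
  qed
qed

lemma real_end_Gamma:
  assumes t: "0 < t" "t \<le> \<delta>" and x: "x \<in> real_end" "tp x = of_real t"
  shows "x \<in> \<Gamma> t"
proof -
  obtain i where i: "i \<le> M" "x \<in> real_box i R \<delta>" using x(1) unfolding real_end_def by blast
  obtain a c s \<tau> where y: "real_pt i x a c s \<tau>" "(a, c, s, \<tau>) \<in> box_coords i R \<delta>" using i(2) unfolding real_box_iff[OF i(1)] by blast
  have "\<tau> = t" using y(1) x(2) unfolding real_pt_def by simp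
  then show ?thesis unfolding Gamma_eq[OF t] using piece_cover[OF i(1) t] y by simp
qed

lemma Gamma_real_end:
  assumes t: "0 < t" "t \<le> \<delta>" and x: "x \<in> \<Gamma> t"
  shows "x \<in> real_end" "x \<in> rp t"
proof -
  obtain i where i: "i \<le> M" "x \<in> piece i t" using x unfolding Gamma_eq[OF t] by blast
  obtain a c s where y: "real_pt i x a c s t" "s \<in> {s\<^sub>0..s\<^sub>1}" "0 < a" "a \<le> 1" "c * gr (prv i) s t < 1"
    using i(2) unfolding piece_def by blast
  have "x \<in> real_box i R \<delta>" unfolding real_box_iff[OF i(1)] using y(1) piece_box_coords(1)[OF i(1) t y] by blast
  then show "x \<in> real_end" unfolding real_end_def using i(1) by blast
  show "x \<in> rp t" by (rule real_pt_in_real_part[OF i(1) y(1,3,2)]) (use t in simp)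
qed

lemma open_positive:
  assumes i: "i \<le> M" shows "openin (xtop X) {x \<in> U i. 0 < Re (u i x)}"
proof -
  let ?G = "{y \<in> topspace (subtopology (xtop X) (U i)). coords i y \<in> {z. 0 < Re (z $ 1)}}"
  have "open {z :: complex ^ 4. 0 < Re (z $ 1)}" by (intro open_Collect_less continuous_intros)
  then have "openin (subtopology (xtop X) (U i)) ?G"
    by (intro openin_continuous_map_preimage[OF coords_continuous[OF i]]) simp
  then have "openin (xtop X) ?G" using U_open[OF i] openin_trans_full by blast
  moreover have "?G = {x \<in> U i. 0 < Re (u i x)}" using U_topspace[OF i] by (auto simp: coords_nth)
  ultimately show ?thesis by simp
qed

text \<open>Near a point of the cylinder every real point with the same \<open>t\<close> and with \<open>w \<in> [s\<^sub>0, s\<^sub>1]\<close> belongs to the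
  cylinder. Hence the image is the intersection of an open set with the strip \<open>s\<^sub>0 \<le> s \<le> s\<^sub>1\<close>.\<close>

lemma wu_image_borel:
  assumes t: "0 < t" "t \<le> \<delta>" and ij: "i \<le> M" "j \<le> M"
  shows "wu i ` (\<Gamma> t \<inter> Upos i \<inter> Upos j) \<in> sets borel"
proof -
  let ?S = "wu i ` (\<Gamma> t \<inter> Upos i \<inter> Upos j)" and ?I = "{s\<^sub>0..s\<^sub>1} \<times> (UNIV :: real set)"
  have loc: "\<exists>T. open T \<and> z \<in> T \<and> T \<inter> ?I \<subseteq> ?S" if z: "z \<in> ?S" for z
  proof -
    obtain x where x: "x \<in> \<Gamma> t \<inter> Upos i \<inter> Upos j" "z = wu i x" using z by blast
    have xG: "x \<in> \<Gamma> t" "x \<in> \<Gamma> t \<inter> Upos i" using x(1) by auto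
    obtain a c s where xi: "real_pt i x a c s t" "0 < a" using Upos_point[OF t xG(2) ij(1)] by blast
    obtain G where G: "openin (xtop X) G" "x \<in> G" "\<forall>y \<in> G \<inter> rp t. y \<in> real_end"
      using real_end_open[OF Gamma_real_end[OF t xG(1)] t(2)] by blast
    let ?G = "G \<inter> {y \<in> U i. 0 < Re (u i y)} \<inter> {y \<in> U j. 0 < Re (u j y)}"
    have oG: "openin (xtop X) ?G" using G(1) open_positive[OF ij(1)] open_positive[OF ij(2)] by (intro openin_Int)
    have GV: "?G \<subseteq> Ustar i" unfolding Ustar_def by auto
    have oI: "open (wut i ` ?G)" by (rule wut_open_image[OF ij(1) oG GV])
    let ?T = "(\<lambda>z. vector [of_real (fst z), of_real (snd z), of_real t]) -` (wut i ` ?G) :: (real \<times> real) set"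
    have "open ?T" by (rule open_vimage[OF oI]) (intro continuous_intros)
    moreover have "z \<in> ?T"
    proof -
      have "x \<in> ?G" using G(2) x(1) by auto
      then have "wut i x \<in> wut i ` ?G" by (rule imageI)
      then show ?thesis using real_pt_wut[OF xi(1)] real_pt_wu[OF xi(1)] x(2) by simp
    qed
    moreover have "?T \<inter> ?I \<subseteq> ?S"
    proof
      fix z assume z: "z \<in> ?T \<inter> ?I"
      then obtain y where y: "y \<in> ?G" "wut i y = vector [of_real (fst z), of_real (snd z), of_real t]" by auto
      have yU: "y \<in> U i" "y \<in> U j" "0 < Re (u i y)" "0 < Re (u j y)" "y \<in> G" using y(1) by auto
      have yc: "w y = of_real (fst z)" "u i y = of_real (snd z)" "tp y = of_real t"
        using wut_nth[of i y] unfolding y(2) by simp_all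
      have pz: "0 < snd z" using yU(3) yc(2) by simp
      have "of_real (snd z) * v i y = of_real (slabf i (fst z) t * t ^ \<kappa> i)"
        using uv_eq(1)[OF ij(1) yU(1)] unfolding yc by (simp add: out_eval_of_real)
      then have "v i y = of_real (slabf i (fst z) t * t ^ \<kappa> i / snd z)" using pz by (simp add: field_simps)
      then have yr: "real_pt i y (snd z) (slabf i (fst z) t * t ^ \<kappa> i / snd z) (fst z) t"
        unfolding real_pt_def using yU(1) yc by simp
      have "y \<in> rp t" by (rule real_pt_in_real_part[OF ij(1) yr pz]) (use z t in auto)
      then have "y \<in> real_end" using G(3) yU(5) by blast
      then have yG: "y \<in> \<Gamma> t" using real_end_Gamma[OF t] yc(3) by blast
      have "u j y \<in> \<real>" using real_point_iff[OF ij(2) yU(2)] real_pt_real[OF ij(1) yr] by blast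
      then obtain r where r: "u j y = of_real r" by (elim Reals_cases)
      then have "0 < r" using yU(4) by simp
      then have "y \<in> \<Gamma> t \<inter> Upos i \<inter> Upos j" using yG yU yc(2) pz r by blast
      moreover have "z = wu i y" using real_pt_wu[OF yr] by simp
      ultimately show "z \<in> ?S" by (rule rev_image_eqI)
    qed
    ultimately show ?thesis by blast
  qed
  have SI: "?S \<subseteq> ?I"
  proof
    fix z assume "z \<in> ?S"
    then obtain x where x: "x \<in> \<Gamma> t \<inter> Upos i" "z = wu i x" by blast
    obtain a c s where "real_pt i x a c s t" "s \<in> {s\<^sub>0..s\<^sub>1}" using Upos_point[OF t x(1) ij(1)] by blast
    then show "z \<in> ?I" using real_pt_wu x(2) by simp
  qed
  define T where "T = \<Union>{T. open T \<and> T \<inter> ?I \<subseteq> ?S}"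
  have eq: "?S = T \<inter> ?I"
  proof (intro equalityI subsetI)
    fix z assume z: "z \<in> ?S"
    then show "z \<in> T \<inter> ?I" using loc[OF z] subsetD[OF SI z] unfolding T_def by blast
  next
    fix z assume "z \<in> T \<inter> ?I"
    then obtain T' where "z \<in> T'" "T' \<inter> ?I \<subseteq> ?S" "z \<in> ?I" unfolding T_def by blast
    then show "z \<in> ?S" by (elim subsetD) (rule IntI)
  qed
  have "open T" unfolding T_def by (rule open_Union) simp
  moreover have "closed ?I" by (intro closed_Times) auto
  ultimately show ?thesis unfolding eq by (intro sets.Int borel_open borel_closed)
qed

text \<open>The value of \<open>u\<^sub>i\<close> where \<open>u\<^sub>i\<^sub>-\<^sub>1 = 1\<close>, obtained from \<open>u\<^sub>i v\<^sub>i = f t\<^sup>\<kappa>\<close> and \<open>u\<^sub>i\<^sub>-\<^sub>1 v\<^sub>i f\<^sub>i\<^sub>-\<^sub>1 = 1\<close>.\<close>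

definition lower_u :: "nat \<Rightarrow> real \<Rightarrow> real \<Rightarrow> real" where
  "lower_u i t s = slabf i s t * t ^ \<kappa> i * gr (prv i) s t"

lemma lower_u_bounds:
  assumes i: "i \<le> M" and t: "0 < t" "t \<le> \<delta>" and s: "s \<in> {s\<^sub>0..s\<^sub>1}"
  shows "0 < lower_u i t s" "lower_u i t s \<le> 1"
proof -
  have tt: "t \<in> {0..\<delta>}" using t by simp
  show "0 < lower_u i t s" unfolding lower_u_def using slabf_pos'[OF i s tt] gr_pos[OF prv(1)[OF i] s tt] t by simp
  have "1 \<le> R" using A_less_R by linarith
  then show "lower_u i t s \<le> 1" using product_small(2)[OF i prv(1)[OF i] s tt zero_le_one] inv_A(2) unfolding lower_u_def mult_1_right by linarith
qed

lemma lower_u_continuous: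
  assumes i: "i \<le> M" and t: "0 < t" "t \<le> \<delta>"
  shows "continuous_on {s\<^sub>0..s\<^sub>1} (lower_u i t)"
proof -
  have "continuous_on {s\<^sub>0..s\<^sub>1} (\<lambda>s. gr (prv i) (fst (s, t)) (snd (s, t)))"
    by (rule continuous_on_compose2[OF gr_cont[OF prv(1)[OF i]], where f = "\<lambda>s. (s, t)"])
      (use t in \<open>auto intro!: continuous_intros\<close>)
  have g: "continuous_on {s\<^sub>0..s\<^sub>1} (\<lambda>s. gr (prv i) s t)"
    using \<open>continuous_on {s\<^sub>0..s\<^sub>1} (\<lambda>s. gr (prv i) (fst (s, t)) (snd (s, t)))\<close> by simp
  have "continuous_on {s\<^sub>0..s\<^sub>1} (\<lambda>s. slabf i s t * t ^ \<kappa> i * gr (prv i) s t)"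
    by (intro continuous_intros g) (use s0 in auto)
  then show ?thesis unfolding lower_u_def[abs_def] .
qed

lemma piece_image:
  assumes i: "i \<le> M" and t: "0 < t" "t \<le> \<delta>"
  shows "wu i ` piece i t = {z. fst z \<in> {s\<^sub>0..s\<^sub>1} \<and> lower_u i t (fst z) < snd z \<and> snd z \<le> 1}"
proof (intro equalityI subsetI)
  have tt: "t \<in> {0..\<delta>}" using t by simp
  have iff: "lower_u i t s < a \<longleftrightarrow> slabf i s t * t ^ \<kappa> i / a * gr (prv i) s t < 1" if "0 < a" for a s
    unfolding lower_u_def using that by (simp add: field_simps)
  {
    fix z assume "z \<in> wu i ` piece i t"
    then obtain x where x: "x \<in> piece i t" "z = wu i x" by blast
    obtain a c s where y: "real_pt i x a c s t" "s \<in> {s\<^sub>0..s\<^sub>1}" "0 < a" "a \<le> 1" "c * gr (prv i) s t < 1"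
      using x(1) unfolding piece_def by blast
    have "c = slabf i s t * t ^ \<kappa> i / a" using real_pt_eq[OF i y(1)] y(3) by (simp add: field_simps)
    then have "lower_u i t s < a" using iff[OF y(3)] y(5) by simp
    then show "z \<in> {z. fst z \<in> {s\<^sub>0..s\<^sub>1} \<and> lower_u i t (fst z) < snd z \<and> snd z \<le> 1}"
      using real_pt_wu[OF y(1)] x(2) y by simp
  }
  fix z assume "z \<in> {z. fst z \<in> {s\<^sub>0..s\<^sub>1} \<and> lower_u i t (fst z) < snd z \<and> snd z \<le> 1}"
  then obtain s a where z: "z = (s, a)" "s \<in> {s\<^sub>0..s\<^sub>1}" "lower_u i t s < a" "a \<le> 1" by (cases z) auto
  have a: "0 < a" using lower_u_bounds(1)[OF i t z(2)] z(3) by linarith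
  define c where "c = slabf i s t * t ^ \<kappa> i / a"
  have c1: "c * gr (prv i) s t < 1" using iff[OF a] z(3) unfolding c_def by simp
  have c0: "0 < c" unfolding c_def using slabf_pos'[OF i z(2) tt] t a by simp
  have "c * (1 / A) \<le> c * gr (prv i) s t"
    using c0 gr_bounds[OF prv(1)[OF i] z(2) tt] by (intro mult_left_mono) auto
  then have "c * (1 / A) < 1" using c1 by linarith
  then have "c < A" using A0 by (simp add: field_simps)
  moreover have "a * c = slabf i s t * t ^ \<kappa> i" unfolding c_def using a by simp
  moreover have "a \<le> R" using z(4) A_less_R(3) by linarith
  moreover have "c \<le> R" using \<open>c < A\<close> A_less_R(1) by linarith
  ultimately have "(a, c, s, t) \<in> box_coords i R \<delta>"
    unfolding box_coords_iff using less_imp_le[OF a] less_imp_le[OF c0] less_imp_le[OF t(1)] t(2) z(2) by (intro conjI)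
  from box_coords_point[OF i emb_model[OF i] this]
  have p: "real_pt i (chart_inv i (emb (a, c, s, t))) a c s t" .
  then have "chart_inv i (emb (a, c, s, t)) \<in> piece i t" unfolding piece_def using z a c1 by blast
  moreover have "z = wu i (chart_inv i (emb (a, c, s, t)))" using real_pt_wu[OF p] z(1) by simp
  ultimately show "z \<in> wu i ` piece i t" by (rule rev_image_eqI)
qed

lemma piece_Upos: "piece i t \<subseteq> Upos i"
  unfolding piece_def real_pt_def by blast

definition partition_sum :: "real \<Rightarrow> real" where
  "partition_sum t = (\<Sum>i\<le>M. integral {s\<^sub>0..s\<^sub>1} (\<lambda>s. - ln (lower_u i t s) / s))"

lemma of_real_absolutely_integrable_iff:
  "(\<lambda>z. complex_of_real (f z)) absolutely_integrable_on B \<longleftrightarrow> f absolutely_integrable_on B"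
proof
  assume "(\<lambda>z. complex_of_real (f z)) absolutely_integrable_on B"
  from absolutely_integrable_linear[OF this bounded_linear_Re]
  show "f absolutely_integrable_on B" by (simp add: o_def)
next
  assume "f absolutely_integrable_on B"
  from absolutely_integrable_linear[OF this bounded_linear_of_real]
  show "(\<lambda>z. complex_of_real (f z)) absolutely_integrable_on B" by (simp add: o_def)
qed

lemma integral_of_real:
  "f absolutely_integrable_on B \<Longrightarrow> integral B (\<lambda>z. complex_of_real (f z)) = of_real (integral B f)"
  using integral_linear[OF set_lebesgue_integral_eq_integral(1) bounded_linear_of_real, of B f] by (simp add: o_def)

lemma form_log_density:
  assumes t: "0 < t" "t \<le> \<delta>" and i: "i \<le> M" and Q: "Q \<subseteq> \<Gamma> t \<inter> Upos i" and z: "z \<in> wu i ` Q"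
  shows "form2 X (inv_into Q (wu i) z) w (u i) = of_real (log_density z)"
proof -
  obtain x where x: "x \<in> Q" "z = wu i x" using z by blast
  have inv: "inv_into Q (wu i) z = x"
    unfolding x(2) by (rule inv_into_f_f[OF inj_on_subset[OF wu_inj[OF t i] Q] x(1)])
  have xG: "x \<in> \<Gamma> t \<inter> Upos i" using x(1) Q by blast
  obtain a c s where y: "real_pt i x a c s t" "0 < a" using Upos_point[OF t xG i] by blast
  have "x \<in> U i" "u i x \<noteq> 0" using y unfolding real_pt_def by auto
  from form_u[OF i this] have "form2 X x w (u i) = 1 / (w x * u i x)" .
  also have "\<dots> = of_real (log_density z)" using y(1) unfolding x(2) real_pt_wu[OF y(1)] log_density_def real_pt_def by simp
  finally show ?thesis unfolding inv .
qed

text \<open>The pieces are an admissible way to cut the cylinder, with the value given by \<open>region_integral\<close>. By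
  \<open>partition_integral_eq\<close> every other way gives the same value.\<close>

lemma Gamma_has_integral_iff:
  assumes t: "0 < t" "t \<le> \<delta>"
  shows "Gamma_has_integral S W X s\<^sub>0 s\<^sub>1 t I \<longleftrightarrow> I = of_real (partition_sum t)"
proof -
  have Q0: "disjoint_family_on (\<lambda>i. piece i t) {..M}" "(\<Union>i\<le>M. piece i t) = \<Gamma> t"
    "\<And>i. i \<le> M \<Longrightarrow> piece i t \<subseteq> \<Gamma> t \<inter> Upos i"
    using piece_disjoint[OF t] Gamma_eq[OF t] piece_Upos by auto
  have Q0b: "wu i ` piece i t \<in> sets borel"
    "(log_density has_integral integral {s\<^sub>0..s\<^sub>1} (\<lambda>s. - ln (lower_u i t s) / s)) (wu i ` piece i t)" if i: "i \<le> M" for i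
    unfolding piece_image[OF i t]
    using region_integral[OF s0 less_imp_le[OF s01] lower_u_continuous[OF i t] conjI[OF lower_u_bounds[OF i t]]] by auto
  have pos: "fst (wu i x) > 0 \<and> snd (wu i x) > 0" if ix: "i \<le> M" "x \<in> \<Gamma> t \<inter> Upos i" for i x
  proof -
    obtain a c s where "real_pt i x a c s t" "s \<in> {s\<^sub>0..s\<^sub>1}" "0 < a" using Upos_point[OF t ix(2,1)] by blast
    then show ?thesis using real_pt_wu s0 by simp
  qed
  have log_int: "log_density absolutely_integrable_on wu i ` piece i t" if i: "i \<le> M" for i
  proof -
    have "log_density integrable_on wu i ` piece i t" using Q0b(2)[OF i] by blast
    moreover have "0 \<le> log_density z" if z: "z \<in> wu i ` piece i t" for z
    proof -
      obtain x where x: "x \<in> piece i t" "z = wu i x" using z by (elim imageE)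
      then show ?thesis using pos[OF i, of x] subsetD[OF Q0(3)[OF i]] unfolding log_density_def by (simp add: less_imp_le)
    qed
    ultimately show ?thesis by (rule nonnegative_absolutely_integrable_1)
  qed
  show ?thesis
  proof
    assume "Gamma_has_integral S W X s\<^sub>0 s\<^sub>1 t I"
    then obtain Q where Q: "disjoint_family_on Q {..M}" "(\<Union>i\<le>M. Q i) = \<Gamma> t"
      and Qi: "\<forall>i\<le>M. Q i \<subseteq> Upos i \<and> (\<forall>x\<in>Q i. w x \<in> \<real> \<and> u i x \<in> \<real>) \<and> inj_on (wu i) (Q i) \<and>
        wu i ` Q i \<in> sets lebesgue \<and>
        (\<lambda>z. form2 X (inv_into (Q i) (wu i) z) w (u i)) absolutely_integrable_on (wu i ` Q i)"
      and I: "I = (\<Sum>i\<le>M. integral (wu i ` Q i) (\<lambda>z. form2 X (inv_into (Q i) (wu i) z) w (u i)))"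
      unfolding Gamma_has_integral_def has_form_integral_def by (elim exE conjE) (rule that)
    have Q_Upos: "Q i \<subseteq> Upos i" and Qleb: "wu i ` Q i \<in> sets lebesgue"
      and Qint: "(\<lambda>z. form2 X (inv_into (Q i) (wu i) z) w (u i)) absolutely_integrable_on (wu i ` Q i)" if i: "i \<le> M" for i
      by (rule mp[OF spec[OF Qi] i, THEN conjunct1], rule mp[OF spec[OF Qi] i, THEN conjunct2, THEN conjunct2, THEN conjunct2, THEN conjunct1],
        rule mp[OF spec[OF Qi] i, THEN conjunct2, THEN conjunct2, THEN conjunct2, THEN conjunct2])
    have QV: "Q i \<subseteq> \<Gamma> t \<inter> Upos i" if "i \<le> M" for i using Q(2) Q_Upos[OF that] that by blast
    note form = form_log_density[OF t _ QV]
    have int: "log_density absolutely_integrable_on wu i ` Q i" if i: "i \<le> M" for i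
    proof -
      have "(\<lambda>z. form2 X (inv_into (Q i) (wu i) z) w (u i)) absolutely_integrable_on (wu i ` Q i) \<longleftrightarrow>
         (\<lambda>z. complex_of_real (log_density z)) absolutely_integrable_on (wu i ` Q i)"
        by (rule set_integrable_cong) (simp_all add: form[OF i i])
      then show ?thesis unfolding of_real_absolutely_integrable_iff using Qint[OF i] by (rule iffD1)
    qed
    have piece_sub: "\<And>i. i \<le> M \<Longrightarrow> piece i t \<subseteq> Upos i" by (rule piece_Upos)
    have "I = (\<Sum>i\<le>M. integral (wu i ` Q i) (\<lambda>z. complex_of_real (log_density z)))"
      unfolding I by (intro sum.cong refl integral_cong form) auto
    also have "\<dots> = of_real (\<Sum>i\<le>M. integral (wu i ` Q i) log_density)" by (simp add: integral_of_real int)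
    also have "(\<Sum>i\<le>M. integral (wu i ` Q i) log_density) = partition_sum t"
      unfolding partition_sum_def
    proof (rule partition_integral_eq[where \<Gamma> = "\<Gamma> t" and V = Upos and c = wu])
      show "fst (wu j x) = fst (wu i x)" for i j x unfolding real_coords_def by simp
    qed (fact wu_inj[OF t] pos wu_transition[OF t] wu_image_borel[OF t] Q0(1,2) piece_sub Q0b Q Q_Upos Qleb int)+
    finally show "I = of_real (partition_sum t)" .
  next
    assume I: "I = of_real (partition_sum t)"
    note form = form_log_density[OF t _ Q0(3)]
    have "integral (wu i ` piece i t) (\<lambda>z. form2 X (inv_into (piece i t) (wu i) z) w (u i))
       = of_real (integral {s\<^sub>0..s\<^sub>1} (\<lambda>s. - ln (lower_u i t s) / s))" if i: "i \<le> M" for i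
    proof -
      have "integral (wu i ` piece i t) (\<lambda>z. form2 X (inv_into (piece i t) (wu i) z) w (u i)) =
         integral (wu i ` piece i t) (\<lambda>z. complex_of_real (log_density z))"
        by (intro integral_cong form i)
      also have "\<dots> = of_real (integral (wu i ` piece i t) log_density)" by (rule integral_of_real[OF log_int[OF i]])
      finally show ?thesis using integral_unique[OF Q0b(2)[OF i]] by simp
    qed
    then have "I = (\<Sum>i\<le>M. integral (wu i ` piece i t) (\<lambda>z. form2 X (inv_into (piece i t) (wu i) z) w (u i)))"
      unfolding I partition_sum_def by simp
    moreover have "piece i t \<subseteq> Upos i \<and> (\<forall>x\<in>piece i t. w x \<in> \<real> \<and> u i x \<in> \<real>) \<and> inj_on (wu i) (piece i t) \<and>
        wu i ` piece i t \<in> sets lebesgue \<and>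
        (\<lambda>z. form2 X (inv_into (piece i t) (wu i) z) w (u i)) absolutely_integrable_on (wu i ` piece i t)" if i: "i \<le> M" for i
    proof (intro conjI ballI piece_Upos inj_on_subset[OF wu_inj[OF t i] Q0(3)[OF i]])
      show "w x \<in> \<real>" "u i x \<in> \<real>" if "x \<in> piece i t" for x using that unfolding piece_def real_pt_def by auto
      show "wu i ` piece i t \<in> sets lebesgue" using Q0b(1)[OF i] by simp
      have "(\<lambda>z. form2 X (inv_into (piece i t) (wu i) z) w (u i)) absolutely_integrable_on (wu i ` piece i t) \<longleftrightarrow>
         (\<lambda>z. complex_of_real (log_density z)) absolutely_integrable_on (wu i ` piece i t)"
        by (rule set_integrable_cong) (simp_all add: form[OF i i])
      then show "(\<lambda>z. form2 X (inv_into (piece i t) (wu i) z) w (u i)) absolutely_integrable_on (wu i ` piece i t)"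
        unfolding of_real_absolutely_integrable_iff using log_int[OF i] by blast
    qed
    ultimately show "Gamma_has_integral S W X s\<^sub>0 s\<^sub>1 t I"
      unfolding Gamma_has_integral_def has_form_integral_def using Q0(1,2) by (intro exI[of _ "\<lambda>i. piece i t"]) auto
  qed
qed

section \<open>Asymptotics\<close>

definition glued_prod :: "real \<Rightarrow> real \<Rightarrow> real" where
  "glued_prod s t = (\<Prod>i\<le>M. slabf i s t) * (\<Prod>i\<le>M. gr i s t)"

definition out_prod :: "real \<Rightarrow> real \<Rightarrow> real" where
  "out_prod s t = s powi (- shear S) * out_eval k (f_out k S W) s t"

lemma bounded_powi: "bounded_fun s\<^sub>0 s\<^sub>1 \<delta> (\<lambda>s t. s powi n)"
  by (rule bounded_fun_continuous) (use s0 in \<open>auto intro!: continuous_intros\<close>)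

lemma finite_unbounded_walls: "finite (unbounded_walls S W)"
  using walls_finite unfolding unbounded_walls_def by simp

text \<open>The product of the gluing functions collects the unbounded walls that are not slabs, and the factor \<open>s\<^sup>-\<^sup>e\<close> from the
  last one of them, which involves the affine monodromy.\<close>

lemma glued_prod_cong: "cong_mod k s\<^sub>0 s\<^sub>1 \<delta> glued_prod out_prod"
proof -
  let ?w = "\<lambda>s t. \<Prod>p\<in>unbounded_walls S W. out_eval k (out_fun S p) s (t::real)"
  have bs: "bounded_fun s\<^sub>0 s\<^sub>1 \<delta> (\<lambda>s t. \<Prod>i\<le>M. slabf i s t)"
    by (intro bounded_fun_prod bounded_fun_continuous slabf_cont) simp
  have bg: "bounded_fun s\<^sub>0 s\<^sub>1 \<delta> (gr i)" if "i \<le> M" for i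
    by (rule bounded_fun_continuous[OF gr_cont[OF that]])
  have bm: "bounded_fun s\<^sub>0 s\<^sub>1 \<delta> (gr_mod i)" if "i \<le> M" for i
  proof -
    have "bounded_fun s\<^sub>0 s\<^sub>1 \<delta> (\<lambda>s t. if i = M then s powi (- shear S) else 1)"
      using bounded_powi[of "- shear S"] bounded_powi[of 0] by (cases "i = M") simp_all
    moreover have "bounded_fun s\<^sub>0 s\<^sub>1 \<delta> (\<lambda>s t. \<Prod>p\<in>walls_between S W i. out_eval k (out_fun S p) s t)"
      by (intro bounded_fun_prod bounded_fun_out_eval s0 finite_walls_between)
    ultimately show ?thesis unfolding gr_mod_def[abs_def] by (rule bounded_fun_mult)
  qed
  have "cong_mod k s\<^sub>0 s\<^sub>1 \<delta> (\<lambda>s t. \<Prod>i\<le>M. gr i s t) (\<lambda>s t. \<Prod>i\<le>M. gr_mod i s t)"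
    by (rule cong_mod_prod) (use gr_cong bg bm in auto)
  moreover have "bounded_fun s\<^sub>0 s\<^sub>1 \<delta> (\<lambda>s t. \<Prod>i\<le>M. gr i s t)"
    by (rule bounded_fun_prod) (use bg in auto)
  ultimately have "cong_mod k s\<^sub>0 s\<^sub>1 \<delta> glued_prod (\<lambda>s t. (\<Prod>i\<le>M. slabf i s t) * (\<Prod>i\<le>M. gr_mod i s t))"
    unfolding glued_prod_def[abs_def] using cong_mod_mult[OF cong_mod_refl _ _ bs] by blast
  moreover have "(\<Prod>i\<le>M. slabf i s t) * (\<Prod>i\<le>M. gr_mod i s t) = s powi (- shear S) * ?w s t" for s t :: real
  proof -
    have "(\<Prod>i\<le>M. if i = M then s powi (- shear S) else 1) = s powi (- shear S)"
      by (subst prod.delta) auto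
    then show ?thesis
      unfolding gr_mod_def prod.distrib prod_unbounded_walls[of "\<lambda>p. out_eval k (out_fun S p) s t"] by simp
  qed
  ultimately have 1: "cong_mod k s\<^sub>0 s\<^sub>1 \<delta> glued_prod (\<lambda>s t. s powi (- shear S) * ?w s t)" by (simp only:)
  have "cong_mod k s\<^sub>0 s\<^sub>1 \<delta> ?w (out_eval k (f_out k S W))"
    unfolding f_out_def out_eval_cutoff[abs_def]
    using cong_mod_out_eval_prod[OF finite_unbounded_walls s0 \<delta>1, THEN cong_mod_sym] .
  moreover have "bounded_fun s\<^sub>0 s\<^sub>1 \<delta> ?w"
    by (intro bounded_fun_prod bounded_fun_out_eval s0 finite_unbounded_walls)
  ultimately have "cong_mod k s\<^sub>0 s\<^sub>1 \<delta> (\<lambda>s t. s powi (- shear S) * ?w s t) out_prod"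
    unfolding out_prod_def[abs_def] using cong_mod_mult[OF cong_mod_refl _ _ bounded_powi] by blast
  with 1 show ?thesis by (rule cong_mod_trans)
qed

lemma prv_reindex: "(\<Sum>i\<le>M. f (prv i)) = (\<Sum>i\<le>M. f i)"
  using sum.reindex_bij_betw[OF bij_betw_inv_into[OF nxt_bij], of f] unfolding prv_def .

lemma log_lower_u:
  assumes t: "0 < t" "t \<le> \<delta>" and s: "s \<in> {s\<^sub>0..s\<^sub>1}"
  shows "(\<Sum>i\<le>M. ln (lower_u i t s)) = ln (t ^ total_kink S W) + ln (glued_prod s t)" "0 < glued_prod s t"
proof -
  have tt: "t \<in> {0..\<delta>}" using t by simp
  note f = slabf_pos'[OF _ s tt] and g = gr_pos[OF _ s tt]
  have pf: "0 < (\<Prod>i\<le>M. slabf i s t)" and pg: "0 < (\<Prod>i\<le>M. gr i s t)" using f g by (auto intro!: prod_pos)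
  then show "0 < glued_prod s t" unfolding glued_prod_def by simp
  have "ln (lower_u i t s) = ln (slabf i s t) + real (\<kappa> i) * ln t + ln (gr (prv i) s t)" if i: "i \<le> M" for i
    unfolding lower_u_def using f[OF i] g[OF prv(1)[OF i]] t by (simp add: ln_mult ln_realpow)
  then have "(\<Sum>i\<le>M. ln (lower_u i t s)) = (\<Sum>i\<le>M. ln (slabf i s t) + real (\<kappa> i) * ln t + ln (gr (prv i) s t))"
    by (intro sum.cong) auto
  also have "\<dots> = (\<Sum>i\<le>M. ln (slabf i s t)) + (\<Sum>i\<le>M. real (\<kappa> i)) * ln t + (\<Sum>i\<le>M. ln (gr i s t))"
    unfolding sum.distrib sum_distrib_right prv_reindex[of "\<lambda>i. ln (gr i s t)"] ..
  also have "(\<Sum>i\<le>M. ln (slabf i s t)) = ln (\<Prod>i\<le>M. slabf i s t)" using f by (intro ln_prod[symmetric]) (auto simp: less_imp_neq[symmetric])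
  also have "(\<Sum>i\<le>M. ln (gr i s t)) = ln (\<Prod>i\<le>M. gr i s t)" using g by (intro ln_prod[symmetric]) (auto simp: less_imp_neq[symmetric])
  also have "(\<Sum>i\<le>M. real (\<kappa> i)) * ln t = ln (t ^ total_kink S W)"
    unfolding total_kink_def using t by (simp add: ln_realpow)
  finally show "(\<Sum>i\<le>M. ln (lower_u i t s)) = ln (t ^ total_kink S W) + ln (glued_prod s t)"
    unfolding glued_prod_def ln_mult_pos[OF pf pg] by simp
qed

lemma partition_sum_eq:
  assumes t: "0 < t" "t \<le> \<delta>"
  shows "(\<lambda>s. - (ln (t ^ total_kink S W) + ln (glued_prod s t)) / s) integrable_on {s\<^sub>0..s\<^sub>1}"
    "partition_sum t = integral {s\<^sub>0..s\<^sub>1} (\<lambda>s. - (ln (t ^ total_kink S W) + ln (glued_prod s t)) / s)"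
proof -
  have int: "(\<lambda>s. - ln (lower_u i t s) / s) integrable_on {s\<^sub>0..s\<^sub>1}" if i: "i \<le> M" for i
  proof (intro integrable_continuous_real continuous_intros lower_u_continuous[OF i t] ballI)
    show "lower_u i t s \<noteq> 0" if "s \<in> {s\<^sub>0..s\<^sub>1}" for s using lower_u_bounds(1)[OF i t that] by simp
    show "s \<noteq> 0" if "s \<in> {s\<^sub>0..s\<^sub>1}" for s using that s0 by simp
  qed
  have eq: "(\<Sum>i\<le>M. - ln (lower_u i t s) / s) = - (ln (t ^ total_kink S W) + ln (glued_prod s t)) / s" if "s \<in> {s\<^sub>0..s\<^sub>1}" for s
    unfolding log_lower_u(1)[OF t that, symmetric] sum_divide_distrib[symmetric] sum_negf ..
  have "(\<lambda>s. \<Sum>i\<le>M. - ln (lower_u i t s) / s) integrable_on {s\<^sub>0..s\<^sub>1}"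
    by (intro integrable_sum int) auto
  then show "(\<lambda>s. - (ln (t ^ total_kink S W) + ln (glued_prod s t)) / s) integrable_on {s\<^sub>0..s\<^sub>1}"
    by (rule integrable_eq) (rule eq)
  have "partition_sum t = integral {s\<^sub>0..s\<^sub>1} (\<lambda>s. \<Sum>i\<le>M. - ln (lower_u i t s) / s)"
    unfolding partition_sum_def by (intro integral_sum[symmetric] int) auto
  also have "\<dots> = integral {s\<^sub>0..s\<^sub>1} (\<lambda>s. - (ln (t ^ total_kink S W) + ln (glued_prod s t)) / s)"
    by (intro integral_cong eq)
  finally show "partition_sum t = integral {s\<^sub>0..s\<^sub>1} (\<lambda>s. - (ln (t ^ total_kink S W) + ln (glued_prod s t)) / s)" .
qed

lemma glued_prod_lower: "\<exists>\<epsilon>>0. \<forall>s\<in>{s\<^sub>0..s\<^sub>1}. \<forall>t\<in>{0..\<delta>}. \<epsilon> < glued_prod s t"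
proof -
  have "continuous_on (rbox \<delta>) (\<lambda>z. glued_prod (fst z) (snd z))"
    unfolding glued_prod_def by (intro continuous_intros slabf_cont gr_cont) auto
  moreover have "0 < glued_prod (fst z) (snd z)" if "z \<in> rbox \<delta>" for z
    using that slabf_pos'[of _ "fst z" "snd z"] gr_pos[of _ "fst z" "snd z"] unfolding glued_prod_def
    by (intro mult_pos_pos prod_pos) auto
  moreover have "compact (rbox \<delta>)" by (intro compact_Times) auto
  ultimately obtain \<epsilon> where "\<epsilon> > 0" "\<forall>z\<in>rbox \<delta>. \<epsilon> < glued_prod (fst z) (snd z)" using compact_positive_bound by blast
  then show ?thesis by (intro exI[of _ \<epsilon>]) auto
qed

lemma ln_diff_bound:
  fixes x y :: real
  assumes "0 < m" "m \<le> x" "m \<le> y" shows "\<bar>ln x - ln y\<bar> \<le> \<bar>x - y\<bar> / m"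
proof -
  have *: "ln x - ln y \<le> \<bar>x - y\<bar> / m" if "m \<le> x" "m \<le> y" for x y :: real
  proof -
    have "ln x - ln y \<le> (x - y) / y" using that assms(1) by (intro ln_diff_le) auto
    also have "\<dots> \<le> \<bar>x - y\<bar> / y" using that assms(1) by (intro divide_right_mono) auto
    also have "\<dots> \<le> \<bar>x - y\<bar> / m" using that assms(1) by (intro divide_left_mono) auto
    finally show ?thesis .
  qed
  show ?thesis using *[OF assms(2,3)] *[OF assms(3,2)] by (simp add: abs_le_iff abs_minus_commute)
qed

abbreviation "expected t \<equiv> - integral {s\<^sub>0..s\<^sub>1} (\<lambda>s.
         (ln (t ^ total_kink S W) - ln (s powi shear S) + ln (out_eval k (f_out k S W) s t)) * (1 / s))"

text \<open>The product of slab and gluing functions is bounded below by a positive constant, so congruence modulo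
  \<open>t\<^sup>k\<^sup>+\<^sup>1\<close> passes from it to its logarithm.\<close>

lemma partition_sum_asymptotics: "\<exists>B. \<forall>\<^sub>F t in at_right 0. \<bar>partition_sum t - expected t\<bar> \<le> B * t ^ Suc k"
proof -
  obtain C\<^sub>0 where C0: "\<And>s t. s \<in> {s\<^sub>0..s\<^sub>1} \<Longrightarrow> t \<in> {0..\<delta>} \<Longrightarrow> \<bar>glued_prod s t - out_prod s t\<bar> \<le> C\<^sub>0 * t ^ Suc k"
    using glued_prod_cong unfolding cong_mod_def by blast
  define C where "C = \<bar>C\<^sub>0\<bar>"
  have C: "\<bar>glued_prod s t - out_prod s t\<bar> \<le> C * t ^ Suc k" if "s \<in> {s\<^sub>0..s\<^sub>1}" "t \<in> {0..\<delta>}" for s t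
  proof -
    have "C\<^sub>0 * t ^ Suc k \<le> C * t ^ Suc k" unfolding C_def using that(2) by (intro mult_right_mono) auto
    then show ?thesis using C0[OF that] by linarith
  qed
  obtain \<epsilon> where \<epsilon>: "\<epsilon> > 0" "\<And>s t. s \<in> {s\<^sub>0..s\<^sub>1} \<Longrightarrow> t \<in> {0..\<delta>} \<Longrightarrow> \<epsilon> < glued_prod s t" using glued_prod_lower by blast
  have "((\<lambda>t. C * t ^ Suc k) \<longlongrightarrow> C * 0 ^ Suc k) (at_right (0::real))" by (intro tendsto_intros)
  then have "((\<lambda>t. C * t ^ Suc k) \<longlongrightarrow> 0) (at_right (0::real))" by simp
  from order_tendstoD(2)[OF this, of "\<epsilon> / 2"]
  have small: "\<forall>\<^sub>F t in at_right 0. C * t ^ Suc k < \<epsilon> / 2" using \<epsilon>(1) by simp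
  have range: "\<forall>\<^sub>F t in at_right (0::real). 0 < t \<and> t \<le> \<delta>"
    by (intro eventually_conj eventually_at_right_less) (rule eventually_at_right_0I[OF \<delta>0], auto)
  \<comment> \<open>\<open>ln\<close> has Lipschitz constant \<open>2 / \<epsilon>\<close> on the numbers above \<open>\<epsilon> / 2\<close>, and \<open>1 / s \<le> 1 / s\<^sub>0\<close>\<close>
  define B where "B = 2 * C / \<epsilon> / s\<^sub>0 * (s\<^sub>1 - s\<^sub>0)"
  have "\<forall>\<^sub>F t in at_right 0. \<bar>partition_sum t - expected t\<bar> \<le> B * t ^ Suc k"
    using small range
  proof eventually_elim
    case (elim t)
    then have t: "0 < t" "t \<le> \<delta>" and tt: "t \<in> {0..\<delta>}" by auto
    have out_prod_low: "\<epsilon> / 2 \<le> out_prod s t" if "s \<in> {s\<^sub>0..s\<^sub>1}" for s using C[OF that tt] \<epsilon>(2)[OF that tt] elim(1) by linarith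
    have glued_prod_low: "\<epsilon> / 2 \<le> glued_prod s t" if "s \<in> {s\<^sub>0..s\<^sub>1}" for s using \<epsilon>(2)[OF that tt] \<epsilon>(1) by linarith
    have e2: "0 < \<epsilon> / 2" using \<epsilon>(1) by simp
    let ?K = "ln (t ^ total_kink S W)"
    let ?g = "\<lambda>s. - (?K + ln (glued_prod s t)) / s" and ?m = "\<lambda>s. - (?K + ln (out_prod s t)) / s"
    have log_out_prod: "ln (out_prod s t) = - ln (s powi shear S) + ln (out_eval k (f_out k S W) s t)" if s: "s \<in> {s\<^sub>0..s\<^sub>1}" for s
    proof -
      have sp: "0 < s" using s s0 by simp
      then have p: "0 < s powi (- shear S)" by simp
      have "0 < out_prod s t" using out_prod_low[OF s] e2 by linarith
      then have "0 < out_eval k (f_out k S W) s t" unfolding out_prod_def using p by (simp add: zero_less_mult_iff)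
      then show ?thesis unfolding out_prod_def using p sp by (simp add: ln_mult power_int_minus ln_inverse)
    qed
    have m_cont: "continuous_on {s\<^sub>0..s\<^sub>1} ?m"
    proof -
      have "continuous_on {s\<^sub>0..s\<^sub>1} (\<lambda>s. out_prod s t)"
        unfolding out_prod_def by (intro continuous_intros) (use s0 in auto)
      moreover have "out_prod s t \<noteq> 0" if "s \<in> {s\<^sub>0..s\<^sub>1}" for s using out_prod_low[OF that] e2 by linarith
      ultimately show ?thesis by (intro continuous_intros) (use s0 in auto)
    qed
    have "expected t = integral {s\<^sub>0..s\<^sub>1} ?m"
      unfolding integral_neg[symmetric]
    proof (rule integral_cong)
      fix s assume s: "s \<in> {s\<^sub>0..s\<^sub>1}"
      show "- ((?K - ln (s powi shear S) + ln (out_eval k (f_out k S W) s t)) * (1 / s)) = ?m s"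
        unfolding log_out_prod[OF s] by (simp add: algebra_simps add_divide_distrib diff_divide_distrib)
    qed
    then have "partition_sum t - expected t = integral {s\<^sub>0..s\<^sub>1} (\<lambda>s. ?g s - ?m s)"
      unfolding partition_sum_eq(2)[OF t]
      using integral_diff[OF partition_sum_eq(1)[OF t] integrable_continuous_real[OF m_cont]] by simp
    also have "\<bar>\<dots>\<bar> \<le> integral {s\<^sub>0..s\<^sub>1} (\<lambda>s. 2 * C / \<epsilon> / s\<^sub>0 * t ^ Suc k)"
    proof (subst real_norm_def[symmetric], rule integral_norm_bound_integral)
      show "(\<lambda>s. ?g s - ?m s) integrable_on {s\<^sub>0..s\<^sub>1}"
        by (rule integrable_diff[OF partition_sum_eq(1)[OF t] integrable_continuous_real[OF m_cont]])
      show "(\<lambda>s. 2 * C / \<epsilon> / s\<^sub>0 * t ^ Suc k) integrable_on {s\<^sub>0..s\<^sub>1}" by (rule integrable_const_ivl)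
      fix s assume s: "s \<in> {s\<^sub>0..s\<^sub>1}"
      have sp: "0 < s" "s\<^sub>0 \<le> s" using s s0 by auto
      have "\<bar>ln (out_prod s t) - ln (glued_prod s t)\<bar> \<le> \<bar>out_prod s t - glued_prod s t\<bar> / (\<epsilon> / 2)"
        by (rule ln_diff_bound[OF e2 out_prod_low[OF s] glued_prod_low[OF s]])
      also have "\<dots> \<le> C * t ^ Suc k / (\<epsilon> / 2)"
        using C[OF s tt] e2 by (intro divide_right_mono) (auto simp: abs_minus_commute)
      finally have *: "\<bar>ln (out_prod s t) - ln (glued_prod s t)\<bar> \<le> 2 * C / \<epsilon> * t ^ Suc k" by (simp add: mult_ac)
      have "?g s - ?m s = (ln (out_prod s t) - ln (glued_prod s t)) / s" using sp by (simp add: field_simps)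
      then have "norm (?g s - ?m s) = \<bar>ln (out_prod s t) - ln (glued_prod s t)\<bar> / s" using sp by simp
      also have "\<dots> \<le> 2 * C / \<epsilon> * t ^ Suc k / s\<^sub>0"
        using * sp s0 by (intro frac_le) auto
      finally show "norm (?g s - ?m s) \<le> 2 * C / \<epsilon> / s\<^sub>0 * t ^ Suc k" by simp
    qed
    also have "\<dots> = B * t ^ Suc k" unfolding B_def using s01 by simp
    finally show ?case .
  qed
  then show ?thesis ..
qed

lemma asymptotics:
  "(\<forall>\<^sub>F t in at_right 0. \<exists>!I. Gamma_has_integral S W X s\<^sub>0 s\<^sub>1 t I) \<and>
    (\<lambda>t. Gamma_integral S W X s\<^sub>0 s\<^sub>1 t - of_real (expected t)) \<in> O[at_right 0](\<lambda>t. of_real (t ^ (k + 1)))"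
proof
  have range: "\<forall>\<^sub>F t in at_right (0::real). 0 < t \<and> t \<le> \<delta>"
    by (intro eventually_conj eventually_at_right_less) (rule eventually_at_right_0I[OF \<delta>0], auto)
  then show "\<forall>\<^sub>F t in at_right 0. \<exists>!I. Gamma_has_integral S W X s\<^sub>0 s\<^sub>1 t I"
    by (rule eventually_mono) (simp add: Gamma_has_integral_iff)
  obtain B where "\<forall>\<^sub>F t in at_right 0. \<bar>partition_sum t - expected t\<bar> \<le> B * t ^ Suc k" using partition_sum_asymptotics by blast
  then have "\<forall>\<^sub>F t in at_right 0. norm (Gamma_integral S W X s\<^sub>0 s\<^sub>1 t - of_real (expected t))
      \<le> B * norm (of_real (t ^ (k + 1)) :: complex)"
    using range
  proof eventually_elim
    case (elim t)
    have "Gamma_integral S W X s\<^sub>0 s\<^sub>1 t = of_real (partition_sum t)"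
      unfolding Gamma_integral_def using elim(2)
      by (intro the_equality) (simp_all add: Gamma_has_integral_iff)
    then have "Gamma_integral S W X s\<^sub>0 s\<^sub>1 t - of_real (expected t) = of_real (partition_sum t - expected t)" by simp
    then have "norm (Gamma_integral S W X s\<^sub>0 s\<^sub>1 t - of_real (expected t)) = \<bar>partition_sum t - expected t\<bar>"
      by (simp only: norm_of_real)
    moreover have "norm (of_real (t ^ (k + 1)) :: complex) = t ^ Suc k"
      unfolding norm_of_real using elim(2) by simp
    ultimately show ?case using elim(1) by simp
  qed
  then show "(\<lambda>t. Gamma_integral S W X s\<^sub>0 s\<^sub>1 t - of_real (expected t)) \<in> O[at_right 0](\<lambda>t. of_real (t ^ (k + 1)))"
    by (rule bigoI)
qed

end

theorem proposition4p3:
  fixes k :: nat and S :: "'b cyl_surface" and W :: "'b wall_str" and X :: "('b, 'x) family"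
    and s\<^sub>0 s\<^sub>1 :: real
  assumes "asymptotically_cylindrical S"
    and "consistent_wall_structure k S W"
    and "outgoing S W"
    and "fps_nth (f_out k S W) 0 = 1"
    and "positive_slabs k S W"
    and "analytic_family TYPE('n::finite) k S W X"
    and "0 < s\<^sub>0" and "s\<^sub>0 < s\<^sub>1"
  shows "(\<forall>\<^sub>F t in at_right 0. \<exists>!I. Gamma_has_integral S W X s\<^sub>0 s\<^sub>1 t I) \<and>
    (\<lambda>t. Gamma_integral S W X s\<^sub>0 s\<^sub>1 t -
       of_real (- integral {s\<^sub>0..s\<^sub>1} (\<lambda>s.
         (ln (t ^ total_kink S W) - ln (s powi shear S) + ln (out_eval k (f_out k S W) s t)) * (1 / s))))
     \<in> O[at_right 0](\<lambda>t. of_real (t ^ (k + 1)))"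
proof -
  interpret cyl_family k S W X s\<^sub>0 s\<^sub>1
  proof unfold_locales
    show "asymptotically_cylindrical S" "outgoing S W" "positive_slabs k S W" "0 < s\<^sub>0" "s\<^sub>0 < s\<^sub>1"
      by (fact assms)+
    show "wall_structure k S W" using assms(2) unfolding consistent_wall_structure_def by blast
    show "Hausdorff_space (xtop X)"
      using assms(6) unfolding analytic_family_def reduced_complex_space_def by (elim conjE)
    show "real_structure X" "relative_2form X" "agrees_with_scheme k S W X" "cylindrical_end k S W X"
      using assms(6) unfolding analytic_family_def by blast+
  qed
  obtain A \<delta> where "1 < A" "adapted A \<delta>" using adapted_exists by blast
  then interpret cyl_tube k S W X s\<^sub>0 s\<^sub>1 A \<delta> by unfold_locales
  show ?thesis by (rule asymptotics)
qed

end
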